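(* Let $n\ge 4$ and $M>0$. There exists $c_{n,M}>0$ such that for every $u\in \dot W^{1,2(n-2)}(\mathbb S^{n-1};\mathbb R^n)$ with $\|\nabla_T u\|_{L^{2(n-2)}(\mathbb S^{n-1})}\le M$ there exists $O\in O(n)$ such that $$\mathrm{Av}\big(|\nabla_T u-OP_T|^2\big)\le c_{n,M}\Big(\big\|(\sigma_{n-1}-1)_+\big\|_{L^2(\mathbb S^{n-1})}+\big(1-|V_n(u)|\big)_+\Big),$$ where $0\le\sigma_1\le\dots\le\sigma_{n-1}$ are the eigenvalues of $\sqrt{\nabla_T u^t\nabla_T u}$ and $V_n(u):=\mathrm{Av}\Big(\det\begin{pmatrix}u^1&\cdots&u^n\\ \partial_{\tau_1}u^1&\cdots&\partial_{\tau_1}u^n\\ \vdots&&\vdots\\ \partial_{\tau_{n-1}}u^1&\cdots&\partial_{\tau_{n-1}}u^n\end{pmatrix}\Big)$ is the signed volume of $u$.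
   Context: $\mathbb S^{n-1}\subset\mathbb R^n$ is the unit sphere. For integrable $f$ on $\mathbb S^{n-1}$, $\mathrm{Av}(f):=\frac{1}{\mathcal H^{n-1}(\mathbb S^{n-1})}\int_{\mathbb S^{n-1}}f\,d\mathcal H^{n-1}$; all $L^p$ norms on the sphere are taken with respect to the normalized measure. $\{\tau_1,\dots,\tau_{n-1}\}$ is a local orthonormal frame of $T_x\mathbb S^{n-1}$ with $(\tau_1(x),\dots,\tau_{n-1}(x),x)$ a positively oriented basis of $\mathbb R^n$. For $u:\mathbb S^{n-1}\to\mathbb R^n$, $\nabla_T u$ is the tangential gradient, the $n\times(n-1)$ matrix with entries $(\nabla_T u)_{ij}=\partial_{\tau_j}u^i$; $P_T:=\nabla_T\mathrm{id}_{\mathbb S^{n-1}}$. $\dot W^{1,p}$ denotes the homogeneous Sobolev space (maps with gradient in $L^p$). $|\cdot|$ is the Frobenius norm and $(t)_+=\max\{t,0\}$. *)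

theory Defs
  imports "HOL-Analysis.Analysis"
begin

text \<open>Normalized (probability) surface measure on the unit sphere of R^n, realised as the
  push-forward of the normalized Lebesgue measure of the unit ball under radial projection.\<close>
definition sphere_meas :: "(real^'n) measure" where
  "sphere_meas = distr (uniform_measure lborel (ball 0 1)) borel (\<lambda>x. x /\<^sub>R norm x)"

definition Av :: "(real^'n \<Rightarrow> real) \<Rightarrow> real" where
  "Av f = integral\<^sup>L sphere_meas f"

definition Lp_sphere :: "real \<Rightarrow> (real^'n \<Rightarrow> real) \<Rightarrow> real" where
  "Lp_sphere p f = (Av (\<lambda>x. \<bar>f x\<bar> powr p)) powr (1 / p)"

text \<open>Orthogonal projection onto the tangent space T_x S^{n-1}: P_T(x) = I - x x^t.
  As an n x n matrix, (this is the tangential gradient of the identity map, read as a linear map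
  on R^n vanishing on the normal direction).\<close>
definition PT :: "real^'n \<Rightarrow> real^'n^'n" where
  "PT x = mat 1 - (\<chi> i j. x $ i * x $ j)"

definition annulus :: "(real^'n) set" where
  "annulus = {y. 1/2 < norm y \<and> norm y < 2}"

definition test_fun :: "(real^'n \<Rightarrow> real) \<Rightarrow> bool" where
  "test_fun \<phi> \<longleftrightarrow> (\<forall>x. \<phi> differentiable (at x))
     \<and> (\<forall>j. continuous_on UNIV (\<lambda>x. frechet_derivative \<phi> (at x) (axis j 1)))
     \<and> compact (closure {x. \<phi> x \<noteq> 0}) \<and> closure {x. \<phi> x \<noteq> 0} \<subseteq> annulus"

text \<open>G is the (weak) tangential gradient of u : S^{n-1} \<rightarrow> R^n:
  G x is the n x n matrix of the differential of u at x (entries (G x)$i$j = \<partial>_j u^i of the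
  0-homogeneous extension), i.e. \<nabla>_T u(x) viewed as a linear map on R^n.
  Defined weakly: the 0-homogeneous extension U(y) = u(y/|y|) on the annulus has weak
  gradient DU(y) = G(y/|y|)/|y|.  u and G are required to be integrable (L^1 on the sphere).\<close>
definition tang_weak_grad :: "(real^'n \<Rightarrow> real^'n) \<Rightarrow> (real^'n \<Rightarrow> real^'n^'n) \<Rightarrow> bool" where
  "tang_weak_grad u G \<longleftrightarrow>
     u \<in> borel_measurable borel \<and> G \<in> borel_measurable borel \<and>
     integrable sphere_meas (\<lambda>x. norm (u x)) \<and> integrable sphere_meas (\<lambda>x. norm (G x)) \<and>
     (\<forall>\<phi> i j. test_fun \<phi> \<longrightarrow>
        (\<integral>y\<in>annulus. (u (y /\<^sub>R norm y)) $ i * frechet_derivative \<phi> (at y) (axis j 1) \<partial>lborel)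
        = - (\<integral>y\<in>annulus. (G (y /\<^sub>R norm y)) $ i $ j / norm y * \<phi> y \<partial>lborel))"

definition grad_norm :: "(real^'n \<Rightarrow> real^'n^'n) \<Rightarrow> real^'n \<Rightarrow> real" where
  "grad_norm G x = norm (G x ** PT x)"

text \<open>Largest singular value \<sigma>_{n-1} of \<nabla>_T u(x) = largest eigenvalue of
  sqrt(\<nabla>_T u^t \<nabla>_T u) = operator norm of \<nabla>_T u(x) on T_x.\<close>
definition sigma_max :: "(real^'n \<Rightarrow> real^'n^'n) \<Rightarrow> real^'n \<Rightarrow> real" where
  "sigma_max G x = Sup {norm (G x *v v) | v. norm v = 1 \<and> v \<bullet> x = 0}"

text \<open>Signed volume V_n(u) = Av(det[u ; \<partial>_{\<tau>_1} u ; ... ; \<partial>_{\<tau>_{n-1}} u]).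
  For a positively oriented frame, (\<tau>_1,...,\<tau>_{n-1},x) = R with det R = 1, one has
  det[\<nabla>_T u \<tau>_1 | ... | \<nabla>_T u \<tau>_{n-1} | u] = det(\<nabla>_T u P_T + u x^t) det R,
  and moving the column u to the front gives the sign (-1)^(n-1).\<close>
definition signed_volume :: "(real^'n \<Rightarrow> real^'n) \<Rightarrow> (real^'n \<Rightarrow> real^'n^'n) \<Rightarrow> real" where
  "signed_volume u G = Av (\<lambda>x. (-1) ^ (CARD('n) - 1) *
      det (G x ** PT x + (\<chi> i j. u x $ i * x $ j)))"

end

theory Submission
  imports Defs "HOL-Probability.Probability_Measure"
begin

text \<open>Let \<open>w\<close> be \<open>u\<close> minus its mean and \<open>\<sigma>\<close> the largest singular value of the gradient \<open>H\<close>.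
  The determinant in the volume is \<open>w \<bullet> N\<close>, where the vector \<open>N\<close> of maximal minors of \<open>H\<close> has mean zero (a null
  Lagrangian) and length at most \<open>\<sigma> ^ (n - 1)\<close>. By Morrey's inequality \<open>w\<close> is bounded, so the
  volume is at most the \<open>L\<^sup>2\<close> norm of \<open>w\<close> plus a multiple of \<open>e\<close>, the \<open>L\<^sup>2\<close> norm of the positive part of \<open>\<sigma> - 1\<close>.
  On the other hand \<open>|H|\<^sup>2 \<le> (n - 1) \<sigma>\<^sup>2\<close>. Hence \<open>u\<close> almost attains equality in the Poincare inequality,
  whose constant is the first eigenvalue \<open>n - 1\<close> of the sphere; the next one being \<open>2 n\<close>, the gradient of \<open>u\<close> is
  close in \<open>L\<^sup>2\<close> to that of a linear map \<open>A\<close>. As \<open>|A|\<^sup>2\<close> is almost at least \<open>n\<close> and the norm of \<open>A\<close> almost at most \<open>1\<close>,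
  \<open>A\<close> is close to an orthogonal matrix.

  Morrey's inequality, the density of smooth functions and the spectral gap all come from the convolutions \<open>T\<^sub>k\<close> with
  the kernels \<open>(1 + x \<bullet> y) ^ k\<close>, normalised to have mean one: they satisfy
  \<open>- \<Delta> T\<^sub>k = \<lambda>\<^sub>k (T\<^sub>k - T\<^sub>k\<^sub>-\<^sub>1)\<close>, where \<open>\<lambda>\<^sub>k = k (k + n - 2)\<close>.\<close>

section \<open>Polar coordinates\<close>

text \<open>The exponent 2 (n - 2) does two jobs. It puts |H|^(n - 2) into L^2, where it can be
  paired with the positive part of \<sigma> - 1, and it exceeds the dimension n - 1 of the sphere
  exactly when n \<ge> 4, which is what the boundedness of w requires. The linear rate rests on
  three relations. Let \<delta> be the bracket on the right-hand side, E the mean of |H - A P_T|^2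
  and S the mean of |w - A x|^2. Then E + (n - 1) |A|^2 / n \<le> (n - 1) (1 + O(\<delta>)), S +
  |A|^2 / n \<ge> 1 - O(\<delta>), and the gap gives 2 n S \<le> E. The last one bounds (n - 1) S by
  E / 2, so half of E survives and E = O(\<delta>). The norm of A is then known only up to the
  square root of \<delta>; this suffices because the distance of A to the orthogonal group enters
  squared. The kernels depend on x \<bullet> y alone, so convolution commutes with rotations and
  never increases the gradient energy. Since the Laplacian acts on them triangularly, the eigenvalue
  decomposition of \<open>Tk f k\<close> is finite linear algebra and spherical harmonics never
  appear.\<close>

lemma emeasure_lborel_radial_scale:
  fixes A :: "(real^'n) set"
  assumes [measurable]: "A \<in> sets borel" and t: "t > 0"
  shows "emeasure lborel {y \<in> ball 0 t. y /\<^sub>R norm y \<in> A}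
       = ennreal (t ^ CARD('n)) * emeasure lborel {y \<in> ball 0 1. y /\<^sub>R norm y \<in> A}"
proof -
  let ?X = "\<lambda>t. {y \<in> ball 0 t. y /\<^sub>R norm y \<in> A}"
  have X[measurable]: "?X s \<in> sets borel" for s by measurable
  have eq: "(\<lambda>x. 0 + t *\<^sub>R x) -` ?X t = ?X 1"
    using t by (auto simp: field_simps)
  have "emeasure lborel (?X t) = emeasure (density (distr lborel borel (\<lambda>x. 0 + t *\<^sub>R x)) (\<lambda>_. \<bar>t\<bar>^DIM(real^'n))) (?X t)"
    using lborel_affine[of t "0::real^'n"] t by simp
  also have "\<dots> = ennreal (t ^ CARD('n)) * emeasure (distr lborel borel (\<lambda>x. 0 + t *\<^sub>R x)) (?X t)"
    using t by (subst emeasure_density) (auto simp: nn_integral_cmult)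
  also have "emeasure (distr lborel borel (\<lambda>x. 0 + t *\<^sub>R x)) (?X t) = emeasure lborel (?X 1)"
    by (subst emeasure_distr) (auto simp only: eq space_lborel Int_UNIV_right, measurable)
  finally show ?thesis .
qed

lemma emeasure_lborel_ball_pos:
  "r > 0 \<Longrightarrow> emeasure lborel (ball (0::real^'n) r) > 0"
  by (simp add: emeasure_ball)

lemma prob_space_uniform_ball:
  "r > 0 \<Longrightarrow> prob_space (uniform_measure lborel (ball (0::real^'n) r))"
  using emeasure_lborel_ball_pos[of r, where 'n='n]
  using emeasure_lborel_ball_finite[of "0::real^'n" r]
  by (intro prob_space_uniform_measure) auto

lemma sets_sphere_meas [simp, measurable_cong]: "sets sphere_meas = sets borel"
  by (simp add: sphere_meas_def)

lemma space_sphere_meas [simp]: "space sphere_meas = UNIV"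
  by (simp add: sphere_meas_def)

interpretation sphere: prob_space "sphere_meas :: (real^'n) measure"
proof -
  interpret prob_space "uniform_measure lborel (ball (0::real^'n) 1)"
    by (rule prob_space_uniform_ball) simp
  show "prob_space (sphere_meas :: (real^'n) measure)"
    unfolding sphere_meas_def by (rule prob_space_distr) simp
qed

lemma AE_sphere_meas_norm: "AE x in (sphere_meas :: (real^'n) measure). norm x = 1"
proof -
  have "AE y in uniform_measure lborel (ball (0::real^'n) 1). norm (y /\<^sub>R norm y) = 1"
    using AE_lborel_singleton[of "0::real^'n"]
    by (intro AE_uniform_measureI) (auto elim!: eventually_mono)
  then show ?thesis
    unfolding sphere_meas_def by (subst AE_distr_iff) auto
qed

lemma emeasure_sphere_meas:
  fixes A :: "(real^'n) set"
  assumes [measurable]: "A \<in> sets borel"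
  shows "emeasure sphere_meas A
       = emeasure lborel {y \<in> ball 0 1. y /\<^sub>R norm y \<in> A} / emeasure lborel (ball (0::real^'n) 1)"
proof -
  have [measurable]: "(\<lambda>x::real^'n. x /\<^sub>R norm x) -` A \<in> sets borel"
    by (rule measurable_sets_borel[OF _ assms]) measurable
  have "ball 0 1 \<inter> (\<lambda>x::real^'n. x /\<^sub>R norm x) -` A = {y \<in> ball 0 1. y /\<^sub>R norm y \<in> A}"
    by auto
  then show ?thesis
    unfolding sphere_meas_def
    by (simp add: emeasure_distr)
qed

text \<open>Radius 2 is the outer radius of \<open>annulus\<close>, so every integral of the weak
  formulation lives in this ball. Normalised, it splits in \<open>polar_distr\<close> into a product
  of two probability measures.\<close>

abbreviation uball :: "(real^'n) measure" where
  "uball \<equiv> uniform_measure lborel (ball 0 2)"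

lemma emeasure_uball_polar:
  fixes A :: "(real^'n) set"
  assumes [measurable]: "A \<in> sets borel" and t: "0 < t" "t \<le> 2"
  shows "emeasure uball {y. norm y < t \<and> y /\<^sub>R norm y \<in> A}
       = emeasure sphere_meas A * ennreal ((t / 2) ^ CARD('n))"
proof -
  let ?b = "emeasure lborel (ball (0::real^'n) 1)" and ?\<beta> = "emeasure lborel {y \<in> ball (0::real^'n) 1. y /\<^sub>R norm y \<in> A}"
  have b: "?b \<noteq> 0" "?b \<noteq> \<infinity>"
    using emeasure_lborel_ball_pos[of 1, where 'n='n] emeasure_lborel_ball_finite[of "0::real^'n" 1] by auto
  have "?\<beta> \<le> ?b" by (rule emeasure_mono) auto
  then have "?\<beta> \<noteq> \<infinity>" using b by (auto simp: top_unique)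
  obtain b' where b': "?b = ennreal b'" "b' > 0"
    using b by (cases ?b) (auto simp: less_le)
  obtain \<beta>' where \<beta>': "?\<beta> = ennreal \<beta>'" "\<beta>' \<ge> 0"
    using \<open>?\<beta> \<noteq> \<infinity>\<close> by (cases ?\<beta>) auto
  have b2: "emeasure lborel (ball (0::real^'n) 2) = ennreal (2 ^ CARD('n) * b')"
    using emeasure_lborel_radial_scale[of "UNIV::(real^'n) set" 2] b' by (simp add: ennreal_mult ball_def)
  have "emeasure uball {y. norm y < t \<and> y /\<^sub>R norm y \<in> A}
     = emeasure lborel (ball 0 2 \<inter> {y. norm y < t \<and> y /\<^sub>R norm y \<in> A}) / emeasure lborel (ball (0::real^'n) 2)"
    by (rule emeasure_uniform_measure) measurable
  also have "ball 0 2 \<inter> {y. norm y < t \<and> y /\<^sub>R norm y \<in> A} = {y \<in> ball 0 t. y /\<^sub>R norm y \<in> A}"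
    using t by auto
  also have "emeasure lborel \<dots> = ennreal (t ^ CARD('n) * \<beta>')"
    using emeasure_lborel_radial_scale[OF assms(1) t(1)] \<beta>' t by (simp add: ennreal_mult)
  finally have 1: "emeasure uball {y. norm y < t \<and> y /\<^sub>R norm y \<in> A}
    = ennreal (t ^ CARD('n) * \<beta>') / ennreal (2 ^ CARD('n) * b')" by (simp add: b2)
  show ?thesis
    unfolding 1 emeasure_sphere_meas[OF assms(1)] \<beta>' b' using t \<beta>' b'
    by (subst divide_ennreal, simp, simp, subst divide_ennreal, simp, simp, subst ennreal_mult[symmetric])
       (auto simp: power_divide mult_ac)
qed

text \<open>Direction and radius of a uniform point of a ball are independent, and the direction has
  the law \<open>sphere_meas\<close>. Measures on the line are compared on the rays
  \<open>{x<..}\<close>, hence the minus sign: it turns the balls \<open>norm y < t\<close>, whose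
  mass scales like \<open>t ^ CARD('n)\<close>, into such rays.\<close>

lemma polar_distr:
  "sphere_meas \<Otimes>\<^sub>M distr uball borel (\<lambda>y::real^'n. - norm y)
     = distr uball (borel \<Otimes>\<^sub>M borel) (\<lambda>y::real^'n. (y /\<^sub>R norm y, - norm y))"
proof (rule pair_measure_eqI)
  interpret U: prob_space "uball :: (real^'n) measure" by (rule prob_space_uniform_ball) simp
  interpret R: prob_space "distr (uball :: (real^'n) measure) borel (\<lambda>y. - norm y)"
    by (rule U.prob_space_distr) simp
  show "sigma_finite_measure (sphere_meas::(real^'n) measure)" ..
  show "sigma_finite_measure (distr (uball :: (real^'n) measure) borel (\<lambda>y. - norm y))" ..
  show "sets ((sphere_meas::(real^'n) measure) \<Otimes>\<^sub>M distr (uball :: (real^'n) measure) borel (\<lambda>y. - norm y)) =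
    sets (distr uball (borel \<Otimes>\<^sub>M borel) (\<lambda>y::real^'n. (y /\<^sub>R norm y, - norm y)))"
    by (simp only: sets_distr) (rule sets_pair_measure_cong, simp_all)
  fix A :: "(real^'n) set" and B assume "A \<in> sets sphere_meas" "B \<in> sets (distr (uball :: (real^'n) measure) borel (\<lambda>y. - norm y))"
  then have [measurable]: "A \<in> sets borel" "B \<in> sets borel" by auto
  let ?n = "\<lambda>y::real^'n. y /\<^sub>R norm y"
  \<comment> \<open>For a fixed set \<open>A\<close> of directions, \<open>M\<close> is the radial
    law of the points with direction in \<open>A\<close>, and \<open>N\<close> is the radial law of
    all points multiplied by the mass of \<open>A\<close>.\<close>
  define M where "M = distr (density uball (indicator {y. ?n y \<in> A})) borel (\<lambda>y. - norm y)"
  define N where "N = density (distr (uball :: (real^'n) measure) borel (\<lambda>y. - norm y)) (\<lambda>_. emeasure sphere_meas A)"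
  have M: "emeasure M B = emeasure uball {y. - norm y \<in> B \<and> ?n y \<in> A}" if [measurable]: "B \<in> sets borel" for B
  proof -
    have [measurable]: "(\<lambda>y::real^'n. - norm y) -` B \<in> sets borel"
      by (rule measurable_sets_borel[OF _ that]) measurable
    have "emeasure (distr (density uball (indicator {y. ?n y \<in> A})) borel (\<lambda>y. - norm y)) B
       = (\<integral>\<^sup>+y. indicator {y. ?n y \<in> A} y * indicator ((\<lambda>y. - norm y) -` B) y \<partial>uball)"
      by (subst emeasure_distr, measurable, subst emeasure_density) auto
    also have "\<dots> = (\<integral>\<^sup>+y. indicator {y. - norm y \<in> B \<and> ?n y \<in> A} y \<partial>uball)"
      by (rule nn_integral_cong) (simp split: split_indicator)
    finally show ?thesis by (simp add: M_def)
  qed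
  have N: "emeasure N B = emeasure sphere_meas A * emeasure uball {y::real^'n. - norm y \<in> B}" if [measurable]: "B \<in> sets borel" for B
    unfolding N_def
    by (subst emeasure_density) (auto simp: nn_integral_cmult emeasure_distr vimage_def)
  have le2: "emeasure uball {y::real^'n. norm y < t \<and> ?n y \<in> A} = emeasure uball {y::real^'n. norm y < 2 \<and> ?n y \<in> A}"
    if "t \<ge> 2" "A \<in> sets borel" for t A
    using that by (subst (1 2) emeasure_uniform_measure) (auto intro!: arg_cong2[where f="(/)"] arg_cong2[where f=emeasure])
  have polar: "emeasure uball {y::real^'n. norm y < t \<and> ?n y \<in> A} = emeasure sphere_meas A * ennreal ((max 0 (min t 2) / 2) ^ CARD('n))"
    if "A \<in> sets borel" for t A
  proof -
    consider "t \<le> 0" | "0 < t" "t \<le> 2" | "t > 2" by linarith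
    then show ?thesis
    proof cases
      case 1
      have E: "{y::real^'n. norm y < t \<and> ?n y \<in> A} = {}"
        using 1 norm_ge_zero by (auto simp: not_less) (smt (verit) norm_ge_zero)
      show ?thesis unfolding E using 1 by (simp add: zero_power)
    next
      case 2
      then show ?thesis using emeasure_uball_polar[OF that, of t] by (simp add: min_def max_def)
    next
      case 3
      then show ?thesis using emeasure_uball_polar[OF that, of 2] le2[of t A] that by (simp add: min_def max_def)
    qed
  qed
  have "M = N"
  proof (rule measure_eqI_lessThan)
    show "sets M = sets borel" "sets N = sets borel" by (auto simp: M_def N_def)
    fix x :: real
    have "emeasure M {x<..} = emeasure uball {y::real^'n. norm y < - x \<and> ?n y \<in> A}"
    proof -
      have "{y::real^'n. - norm y \<in> {x<..} \<and> ?n y \<in> A} = {y. norm y < - x \<and> ?n y \<in> A}" by auto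
      then show ?thesis by (simp only: M borel_open[OF open_greaterThan])
    qed
    also have "\<dots> = emeasure sphere_meas A * emeasure uball {y::real^'n. norm y < - x \<and> ?n y \<in> UNIV}"
    proof -
      have "A \<in> sets borel" "(UNIV :: (real^'n) set) \<in> sets borel" by auto
      note polar[OF this(1)] polar[OF this(2)]
      then show ?thesis
        using sphere.emeasure_space_1[where 'n='n] by (simp only: space_sphere_meas mult_1)
    qed
    also have "\<dots> = emeasure N {x<..}"
    proof -
      have "{y::real^'n. - norm y \<in> {x<..}} = {y. norm y < - x \<and> ?n y \<in> UNIV}" by auto
      then show ?thesis by (simp only: N borel_open[OF open_greaterThan])
    qed
    finally show "emeasure M {x<..} = emeasure N {x<..}" .
    show "emeasure M {x<..} < \<infinity>"
      by (subst M) (auto simp: U.emeasure_eq_measure)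
  qed
  then have "emeasure M B = emeasure N B" by simp
  then show "emeasure sphere_meas A * emeasure (distr (uball :: (real^'n) measure) borel (\<lambda>y. - norm y)) B
     = emeasure (distr uball (borel \<Otimes>\<^sub>M borel) (\<lambda>y::real^'n. (y /\<^sub>R norm y, - norm y))) (A \<times> B)"
    by (simp add: M N emeasure_distr vimage_def conj_commute)
qed


lemma polar_integral:
  fixes F :: "real^'n \<Rightarrow> real" and w :: "real \<Rightarrow> real"
  assumes F: "integrable sphere_meas F" and [measurable]: "w \<in> borel_measurable borel" and w: "\<And>r. \<bar>w r\<bar> \<le> C"
  shows "integrable uball (\<lambda>y. w (norm y) * F (y /\<^sub>R norm y))"
    and "(\<integral>y. w (norm y) * F (y /\<^sub>R norm y) \<partial>uball) = (\<integral>y. w (norm (y::real^'n)) \<partial>uball) * (\<integral>x. F x \<partial>sphere_meas)"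
proof -
  interpret U: prob_space "uball :: (real^'n) measure" by (rule prob_space_uniform_ball) simp
  let ?R = "distr uball borel (\<lambda>y::real^'n. - norm y)"
  interpret R: prob_space ?R by (rule U.prob_space_distr) simp
  interpret P: pair_sigma_finite sphere_meas ?R ..
  have [measurable]: "F \<in> borel_measurable borel" using F by auto
  have wint: "integrable ?R (\<lambda>r. w (- r))"
    using w by (intro R.integrable_const_bound[where B=C]) auto
  have int: "integrable (sphere_meas \<Otimes>\<^sub>M ?R) (\<lambda>(x, r). w (- r) * F x)"
  proof (rule P.Fubini_integrable)
    have "integrable sphere_meas (\<lambda>x. \<bar>F x\<bar> * (\<integral>r. \<bar>w (- r)\<bar> \<partial>?R))"
      using F by auto
    then show "integrable sphere_meas (\<lambda>x. \<integral>r. norm (case (x, r) of (x, r) \<Rightarrow> w (- r) * F x) \<partial>?R)"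
      by (simp add: abs_mult mult.commute)
    show "(\<lambda>(x, r). w (- r) * F x) \<in> borel_measurable (sphere_meas \<Otimes>\<^sub>M ?R)" by measurable
    show "AE x in sphere_meas. integrable ?R (\<lambda>r. case (x, r) of (x, r) \<Rightarrow> w (- r) * F x)"
      by (rule AE_I2) (simp only: prod.case, rule integrable_mult_left, rule wint)
  qed
  have 1: "integrable (distr uball (borel \<Otimes>\<^sub>M borel) (\<lambda>y::real^'n. (y /\<^sub>R norm y, - norm y))) (\<lambda>(x, r). w (- r) * F x)"
    using int by (simp only: polar_distr)
  then show "integrable uball (\<lambda>y. w (norm y) * F (y /\<^sub>R norm y))"
    by (simp add: integrable_distr_eq)
  have "(\<integral>y. w (norm y) * F (y /\<^sub>R norm y) \<partial>uball) = (\<integral>p. (case p of (x, r) \<Rightarrow> w (- r) * F x) \<partial>(distr uball (borel \<Otimes>\<^sub>M borel) (\<lambda>y::real^'n. (y /\<^sub>R norm y, - norm y))))"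
    by (simp add: integral_distr)
  also have "\<dots> = (\<integral>p. (case p of (x, r) \<Rightarrow> w (- r) * F x) \<partial>(sphere_meas \<Otimes>\<^sub>M ?R))"
    by (simp only: polar_distr)
  also have "\<dots> = (\<integral>x. \<integral>r. w (- r) * F x \<partial>?R \<partial>sphere_meas)"
    using P.integral_fst'[OF int] by simp
  also have "\<dots> = (\<integral>r. w (- r) \<partial>?R) * (\<integral>x. F x \<partial>sphere_meas)"
    by (simp only: integral_mult_left_zero integral_mult_right_zero)
  also have "(\<integral>r. w (- r) \<partial>?R) = (\<integral>y. w (norm (y::real^'n)) \<partial>uball)"
    by (simp add: integral_distr)
  finally show "(\<integral>y. w (norm y) * F (y /\<^sub>R norm y) \<partial>uball) = (\<integral>y. w (norm (y::real^'n)) \<partial>uball) * (\<integral>x. F x \<partial>sphere_meas)" .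
qed

lemma integral_uball:
  fixes f :: "real^'n \<Rightarrow> real"
  assumes [measurable]: "f \<in> borel_measurable borel" and f: "\<And>y. norm y \<ge> 2 \<Longrightarrow> f y = 0"
  shows "(\<integral>y. f y \<partial>uball) = (\<integral>y. f y \<partial>lborel) / measure lborel (ball (0::real^'n) 2)"
    and "integrable uball f \<longleftrightarrow> integrable lborel f"
proof -
  let ?b = "measure lborel (ball (0::real^'n) 2)"
  have b: "?b > 0" "emeasure lborel (ball (0::real^'n) 2) = ennreal ?b"
    using emeasure_lborel_ball_pos[of 2, where 'n='n] emeasure_lborel_ball_finite[of "0::real^'n" 2]
    by (auto simp: measure_def enn2real_positive_iff)
  have eq: "uball = density lborel (\<lambda>x::real^'n. ennreal (indicator (ball 0 2) x / ?b))"
    unfolding uniform_measure_def b(2) using b(1)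
    by (intro density_cong; (measurable)?) (auto simp: divide_ennreal[symmetric] split: split_indicator)
  have f': "indicator (ball 0 2) x * f x = f x" for x
    using f[of x] by (auto split: split_indicator simp: not_less)
  have [measurable]: "(\<lambda>x::real^'n. indicat_real (ball 0 2) x / ?b) \<in> borel_measurable borel"
    by (intro borel_measurable_divide borel_measurable_indicator borel_measurable_const) auto
  show "(\<integral>y. f y \<partial>uball) = (\<integral>y. f y \<partial>lborel) / ?b"
    unfolding eq using b(1) by (subst integral_density) (auto simp: f')
  show "integrable uball f \<longleftrightarrow> integrable lborel f"
  proof
    assume "integrable uball f"
    then have "integrable lborel (\<lambda>x. f x / ?b)"
      unfolding eq using b(1) by (subst (asm) integrable_density) (auto simp: f')
    then have "integrable lborel (\<lambda>x. ?b * (f x / ?b))" by (rule integrable_mult_right)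
    then show "integrable lborel f" using b(1) by simp
  next
    assume "integrable lborel f"
    then have "integrable lborel (\<lambda>x. f x / ?b)" by simp
    then show "integrable uball f"
      unfolding eq using b(1) by (subst integrable_density) (auto simp: f')
  qed
qed

section \<open>Weak tangential gradients\<close>

text \<open>A cutoff that is positive exactly on (1/2, 2). It will be evaluated at
  \<open>y \<bullet> y\<close>, so it vanishes near the origin and has its support strictly inside
  \<open>annulus\<close>. The square makes it C^1, which is all that \<open>test_fun\<close> asks
  for.\<close>

definition bump :: "real \<Rightarrow> real" where
  "bump t = (max 0 ((t - 1/2) * (2 - t)))\<^sup>2"

definition bump' :: "real \<Rightarrow> real" where
  "bump' t = 2 * max 0 ((t - 1/2) * (2 - t)) * (5/2 - 2 * t)"

lemma has_real_derivative_max0_sq: "((\<lambda>s. (max 0 s)\<^sup>2) has_real_derivative 2 * max 0 s) (at s)"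
proof -
  consider "s > 0" | "s < 0" | "s = 0" by linarith
  then show ?thesis
  proof cases
    case 1
    have "((\<lambda>s. s\<^sup>2) has_real_derivative 2 * max 0 s) (at s)"
      using 1 by (auto intro!: derivative_eq_intros)
    then show ?thesis
      by (rule has_field_derivative_transform_within_open[where S="{0<..}"]) (use 1 in auto)
  next
    case 2
    have "((\<lambda>s. 0) has_real_derivative 2 * max 0 s) (at s)"
      using 2 by (auto intro!: derivative_eq_intros)
    then show ?thesis
      by (rule has_field_derivative_transform_within_open[where S="{..<0}"]) (use 2 in auto)
  next
    case 3
    have "((\<lambda>h. (max 0 h)\<^sup>2 / h) \<longlongrightarrow> 0) (at (0::real))"
    proof (rule Lim_null_comparison)
      show "\<forall>\<^sub>F h in at (0::real). norm ((max 0 h)\<^sup>2 / h) \<le> \<bar>h\<bar>"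
        by (auto simp: eventually_at_filter power2_eq_square max_def)
      show "((\<lambda>h::real. \<bar>h\<bar>) \<longlongrightarrow> 0) (at 0)"
        by (intro tendsto_rabs_zero tendsto_ident_at)
    qed
    then show ?thesis using 3 by (simp add: DERIV_def)
  qed
qed

lemma bump_has_derivative: "(bump has_real_derivative bump' t) (at t)"
  unfolding bump_def[abs_def] bump'_def
  by (rule DERIV_chain2[OF has_real_derivative_max0_sq, THEN DERIV_cong])
     (auto intro!: derivative_eq_intros simp: algebra_simps)

lemma bump_eq_0: "t \<le> 1/2 \<or> t \<ge> 2 \<Longrightarrow> bump t = 0" "t \<le> 1/2 \<or> t \<ge> 2 \<Longrightarrow> bump' t = 0"
proof -
  assume "t \<le> 1/2 \<or> t \<ge> 2"
  then have "(t - 1/2) * (2 - t) \<le> 0"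
    by (auto simp: mult_le_0_iff)
  then show "bump t = 0" "bump' t = 0" by (auto simp: bump_def bump'_def max_def)
qed

lemma bump_nonneg: "bump t \<ge> 0"
  by (simp add: bump_def)

lemma bump_pos: "1/2 < t \<Longrightarrow> t < 2 \<Longrightarrow> bump t > 0"
  by (simp add: bump_def max_def not_le)

lemma continuous_bump: "continuous_on S bump" "continuous_on S bump'"
  unfolding bump_def[abs_def] bump'_def[abs_def] by (intro continuous_intros)+

lemma has_derivative_radial_proj:
  fixes y :: "real^'n"
  assumes "y \<noteq> 0"
  shows "((\<lambda>y. y /\<^sub>R norm y) has_derivative
    (\<lambda>v. (v - ((y /\<^sub>R norm y) \<bullet> v) *\<^sub>R (y /\<^sub>R norm y)) /\<^sub>R norm y)) (at y)"
proof -
  have "y \<bullet> y > 0" using assms by simp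
  have "((\<lambda>y. y /\<^sub>R sqrt (y \<bullet> y)) has_derivative
    (\<lambda>v. (v - ((y /\<^sub>R norm y) \<bullet> v) *\<^sub>R (y /\<^sub>R norm y)) /\<^sub>R norm y)) (at y)"
    using \<open>y \<bullet> y > 0\<close> assms
    apply (auto intro!: derivative_eq_intros ext)
    apply (auto simp: norm_eq_sqrt_inner[symmetric] algebra_simps inner_commute divide_simps power2_eq_square)
    done
  then show ?thesis by (simp add: norm_eq_sqrt_inner[symmetric])
qed

text \<open>The derivative is kept as a plain function of base point and direction. Continuity for
  each fixed direction is, in finite dimension, the same as continuity of the derivative as a linear
  map.\<close>

definition C1_map :: "('a::real_normed_vector \<Rightarrow> 'b::real_normed_vector) \<Rightarrow> ('a \<Rightarrow> 'a \<Rightarrow> 'b) \<Rightarrow> bool" where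
  "C1_map X X' \<longleftrightarrow> (\<forall>x. (X has_derivative X' x) (at x)) \<and> (\<forall>v. continuous_on UNIV (\<lambda>x. X' x v))"

text \<open>The full divergence minus its normal-normal entry: at a unit vector \<open>x\<close>
  this is the trace of the derivative over the tangent space, that is, the divergence on the sphere
  of a tangential field.\<close>

definition tdiv :: "(real^'n \<Rightarrow> real^'n \<Rightarrow> real^'n) \<Rightarrow> real^'n \<Rightarrow> real" where
  "tdiv X' x = (\<Sum>j\<in>UNIV. X' x (axis j 1) $ j) - x \<bullet> X' x x"

text \<open>Integration by parts on the sphere itself, for one scalar component. Tangential fields
  do not see the normal part of \<open>h\<close>, so \<open>h\<close> is determined only up to that
  part; \<open>wgrad_tangential\<close> removes it. The fields are C^1 on the whole space and
  tangential to every sphere about the origin.\<close>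

definition wgrad :: "(real^'n \<Rightarrow> real) \<Rightarrow> (real^'n \<Rightarrow> real^'n) \<Rightarrow> bool" where
  "wgrad f h \<longleftrightarrow> f \<in> borel_measurable borel \<and> integrable sphere_meas f \<and> h \<in> borel_measurable borel \<and> integrable sphere_meas (\<lambda>x. norm (h x))
     \<and> (\<forall>X X'. C1_map X X' \<and> (\<forall>x. x \<bullet> X x = 0) \<longrightarrow>
          (\<integral>x. h x \<bullet> X x \<partial>sphere_meas) = - (\<integral>x. f x * tdiv X' x \<partial>sphere_meas))"

lemma C1_map_continuous: "C1_map X X' \<Longrightarrow> continuous_on S X"
  unfolding C1_map_def
  by (meson continuous_at_imp_continuous_on has_derivative_continuous)

lemma C1_map_linear: "C1_map X X' \<Longrightarrow> linear (X' x)"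
  by (rule has_derivative_linear[of X _ "at x"]) (simp add: C1_map_def)

lemma C1_map_expand:
  fixes X :: "real^'n \<Rightarrow> 'b::real_normed_vector"
  assumes "C1_map X X'"
  shows "X' x v = (\<Sum>k\<in>UNIV. (v $ k) *\<^sub>R X' x (axis k 1))"
proof -
  interpret linear "X' x" by (rule C1_map_linear[OF assms])
  have "v = (\<Sum>k\<in>UNIV. (v $ k) *\<^sub>R axis k 1)"
    using basis_expansion[of v] by (simp add: scalar_mult_eq_scaleR)
  then have "X' x v = X' x (\<Sum>k\<in>UNIV. (v $ k) *\<^sub>R axis k 1)" by simp
  then show ?thesis by (simp add: sum scale)
qed

lemma C1_map_continuous_deriv:
  fixes X :: "real^'n \<Rightarrow> 'b::real_normed_vector"
  assumes X: "C1_map X X'" and a: "continuous_on S a" and b: "continuous_on S b"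
  shows "continuous_on S (\<lambda>y. X' (a y) (b y))"
proof -
  have "continuous_on S (\<lambda>y. X' (a y) (axis k 1))" for k
    using continuous_on_compose2[OF _ a, of UNIV "\<lambda>x. X' x (axis k 1)"] X by (auto simp: C1_map_def)
  then have "continuous_on S (\<lambda>y. \<Sum>k\<in>UNIV. (b y $ k) *\<^sub>R X' (a y) (axis k 1))"
    by (intro continuous_intros b)
  then show ?thesis by (simp add: C1_map_expand[OF X, of _ "b _"])
qed

lemma integrable_sphere_mult_continuous:
  fixes f g :: "real^'n \<Rightarrow> real"
  assumes f: "integrable sphere_meas f" and g: "continuous_on UNIV g"
  shows "integrable sphere_meas (\<lambda>x. f x * g x)"
proof -
  have "compact (g ` sphere 0 1)"
    by (rule compact_continuous_image) (auto intro: continuous_on_subset[OF g])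
  then have "bounded (g ` sphere 0 1)" by (rule compact_imp_bounded)
  then obtain C where "\<forall>x\<in>g ` sphere 0 1. norm x \<le> C" unfolding bounded_iff by blast
  then have C: "\<bar>g x\<bar> \<le> C" if "norm x = 1" for x using that by simp
  have [measurable]: "g \<in> borel_measurable borel" by (rule borel_measurable_continuous_onI[OF g])
  have [measurable]: "f \<in> borel_measurable borel" using f by auto
  show ?thesis
  proof (rule Bochner_Integration.integrable_bound)
    show "integrable sphere_meas (\<lambda>x. C * f x)" using f by simp
    show "AE x in sphere_meas. norm (f x * g x) \<le> norm (C * f x)"
      using AE_sphere_meas_norm
    proof eventually_elim
      case (elim x)
      have "\<bar>g x\<bar> \<le> \<bar>C\<bar>" using C[OF elim] by linarith
      then show ?case using mult_right_mono[of "\<bar>g x\<bar>" "\<bar>C\<bar>" "\<bar>f x\<bar>"] by (simp add: abs_mult mult.commute)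
    qed
  qed simp
qed

lemma integrable_sphere_continuous:
  "continuous_on UNIV (g::real^'n \<Rightarrow> real) \<Longrightarrow> integrable sphere_meas g"
  using integrable_sphere_mult_continuous[of "\<lambda>_. 1" g] by simp

text \<open>One component of the 0-homogeneous extension of the field, cut off so as to be an
  admissible test function. Differentiating component \<open>j\<close> in direction \<open>j\<close>
  and summing over \<open>j\<close> produces the divergence.\<close>

definition test_field :: "(real^'n \<Rightarrow> real^'n) \<Rightarrow> 'n \<Rightarrow> real^'n \<Rightarrow> real" where
  "test_field X j y = bump (y \<bullet> y) * X (y /\<^sub>R norm y) $ j"

definition test_field' :: "(real^'n \<Rightarrow> real^'n) \<Rightarrow> (real^'n \<Rightarrow> real^'n \<Rightarrow> real^'n) \<Rightarrow> 'n \<Rightarrow> real^'n \<Rightarrow> real^'n \<Rightarrow> real" where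
  "test_field' X X' j y v = bump' (y \<bullet> y) * (2 * (y \<bullet> v)) * X (y /\<^sub>R norm y) $ j
     + bump (y \<bullet> y) * X' (y /\<^sub>R norm y) ((v - ((y /\<^sub>R norm y) \<bullet> v) *\<^sub>R (y /\<^sub>R norm y)) /\<^sub>R norm y) $ j"

text \<open>The support is contained in 1/2 \<le> |y|^2 \<le> 2. The rational bounds 2/3 and 3/2
  enclose these radii with some room, since 4/9 < 1/2 and 9/4 > 2, and still lie inside
  \<open>annulus\<close>.\<close>

lemma test_field_zero:
  assumes "norm y < 2/3 \<or> norm y > 3/2"
  shows "test_field X j y = 0" "test_field' X X' j y v = 0"
proof -
  have "norm y ^ 2 \<le> 1/2 \<or> norm y ^ 2 \<ge> 2"
  proof (cases "norm y < 2/3")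
    case True
    have "norm y ^ 2 \<le> (2/3)^2" using True by (intro power_mono) auto
    then show ?thesis by (simp add: power2_eq_square)
  next
    case False
    have "norm y ^ 2 \<ge> (3/2)^2" using False assms by (intro power_mono) auto
    then show ?thesis by (simp add: power2_eq_square)
  qed
  then have "y \<bullet> y \<le> 1/2 \<or> y \<bullet> y \<ge> 2" by (simp add: power2_norm_eq_inner)
  then show "test_field X j y = 0" "test_field' X X' j y v = 0"
    using bump_eq_0[of "y \<bullet> y"] by (auto simp: test_field_def test_field'_def)
qed

lemma test_field_has_derivative:
  assumes X: "C1_map X X'"
  shows "(test_field X j has_derivative test_field' X X' j y) (at y)"
proof (cases "y = 0")
  case True
  have "((\<lambda>y. 0) has_derivative (\<lambda>v. 0)) (at y)" by simp
  then have "(test_field X j has_derivative (\<lambda>v. 0)) (at y)"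
    by (rule has_derivative_transform_within_open[where s="ball 0 (1/2)"])
       (use True test_field_zero(1)[of _ X j] in auto)
  moreover have "test_field' X X' j y = (\<lambda>v. 0)"
    by (rule ext, rule test_field_zero(2)) (use True in simp)
  ultimately show ?thesis by simp
next
  case False
  have Xc: "((\<lambda>y. X (y /\<^sub>R norm y)) has_derivative (\<lambda>v. X' (y /\<^sub>R norm y) ((v - ((y /\<^sub>R norm y) \<bullet> v) *\<^sub>R (y /\<^sub>R norm y)) /\<^sub>R norm y))) (at y)"
    by (rule has_derivative_compose[OF has_derivative_radial_proj[OF False]])
       (use X in \<open>auto simp: C1_map_def\<close>)
  have b: "((\<lambda>y. bump (y \<bullet> y)) has_derivative (\<lambda>v. bump' (y \<bullet> y) * (2 * (y \<bullet> v)))) (at y)"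
    by (rule has_derivative_compose[OF _ bump_has_derivative[unfolded has_field_derivative_def], THEN has_derivative_eq_rhs])
       (auto intro!: derivative_eq_intros simp: inner_commute)
  have Xj: "((\<lambda>y. X (y /\<^sub>R norm y) $ j) has_derivative (\<lambda>v. X' (y /\<^sub>R norm y) ((v - ((y /\<^sub>R norm y) \<bullet> v) *\<^sub>R (y /\<^sub>R norm y)) /\<^sub>R norm y) $ j)) (at y)"
    by (rule bounded_linear.has_derivative[OF bounded_linear_vec_nth Xc])
  show ?thesis
    unfolding test_field_def[abs_def] test_field'_def[abs_def]
    by (rule has_derivative_eq_rhs[OF has_derivative_mult[OF b Xj]]) (auto simp: algebra_simps)
qed

lemma continuous_test_field':
  assumes X: "C1_map X X'"
  shows "continuous_on UNIV (\<lambda>y. test_field' X X' j y v)"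
proof -
  have "isCont (\<lambda>y. test_field' X X' j y v) y" for y
  proof (cases "y = 0")
    case True
    have "\<forall>\<^sub>F z in nhds y. test_field' X X' j z v = 0"
      unfolding eventually_nhds using test_field_zero(2)[of _ X X' j v] True
      by (intro exI[of _ "ball 0 (1/2)"]) auto
    then show ?thesis
      by (subst isCont_cong) auto
  next
    case False
    have n: "continuous_on (-{0}) (\<lambda>y::real^'a. y /\<^sub>R norm y)"
      by (intro continuous_intros) auto
    have Xn: "continuous_on (-{0}) (\<lambda>y. X (y /\<^sub>R norm y))"
      by (rule continuous_on_compose2[OF C1_map_continuous[OF X, of UNIV] n]) auto
    have X'n: "continuous_on (-{0}) (\<lambda>y. X' (y /\<^sub>R norm y) ((v - ((y /\<^sub>R norm y) \<bullet> v) *\<^sub>R (y /\<^sub>R norm y)) /\<^sub>R norm y))"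
      by (rule C1_map_continuous_deriv[OF X n]) (intro continuous_intros n, auto)
    have bb: "continuous_on (-{0}) (\<lambda>y::real^'a. bump (y \<bullet> y))" "continuous_on (-{0}) (\<lambda>y::real^'a. bump' (y \<bullet> y))"
      by (rule continuous_on_compose2[OF continuous_bump(1)[of UNIV]], auto intro!: continuous_intros)
         (rule continuous_on_compose2[OF continuous_bump(2)[of UNIV]], auto intro!: continuous_intros)
    have "continuous_on (-{0}) (\<lambda>y. test_field' X X' j y v)"
      unfolding test_field'_def by (intro continuous_intros bb Xn X'n)
    then show ?thesis
      using False by (simp add: continuous_on_eq_continuous_at open_Compl)
  qed
  then show ?thesis by (simp add: continuous_at_imp_continuous_on)
qed

lemma test_fun_test_field:
  assumes X: "C1_map X X'"
  shows "test_fun (test_field X j)"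
    and "frechet_derivative (test_field X j) (at y) = test_field' X X' j y"
proof -
  show fr: "frechet_derivative (test_field X j) (at y) = test_field' X X' j y" for y
    using frechet_derivative_at[OF test_field_has_derivative[OF X]] by metis
  have sub: "{x. test_field X j x \<noteq> 0} \<subseteq> cball 0 (3/2) - ball 0 (2/3)"
    using test_field_zero(1)[of _ X j] by (auto simp: not_less) (metis not_le)+
  have "closure {x. test_field X j x \<noteq> 0} \<subseteq> cball 0 (3/2) - ball 0 (2/3)"
    by (rule closure_minimal[OF sub]) (auto intro: closed_Diff)
  moreover have "cball 0 (3/2) - ball 0 (2/3) \<subseteq> (annulus :: (real^'a) set)"
    by (auto simp: annulus_def)
  moreover have "bounded {x. test_field X j x \<noteq> 0}"
    by (rule bounded_subset[OF _ sub]) (simp add: bounded_diff)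
  ultimately show "test_fun (test_field X j)"
    unfolding test_fun_def fr
    using test_field_has_derivative[OF X] continuous_test_field'[OF X]
    by (auto simp: differentiable_def compact_closure) blast
qed

lemma borel_measurable_vec_nth [measurable (raw)]:
  fixes f :: "'a \<Rightarrow> ('b::{second_countable_topology, real_normed_vector}) ^ 'n"
  shows "f \<in> borel_measurable M \<Longrightarrow> (\<lambda>x. f x $ i) \<in> borel_measurable M"
  by (rule measurable_compose[OF _ borel_measurable_continuous_onI]) (auto intro!: continuous_intros)

lemma bump_le_1: "bump t \<le> 1" and bump'_le: "\<bar>bump' t\<bar> \<le> 3"
proof -
  have p: "(t - 1/2) * (2 - t) \<le> 1"
  proof -
    have "(t - 1/2) * (2 - t) = 9/16 - (t - 5/4)\<^sup>2" by (simp add: power2_eq_square field_simps)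
    then show ?thesis using zero_le_power2[of "t - 5/4"] by linarith
  qed
  then show "bump t \<le> 1"
    by (auto simp: bump_def max_def power_le_one_iff abs_square_le_1)
  show "\<bar>bump' t\<bar> \<le> 3"
  proof (cases "1/2 \<le> t \<and> t \<le> 2")
    case True
    then have "\<bar>5/2 - 2 * t\<bar> \<le> 3/2" by linarith
    moreover have "\<bar>max 0 ((t - 1/2) * (2 - t))\<bar> \<le> 1" using p by auto
    ultimately have "\<bar>max 0 ((t - 1/2) * (2 - t))\<bar> * \<bar>5/2 - 2 * t\<bar> \<le> 1 * (3/2)"
      by (intro mult_mono) auto
    then show ?thesis by (simp add: bump'_def abs_mult)
  next
    case False
    then show ?thesis using bump_eq_0(2)[of t] by auto
  qed
qed

lemma bump_weight_bounds:
  "\<bar>bump (r\<^sup>2) / r\<bar> \<le> 2" "\<bar>bump' (r\<^sup>2) * (2 * r)\<bar> \<le> 12"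
proof -
  consider "r\<^sup>2 \<le> 1/2 \<or> r\<^sup>2 \<ge> 2" | "r\<^sup>2 > 1/2" "r\<^sup>2 < 2" by linarith
  then have "\<bar>bump (r\<^sup>2) / r\<bar> \<le> 2 \<and> \<bar>bump' (r\<^sup>2) * (2 * r)\<bar> \<le> 12"
  proof cases
    case 1
    then show ?thesis using bump_eq_0[of "r\<^sup>2"] by auto
  next
    case 2
    have r1: "\<bar>r\<bar> \<ge> 1/2"
    proof (rule ccontr)
      assume "\<not> \<bar>r\<bar> \<ge> 1/2"
      then have "\<bar>r\<bar>^2 \<le> (1/2)^2" by (intro power_mono) auto
      then show False using 2 by (simp add: power2_eq_square)
    qed
    have r2: "\<bar>r\<bar> \<le> 2"
    proof (rule ccontr)
      assume "\<not> \<bar>r\<bar> \<le> 2"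
      then have "\<bar>r\<bar>^2 \<ge> 2^2" by (intro power_mono) auto
      then show False using 2 by (simp add: power2_eq_square)
    qed
    have "\<bar>bump (r\<^sup>2)\<bar> / \<bar>r\<bar> \<le> 1 / (1/2)"
      using bump_le_1[of "r\<^sup>2"] bump_nonneg[of "r\<^sup>2"] r1 by (intro frac_le) auto
    moreover have "\<bar>bump' (r\<^sup>2)\<bar> * \<bar>2 * r\<bar> \<le> 3 * 4"
      using bump'_le[of "r\<^sup>2"] r2 by (intro mult_mono) auto
    ultimately show ?thesis by (simp add: abs_mult)
  qed
  then show "\<bar>bump (r\<^sup>2) / r\<bar> \<le> 2" "\<bar>bump' (r\<^sup>2) * (2 * r)\<bar> \<le> 12" by auto
qed

lemma bump_weight_measurable [measurable]:
  "(\<lambda>r. bump (r\<^sup>2) / r) \<in> borel_measurable borel" "(\<lambda>r. bump' (r\<^sup>2) * (2 * r)) \<in> borel_measurable borel"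
proof -
  have [measurable]: "bump \<in> borel_measurable borel" "bump' \<in> borel_measurable borel"
    by (auto intro!: borel_measurable_continuous_onI continuous_bump)
  show "(\<lambda>r. bump (r\<^sup>2) / r) \<in> borel_measurable borel" "(\<lambda>r. bump' (r\<^sup>2) * (2 * r)) \<in> borel_measurable borel"
    by measurable
qed

text \<open>This integral is the factor that \<open>wgradI\<close> finally cancels, so it must not
  vanish. In the ball of radius 1/5 about a unit vector the square of the norm stays between 16/25
  and 36/25, where \<open>bump\<close> is positive.\<close>

lemma bump_weight_integral_pos: "(\<integral>y. bump ((norm (y::real^'n))\<^sup>2) / norm y \<partial>uball) > 0"
proof -
  interpret U: prob_space "uball :: (real^'n) measure" by (rule prob_space_uniform_ball) simp
  let ?w = "\<lambda>y::real^'n. bump ((norm y)\<^sup>2) / norm y"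
  have int: "integrable uball ?w"
  proof (rule U.integrable_const_bound[where B=2])
    have "norm (?w y) \<le> 2" for y using bump_weight_bounds(1)[of "norm y"] by simp
    then show "AE y in uball. norm (?w y) \<le> 2" by simp
    have "(\<lambda>y::real^'n. (\<lambda>r. bump (r\<^sup>2) / r) (norm y)) \<in> borel_measurable uball" by measurable
    then show "?w \<in> borel_measurable uball" by simp
  qed
  have nn: "AE y in uball. 0 \<le> ?w y" by (simp add: bump_nonneg)
  have "\<not> (AE y in uball. ?w y = 0)"
  proof
    assume "AE y in uball. ?w y = 0"
    then have "AE y in lborel. y \<in> ball (0::real^'n) 2 \<longrightarrow> ?w y = 0"
      using emeasure_lborel_ball_pos[of 2, where 'n='n] emeasure_lborel_ball_finite[of "0::real^'n" 2]
      by (subst (asm) AE_uniform_measure) auto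
    then have "AE y in lborel. y \<notin> ball (axis undefined 1 :: real^'n) (1/5)"
    proof eventually_elim
      case (elim y)
      show ?case
      proof
        assume y: "y \<in> ball (axis undefined 1 :: real^'n) (1/5)"
        then have "\<bar>norm (axis undefined 1 :: real^'n) - norm y\<bar> < 1/5"
          using norm_triangle_ineq3[of "axis undefined 1" y] by (auto simp: dist_norm)
        then have "\<bar>1 - norm y\<bar> < 1/5" by simp
        then have n: "norm y > 4/5" "norm y < 6/5" by linarith+
        then have "(norm y)^2 > (4/5)^2" "(norm y)^2 < (6/5)^2"
          by (auto intro!: power_strict_mono)
        then have "bump ((norm y)\<^sup>2) > 0" by (intro bump_pos) (auto simp: power2_eq_square)
        then show False using elim n by auto
      qed
    qed
    then have "emeasure lborel (ball (axis undefined 1 :: real^'n) (1/5)) = 0"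
      by (subst (asm) AE_iff_measurable[OF _ refl]) (auto simp: ball_def)
    then show False using unit_ball_vol_pos[of "real CARD('n)"] by (simp add: emeasure_ball)
  qed
  then have "(\<integral>y. ?w y \<partial>uball) \<noteq> 0"
    using integral_nonneg_eq_0_iff_AE[OF int nn] by simp
  moreover have "(\<integral>y. ?w y \<partial>uball) \<ge> 0" by (rule integral_nonneg_AE[OF nn])
  ultimately show ?thesis by simp
qed

text \<open>In polar coordinates the derivative of a test field splits into a radial part with
  weight \<open>w1\<close> and a tangential part with weight \<open>w2\<close>. Summed over the
  components, the radial parts add up to a multiple of \<open>x \<bullet> X x\<close>, which is 0.
  Only the weight \<open>w2\<close> survives, the same on both sides, and its integral is
  cancelled.\<close>

lemma wgradI:
  fixes f :: "real^'n \<Rightarrow> real" and g :: "real^'n \<Rightarrow> real^'n"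
  assumes f [measurable]: "f \<in> borel_measurable borel" "integrable sphere_meas f"
    and g [measurable]: "g \<in> borel_measurable borel" "integrable sphere_meas (\<lambda>x. norm (g x))"
    and weak: "\<And>\<phi> j. test_fun \<phi> \<Longrightarrow>
      (\<integral>y\<in>annulus. f (y /\<^sub>R norm y) * frechet_derivative \<phi> (at y) (axis j 1) \<partial>lborel)
        = - (\<integral>y\<in>annulus. g (y /\<^sub>R norm y) $ j / norm y * \<phi> y \<partial>lborel)"
  shows "wgrad f g"
  unfolding wgrad_def
proof (intro conjI allI impI, fact, fact, fact, fact)
  fix X :: "real^'n \<Rightarrow> real^'n" and X'
  assume "C1_map X X' \<and> (\<forall>x. x \<bullet> X x = 0)"
  then have X: "C1_map X X'" and tan: "\<And>x. x \<bullet> X x = 0" by auto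
  let ?n = "\<lambda>y::real^'n. y /\<^sub>R norm y"
  \<comment> \<open>The factor \<open>2 * r\<close> is the inner derivative of
    \<open>bump (r\<^sup>2)\<close>. The factor \<open>1 / r\<close> in \<open>w2\<close> comes from
    the derivative of the radial projection, and on the gradient side from the homogeneity of degree
    -1.\<close>
  define w1 where "w1 r = bump' (r\<^sup>2) * (2 * r)" for r
  define w2 where "w2 r = bump (r\<^sup>2) / r" for r
  have [measurable]: "w1 \<in> borel_measurable borel" "w2 \<in> borel_measurable borel"
    unfolding w1_def[abs_def] w2_def[abs_def] by measurable
  define W1 where "W1 = (\<integral>y. w1 (norm (y::real^'n)) \<partial>uball)"
  define W2 where "W2 = (\<integral>y. w2 (norm (y::real^'n)) \<partial>uball)"
  define \<beta> where "\<beta> = measure lborel (ball (0::real^'n) 2)"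
  have \<beta>: "\<beta> > 0" unfolding \<beta>_def
    using emeasure_lborel_ball_pos[of 2, where 'n='n] emeasure_lborel_ball_finite[of "0::real^'n" 2]
    by (auto simp: measure_def enn2real_positive_iff)
  have W2: "W2 > 0" unfolding W2_def w2_def by (rule bump_weight_integral_pos)
  define F1 where "F1 j x = x $ j * X x $ j" for j x
  define F2 where "F2 j x = X' x (axis j 1 - x $ j *\<^sub>R x) $ j" for j x
  have Xc: "continuous_on S X" for S by (rule C1_map_continuous[OF X])
  have F1c: "continuous_on UNIV (F1 j)" for j
    unfolding F1_def[abs_def] by (intro continuous_intros Xc)
  have F2c: "continuous_on UNIV (F2 j)" for j
    unfolding F2_def[abs_def] by (intro continuous_intros C1_map_continuous_deriv[OF X])
  have [measurable]: "F1 j \<in> borel_measurable borel" "F2 j \<in> borel_measurable borel" "X \<in> borel_measurable borel" for j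
    by (auto intro!: borel_measurable_continuous_onI F1c F2c Xc)
  have fF: "integrable sphere_meas (\<lambda>x. f x * F1 j x)" "integrable sphere_meas (\<lambda>x. f x * F2 j x)" for j
    by (rule integrable_sphere_mult_continuous[OF f(2)]; rule F1c F2c)+
  have gj: "integrable sphere_meas (\<lambda>x. g x $ j)" for j
    by (rule Bochner_Integration.integrable_bound[OF g(2)]) (auto simp: component_le_norm_cart)
  have gX: "integrable sphere_meas (\<lambda>x. g x $ j * X x $ j)" for j
    by (rule integrable_sphere_mult_continuous[OF gj]) (intro continuous_intros Xc)
  have deriv: "test_field' X X' j y (axis j 1) = w1 (norm y) * F1 j (?n y) + w2 (norm y) * F2 j (?n y)" for j y
  proof (cases "y = 0")
    case True
    then show ?thesis using test_field_zero(2)[of y X X' j] by (simp add: w1_def w2_def bump_eq_0)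
  next
    case False
    interpret L: linear "X' (?n y)" by (rule C1_map_linear[OF X])
    have "(axis j 1 - (?n y \<bullet> axis j 1) *\<^sub>R ?n y) /\<^sub>R norm y = (1 / norm y) *\<^sub>R (axis j 1 - ?n y $ j *\<^sub>R ?n y)"
      by (simp add: inner_axis inverse_eq_divide)
    then show ?thesis
      unfolding test_field'_def F1_def F2_def w1_def w2_def using False
      by (simp only: L.scale) (simp add: inner_axis power2_norm_eq_inner field_simps)
  qed
  have out: "y \<notin> annulus \<Longrightarrow> test_field X j y = 0" "y \<notin> annulus \<Longrightarrow> test_field' X X' j y v = 0" for j y v
    using test_field_zero(1)[of y X j] test_field_zero(2)[of y X X' j v] by (auto simp: annulus_def)
  have big: "norm y \<ge> 2 \<Longrightarrow> w1 (norm y) = 0" "norm y \<ge> 2 \<Longrightarrow> w2 (norm y) = 0" for y :: "real^'n"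
  proof -
    assume "norm y \<ge> 2"
    then have "(norm y)^2 \<ge> 2^2" by (intro power_mono) auto
    then show "w1 (norm y) = 0" "w2 (norm y) = 0" unfolding w1_def w2_def by (auto simp: bump_eq_0)
  qed
  have eqj: "W1 * (\<integral>x. f x * F1 j x \<partial>sphere_meas) + W2 * (\<integral>x. f x * F2 j x \<partial>sphere_meas)
       = - W2 * (\<integral>x. g x $ j * X x $ j \<partial>sphere_meas)" for j
  proof -
    have b1: "\<bar>w1 r\<bar> \<le> 12" and b2: "\<bar>w2 r\<bar> \<le> 2" for r unfolding w1_def w2_def by (rule bump_weight_bounds)+
    note p1 = polar_integral[OF fF(1)[of j], of w1 12, OF _ b1, simplified]
    note p2 = polar_integral[OF fF(2)[of j], of w2 2, OF _ b2, simplified]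
    note p3 = polar_integral[OF gX[of j], of w2 2, OF _ b2, simplified]
    have "(\<integral>y\<in>annulus. f (?n y) * frechet_derivative (test_field X j) (at y) (axis j 1) \<partial>lborel)
       = (\<integral>y. w1 (norm y) * (f (?n y) * F1 j (?n y)) + w2 (norm y) * (f (?n y) * F2 j (?n y)) \<partial>lborel)"
      unfolding set_lebesgue_integral_def
    proof (rule Bochner_Integration.integral_cong)
      fix y :: "real^'n"
      have "f (?n y) * test_field' X X' j y (axis j 1)
          = w1 (norm y) * (f (?n y) * F1 j (?n y)) + w2 (norm y) * (f (?n y) * F2 j (?n y))"
        unfolding deriv by (simp only: distrib_left mult.left_commute)
      note E = this
      show "indicat_real annulus y *\<^sub>R (f (?n y) * frechet_derivative (test_field X j) (at y) (axis j 1))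
          = w1 (norm y) * (f (?n y) * F1 j (?n y)) + w2 (norm y) * (f (?n y) * F2 j (?n y))"
      proof (cases "y \<in> annulus")
        case True
        then show ?thesis by (simp only: test_fun_test_field(2)[OF X] E indicator_simps scaleR_one)
      next
        case False
        show ?thesis unfolding E[symmetric] using False by (simp only: out(2) indicator_simps scaleR_zero_left mult_zero_right simp_thms)
      qed
    qed simp
    also have "\<dots> = \<beta> * (\<integral>y. w1 (norm y) * (f (?n y) * F1 j (?n y)) + w2 (norm y) * (f (?n y) * F2 j (?n y)) \<partial>uball)"
      unfolding \<beta>_def using \<beta>[unfolded \<beta>_def] by (subst integral_uball(1)) (auto simp: big)
    also have "(\<integral>y. w1 (norm y) * (f (?n y) * F1 j (?n y)) + w2 (norm y) * (f (?n y) * F2 j (?n y)) \<partial>uball)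
        = W1 * (\<integral>x. f x * F1 j x \<partial>sphere_meas) + W2 * (\<integral>x. f x * F2 j x \<partial>sphere_meas)"
      unfolding W1_def W2_def by (subst Bochner_Integration.integral_add[OF p1(1) p2(1)]) (simp add: p1(2) p2(2))
    finally have L: "(\<integral>y\<in>annulus. f (?n y) * frechet_derivative (test_field X j) (at y) (axis j 1) \<partial>lborel)
       = \<beta> * (W1 * (\<integral>x. f x * F1 j x \<partial>sphere_meas) + W2 * (\<integral>x. f x * F2 j x \<partial>sphere_meas))" .
    have "(\<integral>y\<in>annulus. g (?n y) $ j / norm y * test_field X j y \<partial>lborel)
       = (\<integral>y. w2 (norm y) * (g (?n y) $ j * X (?n y) $ j) \<partial>lborel)"
      unfolding set_lebesgue_integral_def
    proof (rule Bochner_Integration.integral_cong)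
      fix y :: "real^'n"
      have "test_field X j y = 0 \<Longrightarrow> w2 (norm y) * (g (?n y) $ j * X (?n y) $ j) = 0"
        unfolding test_field_def w2_def by (auto simp: power2_norm_eq_inner)
      then show "indicat_real annulus y *\<^sub>R (g (?n y) $ j / norm y * test_field X j y) = w2 (norm y) * (g (?n y) $ j * X (?n y) $ j)"
        using out(1)[of y j]
        by (auto simp: test_field_def w2_def power2_norm_eq_inner split: split_indicator)
    qed simp
    also have "\<dots> = \<beta> * (\<integral>y. w2 (norm y) * (g (?n y) $ j * X (?n y) $ j) \<partial>uball)"
      unfolding \<beta>_def using \<beta>[unfolded \<beta>_def] by (subst integral_uball(1)) (auto simp: big)
    also have "\<dots> = \<beta> * (W2 * (\<integral>x. g x $ j * X x $ j \<partial>sphere_meas))"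
      unfolding W2_def by (simp only: p3(2))
    finally have R: "(\<integral>y\<in>annulus. g (?n y) $ j / norm y * test_field X j y \<partial>lborel) = \<beta> * (W2 * (\<integral>x. g x $ j * X x $ j \<partial>sphere_meas))" .
    have "\<beta> * (W1 * (\<integral>x. f x * F1 j x \<partial>sphere_meas) + W2 * (\<integral>x. f x * F2 j x \<partial>sphere_meas))
        = \<beta> * (- W2 * (\<integral>x. g x $ j * X x $ j \<partial>sphere_meas))"
      using weak[OF test_fun_test_field(1)[OF X], of j j] unfolding L R by linarith
    then show ?thesis using \<beta> by (simp only: mult_cancel_left) linarith
  qed
  have sumeq: "(\<Sum>j\<in>UNIV. W1 * (\<integral>x. f x * F1 j x \<partial>sphere_meas) + W2 * (\<integral>x. f x * F2 j x \<partial>sphere_meas))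
      = (\<Sum>j\<in>UNIV. - W2 * (\<integral>x. g x $ j * X x $ j \<partial>sphere_meas))"
    by (rule sum.cong[OF refl eqj])
  have "W1 * (\<integral>x. (\<Sum>j\<in>UNIV. f x * F1 j x) \<partial>sphere_meas) + W2 * (\<integral>x. (\<Sum>j\<in>UNIV. f x * F2 j x) \<partial>sphere_meas)
      = - W2 * (\<integral>x. (\<Sum>j\<in>UNIV. g x $ j * X x $ j) \<partial>sphere_meas)"
  proof -
    have "(\<integral>x. (\<Sum>j\<in>UNIV. f x * F1 j x) \<partial>sphere_meas) = (\<Sum>j\<in>UNIV. \<integral>x. f x * F1 j x \<partial>sphere_meas)"
      by (rule Bochner_Integration.integral_sum) (rule fF)
    moreover have "(\<integral>x. (\<Sum>j\<in>UNIV. f x * F2 j x) \<partial>sphere_meas) = (\<Sum>j\<in>UNIV. \<integral>x. f x * F2 j x \<partial>sphere_meas)"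
      by (rule Bochner_Integration.integral_sum) (rule fF)
    moreover have "(\<integral>x. (\<Sum>j\<in>UNIV. g x $ j * X x $ j) \<partial>sphere_meas) = (\<Sum>j\<in>UNIV. \<integral>x. g x $ j * X x $ j \<partial>sphere_meas)"
      by (rule Bochner_Integration.integral_sum) (rule gX)
    ultimately show ?thesis
      using sumeq by (simp only: sum.distrib sum_distrib_left)
  qed
  moreover have "(\<Sum>j\<in>UNIV. f x * F1 j x) = 0" for x
    using tan[of x] unfolding F1_def by (simp add: sum_distrib_left[symmetric] inner_vec_def)
  moreover have "(\<Sum>j\<in>UNIV. f x * F2 j x) = f x * tdiv X' x" for x
  proof -
    interpret L: linear "X' x" by (rule C1_map_linear[OF X])
    show ?thesis unfolding F2_def tdiv_def
      by (simp add: L.diff L.scale sum_distrib_left[symmetric] sum_subtractf inner_vec_def)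
  qed
  moreover have "(\<Sum>j\<in>UNIV. g x $ j * X x $ j) = g x \<bullet> X x" for x
    by (simp add: inner_vec_def)
  ultimately have "W2 * (\<integral>x. f x * tdiv X' x \<partial>sphere_meas) = W2 * - (\<integral>x. g x \<bullet> X x \<partial>sphere_meas)" by simp
  then show "(\<integral>x. g x \<bullet> X x \<partial>sphere_meas) = - (\<integral>x. f x * tdiv X' x \<partial>sphere_meas)"
    using W2 by (simp only: mult_cancel_left) linarith
qed

lemma tang_weak_grad_imp_wgrad:
  assumes "tang_weak_grad u G"
  shows "wgrad (\<lambda>x. u x $ i) (\<lambda>x. G x $ i)"
proof (rule wgradI)
  have [measurable]: "u \<in> borel_measurable borel" "G \<in> borel_measurable borel"
    and iu: "integrable sphere_meas (\<lambda>x. norm (u x))" and iG: "integrable sphere_meas (\<lambda>x. norm (G x))"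
    using assms by (auto simp: tang_weak_grad_def)
  show "(\<lambda>x. u x $ i) \<in> borel_measurable borel" "(\<lambda>x. G x $ i) \<in> borel_measurable borel"
    by measurable
  show "integrable sphere_meas (\<lambda>x. u x $ i)"
    by (rule Bochner_Integration.integrable_bound[OF iu]) (auto simp: component_le_norm_cart)
  show "integrable sphere_meas (\<lambda>x. norm (G x $ i))"
    by (rule Bochner_Integration.integrable_bound[OF iG]) (auto simp: Finite_Cartesian_Product.norm_nth_le)
qed (use assms in \<open>auto simp: tang_weak_grad_def\<close>)


section \<open>The divergence theorem on the sphere and three families of test fields\<close>

lemma integral_partial_derivative_0:
  fixes \<phi> D :: "real^'n \<Rightarrow> real"
  assumes \<phi>: "\<And>y. (\<phi> has_derivative \<phi>' y) (at y)" and D: "continuous_on UNIV D" "\<And>y. D y = \<phi>' y e"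
    and supp: "\<And>y. norm y \<ge> R \<Longrightarrow> \<phi> y = 0" "\<And>y. norm y \<ge> R \<Longrightarrow> D y = 0"
    and e: "norm e = 1"
  shows "(\<integral>y. D y \<partial>lborel) = 0"
proof -
  have \<phi>c: "continuous_on UNIV \<phi>"
    using \<phi> by (meson continuous_at_imp_continuous_on has_derivative_continuous)
  have [measurable]: "\<phi> \<in> borel_measurable borel" "D \<in> borel_measurable borel"
    by (auto intro!: borel_measurable_continuous_onI \<phi>c D)
  have bdd: "\<exists>B. \<forall>y. \<bar>g y\<bar> \<le> B" if "continuous_on UNIV g" "\<And>y. norm y \<ge> R \<Longrightarrow> g y = 0" for g :: "real^'n \<Rightarrow> real"
  proof -
    have "compact (g ` cball 0 R)"
      by (rule compact_continuous_image) (auto intro: continuous_on_subset[OF that(1)])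
    then have "bounded (g ` cball 0 R)" by (rule compact_imp_bounded)
    then obtain C where C: "\<forall>x\<in>g ` cball 0 R. norm x \<le> C" unfolding bounded_iff by blast
    have "\<bar>g y\<bar> \<le> max C 0" for y
      using C that(2)[of y] by (cases "norm y \<le> R") (auto simp: le_max_iff_disj)
    then show ?thesis by blast
  qed
  obtain B where B: "\<And>y. \<bar>\<phi> y\<bar> \<le> B" using bdd[OF \<phi>c supp(1)] by auto
  obtain L where L: "\<And>y. \<bar>D y\<bar> \<le> L" using bdd[OF D(1) supp(2)] by auto
  have int_ball: "integrable lborel (\<lambda>y::real^'n. C * indicator (cball 0 r) y :: real)" for C r
  proof (rule integrable_mult_right, rule integrable_real_indicator)
    show "emeasure lborel (cball (0::real^'n) r) < \<infinity>"
      by (metis bounded_cball emeasure_bounded_finite)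
  qed simp
  have \<phi>int: "integrable lborel \<phi>"
    by (rule Bochner_Integration.integrable_bound[OF int_ball[of B R]])
       (use order_trans[OF B abs_ge_self] supp(1) in \<open>auto split: split_indicator\<close>)
  have shift: "integrable lborel (\<lambda>y. \<phi> (a + y))" "(\<integral>y. \<phi> (a + y) \<partial>lborel) = (\<integral>y. \<phi> y \<partial>lborel)" for a
  proof -
    have "integrable (distr lborel borel ((+) a)) \<phi>" using \<phi>int by (simp add: lborel_distr_plus)
    then show "integrable lborel (\<lambda>y. \<phi> (a + y))" by (subst (asm) integrable_distr_eq) auto
    have "(\<integral>y. \<phi> y \<partial>(distr lborel borel ((+) a))) = (\<integral>y. \<phi> (a + y) \<partial>lborel)"
      by (rule integral_distr) auto
    then show "(\<integral>y. \<phi> (a + y) \<partial>lborel) = (\<integral>y. \<phi> y \<partial>lborel)" by (simp add: lborel_distr_plus)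
  qed
  have line: "((\<lambda>t. \<phi> (y + t *\<^sub>R e)) has_real_derivative D (y + t *\<^sub>R e)) (at t)" for y t
  proof -
    have "((\<lambda>t. \<phi> (y + t *\<^sub>R e)) has_derivative (\<lambda>h. \<phi>' (y + t *\<^sub>R e) (h *\<^sub>R e))) (at t)"
      by (rule has_derivative_compose[OF _ \<phi>]) (auto intro!: derivative_eq_intros)
    moreover have "linear (\<phi>' (y + t *\<^sub>R e))" using \<phi> has_derivative_linear by blast
    ultimately show ?thesis
      by (simp add: has_field_derivative_def D(2) linear_scale mult_commute_abs)
  qed
  \<comment> \<open>The integral of \<open>D\<close> is the limit of the integrals of difference
    quotients along \<open>e\<close>, and each of these is 0 by translation invariance. The mean
    value theorem supplies a common bound; as the steps are at most 1, the supports stay in the ball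
    of radius \<open>R + 1\<close>.\<close>
  define t where "t k = inverse (real (Suc k))" for k
  have t: "t k > 0" "t k \<le> 1" for k by (auto simp: t_def field_simps)
  define s where "s k y = (\<phi> (t k *\<^sub>R e + y) - \<phi> y) / t k" for k y
  have bound: "\<bar>s k y\<bar> \<le> L * indicator (cball 0 (R + 1)) y" for k y
  proof (cases "norm y \<le> R + 1")
    case True
    obtain z where z: "0 < z" "z < t k" "\<phi> (y + t k *\<^sub>R e) - \<phi> (y + 0 *\<^sub>R e) = (t k - 0) * D (y + z *\<^sub>R e)"
      using MVT2[of 0 "t k" "\<lambda>t. \<phi> (y + t *\<^sub>R e)" "\<lambda>t. D (y + t *\<^sub>R e)"] t[of k] line by auto
    have "s k y = D (y + z *\<^sub>R e)" using z(3) t(1)[of k] by (simp add: s_def add.commute)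
    then show ?thesis using True L by simp
  next
    case False
    have "norm (t k *\<^sub>R e + y) \<ge> norm y - norm (t k *\<^sub>R e)"
      by (metis add.commute norm_diff_ineq)
    also have "norm (t k *\<^sub>R e) = t k" using t[of k] e by simp
    finally have "norm (t k *\<^sub>R e + y) \<ge> R" using False t[of k] by simp
    then show ?thesis using False supp(1) by (simp add: s_def)
  qed
  have lim: "(\<lambda>k. s k y) \<longlonglongrightarrow> D y" for y
  proof -
    have "(\<lambda>k. (\<phi> (y + (0 + t k) *\<^sub>R e) - \<phi> (y + 0 *\<^sub>R e)) / t k) \<longlonglongrightarrow> D (y + 0 *\<^sub>R e)"
    proof (rule filterlim_compose[OF line[of y 0, unfolded DERIV_def]])
      show "filterlim t (at 0) sequentially"
        unfolding filterlim_at using t LIMSEQ_inverse_real_of_nat by (auto simp: t_def[abs_def])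
    qed
    then show ?thesis by (simp add: s_def add.commute)
  qed
  have "(\<lambda>k. \<integral>y. s k y \<partial>lborel) \<longlonglongrightarrow> (\<integral>y. D y \<partial>lborel)"
    by (rule integral_dominated_convergence[where w="\<lambda>y. L * indicator (cball 0 (R + 1)) y"])
       (use bound lim int_ball in \<open>auto simp: s_def[abs_def]\<close>)
  moreover have "(\<integral>y. s k y \<partial>lborel) = 0" for k
    unfolding s_def using shift[of "t k *\<^sub>R e"] \<phi>int by (simp add: Bochner_Integration.integral_diff)
  ultimately show ?thesis by (simp add: LIMSEQ_const_iff)
qed

text \<open>This is the divergence theorem on the sphere: the tangential divergence of a tangential
  C^1 field has mean zero. The surface measure is a push-forward of Lebesgue measure, so the
  statement is inherited from compactly supported functions on the annulus.\<close>

lemma wgrad_const: "wgrad (\<lambda>_. 1) (\<lambda>_. 0 :: real^'n)"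
proof (rule wgradI)
  fix \<phi> :: "real^'n \<Rightarrow> real" and j
  assume \<phi>: "test_fun \<phi>"
  let ?D = "\<lambda>y. frechet_derivative \<phi> (at y) (axis j 1)"
  have der: "(\<phi> has_derivative frechet_derivative \<phi> (at y)) (at y)" for y
    using \<phi> by (simp add: test_fun_def frechet_derivative_works[symmetric])
  have z: "\<phi> y = 0" "?D y = 0" if "y \<notin> annulus" for y
  proof -
    have y: "y \<notin> closure {x. \<phi> x \<noteq> 0}" using \<phi> that by (auto simp: test_fun_def)
    then show "\<phi> y = 0" using closure_subset[of "{x. \<phi> x \<noteq> 0}"] by blast
    have "((\<lambda>_. 0) has_derivative (\<lambda>_. 0)) (at y)" by simp
    then have "(\<phi> has_derivative (\<lambda>_. 0)) (at y)"
      by (rule has_derivative_transform_within_open[where s="- closure {x. \<phi> x \<noteq> 0}"])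
         (use y closure_subset[of "{x. \<phi> x \<noteq> 0}"] in auto)
    then have "frechet_derivative \<phi> (at y) = (\<lambda>_. 0)"
      by (rule frechet_derivative_at[symmetric])
    then show "?D y = 0" by simp
  qed
  have "(\<integral>y. ?D y \<partial>lborel) = 0"
  proof (rule integral_partial_derivative_0[OF der, of _ _ 2])
    show "continuous_on UNIV ?D" using \<phi> by (auto simp: test_fun_def)
  qed (use z in \<open>auto simp: annulus_def\<close>)
  also have "(\<integral>y. ?D y \<partial>lborel) = (\<integral>y\<in>annulus. 1 * ?D y \<partial>lborel)"
    unfolding set_lebesgue_integral_def
    by (rule Bochner_Integration.integral_cong) (use z in \<open>auto split: split_indicator\<close>)
  finally show "(\<integral>y\<in>annulus. 1 * ?D y \<partial>lborel) = - (\<integral>y\<in>annulus. (0::real^'n) $ j / norm y * \<phi> y \<partial>lborel)"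
    by simp
qed auto

lemma sphere_integral_cong:
  fixes f g :: "real^'n \<Rightarrow> real"
  assumes "f \<in> borel_measurable borel" "g \<in> borel_measurable borel" "\<And>x. norm x = 1 \<Longrightarrow> f x = g x"
  shows "(\<integral>x. f x \<partial>sphere_meas) = (\<integral>x. g x \<partial>sphere_meas)"
  by (rule integral_cong_AE) (use assms AE_sphere_meas_norm[where 'n='n] in \<open>auto elim!: eventually_mono\<close>)

lemma sphere_integrable_bound:
  fixes f g :: "real^'n \<Rightarrow> real"
  assumes "integrable sphere_meas g" "f \<in> borel_measurable borel" "\<And>x. norm x = 1 \<Longrightarrow> \<bar>f x\<bar> \<le> g x"
  shows "integrable sphere_meas f"
proof (rule Bochner_Integration.integrable_bound[OF assms(1)])
  show "AE x in sphere_meas. norm (f x) \<le> norm (g x)"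
    using AE_sphere_meas_norm
  proof eventually_elim
    case (elim x) then show ?case using assms(3)[of x] by auto
  qed
qed (use assms in simp)

lemma sphere_integral_mono:
  fixes f g :: "real^'n \<Rightarrow> real"
  assumes "integrable sphere_meas f" "integrable sphere_meas g" "\<And>x. norm x = 1 \<Longrightarrow> f x \<le> g x"
  shows "(\<integral>x. f x \<partial>sphere_meas) \<le> (\<integral>x. g x \<partial>sphere_meas)"
  by (rule integral_mono_AE) (use assms AE_sphere_meas_norm[where 'n='n] in \<open>auto elim!: eventually_mono\<close>)

text \<open>\<open>B\<close> is skew-symmetric, hence the generator of a rotation: it is tangential
  and divergence free, and in the divergence of \<open>q x *\<^sub>R B x\<close> only the derivative
  of \<open>q\<close> along \<open>B\<close> remains.\<close>

lemma wgrad_rotation: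
  fixes q :: "real^'n \<Rightarrow> real"
  assumes w: "wgrad f h" and q: "C1_map q q'" and B: "linear B" "\<And>x. x \<bullet> B x = 0"
  shows "(\<integral>x. (h x \<bullet> B x) * q x \<partial>sphere_meas) = - (\<integral>x. f x * q' x (B x) \<partial>sphere_meas)"
proof -
  interpret B: linear B by fact
  define X where "X x = q x *\<^sub>R B x" for x
  define X' where "X' x v = q x *\<^sub>R B v + q' x v *\<^sub>R B x" for x v
  have Bd: "(B has_derivative B) (at x)" for x
    using B(1) by (simp add: linear_imp_has_derivative)
  have qd: "(q has_derivative q' x) (at x)" for x using q by (simp add: C1_map_def)
  have "C1_map X X'"
    unfolding C1_map_def
  proof (intro conjI allI)
    show "(X has_derivative X' x) (at x)" for x
      unfolding X_def[abs_def] X'_def[abs_def] by (rule has_derivative_scaleR[OF qd Bd])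
    show "continuous_on UNIV (\<lambda>x. X' x v)" for v
    proof -
      have "continuous_on UNIV B" "continuous_on UNIV (\<lambda>x. q' x v)"
        using q B(1) by (auto simp: C1_map_def linear_conv_bounded_linear intro: linear_continuous_on)
      then show ?thesis
        unfolding X'_def by (intro continuous_intros C1_map_continuous[OF q])
    qed
  qed
  moreover have "x \<bullet> X x = 0" for x by (simp add: X_def B)
  ultimately have "(\<integral>x. h x \<bullet> X x \<partial>sphere_meas) = - (\<integral>x. f x * tdiv X' x \<partial>sphere_meas)"
    using w by (auto simp: wgrad_def)
  moreover have "tdiv X' x = q' x (B x)" for x
  proof -
    have "B (axis j 1) $ j = 0" for j using B(2)[of "axis j 1"] by (simp add: inner_axis')
    then have "(\<Sum>j\<in>UNIV. X' x (axis j 1) $ j) = q' x (B x)"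
      by (simp add: X'_def C1_map_expand[OF q, of x "B x"] mult.commute)
    then show ?thesis by (simp add: tdiv_def X'_def inner_add_right B)
  qed
  ultimately show ?thesis by (simp add: X_def mult.commute)
qed

text \<open>The test field is \<open>\<eta> (x \<bullet> z)\<close> times the tangential projection
  of \<open>z\<close>. If \<eta> is the derivative of \<phi>, this is on the sphere the gradient of
  x \<mapsto> \<phi>(x \<bullet> z), so the bracket on the right is the spherical Laplacian of that
  function. The projection is multiplied by \<open>x \<bullet> x\<close> in order to be a
  polynomial, tangential off the sphere as well.\<close>

lemma wgrad_ridge:
  fixes z :: "real^'n"
  assumes w: "wgrad f h" and e: "\<And>s. (\<eta> has_real_derivative \<eta>' s) (at s)" "continuous_on UNIV \<eta>'"
  shows "(\<integral>x. (h x \<bullet> z - (h x \<bullet> x) * (x \<bullet> z)) * \<eta> (x \<bullet> z) \<partial>sphere_meas)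
    = - (\<integral>x. f x * ((z \<bullet> z - (x \<bullet> z)\<^sup>2) * \<eta>' (x \<bullet> z) - (real CARD('n) - 1) * (x \<bullet> z) * \<eta> (x \<bullet> z)) \<partial>sphere_meas)"
proof -
  have [measurable]: "f \<in> borel_measurable borel" "h \<in> borel_measurable borel" using w by (auto simp: wgrad_def)
  have ec: "continuous_on UNIV \<eta>" using e(1) by (meson DERIV_isCont continuous_at_imp_continuous_on)
  have [measurable]: "\<eta> \<in> borel_measurable borel" "\<eta>' \<in> borel_measurable borel"
    by (auto intro!: borel_measurable_continuous_onI ec e)
  define Y where "Y x = (x \<bullet> x) *\<^sub>R z - (x \<bullet> z) *\<^sub>R x" for x :: "real^'n"
  define Y' where "Y' x v = (2 * (x \<bullet> v)) *\<^sub>R z - ((v \<bullet> z) *\<^sub>R x + (x \<bullet> z) *\<^sub>R v)" for x v :: "real^'n"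
  define X where "X x = \<eta> (x \<bullet> z) *\<^sub>R Y x" for x
  define X' where "X' x v = \<eta> (x \<bullet> z) *\<^sub>R Y' x v + (\<eta>' (x \<bullet> z) * (v \<bullet> z)) *\<^sub>R Y x" for x v
  have Yd: "(Y has_derivative Y' x) (at x)" for x
    unfolding Y_def[abs_def] Y'_def[abs_def]
    by (auto intro!: derivative_eq_intros ext simp: inner_commute algebra_simps)
  have ed: "((\<lambda>x. \<eta> (x \<bullet> z)) has_derivative (\<lambda>v. \<eta>' (x \<bullet> z) * (v \<bullet> z))) (at x)" for x
    by (rule has_derivative_compose[OF _ e(1)[unfolded has_field_derivative_def]])
       (auto intro!: derivative_eq_intros)
  have "C1_map X X'"
    unfolding C1_map_def
  proof (intro conjI allI)
    show "(X has_derivative X' x) (at x)" for x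
      unfolding X_def[abs_def] X'_def[abs_def] by (rule has_derivative_scaleR[OF ed Yd])
    have "continuous_on UNIV (\<lambda>x. \<eta> (x \<bullet> z))" "continuous_on UNIV (\<lambda>x. \<eta>' (x \<bullet> z))"
      by (rule continuous_on_compose2[OF ec], auto intro!: continuous_intros)
         (rule continuous_on_compose2[OF e(2)], auto intro!: continuous_intros)
    then show "continuous_on UNIV (\<lambda>x. X' x v)" for v
      unfolding X'_def Y'_def Y_def by (intro continuous_intros)
  qed
  moreover have xY: "x \<bullet> Y x = 0" for x by (simp add: Y_def inner_diff_right)
  moreover have "x \<bullet> X x = 0" for x using xY by (simp add: X_def)
  ultimately have "(\<integral>x. h x \<bullet> X x \<partial>sphere_meas) = - (\<integral>x. f x * tdiv X' x \<partial>sphere_meas)"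
    using w by (auto simp: wgrad_def)
  moreover have td: "tdiv X' x = ((x \<bullet> x) * (z \<bullet> z) - (x \<bullet> z)\<^sup>2) * \<eta>' (x \<bullet> z) - (real CARD('n) - 1) * (x \<bullet> z) * \<eta> (x \<bullet> z)" for x
  proof -
    have 1: "(\<Sum>j\<in>UNIV. (axis j 1 \<bullet> z) * Y x $ j) = (x \<bullet> x) * (z \<bullet> z) - (x \<bullet> z)\<^sup>2"
    proof -
      have "(\<Sum>j\<in>UNIV. (axis j 1 \<bullet> z) * Y x $ j) = (\<Sum>j\<in>UNIV. z $ j * Y x $ j)"
        by (simp add: inner_axis')
      also have "\<dots> = z \<bullet> Y x" by (simp add: inner_vec_def)
      finally have "(\<Sum>j\<in>UNIV. (axis j 1 \<bullet> z) * Y x $ j) = z \<bullet> Y x" .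
      then show ?thesis by (simp add: Y_def inner_diff_right power2_eq_square inner_commute)
    qed
    have 2: "(\<Sum>j\<in>UNIV. Y' x (axis j 1) $ j) = - (real CARD('n) - 1) * (x \<bullet> z)"
    proof -
      have "Y' x (axis j 1) $ j = x $ j * z $ j - x \<bullet> z" for j
        by (simp add: Y'_def inner_axis inner_axis')
      then have "(\<Sum>j\<in>UNIV. Y' x (axis j 1) $ j) = (\<Sum>j\<in>UNIV. x $ j * z $ j) - (\<Sum>j\<in>(UNIV::'n set). x \<bullet> z)"
        by (simp add: sum_subtractf)
      also have "(\<Sum>j\<in>UNIV. x $ j * z $ j) = x \<bullet> z" by (simp add: inner_vec_def)
      finally show ?thesis by (simp add: algebra_simps)
    qed
    have 3: "x \<bullet> Y' x x = 0" unfolding Y'_def inner_diff_right inner_add_right inner_scaleR_right by algebra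
    have "(\<Sum>j\<in>UNIV. X' x (axis j 1) $ j) = \<eta> (x \<bullet> z) * (\<Sum>j\<in>UNIV. Y' x (axis j 1) $ j) + \<eta>' (x \<bullet> z) * (\<Sum>j\<in>UNIV. (axis j 1 \<bullet> z) * Y x $ j)"
      by (simp add: X'_def sum.distrib sum_distrib_left mult.assoc)
    moreover have "x \<bullet> X' x x = 0" by (simp add: X'_def inner_add_right 3 xY)
    ultimately show ?thesis unfolding tdiv_def 1 2 by (simp add: algebra_simps)
  qed
  moreover have "(\<integral>x. h x \<bullet> X x \<partial>sphere_meas) = (\<integral>x. (h x \<bullet> z - (h x \<bullet> x) * (x \<bullet> z)) * \<eta> (x \<bullet> z) \<partial>sphere_meas)"
  proof (rule sphere_integral_cong)
    show "h x \<bullet> X x = (h x \<bullet> z - (h x \<bullet> x) * (x \<bullet> z)) * \<eta> (x \<bullet> z)" if "norm x = 1" for x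
      using that by (simp add: X_def Y_def inner_diff_right norm_eq_1 algebra_simps)
    show "(\<lambda>x. h x \<bullet> X x) \<in> borel_measurable borel" unfolding X_def Y_def by measurable
  qed measurable
  moreover have "(\<integral>x. f x * tdiv X' x \<partial>sphere_meas) = (\<integral>x. f x * ((z \<bullet> z - (x \<bullet> z)\<^sup>2) * \<eta>' (x \<bullet> z) - (real CARD('n) - 1) * (x \<bullet> z) * \<eta> (x \<bullet> z)) \<partial>sphere_meas)"
    unfolding td by (rule sphere_integral_cong, measurable) (simp add: norm_eq_1)
  ultimately show ?thesis by simp
qed

text \<open>The divergence theorem for the product of \<open>q\<close> with a tangential field. The
  weak gradient is the Euclidean gradient with its normal component removed.\<close>

lemma wgrad_C1:
  fixes q :: "real^'n \<Rightarrow> real"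
  assumes q: "C1_map q q'"
  shows "wgrad q (\<lambda>x. (\<chi> j. q' x (axis j 1)) - q' x x *\<^sub>R x)"
proof -
  have qd: "(q has_derivative q' x) (at x)" for x using q by (simp add: C1_map_def)
  have qc: "continuous_on UNIV q" by (rule C1_map_continuous[OF q])
  have gc: "continuous_on UNIV (\<lambda>x. (\<chi> j. q' x (axis j 1)) - q' x x *\<^sub>R x)"
    by (intro continuous_intros C1_map_continuous_deriv[OF q] continuous_on_vec_lambda)
  show ?thesis
    unfolding wgrad_def
  proof (intro conjI allI impI)
    show "q \<in> borel_measurable borel" by (rule borel_measurable_continuous_onI[OF qc])
    show "integrable sphere_meas q" by (rule integrable_sphere_continuous[OF qc])
    show "(\<lambda>x. (\<chi> j. q' x (axis j 1)) - q' x x *\<^sub>R x) \<in> borel_measurable borel"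
      by (rule borel_measurable_continuous_onI[OF gc])
    show "integrable sphere_meas (\<lambda>x. norm ((\<chi> j. q' x (axis j 1)) - q' x x *\<^sub>R x))"
      by (rule integrable_sphere_continuous) (intro continuous_on_norm gc)
    fix X :: "real^'n \<Rightarrow> real^'n" and X'
    assume "C1_map X X' \<and> (\<forall>x. x \<bullet> X x = 0)"
    then have X: "C1_map X X'" and tan: "\<And>x. x \<bullet> X x = 0" by auto
    have Xd: "(X has_derivative X' x) (at x)" for x using X by (simp add: C1_map_def)
    define Z where "Z x = q x *\<^sub>R X x" for x
    define Z' where "Z' x v = q x *\<^sub>R X' x v + q' x v *\<^sub>R X x" for x v
    have "C1_map Z Z'"
      unfolding C1_map_def
    proof (intro conjI allI)
      show "(Z has_derivative Z' x) (at x)" for x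
        unfolding Z_def[abs_def] Z'_def[abs_def] by (rule has_derivative_scaleR[OF qd Xd])
      show "continuous_on UNIV (\<lambda>x. Z' x v)" for v
        unfolding Z'_def using q X
        by (intro continuous_intros C1_map_continuous[OF q] C1_map_continuous[OF X]) (auto simp: C1_map_def)
    qed
    moreover have "x \<bullet> Z x = 0" for x by (simp add: Z_def tan)
    ultimately have "(\<integral>x. 0 \<bullet> Z x \<partial>sphere_meas) = - (\<integral>x. 1 * tdiv Z' x \<partial>sphere_meas)"
      using wgrad_const[where 'n='n] unfolding wgrad_def by blast
    then have 0: "(\<integral>x. tdiv Z' x \<partial>sphere_meas) = 0" by simp
    have td: "tdiv Z' x = q x * tdiv X' x + ((\<chi> j. q' x (axis j 1)) - q' x x *\<^sub>R x) \<bullet> X x" for x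
      by (simp add: tdiv_def Z'_def sum.distrib inner_add_right tan inner_diff_left right_diff_distrib sum_distrib_left)
         (simp add: inner_vec_def)
    have tc: "continuous_on UNIV (tdiv X')" unfolding tdiv_def[abs_def]
      by (intro continuous_intros C1_map_continuous_deriv[OF X])
    have i1: "integrable sphere_meas (\<lambda>x. q x * tdiv X' x)"
      by (rule integrable_sphere_continuous) (intro continuous_on_mult qc tc)
    have i2: "integrable sphere_meas (\<lambda>x. ((\<chi> j. q' x (axis j 1)) - q' x x *\<^sub>R x) \<bullet> X x)"
      by (rule integrable_sphere_continuous) (intro continuous_on_inner gc C1_map_continuous[OF X])
    have "(\<integral>x. q x * tdiv X' x \<partial>sphere_meas) + (\<integral>x. ((\<chi> j. q' x (axis j 1)) - q' x x *\<^sub>R x) \<bullet> X x \<partial>sphere_meas) = 0"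
      using 0 unfolding td Bochner_Integration.integral_add[OF i1 i2] .
    then show "(\<integral>x. ((\<chi> j. q' x (axis j 1)) - q' x x *\<^sub>R x) \<bullet> X x \<partial>sphere_meas) = - (\<integral>x. q x * tdiv X' x \<partial>sphere_meas)"
      by linarith
  qed
qed

lemma ridge_C1:
  fixes y :: "real^'n"
  assumes e: "\<And>s. (\<eta> has_real_derivative \<eta>' s) (at s)" "continuous_on UNIV \<eta>'"
  shows "C1_map (\<lambda>x. \<eta> (y \<bullet> x)) (\<lambda>x v. \<eta>' (y \<bullet> x) * (y \<bullet> v))"
  unfolding C1_map_def
proof (intro conjI allI)
  show "((\<lambda>x. \<eta> (y \<bullet> x)) has_derivative (\<lambda>v. \<eta>' (y \<bullet> x) * (y \<bullet> v))) (at x)" for x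
    by (rule has_derivative_compose[OF _ e(1)[unfolded has_field_derivative_def]])
       (auto intro!: derivative_eq_intros)
  have "continuous_on UNIV (\<lambda>x. \<eta>' (y \<bullet> x))"
    by (rule continuous_on_compose2[OF e(2)]) (auto intro!: continuous_intros)
  then show "continuous_on UNIV (\<lambda>x. \<eta>' (y \<bullet> x) * (y \<bullet> v))" for v
    by (intro continuous_intros)
qed

section \<open>Second and fourth moments of the sphere\<close>

lemma sphere_ridge_moment:
  fixes z :: "real^'n"
  assumes e: "\<And>s. (\<eta> has_real_derivative \<eta>' s) (at s)" "continuous_on UNIV \<eta>'"
  shows "(\<integral>x. (z \<bullet> z - (x \<bullet> z)\<^sup>2) * \<eta>' (x \<bullet> z) - (real CARD('n) - 1) * (x \<bullet> z) * \<eta> (x \<bullet> z) \<partial>sphere_meas) = 0"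
  using wgrad_ridge[OF wgrad_const e, of z] by simp

lemma sphere_moment2_diag:
  fixes z :: "real^'n"
  shows "(\<integral>x. (x \<bullet> z)\<^sup>2 \<partial>sphere_meas) = (z \<bullet> z) / real CARD('n)"
proof -
  have i: "integrable sphere_meas (\<lambda>x. (x \<bullet> z)\<^sup>2)"
    by (rule integrable_sphere_continuous) (intro continuous_intros)
  have "(\<integral>x. (z \<bullet> z - (x \<bullet> z)\<^sup>2) * 1 - (real CARD('n) - 1) * (x \<bullet> z) * (x \<bullet> z) \<partial>sphere_meas) = 0"
    by (rule sphere_ridge_moment) (auto intro!: derivative_eq_intros)
  moreover have "(z \<bullet> z - (x \<bullet> z)\<^sup>2) * 1 - (real CARD('n) - 1) * (x \<bullet> z) * (x \<bullet> z) = z \<bullet> z - real CARD('n) * (x \<bullet> z)\<^sup>2" for x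
    by (simp add: algebra_simps power2_eq_square)
  ultimately have "(\<integral>x. z \<bullet> z - real CARD('n) * (x \<bullet> z)\<^sup>2 \<partial>sphere_meas) = 0" by (simp only:)
  then have "z \<bullet> z - real CARD('n) * (\<integral>x. (x \<bullet> z)\<^sup>2 \<partial>sphere_meas) = 0"
    using i by (simp add: sphere.prob_space[unfolded space_sphere_meas])
  then show ?thesis by (simp add: field_simps)
qed

lemma sphere_moment4_diag:
  fixes z :: "real^'n"
  shows "(\<integral>x. (x \<bullet> z)^4 \<partial>sphere_meas) = 3 * (z \<bullet> z)\<^sup>2 / (real CARD('n) * (real CARD('n) + 2))"
proof -
  have i: "integrable sphere_meas (\<lambda>x. (x \<bullet> z)\<^sup>2)" "integrable sphere_meas (\<lambda>x. (x \<bullet> z)^4)"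
    by (rule integrable_sphere_continuous; intro continuous_intros)+
  have "(\<integral>x. (z \<bullet> z - (x \<bullet> z)\<^sup>2) * (3 * (x \<bullet> z)\<^sup>2) - (real CARD('n) - 1) * (x \<bullet> z) * (x \<bullet> z)^3 \<partial>sphere_meas) = 0"
    by (rule sphere_ridge_moment) (auto intro!: derivative_eq_intros continuous_intros)
  moreover have "(z \<bullet> z - (x \<bullet> z)\<^sup>2) * (3 * (x \<bullet> z)\<^sup>2) - (real CARD('n) - 1) * (x \<bullet> z) * (x \<bullet> z)^3
      = 3 * (z \<bullet> z) * (x \<bullet> z)\<^sup>2 - (real CARD('n) + 2) * (x \<bullet> z)^4" for x
    by (simp add: algebra_simps eval_nat_numeral)
  ultimately have "(\<integral>x. 3 * (z \<bullet> z) * (x \<bullet> z)\<^sup>2 - (real CARD('n) + 2) * (x \<bullet> z)^4 \<partial>sphere_meas) = 0" by (simp only:)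
  then have "3 * (z \<bullet> z) * ((z \<bullet> z) / real CARD('n)) - (real CARD('n) + 2) * (\<integral>x. (x \<bullet> z)^4 \<partial>sphere_meas) = 0"
    using i by (simp add: sphere_moment2_diag)
  then have "(real CARD('n) + 2) * (\<integral>x. (x \<bullet> z)^4 \<partial>sphere_meas) = 3 * (z \<bullet> z)\<^sup>2 / real CARD('n)"
    by (simp add: power2_eq_square)
  then have "(\<integral>x. (x \<bullet> z)^4 \<partial>sphere_meas) = 3 * (z \<bullet> z)\<^sup>2 / real CARD('n) / (real CARD('n) + 2)"
    by (simp add: eq_divide_eq mult_ac)
  then show ?thesis by simp
qed

lemma sphere_moment2:
  fixes v w :: "real^'n"
  shows "(\<integral>x. (x \<bullet> v) * (x \<bullet> w) \<partial>sphere_meas) = (v \<bullet> w) / real CARD('n)"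
proof -
  have i: "integrable sphere_meas (\<lambda>x. (x \<bullet> v) * (x \<bullet> w))" "integrable sphere_meas (\<lambda>x. (x \<bullet> v)\<^sup>2)" for v w :: "real^'n"
    by (rule integrable_sphere_continuous; intro continuous_intros)+
  have "(\<integral>x. (x \<bullet> v) * (x \<bullet> w) \<partial>sphere_meas) = (\<integral>x. ((x \<bullet> (v + w))\<^sup>2 - (x \<bullet> v)\<^sup>2 - (x \<bullet> w)\<^sup>2) / 2 \<partial>sphere_meas)"
    by (rule Bochner_Integration.integral_cong) (auto simp: inner_add_right power2_eq_square algebra_simps)
  also have "\<dots> = (((v + w) \<bullet> (v + w)) / real CARD('n) - (v \<bullet> v) / real CARD('n) - (w \<bullet> w) / real CARD('n)) / 2"
    using i by (simp add: sphere_moment2_diag)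
  also have "\<dots> = (v \<bullet> w) / real CARD('n)"
    by (simp add: inner_add_left inner_add_right inner_commute field_simps)
  finally show ?thesis .
qed

text \<open>Polarisation of the diagonal case: (a + b)^4 + (a - b)^4 - 2 a^4 - 2 b^4 = 12 a^2 b^2.
  This moment enters when a linear map is averaged over all tangential projections, in
  \<open>integral_norm_PT_sq\<close>.\<close>

lemma sphere_moment4:
  fixes v w :: "real^'n"
  shows "(\<integral>x. (x \<bullet> v)\<^sup>2 * (x \<bullet> w)\<^sup>2 \<partial>sphere_meas)
    = ((v \<bullet> v) * (w \<bullet> w) + 2 * (v \<bullet> w)\<^sup>2) / (real CARD('n) * (real CARD('n) + 2))"
proof -
  let ?c = "real CARD('n) * (real CARD('n) + 2)"
  have i: "integrable sphere_meas (\<lambda>x. (x \<bullet> v)^4)" for v :: "real^'n"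
    by (rule integrable_sphere_continuous; intro continuous_intros)
  have "(\<integral>x. (x \<bullet> v)\<^sup>2 * (x \<bullet> w)\<^sup>2 \<partial>sphere_meas)
     = (\<integral>x. ((x \<bullet> (v + w))^4 + (x \<bullet> (v - w))^4 - 2 * (x \<bullet> v)^4 - 2 * (x \<bullet> w)^4) / 12 \<partial>sphere_meas)"
    by (rule Bochner_Integration.integral_cong)
       (auto simp: inner_add_right inner_diff_right eval_nat_numeral algebra_simps)
  also have "\<dots> = (3 * ((v + w) \<bullet> (v + w))\<^sup>2 / ?c + 3 * ((v - w) \<bullet> (v - w))\<^sup>2 / ?c - 2 * (3 * (v \<bullet> v)\<^sup>2 / ?c) - 2 * (3 * (w \<bullet> w)\<^sup>2 / ?c)) / 12"
    using i by (simp add: sphere_moment4_diag)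
  also have "\<dots> = (3 * ((v + w) \<bullet> (v + w))\<^sup>2 + 3 * ((v - w) \<bullet> (v - w))\<^sup>2 - 2 * (3 * (v \<bullet> v)\<^sup>2) - 2 * (3 * (w \<bullet> w)\<^sup>2)) / 12 / ?c"
    by (simp only: add_divide_distrib diff_divide_distrib divide_divide_eq_left' times_divide_eq_right mult.commute)
  also have "(3 * ((v + w) \<bullet> (v + w))\<^sup>2 + 3 * ((v - w) \<bullet> (v - w))\<^sup>2 - 2 * (3 * (v \<bullet> v)\<^sup>2) - 2 * (3 * (w \<bullet> w)\<^sup>2)) / 12
      = (v \<bullet> v) * (w \<bullet> w) + 2 * (v \<bullet> w)\<^sup>2"
    by (simp add: inner_add_left inner_add_right inner_diff_left inner_diff_right inner_commute[of w v] power2_eq_square field_simps)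
  finally show ?thesis by simp
qed

section \<open>The averaging operators\<close>

text \<open>Here \<open>d\<close> stands for the dimension n - 1 of the sphere. The product of (j +
  d) / (2 j + d) over j < k is the reciprocal of the mean of (1 + x \<bullet> y)^k; this is
  confirmed by \<open>kern_integral\<close>.\<close>

primrec kcoef :: "real \<Rightarrow> nat \<Rightarrow> real" where
  "kcoef d 0 = 1"
| "kcoef d (Suc k) = kcoef d k * ((k + d) / (2 * real k + d))"

definition kern :: "real \<Rightarrow> nat \<Rightarrow> real \<Rightarrow> real" where
  "kern d k s = kcoef d k * (1 + s) ^ k"

definition kern' :: "real \<Rightarrow> nat \<Rightarrow> real \<Rightarrow> real" where
  "kern' d k s = kcoef d k * (real k * (1 + s) ^ (k - 1))"

text \<open>The truncated subtractions are harmless: for \<open>k < 2\<close>, where the exponent is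
  off, one of the factors \<open>real k\<close> and \<open>real (k - 1)\<close> is 0.\<close>

definition kern'' :: "real \<Rightarrow> nat \<Rightarrow> real \<Rightarrow> real" where
  "kern'' d k s = kcoef d k * (real k * (real (k - 1) * (1 + s) ^ (k - 2)))"

definition lam :: "real \<Rightarrow> nat \<Rightarrow> real" where
  "lam d k = k * (k + d - 1)"

lemma kcoef_pos: "d > 0 \<Longrightarrow> kcoef d k > 0"
  by (induction k) (auto intro!: divide_pos_pos mult_pos_pos add_nonneg_pos)

lemma kern_derivs:
  "(kern d k has_real_derivative kern' d k s) (at s)"
  "(kern' d k has_real_derivative kern'' d k s) (at s)"
  "continuous_on S (kern d k)" "continuous_on S (kern' d k)" "continuous_on S (kern'' d k)"
  unfolding kern_def[abs_def] kern'_def[abs_def] kern''_def[abs_def]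
  by (auto intro!: derivative_eq_intros continuous_intros simp: numeral_2_eq_2)

lemma kern_measurable [measurable]:
  "kern d k \<in> borel_measurable borel" "kern' d k \<in> borel_measurable borel"
  by (auto intro!: borel_measurable_continuous_onI kern_derivs)

lemma kern_nonneg: "d > 0 \<Longrightarrow> s \<ge> -1 \<Longrightarrow> kern d k s \<ge> 0"
  using kcoef_pos[of d k] by (simp add: kern_def)

lemma kern_le: "d > 0 \<Longrightarrow> -1 \<le> s \<Longrightarrow> s \<le> 1 \<Longrightarrow> kern d k s \<le> kcoef d k * 2 ^ k"
  using kcoef_pos[of d k] by (auto simp: kern_def intro!: mult_left_mono power_mono)

lemma kern'_bound: "d > 0 \<Longrightarrow> -1 \<le> s \<Longrightarrow> s \<le> 1 \<Longrightarrow> \<bar>kern' d k s\<bar> \<le> kcoef d k * (k * 2 ^ (k - 1))"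
  using kcoef_pos[of d k] by (auto simp: kern'_def abs_mult power_abs intro!: mult_left_mono power_mono)

text \<open>The kernels satisfy \<open>- \<Delta> K\<^sub>k = \<lambda>\<^sub>k (K\<^sub>k - K\<^sub>k\<^sub>-\<^sub>1)\<close> on the sphere.\<close>

lemma kern_laplace:
  assumes d: "d > 0"
  shows "(1 - s\<^sup>2) * kern'' d (Suc k) s - d * s * kern' d (Suc k) s
       = - (lam d (Suc k) * (kern d (Suc k) s - kern d k s))"
proof -
  \<comment> \<open>With t = 1 + s one has 1 - s^2 = t (2 - t), so both terms become combinations of
    t^k and t^(k + 1). The recursion of \<open>kcoef\<close> turns the coefficient of t^k into that
    of the preceding kernel.\<close>
  define t where "t = 1 + s"
  have s: "s = t - 1" by (simp add: t_def)
  have c: "kcoef d (Suc k) * (2 * real k + d) = kcoef d k * (k + d)" using d by simp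
  have a: "(1 - s\<^sup>2) * kern'' d (Suc k) s = kcoef d (Suc k) * Suc k * (k * (2 - t) * t ^ k)"
    by (cases k) (auto simp: kern''_def s power2_eq_square algebra_simps simp del: kcoef.simps)
  have b: "d * s * kern' d (Suc k) s = kcoef d (Suc k) * Suc k * (d * (t - 1) * t ^ k)"
    by (simp add: kern'_def s del: kcoef.simps)
  have "(1 - s\<^sup>2) * kern'' d (Suc k) s - d * s * kern' d (Suc k) s
      = Suc k * (kcoef d (Suc k) * (2 * real k + d)) * t ^ k - Suc k * kcoef d (Suc k) * (k + d) * t ^ Suc k"
    unfolding a b by (simp add: algebra_simps del: kcoef.simps)
  also have "\<dots> = Suc k * (kcoef d k * (k + d)) * t ^ k - Suc k * kcoef d (Suc k) * (k + d) * t ^ Suc k"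
    by (simp only: c)
  also have "\<dots> = - (lam d (Suc k) * (kern d (Suc k) s - kern d k s))"
    unfolding lam_def kern_def t_def[symmetric] by (simp only: of_nat_Suc) (simp add: algebra_simps del: kcoef.simps)
  finally show ?thesis .
qed

text \<open>Differentiation steps down by one kernel, up to a factor. Integrals of a gradient
  against the derivative of a kernel are therefore again averages with a probability
  density.\<close>

lemma kern'_Suc:
  assumes "d > 0"
  shows "kern' d (Suc k) s = lam d (Suc k) / (2 * real k + d) * kern d k s"
  using assms by (simp add: kern'_def kern_def lam_def field_simps)

text \<open>For unit vectors 1 - x \<bullet> y is half the squared distance, so this identity
  measures the concentration of the kernels. Integrated, it yields a mean squared distance of order
  1 / k.\<close>

lemma kern_one_minus:
  assumes "d > 0"
  shows "kern d k s * (1 - s) = 2 * kern d k s - (2 * real k + d) / (k + d) * kern d (Suc k) s"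
proof -
  have "k + d > 0" "2 * real k + d > 0" using assms by (auto intro: add_nonneg_pos)
  then have "(2 * real k + d) / (k + d) * kcoef d (Suc k) = kcoef d k" by simp
  then have "(2 * real k + d) / (k + d) * kern d (Suc k) s = kern d k s * (1 + s)"
    unfolding kern_def by (simp del: kcoef.simps add: mult.assoc[symmetric])
  then show ?thesis by (simp add: algebra_simps)
qed

lemma Bernoulli_powr:
  fixes x a :: real
  assumes "x \<ge> 0" "a \<ge> 1"
  shows "1 + a * x \<le> (1 + x) powr a"
proof -
  have "(1 + 0) powr a - a * 0 \<le> (1 + x) powr a - a * x"
  proof (rule DERIV_nonneg_imp_nondecreasing[OF assms(1)])
    fix t :: real assume "0 \<le> t" "t \<le> x"
    then have "((\<lambda>t. (1 + t) powr a - a * t) has_real_derivative a * (1 + t) powr (a - 1) - a) (at t)"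
      by (auto intro!: derivative_eq_intros)
    moreover have "a * (1 + t) powr (a - 1) - a \<ge> 0"
      using ge_one_powr_ge_zero[of "1 + t" "a - 1"] \<open>0 \<le> t\<close> assms(2) by (simp add: mult_left_mono)
    ultimately show "\<exists>y. ((\<lambda>t. (1 + t) powr a - a * t) has_real_derivative y) (at t) \<and> 0 \<le> y" by blast
  qed
  then show ?thesis by simp
qed

text \<open>The left-hand side is the maximum of the kernel, attained at s = 1. A density of mass
  one, concentrated on the scale k^(-1/2) in dimension d, has height of order k^(d/2). The quotient
  of consecutive maxima is 1 + (d/2) / t with t = k + d/2, and Bernoulli's inequality compares it
  with (1 + 1/t)^(d/2).\<close>

lemma kcoef_growth:
  assumes d: "d \<ge> 2"
  shows "kcoef d k * 2 ^ k \<le> ((2 * real k + d) / d) powr (d / 2)"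
proof (induction k)
  case (Suc k)
  define t where "t = k + d / 2"
  have t: "t > 0" using d by (simp add: t_def add_nonneg_pos)
  have kd: "2 * real k + d = 2 * t" by (simp add: t_def)
  have "1 + (d / 2) * (1 / t) \<le> (1 + 1 / t) powr (d / 2)"
    using t d by (intro Bernoulli_powr) auto
  then have B: "(k + d) / t \<le> ((t + 1) / t) powr (d / 2)"
  proof -
    have kt: "k + d = t + d / 2" by (simp add: t_def)
    have "(k + d) / t = 1 + (d / 2) * (1 / t)" "(t + 1) / t = 1 + 1 / t"
      unfolding kt using t by (simp_all add: add_divide_distrib)
    then show ?thesis using \<open>1 + (d / 2) * (1 / t) \<le> (1 + 1 / t) powr (d / 2)\<close> by (simp only:)
  qed
  have "kcoef d (Suc k) * 2 ^ Suc k = (kcoef d k * 2 ^ k) * ((k + d) / t)"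
    unfolding kcoef.simps kd power_Suc using t by simp
  also have "\<dots> \<le> ((2 * real k + d) / d) powr (d / 2) * ((t + 1) / t) powr (d / 2)"
    using Suc B d t by (intro mult_mono) (auto intro: divide_nonneg_nonneg add_nonneg_nonneg)
  also have "\<dots> = (((2 * real k + d) / d) * ((t + 1) / t)) powr (d / 2)"
    using d t by (subst powr_mult) auto
  also have "((2 * real k + d) / d) * ((t + 1) / t) = (2 * real (Suc k) + d) / d"
  proof -
    have "2 * real (Suc k) + d = 2 * (t + 1)" by (simp add: t_def)
    moreover have "((2 * t) / d) * ((t + 1) / t) = (2 * (t + 1)) / d" using t by simp
    ultimately show ?thesis by (simp only: kd)
  qed
  finally show ?case .
qed (use d in simp)

section \<open>Convolution with the kernels\<close>

abbreviation dm :: "'n::finite itself \<Rightarrow> real" where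
  "dm t \<equiv> real CARD('n) - 1"

definition Tk :: "(real^'n \<Rightarrow> real) \<Rightarrow> nat \<Rightarrow> real^'n \<Rightarrow> real" where
  "Tk f k z = (\<integral>y. f y * kern (dm TYPE('n)) k (y \<bullet> z) \<partial>sphere_meas)"

lemma sphere_inner_bounds:
  "norm x = 1 \<Longrightarrow> norm y = 1 \<Longrightarrow> -1 \<le> x \<bullet> y" "norm x = 1 \<Longrightarrow> norm y = 1 \<Longrightarrow> x \<bullet> y \<le> (1::real)"
  using Cauchy_Schwarz_ineq2[of x y] by auto

lemma kern_unit_bounds:
  assumes "CARD('n) \<ge> 2" "norm (x::real^'n) = 1" "norm y = 1"
  shows "0 \<le> kern (dm TYPE('n)) k (x \<bullet> y)" "kern (dm TYPE('n)) k (x \<bullet> y) \<le> kcoef (dm TYPE('n)) k * 2 ^ k"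
  using assms sphere_inner_bounds[of x y] by (auto intro!: kern_nonneg kern_le)

lemma Tk_integrable:
  fixes f :: "real^'n \<Rightarrow> real"
  assumes "integrable sphere_meas f" "continuous_on UNIV \<eta>"
  shows "integrable sphere_meas (\<lambda>y. f y * \<eta> (y \<bullet> z))"
  by (rule integrable_sphere_mult_continuous[OF assms(1)])
     (rule continuous_on_compose2[OF assms(2)], auto intro!: continuous_intros)

text \<open>Testing the gradient with that of the ridge function of the kernel of index
  \<open>Suc k\<close> produces \<open>lam\<close> times the increment on one side. On the other
  side \<open>kern'_Suc\<close> produces the same factor times an average of the gradient, so the
  eigenvalue cancels and a gain of order 1 / k is left.\<close>

lemma Tk_step:
  fixes z :: "real^'n"
  assumes n: "CARD('n) \<ge> 2" and w: "wgrad f h" and z: "norm z = 1"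
  shows "Tk f (Suc k) z - Tk f k z
    = (\<integral>y. (h y \<bullet> z - (h y \<bullet> y) * (y \<bullet> z)) * kern (dm TYPE('n)) k (y \<bullet> z) \<partial>sphere_meas) / (2 * real k + dm TYPE('n))"
proof -
  let ?d = "dm TYPE('n)"
  have d: "?d > 0" using n by simp
  have f: "integrable sphere_meas f" using w by (simp add: wgrad_def)
  have zz: "z \<bullet> z = 1" using z by (simp add: norm_eq_1)
  have lam: "lam ?d (Suc k) > 0" using d by (simp add: lam_def)
  have kd: "2 * real k + ?d > 0" using d by (intro add_nonneg_pos) auto
  have "(\<integral>y. (h y \<bullet> z - (h y \<bullet> y) * (y \<bullet> z)) * kern' ?d (Suc k) (y \<bullet> z) \<partial>sphere_meas)
     = - (\<integral>y. f y * ((z \<bullet> z - (y \<bullet> z)\<^sup>2) * kern'' ?d (Suc k) (y \<bullet> z) - ?d * (y \<bullet> z) * kern' ?d (Suc k) (y \<bullet> z)) \<partial>sphere_meas)"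
    by (rule wgrad_ridge[OF w]) (auto intro: kern_derivs)
  also have "\<dots> = (\<integral>y. lam ?d (Suc k) * (f y * kern ?d (Suc k) (y \<bullet> z) - f y * kern ?d k (y \<bullet> z)) \<partial>sphere_meas)"
    unfolding zz kern_laplace[OF d] Bochner_Integration.integral_minus[symmetric]
    by (rule Bochner_Integration.integral_cong) (auto simp: algebra_simps)
  also have "\<dots> = lam ?d (Suc k) * (Tk f (Suc k) z - Tk f k z)"
    unfolding Tk_def using Tk_integrable[OF f kern_derivs(3)] by simp
  finally have "lam ?d (Suc k) * (Tk f (Suc k) z - Tk f k z)
     = (\<integral>y. lam ?d (Suc k) / (2 * real k + ?d) * ((h y \<bullet> z - (h y \<bullet> y) * (y \<bullet> z)) * kern ?d k (y \<bullet> z)) \<partial>sphere_meas)"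
    unfolding kern'_Suc[OF d] by (simp only: mult_ac)
  also have "\<dots> = lam ?d (Suc k) * ((\<integral>y. (h y \<bullet> z - (h y \<bullet> y) * (y \<bullet> z)) * kern ?d k (y \<bullet> z) \<partial>sphere_meas) / (2 * real k + ?d))"
    by simp
  finally show ?thesis using lam by (simp only: mult_cancel_left) auto
qed

text \<open>The constant function has gradient zero, so by \<open>Tk_step\<close> its averages do
  not depend on \<open>k\<close>, and for \<open>k = 0\<close> the kernel is 1.\<close>

lemma kern_integral:
  fixes z :: "real^'n"
  assumes n: "CARD('n) \<ge> 2" and z: "norm z = 1"
  shows "(\<integral>y. kern (dm TYPE('n)) k (y \<bullet> z) \<partial>sphere_meas) = 1"
proof (induction k)
  case 0
  then show ?case by (simp add: kern_def sphere.prob_space[unfolded space_sphere_meas])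
next
  case (Suc k)
  then show ?case using Tk_step[OF n wgrad_const z, of k] by (simp add: Tk_def)
qed

lemma kern_integrable: "integrable sphere_meas (\<lambda>y. kern d k (y \<bullet> z))"
  using Tk_integrable[OF _ kern_derivs(3), of "\<lambda>_. 1" d k] by simp

lemma kern_dist_integral:
  fixes z :: "real^'n"
  assumes n: "CARD('n) \<ge> 2" and z: "norm z = 1"
  shows "(\<integral>y. kern (dm TYPE('n)) k (y \<bullet> z) * (1 - y \<bullet> z) \<partial>sphere_meas) = dm TYPE('n) / (k + dm TYPE('n))"
proof -
  have d: "dm TYPE('n) > 0" using n by simp
  then have kd: "k + dm TYPE('n) > 0" by (intro add_nonneg_pos) auto
  show ?thesis
  proof -
    have "(\<integral>y. kern (dm TYPE('n)) k (y \<bullet> z) * (1 - y \<bullet> z) \<partial>sphere_meas) = 2 - (2 * real k + dm TYPE('n)) / (k + dm TYPE('n))"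
      unfolding kern_one_minus[OF d]
      by (subst Bochner_Integration.integral_diff)
         (intro integrable_mult_right kern_integrable, intro integrable_mult_right kern_integrable, simp only: integral_mult_right_zero kern_integral[OF n z] mult_1_right)
    also have "\<dots> = dm TYPE('n) / (k + dm TYPE('n))"
      using kd by (simp only: field_simps) auto
    finally show ?thesis .
  qed
qed

lemma sphere_swap:
  fixes f g :: "real^'n \<Rightarrow> real" and k :: "real^'n \<Rightarrow> real^'n \<Rightarrow> real"
  assumes f: "integrable sphere_meas f" and g: "integrable sphere_meas g"
    and k [measurable]: "case_prod k \<in> borel_measurable (borel \<Otimes>\<^sub>M borel)"
    and C: "\<And>x y. norm x = 1 \<Longrightarrow> norm y = 1 \<Longrightarrow> \<bar>k x y\<bar> \<le> C"
  shows "(\<integral>x. g x * (\<integral>y. f y * k y x \<partial>sphere_meas) \<partial>sphere_meas)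
       = (\<integral>y. f y * (\<integral>x. g x * k y x \<partial>sphere_meas) \<partial>sphere_meas)" (is ?eq)
    and "integrable sphere_meas (\<lambda>x. g x * (\<integral>y. f y * k y x \<partial>sphere_meas))" (is ?int)
proof -
  interpret P: pair_sigma_finite "sphere_meas :: (real^'n) measure" "sphere_meas :: (real^'n) measure" ..
  have [measurable]: "f \<in> borel_measurable borel" "g \<in> borel_measurable borel" using f g by auto
  let ?F = "\<lambda>(x, y). g x * (f y * k y x)"
  have m: "?F \<in> borel_measurable (sphere_meas \<Otimes>\<^sub>M sphere_meas)" by measurable
  have inner: "integrable sphere_meas (\<lambda>y. f y * k y x)" if "norm x = 1" for x
  proof (rule sphere_integrable_bound)
    show "integrable sphere_meas (\<lambda>y. \<bar>C\<bar> * \<bar>f y\<bar>)" using f by auto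
    show "\<bar>f y * k y x\<bar> \<le> \<bar>C\<bar> * \<bar>f y\<bar>" if "norm y = 1" for y
      using C[OF that \<open>norm x = 1\<close>] mult_right_mono[of "\<bar>k y x\<bar>" "\<bar>C\<bar>" "\<bar>f y\<bar>"]
      by (simp add: abs_mult mult.commute)
  qed simp
  have "integrable (sphere_meas \<Otimes>\<^sub>M sphere_meas) ?F"
  proof (rule P.Fubini_integrable[OF m])
    show "integrable sphere_meas (\<lambda>x. \<integral>y. norm (case (x, y) of (x, y) \<Rightarrow> g x * (f y * k y x)) \<partial>sphere_meas)"
    proof (rule sphere_integrable_bound)
      show "integrable sphere_meas (\<lambda>x. \<bar>g x\<bar> * (\<bar>C\<bar> * (\<integral>y. \<bar>f y\<bar> \<partial>sphere_meas)))" using g by auto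
      show "(\<lambda>x. \<integral>y. norm (case (x, y) of (x, y) \<Rightarrow> g x * (f y * k y x)) \<partial>sphere_meas) \<in> borel_measurable borel"
        by measurable
      fix x :: "real^'n" assume x: "norm x = 1"
      have "(\<integral>y. norm (case (x, y) of (x, y) \<Rightarrow> g x * (f y * k y x)) \<partial>sphere_meas) = \<bar>g x\<bar> * (\<integral>y. \<bar>f y * k y x\<bar> \<partial>sphere_meas)"
        by (simp add: abs_mult)
      also have "\<dots> \<le> \<bar>g x\<bar> * (\<integral>y. \<bar>C\<bar> * \<bar>f y\<bar> \<partial>sphere_meas)"
      proof (intro mult_left_mono sphere_integral_mono)
        show "\<bar>f y * k y x\<bar> \<le> \<bar>C\<bar> * \<bar>f y\<bar>" if "norm y = 1" for y
          using C[OF that x] mult_right_mono[of "\<bar>k y x\<bar>" "\<bar>C\<bar>" "\<bar>f y\<bar>"]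
          by (simp add: abs_mult mult.commute)
      qed (use f inner[OF x] in auto)
      finally show "\<bar>\<integral>y. norm (case (x, y) of (x, y) \<Rightarrow> g x * (f y * k y x)) \<partial>sphere_meas\<bar> \<le> \<bar>g x\<bar> * (\<bar>C\<bar> * (\<integral>y. \<bar>f y\<bar> \<partial>sphere_meas))"
        by (simp add: integral_nonneg_AE)
    qed
    show "AE x in sphere_meas. integrable sphere_meas (\<lambda>y. case (x, y) of (x, y) \<Rightarrow> g x * (f y * k y x))"
      using AE_sphere_meas_norm by eventually_elim (auto intro: inner)
  qed
  note int = this
  show ?eq using P.Fubini_integral[of "\<lambda>x y. g x * (f y * k y x)", OF int]
  proof -
    assume "(\<integral>y. \<integral>x. g x * (f y * k y x) \<partial>sphere_meas \<partial>sphere_meas) = (\<integral>x. \<integral>y. g x * (f y * k y x) \<partial>sphere_meas \<partial>sphere_meas)"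
    moreover have "(\<integral>x. g x * (f y * k y x) \<partial>sphere_meas) = f y * (\<integral>x. g x * k y x \<partial>sphere_meas)" for y
      by (simp only: mult.left_commute[of _ "f y"] integral_mult_right_zero)
    ultimately show ?thesis by simp
  qed
  show ?int using P.integrable_fst'[OF int] by simp
qed

text \<open>The kernel is symmetric, so \<open>Tk\<close> is self-adjoint.\<close>

lemma kern_swap:
  fixes f g :: "real^'n \<Rightarrow> real"
  assumes n: "CARD('n) \<ge> 2" and f: "integrable sphere_meas f" and g: "integrable sphere_meas g"
  shows "(\<integral>x. g x * Tk f k x \<partial>sphere_meas) = (\<integral>y. f y * Tk g k y \<partial>sphere_meas)"
    and "integrable sphere_meas (\<lambda>x. g x * Tk f k x)"
proof -
  have b: "\<bar>kern (dm TYPE('n)) k (x \<bullet> y)\<bar> \<le> kcoef (dm TYPE('n)) k * 2 ^ k" if "norm x = 1" "norm y = 1" for x y :: "real^'n"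
    using kern_unit_bounds[OF n that, of k] by simp
  have m: "(\<lambda>(x::real^'n, y). kern (dm TYPE('n)) k (x \<bullet> y)) \<in> borel_measurable (borel \<Otimes>\<^sub>M borel)" by measurable
  have c: "Tk g k y = (\<integral>x. g x * kern (dm TYPE('n)) k (y \<bullet> x) \<partial>sphere_meas)" for y
    unfolding Tk_def by (subst inner_commute) (rule refl)
  show "(\<integral>x. g x * Tk f k x \<partial>sphere_meas) = (\<integral>y. f y * Tk g k y \<partial>sphere_meas)"
    unfolding c Tk_def[of f] by (rule sphere_swap(1)[OF f g m b])
  show "integrable sphere_meas (\<lambda>x. g x * Tk f k x)"
    unfolding Tk_def[of f] by (rule sphere_swap(2)[OF f g m b])
qed

lemma Tk_measurable [measurable]:
  assumes [measurable]: "f \<in> borel_measurable borel"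
  shows "Tk f k \<in> borel_measurable borel"
  unfolding Tk_def[abs_def] by measurable

lemma Tk_integrable_sphere:
  fixes f :: "real^'n \<Rightarrow> real"
  assumes "CARD('n) \<ge> 2" "integrable sphere_meas f"
  shows "integrable sphere_meas (Tk f k)"
  using kern_swap(2)[OF assms, of "\<lambda>_. 1"] by simp

lemma Tk_const:
  fixes z :: "real^'n"
  assumes "CARD('n) \<ge> 2" "norm z = 1"
  shows "Tk (\<lambda>_. c) k z = c"
  using kern_integral[OF assms, of k] by (simp add: Tk_def)

lemma integral_Tk:
  fixes f :: "real^'n \<Rightarrow> real"
  assumes n: "CARD('n) \<ge> 2" and f: "integrable sphere_meas f"
  shows "(\<integral>x. Tk f k x \<partial>sphere_meas) = (\<integral>x. f x \<partial>sphere_meas)"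
proof -
  have "(\<integral>x. 1 * Tk f k x \<partial>sphere_meas) = (\<integral>y. f y * Tk (\<lambda>_. 1) k y \<partial>sphere_meas)"
    by (rule kern_swap(1)[OF n f]) simp
  also have "\<dots> = (\<integral>y. f y \<partial>sphere_meas)"
    by (rule sphere_integral_cong) (use f Tk_const[OF n] in auto)
  finally show ?thesis by simp
qed

lemma Tk_mono:
  fixes f g :: "real^'n \<Rightarrow> real"
  assumes n: "CARD('n) \<ge> 2" and f: "integrable sphere_meas f" "integrable sphere_meas g"
    and le: "\<And>y. norm y = 1 \<Longrightarrow> f y \<le> g y" and z: "norm z = 1"
  shows "Tk f k z \<le> Tk g k z"
  unfolding Tk_def
  by (rule sphere_integral_mono)
     (use f le kern_unit_bounds(1)[OF n _ z, of _ k] in \<open>auto intro!: Tk_integrable kern_derivs mult_right_mono\<close>)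

lemma Tk_linear:
  fixes f g :: "real^'n \<Rightarrow> real"
  assumes f: "integrable sphere_meas f" "integrable sphere_meas g"
  shows "Tk (\<lambda>x. f x + g x) k z = Tk f k z + Tk g k z" "Tk (\<lambda>x. f x - g x) k z = Tk f k z - Tk g k z"
    "Tk (\<lambda>x. c * f x) k z = c * Tk f k z" "Tk (\<lambda>x. - f x) k z = - Tk f k z"
  unfolding Tk_def using Tk_integrable[OF f(1) kern_derivs(3)] Tk_integrable[OF f(2) kern_derivs(3)]
  by (simp_all add: distrib_right left_diff_distrib mult.assoc)

lemma Tk_abs_le:
  fixes f :: "real^'n \<Rightarrow> real"
  assumes n: "CARD('n) \<ge> 2" and f: "integrable sphere_meas f" and z: "norm z = 1"
  shows "\<bar>Tk f k z\<bar> \<le> Tk (\<lambda>x. \<bar>f x\<bar>) k z"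
proof -
  have "Tk f k z \<le> Tk (\<lambda>x. \<bar>f x\<bar>) k z" by (rule Tk_mono[OF n f _ _ z]) (use f in auto)
  moreover have "Tk (\<lambda>x. - f x) k z \<le> Tk (\<lambda>x. \<bar>f x\<bar>) k z" by (rule Tk_mono[OF n _ _ _ z]) (use f in auto)
  ultimately show ?thesis using Tk_linear(4)[OF f f] by auto
qed

lemma power_tangent:
  fixes a t :: real
  assumes "a \<ge> 0" "t \<ge> 0" "m \<ge> 1"
  shows "a ^ m + m * a ^ (m - 1) * (t - a) \<le> t ^ m"
proof (cases "a = 0")
  case True
  then show ?thesis using assms by (cases "m = 1") (auto simp: zero_power)
next
  case False
  then have a: "a > 0" using assms by simp
  obtain k where m: "m = Suc k" using assms(3) by (cases m) auto
  have 1: "a * (1 + (t - a) / a) = t" using a by (simp add: distrib_left)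
  have 2: "a * ((t - a) / a) = t - a" using a by simp
  have "a ^ m * (1 + m * ((t - a) / a)) \<le> a ^ m * (1 + (t - a) / a) ^ m"
    using a assms(2) by (intro mult_left_mono Bernoulli_inequality) (auto simp: pos_le_divide_eq)
  also have "\<dots> = t ^ m" by (simp only: power_mult_distrib[symmetric] 1)
  also have "a ^ m * (1 + m * ((t - a) / a)) = a ^ m + m * a ^ (m - 1) * (a * ((t - a) / a))"
    unfolding m by (simp add: distrib_left mult_ac del: of_nat_Suc)
  finally show ?thesis unfolding 2 .
qed

text \<open>The tangent line of t \<mapsto> t^m at the average \<open>a\<close> lies below the
  graph, and averaging it with a density of mass one gives exactly \<open>a ^ m\<close>.\<close>

lemma Tk_jensen:
  fixes f :: "real^'n \<Rightarrow> real"
  assumes n: "CARD('n) \<ge> 2" and f: "integrable sphere_meas f" "integrable sphere_meas (\<lambda>x. f x ^ m)"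
    and pos: "\<And>x. norm x = 1 \<Longrightarrow> f x \<ge> 0" and m: "m \<ge> 1" and z: "norm z = 1"
  shows "(Tk f k z) ^ m \<le> Tk (\<lambda>x. f x ^ m) k z"
proof -
  define a where "a = Tk f k z"
  have "Tk (\<lambda>_. 0) k z \<le> Tk f k z" by (rule Tk_mono[OF n _ f(1) _ z]) (use pos in auto)
  then have a: "a \<ge> 0" by (simp add: Tk_const[OF n z] a_def)
  have "Tk (\<lambda>x. a ^ m + m * a ^ (m - 1) * (f x - a)) k z \<le> Tk (\<lambda>x. f x ^ m) k z"
  proof (rule Tk_mono[OF n _ f(2) _ z])
    show "a ^ m + m * a ^ (m - 1) * (f y - a) \<le> f y ^ m" if "norm y = 1" for y
      by (rule power_tangent[OF a pos[OF that] m])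
  qed (use f in auto)
  moreover have "Tk (\<lambda>x. a ^ m + m * a ^ (m - 1) * (f x - a)) k z = a ^ m"
  proof -
    have "Tk (\<lambda>x. a ^ m + m * a ^ (m - 1) * (f x - a)) k z
        = Tk (\<lambda>x. a ^ m) k z + Tk (\<lambda>x. m * a ^ (m - 1) * (f x - a)) k z"
      by (rule Tk_linear(1)) (use f in auto)
    also have "Tk (\<lambda>x. m * a ^ (m - 1) * (f x - a)) k z = m * a ^ (m - 1) * Tk (\<lambda>x. f x - a) k z"
      by (rule Tk_linear(3)) (use f in auto)
    also have "Tk (\<lambda>x. f x - a) k z = Tk f k z - Tk (\<lambda>x. a) k z"
      by (rule Tk_linear(2)) (use f in auto)
    finally show ?thesis by (simp add: Tk_const[OF n z] a_def)
  qed
  ultimately show ?thesis by (simp add: a_def)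
qed

section \<open>Convergence of the averages in L^1\<close>

definition L1conv :: "(real^'n \<Rightarrow> real) \<Rightarrow> bool" where
  "L1conv f \<longleftrightarrow> (\<lambda>k. \<integral>x. \<bar>Tk f k x - f x\<bar> \<partial>sphere_meas) \<longlonglongrightarrow> 0"

lemma L1_contraction:
  fixes f :: "real^'n \<Rightarrow> real"
  assumes n: "CARD('n) \<ge> 2" and f: "integrable sphere_meas f"
  shows "(\<integral>x. \<bar>Tk f k x\<bar> \<partial>sphere_meas) \<le> (\<integral>x. \<bar>f x\<bar> \<partial>sphere_meas)"
proof -
  have "(\<integral>x. \<bar>Tk f k x\<bar> \<partial>sphere_meas) \<le> (\<integral>x. Tk (\<lambda>x. \<bar>f x\<bar>) k x \<partial>sphere_meas)"
    by (rule sphere_integral_mono) (use f Tk_integrable_sphere[OF n] Tk_abs_le[OF n f] in auto)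
  then show ?thesis using integral_Tk[OF n, of "\<lambda>x. \<bar>f x\<bar>" k] f by simp
qed

text \<open>\<open>Tk\<close> contracts the L^1 norm for every \<open>k\<close>. Hence the error for
  \<open>f\<close> is at most the error for \<open>F i\<close> plus twice the distance of
  \<open>F i\<close> from \<open>f\<close>, uniformly in \<open>k\<close>.\<close>

lemma L1conv_limit:
  fixes f :: "real^'n \<Rightarrow> real"
  assumes n: "CARD('n) \<ge> 2" and F: "\<And>i. integrable sphere_meas (F i)" "\<And>i. L1conv (F i)"
    and f: "integrable sphere_meas f" and lim: "(\<lambda>i. \<integral>x. \<bar>F i x - f x\<bar> \<partial>sphere_meas) \<longlonglongrightarrow> 0"
  shows "L1conv f"
  unfolding L1conv_def
proof (rule LIMSEQ_I)
  fix e :: real assume "e > 0"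
  then have e: "e / 3 > 0" by simp
  from LIMSEQ_D[OF lim e] obtain i where i: "\<bar>\<integral>x. \<bar>F i x - f x\<bar> \<partial>sphere_meas\<bar> < e / 3" by auto
  from LIMSEQ_D[OF F(2)[of i, unfolded L1conv_def] e] obtain K where
    K: "\<And>k. k \<ge> K \<Longrightarrow> \<bar>\<integral>x. \<bar>Tk (F i) k x - F i x\<bar> \<partial>sphere_meas\<bar> < e / 3" by auto
  have "norm ((\<integral>x. \<bar>Tk f k x - f x\<bar> \<partial>sphere_meas) - 0) < e" if "k \<ge> K" for k
  proof -
    let ?D = "\<lambda>x. F i x - f x"
    have D: "integrable sphere_meas ?D" using F f by simp
    note Ti = Tk_integrable_sphere[OF n]
    have "(\<integral>x. \<bar>Tk f k x - f x\<bar> \<partial>sphere_meas) \<le> (\<integral>x. \<bar>Tk ?D k x\<bar> + \<bar>Tk (F i) k x - F i x\<bar> + \<bar>?D x\<bar> \<partial>sphere_meas)"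
      by (rule sphere_integral_mono) (use F(1) f D Ti[OF D] Ti[OF F(1)] Ti[OF f] Tk_linear(2)[OF F(1) f] in auto)
    also have "\<dots> = (\<integral>x. \<bar>Tk ?D k x\<bar> \<partial>sphere_meas) + (\<integral>x. \<bar>Tk (F i) k x - F i x\<bar> \<partial>sphere_meas) + (\<integral>x. \<bar>?D x\<bar> \<partial>sphere_meas)"
      using D F(1) Ti[OF D] Ti[OF F(1)] by simp
    also have "\<dots> < e" using L1_contraction[OF n D, of k] i K[OF that] by (simp add: abs_less_iff)
    finally show ?thesis by (simp add: integral_nonneg_AE)
  qed
  then show "\<exists>no. \<forall>n\<ge>no. norm ((\<integral>x. \<bar>Tk f n x - f x\<bar> \<partial>sphere_meas) - 0) < e" by blast
qed

lemma L1conv_add: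
  fixes f g :: "real^'n \<Rightarrow> real"
  assumes n: "CARD('n) \<ge> 2" and f: "integrable sphere_meas f" "L1conv f" and g: "integrable sphere_meas g" "L1conv g"
  shows "L1conv (\<lambda>x. f x + g x)"
  unfolding L1conv_def
proof (rule tendsto_sandwich[where f="\<lambda>_. 0"])
  note Ti = Tk_integrable_sphere[OF n]
  have fg: "integrable sphere_meas (\<lambda>x. f x + g x)" using f g by simp
  show "(\<lambda>k. (\<integral>x. \<bar>Tk f k x - f x\<bar> \<partial>sphere_meas) + (\<integral>x. \<bar>Tk g k x - g x\<bar> \<partial>sphere_meas)) \<longlonglongrightarrow> 0"
    using tendsto_add[OF f(2)[unfolded L1conv_def] g(2)[unfolded L1conv_def]] by simp
  have "(\<integral>x. \<bar>Tk (\<lambda>x. f x + g x) k x - (f x + g x)\<bar> \<partial>sphere_meas) \<le> (\<integral>x. \<bar>Tk f k x - f x\<bar> \<partial>sphere_meas) + (\<integral>x. \<bar>Tk g k x - g x\<bar> \<partial>sphere_meas)" for k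
  proof -
    have "(\<integral>x. \<bar>Tk (\<lambda>x. f x + g x) k x - (f x + g x)\<bar> \<partial>sphere_meas) \<le> (\<integral>x. \<bar>Tk f k x - f x\<bar> + \<bar>Tk g k x - g x\<bar> \<partial>sphere_meas)"
      by (rule sphere_integral_mono) (use f g fg Ti[OF fg] Ti[OF f(1)] Ti[OF g(1)] Tk_linear(1)[OF f(1) g(1)] in auto)
    then show ?thesis using f g Ti[OF f(1)] Ti[OF g(1)] by simp
  qed
  then show "\<forall>\<^sub>F k in sequentially. (\<integral>x. \<bar>Tk (\<lambda>x. f x + g x) k x - (f x + g x)\<bar> \<partial>sphere_meas) \<le> (\<integral>x. \<bar>Tk f k x - f x\<bar> \<partial>sphere_meas) + (\<integral>x. \<bar>Tk g k x - g x\<bar> \<partial>sphere_meas)"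
    by simp
qed (auto simp: integral_nonneg_AE)

lemma L1conv_cmult:
  fixes f :: "real^'n \<Rightarrow> real"
  assumes n: "CARD('n) \<ge> 2" and f: "integrable sphere_meas f" "L1conv f"
  shows "L1conv (\<lambda>x. c * f x)"
proof -
  have "(\<integral>x. \<bar>Tk (\<lambda>x. c * f x) k x - c * f x\<bar> \<partial>sphere_meas) = \<bar>c\<bar> * (\<integral>x. \<bar>Tk f k x - f x\<bar> \<partial>sphere_meas)" for k
    unfolding Tk_linear(3)[OF f(1) f(1)] by (simp add: abs_mult flip: right_diff_distrib)
  then show ?thesis
    using tendsto_mult_right_zero[OF f(2)[unfolded L1conv_def], of "\<bar>c\<bar>"] by (simp add: L1conv_def)
qed

lemma L1conv_const:
  assumes n: "CARD('n) \<ge> 2"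
  shows "L1conv (\<lambda>_::real^'n. c)"
proof -
  have "(\<integral>x. \<bar>Tk (\<lambda>_. c) k x - c\<bar> \<partial>(sphere_meas::(real^'n) measure)) = (\<integral>x. 0 \<partial>(sphere_meas::(real^'n) measure))" for k
    by (rule sphere_integral_cong) (auto simp: Tk_const[OF n])
  then show ?thesis by (simp add: L1conv_def)
qed

text \<open>By the Lipschitz bound the error at \<open>z\<close> is at most \<open>L\<close> times
  the mean distance from \<open>z\<close>. Only the mean of 1 - y \<bullet> z, half the squared
  distance, is known; the distance is therefore estimated by e / 2 + (1 - y \<bullet> z) /
  e.\<close>

lemma L1conv_Lipschitz:
  fixes g :: "real^'n \<Rightarrow> real"
  assumes n: "CARD('n) \<ge> 2" and L: "\<And>x y. \<bar>g x - g y\<bar> \<le> L * dist x y"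
  shows "L1conv g"
  unfolding L1conv_def
proof (rule tendsto_sandwich[where f="\<lambda>_. 0"])
  let ?d = "dm TYPE('n)"
  have d: "?d > 0" using n by simp
  \<comment> \<open>The square of \<open>e k\<close> is the mean of 1 - y \<bullet> z against the
    kernel, so the two terms of the estimate become \<open>e k / 2\<close> and \<open>e k\<close>;
    together they give the factor 3/2 below.\<close>
  define e where "e k = sqrt (?d / (k + ?d))" for k :: nat
  have e: "e k > 0" "e k ^ 2 = ?d / (k + ?d)" for k
    using d by (auto simp: e_def intro!: divide_nonneg_nonneg add_nonneg_nonneg)
  have L0: "L \<ge> 0"
    using L[of 0 "axis undefined 1"] by (simp add: order_trans[OF abs_ge_zero])
  have gc: "continuous_on UNIV g"
  proof (rule lipschitz_on_continuous_on)
    show "L-lipschitz_on UNIV g" using L L0 by (auto simp: lipschitz_on_def dist_real_def)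
  qed
  have gi: "integrable sphere_meas g" by (rule integrable_sphere_continuous[OF gc])
  have pt: "\<bar>Tk g k z - g z\<bar> \<le> L * (3 / 2 * e k)" if z: "norm z = 1" for z k
  proof -
    have "Tk g k z - g z = Tk (\<lambda>y. g y - g z) k z"
      by (simp add: Tk_linear(2)[OF gi] Tk_const[OF n z])
    also have "\<bar>\<dots>\<bar> \<le> Tk (\<lambda>y. \<bar>g y - g z\<bar>) k z" by (rule Tk_abs_le[OF n _ z]) (use gi in auto)
    also have "\<dots> \<le> Tk (\<lambda>y. L * (e k / 2) + L / e k * (1 - y \<bullet> z)) k z"
    proof (rule Tk_mono[OF n _ _ _ z])
      show "integrable sphere_meas (\<lambda>y. L * (e k / 2) + L / e k * (1 - y \<bullet> z))"
        by (rule integrable_sphere_continuous) (intro continuous_intros)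
      fix y :: "real^'n" assume y: "norm y = 1"
      have "(dist y z)\<^sup>2 = 2 * (1 - y \<bullet> z)"
        using y z by (simp add: dist_norm power2_norm_eq_inner inner_diff_left inner_diff_right norm_eq_1 inner_commute)
      moreover have "2 * e k * dist y z \<le> (e k)\<^sup>2 + (dist y z)\<^sup>2"
        using sum_squares_bound[of "e k" "dist y z"] by simp
      ultimately have "dist y z \<le> e k / 2 + (1 / e k) * (1 - y \<bullet> z)"
        using e(1)[of k] by (simp add: field_simps power2_eq_square)
      then have "L * dist y z \<le> L * (e k / 2 + (1 / e k) * (1 - y \<bullet> z))" using L0 by (rule mult_left_mono)
      then show "\<bar>g y - g z\<bar> \<le> L * (e k / 2) + L / e k * (1 - y \<bullet> z)" using L[of y z] by (simp add: distrib_left)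
    qed (use gi in auto)
    also have "\<dots> = L * (e k / 2) + L / e k * (?d / (k + ?d))"
    proof -
      have "Tk (\<lambda>y. 1 - y \<bullet> z) k z = ?d / (k + ?d)"
        using kern_dist_integral[OF n z, of k] by (simp add: Tk_def mult.commute)
      moreover have i: "integrable sphere_meas (\<lambda>y. 1 - y \<bullet> z)"
        by (rule integrable_sphere_continuous) (intro continuous_intros)
      ultimately have "Tk (\<lambda>y. L / e k * (1 - y \<bullet> z)) k z = L / e k * (?d / (k + ?d))"
        using Tk_linear(3)[OF i i, of "L / e k" k z] by (simp only:)
      then show ?thesis
        using Tk_linear(1)[of "\<lambda>_. L * (e k / 2)" "\<lambda>y. L / e k * (1 - y \<bullet> z)" k z] i by (simp add: Tk_const[OF n z])
    qed
    also have "\<dots> = L * (3 / 2 * e k)"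
      unfolding e(2)[symmetric] using e(1)[of k] by (simp add: field_simps power2_eq_square)
    finally show ?thesis .
  qed
  have "(\<integral>x. \<bar>Tk g k x - g x\<bar> \<partial>sphere_meas) \<le> integral\<^sup>L sphere_meas (\<lambda>x::real^'n. L * (3 / 2 * e k))" for k
    by (rule sphere_integral_mono) (use gi pt Tk_integrable_sphere[OF n gi] in auto)
  then show "\<forall>\<^sub>F k in sequentially. (\<integral>x. \<bar>Tk g k x - g x\<bar> \<partial>sphere_meas) \<le> L * (3 / 2 * e k)"
    by (simp add: sphere.prob_space[unfolded space_sphere_meas])
  have "(\<lambda>k. ?d / (k + ?d)) \<longlonglongrightarrow> 0"
    by (rule tendsto_divide_0[OF tendsto_const])
       (rule filterlim_at_top_imp_at_infinity, rule filterlim_tendsto_add_at_top[OF tendsto_const filterlim_real_sequentially, of ?d, simplified add.commute])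
  then have "e \<longlonglongrightarrow> 0" unfolding e_def using tendsto_real_sqrt by fastforce
  then have "(\<lambda>k. L * (3 / 2 * e k)) \<longlonglongrightarrow> L * (3 / 2 * 0)" by (intro tendsto_intros)
  then show "(\<lambda>k. L * (3 / 2 * e k)) \<longlonglongrightarrow> 0" by simp
qed (auto simp: integral_nonneg_AE)

lemma L1_lim_of_pointwise:
  fixes f g :: "real^'n \<Rightarrow> real"
  assumes [measurable]: "\<And>i. F i \<in> borel_measurable borel" "f \<in> borel_measurable borel"
    and lim: "\<And>x. (\<lambda>i. F i x) \<longlonglongrightarrow> f x" and dom: "integrable sphere_meas g" "\<And>i x. \<bar>F i x - f x\<bar> \<le> g x"
  shows "(\<lambda>i. \<integral>x. \<bar>F i x - f x\<bar> \<partial>sphere_meas) \<longlonglongrightarrow> 0"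
proof -
  have "(\<lambda>i. \<integral>x. \<bar>F i x - f x\<bar> \<partial>sphere_meas) \<longlonglongrightarrow> integral\<^sup>L sphere_meas (\<lambda>x::real^'n. 0)"
  proof (rule integral_dominated_convergence[where w=g])
    show "AE x in sphere_meas. (\<lambda>i. \<bar>F i x - f x\<bar>) \<longlonglongrightarrow> 0"
      by (intro AE_I2 tendsto_rabs_zero LIM_zero lim)
  qed (use dom in auto)
  then show ?thesis by simp
qed

text \<open>The Lipschitz functions max 0 (1 - i dist(x, C)) decrease to the indicator because
  \<open>C\<close> is closed. The empty set is treated apart since \<open>infdist\<close> to it is
  0.\<close>

lemma L1conv_closed:
  fixes C :: "(real^'n) set"
  assumes n: "CARD('n) \<ge> 2" and C: "closed C"
  shows "L1conv (indicator C)"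
proof (cases "C = {}")
  case True
  then show ?thesis using L1conv_const[OF n, of 0] by (simp add: indicator_def[abs_def])
next
  case False
  define F where "F i x = max 0 (1 - real i * infdist x C)" for i and x :: "real^'n"
  have Fc: "continuous_on UNIV (F i)" for i
    unfolding F_def[abs_def] by (intro continuous_intros)
  have b: "0 \<le> F i x" "F i x \<le> 1" for i x
    using infdist_nonneg[of x C] by (auto simp: F_def)
  show ?thesis
  proof (rule L1conv_limit[OF n])
    show "integrable sphere_meas (F i)" for i by (rule integrable_sphere_continuous[OF Fc])
    show "L1conv (F i)" for i
    proof (rule L1conv_Lipschitz[OF n])
      fix x y :: "real^'n"
      have "\<bar>real i * infdist x C - real i * infdist y C\<bar> = real i * \<bar>infdist x C - infdist y C\<bar>"
        by (simp add: abs_mult flip: right_diff_distrib)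
      also have "\<dots> \<le> real i * dist x y" by (intro mult_left_mono infdist_triangle_abs) simp
      finally show "\<bar>F i x - F i y\<bar> \<le> real i * dist x y" unfolding F_def by linarith
    qed
    show "integrable sphere_meas (indicat_real C)"
      using C by (intro integrable_real_indicator) (auto simp: sphere.emeasure_eq_measure)
    show "(\<lambda>i. \<integral>x. \<bar>F i x - indicat_real C x\<bar> \<partial>sphere_meas) \<longlonglongrightarrow> 0"
    proof (rule L1_lim_of_pointwise)
      show "F i \<in> borel_measurable borel" for i by (rule borel_measurable_continuous_onI[OF Fc])
      show "indicat_real C \<in> borel_measurable borel" using C by simp
      show "integrable sphere_meas (\<lambda>x::real^'n. 1::real)" by simp
      show "\<bar>F i x - indicat_real C x\<bar> \<le> 1" for i x using b[of i x] by (auto split: split_indicator)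
      show "(\<lambda>i. F i x) \<longlonglongrightarrow> indicat_real C x" for x
      proof (cases "x \<in> C")
        case True
        then show ?thesis by (simp add: F_def)
      next
        case False
        then have p: "infdist x C > 0"
          using C \<open>C \<noteq> {}\<close> infdist_pos_not_in_closed by blast
        then obtain N where N: "1 < real N * infdist x C" using reals_Archimedean3 by blast
        have "F i x = 0" if "i \<ge> N" for i
        proof -
          have "real N * infdist x C \<le> real i * infdist x C" using that p by (intro mult_right_mono) auto
          then show ?thesis using N by (simp add: F_def)
        qed
        then have "\<forall>\<^sub>F i in sequentially. F i x = 0" by (auto simp: eventually_sequentially)
        then show ?thesis using False by (simp add: tendsto_eventually)
      qed
    qed
  qed
qed

text \<open>Closed sets are an intersection-stable generator of the Borel sets, so it suffices to
  pass to complements, by subtraction from the constant 1, and to disjoint countable unions, by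
  dominated convergence of the finite ones.\<close>

lemma L1conv_indicator:
  fixes A :: "(real^'n) set"
  assumes n: "CARD('n) \<ge> 2" and A: "A \<in> sets borel"
  shows "L1conv (indicator A)"
proof -
  have ind: "integrable sphere_meas (indicat_real A)" if "A \<in> sets borel" for A :: "(real^'n) set"
    using that by (intro integrable_real_indicator) (auto simp: sphere.emeasure_eq_measure)
  have sb: "sets borel = sigma_sets UNIV (Collect (closed :: (real^'n) set \<Rightarrow> bool))"
    by (subst borel_eq_closed) simp
  have st: "Int_stable (Collect (closed :: (real^'n) set \<Rightarrow> bool))"
    by (auto simp: Int_stable_def)
  have cl: "Collect closed \<subseteq> Pow (UNIV :: (real^'n) set)" by simp
  have Ac: "A \<in> sigma_sets UNIV (Collect closed)" using A sb by simp
  from st cl Ac show ?thesis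
  proof (induction rule: sigma_sets_induct_disjoint)
    fix C :: "(real^'n) set" assume "C \<in> Collect closed"
    then show "L1conv (indicator C)" using L1conv_closed[OF n] by simp
  next
    show "L1conv (indicator ({} :: (real^'n) set))" by (rule L1conv_closed[OF n]) simp
  next
    fix B :: "(real^'n) set" assume B: "B \<in> sigma_sets UNIV (Collect closed)" "L1conv (indicator B)"
    then have Bb: "B \<in> sets borel" using sb by simp
    have eq: "(\<lambda>x. 1 + - 1 * indicat_real B x) = indicator (UNIV - B)" by (auto simp: indicator_def)
    have "L1conv (\<lambda>x. 1 + - 1 * indicat_real B x)"
      by (rule L1conv_add[OF n _ L1conv_const[OF n] _ L1conv_cmult[OF n ind[OF Bb] B(2)]])
         (use ind[OF Bb] in auto)
    then show "L1conv (indicator (UNIV - B))" unfolding eq .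
  next
    fix B :: "nat \<Rightarrow> (real^'n) set"
    assume B: "disjoint_family B" "range B \<subseteq> sigma_sets UNIV (Collect closed)" "\<And>i. L1conv (indicator (B i))"
    then have Bb [measurable]: "B i \<in> sets borel" for i using sb by auto
    have S: "L1conv (indicator (\<Union>i<m. B i))" for m
    proof (induction m)
      case 0 then show ?case using L1conv_const[OF n, of 0] by simp
    next
      case (Suc m)
      have "indicat_real (\<Union>i<m. B i) x + indicat_real (B m) x = indicator (\<Union>i<Suc m. B i) x" for x
        using B(1) unfolding disjoint_family_on_def
        by (auto simp: lessThan_Suc indicator_def) (metis IntI UNIV_I empty_iff less_irrefl)
      moreover have "L1conv (\<lambda>x. indicat_real (\<Union>i<m. B i) x + indicat_real (B m) x)"
        by (rule L1conv_add[OF n ind Suc ind B(3)]) auto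
      ultimately show ?case by simp
    qed
    show "L1conv (indicator (\<Union>i. B i))"
    proof (rule L1conv_limit[OF n, of "\<lambda>m. indicator (\<Union>i<m. B i)"])
      show "(\<lambda>m. \<integral>x. \<bar>indicat_real (\<Union>i<m. B i) x - indicat_real (\<Union>i. B i) x\<bar> \<partial>sphere_meas) \<longlonglongrightarrow> 0"
      proof (rule L1_lim_of_pointwise[where g="\<lambda>_. 1"])
        show "(\<lambda>m. indicat_real (\<Union>i<m. B i) x) \<longlonglongrightarrow> indicat_real (\<Union>i. B i) x" for x
          by (rule LIMSEQ_indicator_UN)
      qed (auto split: split_indicator)
    qed (use S ind in auto)
  qed
qed

proposition Tk_L1_convergence:
  fixes f :: "real^'n \<Rightarrow> real"
  assumes n: "CARD('n) \<ge> 2" and f: "integrable sphere_meas f"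
  shows "(\<lambda>k. \<integral>x. \<bar>Tk f k x - f x\<bar> \<partial>sphere_meas) \<longlonglongrightarrow> 0"
proof -
  from f have "L1conv f"
  proof induction
    case (base A c)
    then have [measurable]: "A \<in> sets borel" by simp
    have "L1conv (\<lambda>x. c * indicat_real A x)"
      by (rule L1conv_cmult[OF n _ L1conv_indicator[OF n]])
         (auto intro!: integrable_real_indicator simp: sphere.emeasure_eq_measure)
    then show ?case by (simp add: mult.commute)
  next
    case (add f g)
    then show ?case by (intro L1conv_add[OF n])
  next
    case (lim f s)
    show ?case
    proof (rule L1conv_limit[OF n lim(1) lim(5) lim(4)])
      have [measurable]: "s i \<in> borel_measurable borel" "f \<in> borel_measurable borel" for i using lim(1)[of i] lim(4) by auto
      show "(\<lambda>i. \<integral>x. \<bar>s i x - f x\<bar> \<partial>sphere_meas) \<longlonglongrightarrow> 0"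
      proof (rule L1_lim_of_pointwise[where g="\<lambda>x. 3 * \<bar>f x\<bar>"])
        show "(\<lambda>i. s i x) \<longlonglongrightarrow> f x" for x using lim(2) by simp
        show "\<bar>s i x - f x\<bar> \<le> 3 * \<bar>f x\<bar>" for i x using lim(3)[of x i] by simp
      qed (use lim(4) in auto)
    qed
  qed
  then show ?thesis by (simp add: L1conv_def)
qed

section \<open>Morrey's inequality\<close>

text \<open>Since \<open>h y\<close> is tangential at \<open>y\<close>, one may replace
  \<open>h y \<bullet> z\<close> by \<open>h y \<bullet> (z - y)\<close>, which gains a distance of
  order k^(-1/2). By Cauchy-Schwarz the average in \<open>Tk_step\<close> is at most the root of the
  averages of |h|^2 and of |z - y|^2. With the factor 1 / k of \<open>Tk_step\<close> the increment
  is of order k^(-9/8), where 9/8 = 1 + 1/2 - 3/8 and 3/4 is the growth exponent of the average of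
  |h|^2. What matters is that this is summable.\<close>

lemma Tk_step_bound:
  fixes z :: "real^'n"
  assumes n: "CARD('n) \<ge> 4" and w: "wgrad f h" and tan: "\<And>x. norm x = 1 \<Longrightarrow> h x \<bullet> x = 0"
    and int: "integrable sphere_meas (\<lambda>x. norm (h x) ^ (2 * (CARD('n) - 2)))"
    and M: "(\<integral>x. norm (h x) ^ (2 * (CARD('n) - 2)) \<partial>sphere_meas) \<le> M ^ (2 * (CARD('n) - 2))" "M > 0"
    and z: "norm z = 1"
  shows "\<bar>Tk f (Suc k) z - Tk f k z\<bar> \<le> M * sqrt (4 * dm TYPE('n)) * real (Suc k) powr (-9/8)"
proof -
  let ?d = "dm TYPE('n)"
  define m where "m = CARD('n) - 2"
  have m: "m \<ge> 2" "real m = ?d - 1" using n by (auto simp: m_def)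
  have n2: "CARD('n) \<ge> 2" and d: "?d \<ge> 3" using n by auto
  define u where "u = 2 * real k + ?d"
  have u: "u > 0" "u \<ge> real (Suc k)" "u \<ge> ?d" using d by (auto simp: u_def)
  have [measurable]: "h \<in> borel_measurable borel" using w by (simp add: wgrad_def)
  have ihm: "integrable sphere_meas (\<lambda>x. ((norm (h x))\<^sup>2) ^ m)" using int by (simp add: m_def power_mult)
  have ih2: "integrable sphere_meas (\<lambda>x. (norm (h x))\<^sup>2)"
  proof (rule sphere_integrable_bound)
    show "integrable sphere_meas (\<lambda>x. 1 + ((norm (h x))\<^sup>2) ^ m)" using ihm by simp
    show "\<bar>(norm (h x))\<^sup>2\<bar> \<le> 1 + ((norm (h x))\<^sup>2) ^ m" for x
    proof (cases "(norm (h x))\<^sup>2 \<le> 1")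
      case False
      then show ?thesis using self_le_power[of "(norm (h x))\<^sup>2" m] m by simp
    qed (auto intro: order_trans)
  qed simp
  \<comment> \<open>\<open>X\<close> and \<open>Y\<close> bound the averages at \<open>z\<close> of
    |h|^2 and of |z - y|^2. Jensen's inequality with the power m, together with the height u^(d/2)
    of the kernel, bounds the first by M^2 u^(d/(2m)). As m = d - 1, the exponent is at most 3/4
    exactly when d \<ge> 3, that is, n \<ge> 4.\<close>
  define X where "X = u powr (3/4) * M\<^sup>2"
  define Y where "Y = 4 * ?d / u"
  have X: "X > 0" and Y: "Y > 0" using u M d by (auto simp: X_def Y_def)
  have TXm: "(Tk (\<lambda>x. (norm (h x))\<^sup>2) k z) ^ m \<le> X ^ m"
  proof -
    have "(Tk (\<lambda>x. (norm (h x))\<^sup>2) k z) ^ m \<le> Tk (\<lambda>x. ((norm (h x))\<^sup>2) ^ m) k z"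
      by (rule Tk_jensen[OF n2 ih2 ihm _ _ z]) (use m in auto)
    also have "\<dots> \<le> (\<integral>x. ((norm (h x))\<^sup>2) ^ m * (kcoef ?d k * 2 ^ k) \<partial>sphere_meas)"
      unfolding Tk_def
    proof (rule sphere_integral_mono)
      show "integrable sphere_meas (\<lambda>y. (norm (h y))\<^sup>2 ^ m * kern ?d k (y \<bullet> z))"
        by (rule Tk_integrable[OF ihm kern_derivs(3)])
      show "integrable sphere_meas (\<lambda>x. (norm (h x))\<^sup>2 ^ m * (kcoef ?d k * 2 ^ k))" using ihm by simp
      show "(norm (h y))\<^sup>2 ^ m * kern ?d k (y \<bullet> z) \<le> (norm (h y))\<^sup>2 ^ m * (kcoef ?d k * 2 ^ k)" if "norm y = 1" for y
        by (rule mult_left_mono[OF kern_unit_bounds(2)[OF n2 that z]]) simp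
    qed
    also have "\<dots> = (\<integral>x. norm (h x) ^ (2 * (CARD('n) - 2)) \<partial>sphere_meas) * (kcoef ?d k * 2 ^ k)"
      by (simp add: m_def power_mult)
    also have "\<dots> \<le> M ^ (2 * m) * u powr (3/4 * m)"
    proof (rule mult_mono)
      have "kcoef ?d k * 2 ^ k \<le> (u / ?d) powr (?d / 2)"
        unfolding u_def using d by (intro kcoef_growth) auto
      also have "\<dots> \<le> (u / ?d) powr (3/4 * m)"
        using u d m by (intro powr_mono) (auto simp: field_simps)
      also have "\<dots> \<le> u powr (3/4 * m)"
        using u d by (intro powr_mono2) (auto simp: divide_le_eq)
      finally show "kcoef ?d k * 2 ^ k \<le> u powr (3/4 * m)" .
      show "(\<integral>x. norm (h x) ^ (2 * (CARD('n) - 2)) \<partial>sphere_meas) \<le> M ^ (2 * m)" using M by (simp add: m_def)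
      show "0 \<le> M ^ (2 * m)" using M by simp
      show "0 \<le> kcoef ?d k * 2 ^ k" using kcoef_pos[of ?d k] d by simp
    qed
    also have "\<dots> = X ^ m"
    proof -
      have "M ^ (2 * m) = (M\<^sup>2) ^ m" by (rule power_mult)
      moreover have "(u powr (3/4)) ^ m = u powr (3/4 * m)" using u by (simp add: powr_power mult.commute)
      ultimately show ?thesis unfolding X_def power_mult_distrib by (simp only: mult.commute)
    qed
    finally show ?thesis .
  qed
  have TX: "Tk (\<lambda>x. (norm (h x))\<^sup>2) k z \<le> X"
  proof (rule power_le_imp_le_base)
    show "Tk (\<lambda>x. (norm (h x))\<^sup>2) k z ^ Suc (m - 1) \<le> X ^ Suc (m - 1)" using TXm m by simp
  qed (use X in simp)
  have iY: "integrable sphere_meas (\<lambda>y. 2 * (1 - y \<bullet> z))"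
    by (rule integrable_sphere_continuous) (intro continuous_intros)
  have TY: "Tk (\<lambda>y. 2 * (1 - y \<bullet> z)) k z \<le> Y"
  proof -
    have "Tk (\<lambda>y. 2 * (1 - y \<bullet> z)) k z = (\<integral>y. 2 * (kern ?d k (y \<bullet> z) * (1 - y \<bullet> z)) \<partial>sphere_meas)"
      unfolding Tk_def by (rule Bochner_Integration.integral_cong) auto
    also have "\<dots> = 2 * (?d / (k + ?d))" using kern_dist_integral[OF n2 z, of k] by simp
    also have "\<dots> \<le> Y"
    proof -
      have "u \<le> 2 * (k + ?d)" using d by (simp add: u_def)
      then have "2 * ?d * u \<le> 4 * ?d * (k + ?d)"
      proof -
        have "2 * ?d * u \<le> 2 * ?d * (2 * (k + ?d))"
          using \<open>u \<le> 2 * (k + ?d)\<close> by (rule mult_left_mono) (use d in simp)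
        also have "\<dots> = 4 * ?d * (k + ?d)" by algebra
        finally show ?thesis .
      qed
      moreover have "k + ?d > 0" using d by simp
      ultimately show ?thesis unfolding Y_def using u(1) by (simp add: divide_simps mult.commute)
    qed
    finally show ?thesis .
  qed
  \<comment> \<open>The weight in Young's inequality for which both terms contribute equally, so
    that the pointwise estimate averages to \<open>sqrt (X * Y)\<close>.\<close>
  define \<theta> where "\<theta> = sqrt (Y / X)"
  have \<theta>: "\<theta> > 0" "\<theta> * X = sqrt (X * Y)" "Y / \<theta> = sqrt (X * Y)"
    using X Y by (auto simp: \<theta>_def real_sqrt_divide real_sqrt_mult real_div_sqrt field_simps power2_eq_square[symmetric])
  have ph: "\<bar>h y \<bullet> z\<bar> \<le> \<theta> / 2 * (norm (h y))\<^sup>2 + 1 / (2 * \<theta>) * (2 * (1 - y \<bullet> z))" if y: "norm y = 1" for y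
  proof -
    have "h y \<bullet> z = h y \<bullet> (z - y)" using tan[OF y] by (simp add: inner_diff_right)
    then have "\<bar>h y \<bullet> z\<bar> \<le> norm (h y) * norm (z - y)" using Cauchy_Schwarz_ineq2[of "h y" "z - y"] by simp
    also have "\<dots> \<le> \<theta> / 2 * (norm (h y))\<^sup>2 + 1 / (2 * \<theta>) * (norm (z - y))\<^sup>2"
    proof -
      have "0 \<le> (\<theta> * norm (h y) - norm (z - y))\<^sup>2 / (2 * \<theta>)" using \<theta> by simp
      also have "\<dots> = \<theta> / 2 * (norm (h y))\<^sup>2 + 1 / (2 * \<theta>) * (norm (z - y))\<^sup>2 - norm (h y) * norm (z - y)"
        using \<theta>(1) by (simp add: power2_diff power_mult_distrib field_simps power2_eq_square[of \<theta>])
      finally show ?thesis by simp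
    qed
    also have "(norm (z - y))\<^sup>2 = 2 * (1 - y \<bullet> z)"
      using y z by (simp add: power2_norm_eq_inner inner_diff_left inner_diff_right norm_eq_1 inner_commute)
    finally show ?thesis .
  qed
  have ih: "integrable sphere_meas (\<lambda>y. h y \<bullet> z)"
  proof (rule sphere_integrable_bound)
    show "integrable sphere_meas (\<lambda>x. norm (h x))" using w by (simp add: wgrad_def)
    show "\<bar>h x \<bullet> z\<bar> \<le> norm (h x)" for x using Cauchy_Schwarz_ineq2[of "h x" z] z by simp
  qed simp
  have "\<bar>\<integral>y. (h y \<bullet> z - (h y \<bullet> y) * (y \<bullet> z)) * kern ?d k (y \<bullet> z) \<partial>sphere_meas\<bar> = \<bar>Tk (\<lambda>y. h y \<bullet> z) k z\<bar>"
    unfolding Tk_def by (rule arg_cong[where f=abs], rule sphere_integral_cong) (auto simp: tan)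
  also have "\<dots> \<le> Tk (\<lambda>y. \<bar>h y \<bullet> z\<bar>) k z" by (rule Tk_abs_le[OF n2 ih z])
  also have "\<dots> \<le> Tk (\<lambda>y. \<theta> / 2 * (norm (h y))\<^sup>2 + 1 / (2 * \<theta>) * (2 * (1 - y \<bullet> z))) k z"
    by (rule Tk_mono[OF n2 _ _ ph z]) (use ih ih2 iY in auto)
  also have "\<dots> = \<theta> / 2 * Tk (\<lambda>y. (norm (h y))\<^sup>2) k z + 1 / (2 * \<theta>) * Tk (\<lambda>y. 2 * (1 - y \<bullet> z)) k z"
  proof -
    have "integrable sphere_meas (\<lambda>y. \<theta> / 2 * (norm (h y))\<^sup>2)" "integrable sphere_meas (\<lambda>y. 1 / (2 * \<theta>) * (2 * (1 - y \<bullet> z)))"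
      by (intro integrable_mult_right ih2 iY)+
    then show ?thesis by (simp only: Tk_linear(1) Tk_linear(3)[OF ih2 ih2] Tk_linear(3)[OF iY iY])
  qed
  also have "\<dots> \<le> \<theta> / 2 * X + 1 / (2 * \<theta>) * Y"
    using \<theta>(1) TX TY by (intro add_mono mult_left_mono) auto
  also have "\<dots> = sqrt (X * Y)" using \<theta>(2,3) by (simp add: field_simps)
  finally have A: "\<bar>\<integral>y. (h y \<bullet> z - (h y \<bullet> y) * (y \<bullet> z)) * kern ?d k (y \<bullet> z) \<partial>sphere_meas\<bar> \<le> sqrt (X * Y)" .
  have "\<bar>Tk f (Suc k) z - Tk f k z\<bar> \<le> sqrt (X * Y) / u"
    unfolding Tk_step[OF n2 w z] u_def[symmetric] using A u(1) by (simp add: divide_right_mono)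
  also have "sqrt (X * Y) / u = M * sqrt (4 * ?d) * u powr (-9/8)"
  proof -
    have "X * Y = M\<^sup>2 * (4 * ?d) * u powr (-1/4)"
      using u(1) by (simp add: X_def Y_def powr_diff[of u "3/4" 1, simplified] )
    then have "sqrt (X * Y) = M * sqrt (4 * ?d) * sqrt (u powr (-1/4))"
      using M by (simp add: real_sqrt_mult)
    also have "sqrt (u powr (-1/4)) = u powr (-1/8)" using u(1) by (simp add: powr_half_sqrt[symmetric] powr_powr)
    finally show ?thesis using u(1) powr_diff[of u "-1/8" 1] by simp
  qed
  also have "\<dots> \<le> M * sqrt (4 * ?d) * real (Suc k) powr (-9/8)"
    using u M d by (intro mult_left_mono powr_mono2') auto
  finally show ?thesis .
qed

definition morrey_const :: "'n::finite itself \<Rightarrow> real" where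
  "morrey_const t = sqrt (4 * dm TYPE('n)) * (\<Sum>k. real (Suc k) powr (-9/8))"

lemma Tk_0: "Tk f 0 z = (\<integral>x. f x \<partial>sphere_meas)"
  by (simp add: Tk_def kern_def)

text \<open>The average of index 0 is the mean of \<open>f\<close>, and the increments are summable
  uniformly in \<open>z\<close>, so all averages stay within a fixed distance of the mean. A
  subsequence converges to \<open>f\<close> almost everywhere and carries the bound over to
  \<open>f\<close>.\<close>

proposition morrey_bound:
  fixes f :: "real^'n \<Rightarrow> real"
  assumes n: "CARD('n) \<ge> 4" and w: "wgrad f h" and tan: "\<And>x. norm x = 1 \<Longrightarrow> h x \<bullet> x = 0"
    and int: "integrable sphere_meas (\<lambda>x. norm (h x) ^ (2 * (CARD('n) - 2)))"
    and M: "(\<integral>x. norm (h x) ^ (2 * (CARD('n) - 2)) \<partial>sphere_meas) \<le> M ^ (2 * (CARD('n) - 2))" "M > 0"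
  shows "AE x in sphere_meas. \<bar>f x - (\<integral>x. f x \<partial>sphere_meas)\<bar> \<le> morrey_const TYPE('n) * M"
proof -
  have n2: "CARD('n) \<ge> 2" using n by simp
  have f: "integrable sphere_meas f" using w by (simp add: wgrad_def)
  define a where "a k = M * sqrt (4 * dm TYPE('n)) * real (Suc k) powr (-9/8)" for k
  have sm: "summable (\<lambda>k. real (Suc k) powr (-9/8))"
    by (subst summable_Suc_iff[of "\<lambda>k. real k powr (-9/8)"]) (simp add: summable_real_powr_iff)
  have sa: "summable a" unfolding a_def by (intro summable_mult sm)
  have a0: "a k \<ge> 0" for k using M n by (auto simp: a_def)
  have sumk: "\<bar>Tk f k z - Tk f 0 z\<bar> \<le> (\<Sum>i<k. a i)" if "norm z = 1" for k z
  proof (induction k)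
    case (Suc k)
    then show ?case using Tk_step_bound[OF n w tan int M that, of k] by (simp add: a_def)
  qed simp
  have tot: "suminf a = morrey_const TYPE('n) * M"
    unfolding a_def morrey_const_def using suminf_mult[OF sm] by simp
  have bd: "\<bar>Tk f k z - (\<integral>x. f x \<partial>sphere_meas)\<bar> \<le> morrey_const TYPE('n) * M" if "norm z = 1" for k z
    using sumk[OF that, of k] sum_le_suminf[OF sa, of "{..<k}"] a0 by (simp add: Tk_0 tot)
  obtain r where r: "strict_mono r" "AE x in sphere_meas. (\<lambda>k. Tk f (r k) x - f x) \<longlonglongrightarrow> 0"
    using tendsto_L1_AE_subseq[of sphere_meas "\<lambda>k x. Tk f k x - f x"] Tk_L1_convergence[OF n2 f] Tk_integrable_sphere[OF n2 f] f
    by auto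
  show ?thesis
    using r(2) AE_sphere_meas_norm
  proof eventually_elim
    case (elim x)
    have "(\<lambda>k. Tk f (r k) x) \<longlonglongrightarrow> f x" using LIM_zero_cancel[OF elim(1)] .
    then have "(\<lambda>k. \<bar>Tk f (r k) x - (\<integral>x. f x \<partial>sphere_meas)\<bar>) \<longlonglongrightarrow> \<bar>f x - (\<integral>x. f x \<partial>sphere_meas)\<bar>"
      by (intro tendsto_intros)
    then show ?case by (rule LIMSEQ_le_const2) (use bd[OF elim(2)] in auto)
  qed
qed

section \<open>The spectral gap\<close>

text \<open>An algebra of integrable functions, closed under all operations used below. The bound is
  asked on unit vectors only, because continuous functions and integrals with a kernel need not be
  bounded on the whole space.\<close>

definition sbdd :: "(real^'n \<Rightarrow> real) \<Rightarrow> bool" where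
  "sbdd g \<longleftrightarrow> g \<in> borel_measurable borel \<and> (\<exists>C. \<forall>x. norm x = 1 \<longrightarrow> \<bar>g x\<bar> \<le> C)"

lemma sbddI:
  "g \<in> borel_measurable borel \<Longrightarrow> (\<And>x. norm x = 1 \<Longrightarrow> \<bar>g x\<bar> \<le> C) \<Longrightarrow> sbdd g"
  unfolding sbdd_def by blast

lemma sbddE:
  assumes "sbdd g"
  obtains C where "g \<in> borel_measurable borel" "\<And>x. norm x = 1 \<Longrightarrow> \<bar>g x\<bar> \<le> C"
  using assms unfolding sbdd_def by blast

lemma sbdd_integrable: "sbdd g \<Longrightarrow> integrable sphere_meas g"
  by (erule sbddE, rule sphere_integrable_bound[of "\<lambda>_. _"]) simp

lemma sbdd_continuous:
  assumes "continuous_on UNIV (g :: real^'n \<Rightarrow> real)"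
  shows "sbdd g"
proof -
  have "compact (g ` sphere 0 1)"
    by (rule compact_continuous_image) (auto intro: continuous_on_subset[OF assms])
  then have "bounded (g ` sphere 0 1)" by (rule compact_imp_bounded)
  then obtain C where C: "\<forall>x\<in>g ` sphere 0 1. norm x \<le> C" unfolding bounded_iff by blast
  show ?thesis
    by (rule sbddI[of _ C]) (use C borel_measurable_continuous_onI[OF assms] in auto)
qed

lemma sbdd_const: "sbdd (\<lambda>_. c)"
  by (rule sbddI[of _ "\<bar>c\<bar>"]) auto

lemma sbdd_add:
  assumes "sbdd f" "sbdd g"
  shows "sbdd (\<lambda>x. f x + g x)"
proof -
  obtain C where [measurable]: "f \<in> borel_measurable borel" and C: "\<And>x. norm x = 1 \<Longrightarrow> \<bar>f x\<bar> \<le> C"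
    using assms(1) by (rule sbddE) blast
  obtain D where [measurable]: "g \<in> borel_measurable borel" and D: "\<And>x. norm x = 1 \<Longrightarrow> \<bar>g x\<bar> \<le> D"
    using assms(2) by (rule sbddE) blast
  show ?thesis
  proof (rule sbddI)
    show "\<bar>f x + g x\<bar> \<le> C + D" if "norm x = 1" for x using C[OF that] D[OF that] by linarith
  qed measurable
qed

lemma sbdd_mult:
  assumes "sbdd f" "sbdd g"
  shows "sbdd (\<lambda>x. f x * g x)"
proof -
  obtain C where [measurable]: "f \<in> borel_measurable borel" and C: "\<And>x. norm x = 1 \<Longrightarrow> \<bar>f x\<bar> \<le> C"
    using assms(1) by (rule sbddE) blast
  obtain D where [measurable]: "g \<in> borel_measurable borel" and D: "\<And>x. norm x = 1 \<Longrightarrow> \<bar>g x\<bar> \<le> D"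
    using assms(2) by (rule sbddE) blast
  show ?thesis
  proof (rule sbddI)
    show "\<bar>f x * g x\<bar> \<le> \<bar>C\<bar> * \<bar>D\<bar>" if "norm x = 1" for x
      unfolding abs_mult using C[OF that] D[OF that] by (intro mult_mono) auto
  qed measurable
qed

lemma sbdd_cmult: "sbdd f \<Longrightarrow> sbdd (\<lambda>x. c * f x)"
  using sbdd_mult[OF sbdd_const] .

lemma sbdd_diff: "sbdd f \<Longrightarrow> sbdd g \<Longrightarrow> sbdd (\<lambda>x. f x - g x)"
  using sbdd_add[of f "\<lambda>x. - 1 * g x"] sbdd_cmult[of g "- 1"] by simp

lemma sbdd_sum: "(\<And>i. i \<in> I \<Longrightarrow> sbdd (F i)) \<Longrightarrow> sbdd (\<lambda>x. \<Sum>i\<in>I. F i x)"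
  by (induction I rule: infinite_finite_induct) (auto intro: sbdd_const sbdd_add)

lemma sbdd_inner_integral:
  fixes f :: "real^'n \<Rightarrow> real" and k :: "real^'n \<Rightarrow> real^'n \<Rightarrow> real"
  assumes f: "integrable sphere_meas f"
    and k [measurable]: "case_prod k \<in> borel_measurable (borel \<Otimes>\<^sub>M borel)"
    and C: "\<And>x y. norm x = 1 \<Longrightarrow> norm y = 1 \<Longrightarrow> \<bar>k x y\<bar> \<le> C"
  shows "sbdd (\<lambda>x. \<integral>y. f y * k y x \<partial>sphere_meas)"
proof (rule sbddI)
  have [measurable]: "f \<in> borel_measurable borel" using f by auto
  show "(\<lambda>x. \<integral>y. f y * k y x \<partial>sphere_meas) \<in> borel_measurable borel" by measurable
  fix x :: "real^'n" assume x: "norm x = 1"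
  have b: "\<bar>f y * k y x\<bar> \<le> \<bar>C\<bar> * \<bar>f y\<bar>" if "norm y = 1" for y
    using C[OF that x] mult_right_mono[of "\<bar>k y x\<bar>" "\<bar>C\<bar>" "\<bar>f y\<bar>"] by (simp add: abs_mult mult.commute)
  have "integrable sphere_meas (\<lambda>y. f y * k y x)"
    by (rule sphere_integrable_bound[of "\<lambda>y. \<bar>C\<bar> * \<bar>f y\<bar>"]) (use f b in auto)
  then have "(\<integral>y. \<bar>f y * k y x\<bar> \<partial>sphere_meas) \<le> (\<integral>y. \<bar>C\<bar> * \<bar>f y\<bar> \<partial>sphere_meas)"
    by (intro sphere_integral_mono) (use f b in auto)
  then show "\<bar>\<integral>y. f y * k y x \<partial>sphere_meas\<bar> \<le> (\<integral>y. \<bar>C\<bar> * \<bar>f y\<bar> \<partial>sphere_meas)"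
    using integral_abs_bound[of sphere_meas "\<lambda>y. f y * k y x"] by linarith
qed

lemma sbdd_Tk:
  fixes f :: "real^'n \<Rightarrow> real"
  assumes n: "CARD('n) \<ge> 2" and f: "integrable sphere_meas f"
  shows "sbdd (Tk f k)"
  unfolding Tk_def[abs_def]
proof (rule sbdd_inner_integral[OF f])
  show "\<bar>kern (dm TYPE('n)) k (x \<bullet> y)\<bar> \<le> kcoef (dm TYPE('n)) k * 2 ^ k" if "norm x = 1" "norm y = 1" for x y :: "real^'n"
    using kern_unit_bounds[OF n that, of k] by simp
qed measurable

section \<open>Gradients of the averages\<close>

definition gTk :: "(real^'n \<Rightarrow> real) \<Rightarrow> nat \<Rightarrow> real^'n \<Rightarrow> real^'n" where
  "gTk f k z = (\<chi> i. \<integral>y. f y * (kern' (dm TYPE('n)) k (y \<bullet> z) * (y $ i - (y \<bullet> z) * z $ i)) \<partial>sphere_meas)"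

text \<open>The pairing of \<open>v\<close> with the rotation field x_i e_j - x_j e_i; if
  \<open>v\<close> is a gradient, it is the derivative along that rotation. Unlike the coordinates
  of a tangent vector, these entries commute with \<open>Tk\<close>.\<close>

definition rot :: "'n \<Rightarrow> 'n \<Rightarrow> real^'n \<Rightarrow> real^'n \<Rightarrow> real" where
  "rot i j x v = x $ i * v $ j - x $ j * v $ i"

lemma gTk_inner:
  fixes f :: "real^'n \<Rightarrow> real"
  assumes f: "integrable sphere_meas f"
  shows "gTk f k z \<bullet> v = (\<integral>y. f y * (kern' (dm TYPE('n)) k (y \<bullet> z) * (y \<bullet> v - (y \<bullet> z) * (z \<bullet> v))) \<partial>sphere_meas)"
proof -
  let ?d = "dm TYPE('n)"
  have i: "integrable sphere_meas (\<lambda>y. f y * (kern' ?d k (y \<bullet> z) * (y $ i - (y \<bullet> z) * z $ i)))" for i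
  proof (rule integrable_sphere_mult_continuous[OF f])
    have "continuous_on UNIV (\<lambda>y. kern' ?d k (y \<bullet> z))"
      by (rule continuous_on_compose2[OF kern_derivs(4)[of UNIV]]) (auto intro!: continuous_intros)
    then show "continuous_on UNIV (\<lambda>y. kern' ?d k (y \<bullet> z) * (y $ i - (y \<bullet> z) * z $ i))"
      by (intro continuous_intros)
  qed
  have "gTk f k z \<bullet> v = (\<Sum>i\<in>UNIV. \<integral>y. f y * (kern' ?d k (y \<bullet> z) * (y $ i - (y \<bullet> z) * z $ i)) * v $ i \<partial>sphere_meas)"
    by (simp add: gTk_def inner_vec_def)
  also have "\<dots> = (\<integral>y. (\<Sum>i\<in>UNIV. f y * (kern' ?d k (y \<bullet> z) * (y $ i - (y \<bullet> z) * z $ i)) * v $ i) \<partial>sphere_meas)"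
    by (rule Bochner_Integration.integral_sum[symmetric]) (intro integrable_mult_left i)
  also have "\<dots> = (\<integral>y. f y * (kern' ?d k (y \<bullet> z) * (y \<bullet> v - (y \<bullet> z) * (z \<bullet> v))) \<partial>sphere_meas)"
  proof (rule Bochner_Integration.integral_cong[OF refl])
    fix y :: "real^'n"
    have "(\<Sum>i\<in>UNIV. (y $ i - (y \<bullet> z) * z $ i) * v $ i) = (y - (y \<bullet> z) *\<^sub>R z) \<bullet> v"
      unfolding inner_vec_def[of _ v] by simp
    also have "\<dots> = y \<bullet> v - (y \<bullet> z) * (z \<bullet> v)" by (simp add: inner_diff_left)
    finally show "(\<Sum>i\<in>UNIV. f y * (kern' ?d k (y \<bullet> z) * (y $ i - (y \<bullet> z) * z $ i)) * v $ i)
      = f y * (kern' ?d k (y \<bullet> z) * (y \<bullet> v - (y \<bullet> z) * (z \<bullet> v)))"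
      by (simp add: sum_distrib_left[symmetric] mult.assoc)
  qed
  finally show ?thesis .
qed

lemma gTk_tangential:
  assumes f: "integrable sphere_meas f" and z: "norm z = 1"
  shows "gTk f k z \<bullet> z = 0"
  using z by (simp add: gTk_inner[OF f] norm_eq_1)

text \<open>Lagrange's identity. At a unit vector \<open>x\<close> and for a tangential
  \<open>v\<close> the right-hand side is twice the squared length of \<open>v\<close>.\<close>

lemma sum_rot_sq:
  fixes x v :: "real^'n"
  shows "(\<Sum>i\<in>UNIV. \<Sum>j\<in>UNIV. (rot i j x v)\<^sup>2) = 2 * ((x \<bullet> x) * (v \<bullet> v) - (x \<bullet> v)\<^sup>2)"
proof -
  have "(rot i j x v)\<^sup>2 = (x $ i * x $ i) * (v $ j * v $ j) + (v $ i * v $ i) * (x $ j * x $ j) - 2 * ((x $ i * v $ i) * (x $ j * v $ j))" for i j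
    by (simp add: rot_def power2_eq_square algebra_simps)
  then show ?thesis
    by (simp add: sum.distrib sum_subtractf sum_distrib_left[symmetric] sum_distrib_right[symmetric] inner_vec_def power2_eq_square)
qed

text \<open>The kernel is unchanged when both of its arguments are rotated, so differentiating it
  along a rotation of \<open>z\<close> is the negative of differentiating it along the same rotation
  of \<open>y\<close>. Integration by parts in \<open>y\<close> moves the derivative to
  \<open>f\<close> and restores the sign.\<close>

lemma rot_gTk:
  fixes f :: "real^'n \<Rightarrow> real"
  assumes w: "wgrad f h"
  shows "rot i j z (gTk f k z) = Tk (\<lambda>y. rot i j y (h y)) k z"
proof -
  let ?d = "dm TYPE('n)"
  have f: "integrable sphere_meas f" using w by (simp add: wgrad_def)
  define B where "B y = y $ i *\<^sub>R axis j 1 - y $ j *\<^sub>R axis i (1::real)" for y :: "real^'n"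
  have B: "linear B" "\<And>x. x \<bullet> B x = 0" "\<And>x v. v \<bullet> B x = rot i j x v"
    by (auto simp: B_def rot_def inner_diff_right inner_axis intro!: linearI simp: algebra_simps)
  have q: "C1_map (\<lambda>y. kern ?d k (z \<bullet> y)) (\<lambda>y v. kern' ?d k (z \<bullet> y) * (z \<bullet> v))"
    by (rule ridge_C1) (auto intro: kern_derivs)
  have "(\<integral>x. (h x \<bullet> B x) * kern ?d k (z \<bullet> x) \<partial>sphere_meas) = - (\<integral>x. f x * (kern' ?d k (z \<bullet> x) * (z \<bullet> B x)) \<partial>sphere_meas)"
    by (rule wgrad_rotation[OF w q B(1,2)])
  then have "Tk (\<lambda>y. rot i j y (h y)) k z = (\<integral>x. - (f x * (kern' ?d k (x \<bullet> z) * rot i j x z)) \<partial>sphere_meas)"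
    unfolding B(3) inner_commute[of z] by (simp add: Tk_def)
  also have "\<dots> = (\<integral>y. f y * (kern' ?d k (y \<bullet> z) * (y \<bullet> B z - (y \<bullet> z) * (z \<bullet> B z))) \<partial>sphere_meas)"
    by (rule Bochner_Integration.integral_cong) (auto simp: B(2,3) rot_def algebra_simps)
  also have "\<dots> = gTk f k z \<bullet> B z" by (rule gTk_inner[OF f, symmetric])
  finally show ?thesis by (simp add: B(3))
qed

lemma kern'_unit_bound:
  assumes "CARD('n) \<ge> 2" "norm (x::real^'n) = 1" "norm y = 1"
  shows "\<bar>kern' (dm TYPE('n)) k (x \<bullet> y)\<bar> \<le> kcoef (dm TYPE('n)) k * (k * 2 ^ (k - 1))"
  using assms sphere_inner_bounds[of x y] by (intro kern'_bound) auto

lemma gTk_component_sbdd: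
  fixes f :: "real^'n \<Rightarrow> real"
  assumes n: "CARD('n) \<ge> 2" and f: "integrable sphere_meas f"
  shows "sbdd (\<lambda>z. gTk f k z $ i)"
  unfolding gTk_def vec_lambda_beta
proof (rule sbdd_inner_integral[OF f])
  let ?C = "kcoef (dm TYPE('n)) k * (k * 2 ^ (k - 1))"
  show "\<bar>kern' (dm TYPE('n)) k (x \<bullet> y) * (x $ i - (x \<bullet> y) * y $ i)\<bar> \<le> ?C * 2" if "norm x = 1" "norm y = 1" for x y :: "real^'n"
  proof -
    have "\<bar>(x \<bullet> y) * y $ i\<bar> \<le> 1 * 1"
      unfolding abs_mult using sphere_inner_bounds[OF that] component_le_norm_cart[of y i] that
      by (intro mult_mono) auto
    then have "\<bar>x $ i - (x \<bullet> y) * y $ i\<bar> \<le> 2"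
      using component_le_norm_cart[of x i] that by linarith
    then show ?thesis unfolding abs_mult using kern'_unit_bound[OF n that, of k] by (intro mult_mono) auto
  qed
qed measurable

lemma gTk_measurable:
  fixes f :: "real^'n \<Rightarrow> real"
  assumes n: "CARD('n) \<ge> 2" and f: "integrable sphere_meas f"
  shows "gTk f k \<in> borel_measurable borel"
proof -
  have "(\<lambda>z. gTk f k z \<bullet> axis i 1) \<in> borel_measurable borel" for i
    using gTk_component_sbdd[OF n f, of k i] unfolding sbdd_def inner_axis by simp
  then show ?thesis
    by (intro borel_measurable_euclidean_space[THEN iffD2]) (auto simp: Basis_vec_def)
qed

text \<open>For fixed \<open>y\<close> the kernel is a smooth ridge function of \<open>x\<close> and
  may be integrated by parts; Fubini's theorem then yields the weak gradient of the average, without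
  differentiating under the integral sign.\<close>

lemma wgrad_Tk:
  fixes f :: "real^'n \<Rightarrow> real"
  assumes n: "CARD('n) \<ge> 2" and f: "integrable sphere_meas f"
  shows "wgrad (Tk f k) (gTk f k)"
  unfolding wgrad_def
proof (intro conjI allI impI)
  let ?d = "dm TYPE('n)"
  have [measurable]: "f \<in> borel_measurable borel" using f by auto
  show "Tk f k \<in> borel_measurable borel" by measurable
  show "integrable sphere_meas (Tk f k)" by (rule Tk_integrable_sphere[OF n f])
  show gm: "gTk f k \<in> borel_measurable borel" by (rule gTk_measurable[OF n f])
  show "integrable sphere_meas (\<lambda>x. norm (gTk f k x))"
  proof (rule sphere_integrable_bound)
    show "integrable sphere_meas (\<lambda>x. \<Sum>i\<in>UNIV. \<bar>gTk f k x $ i\<bar>)"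
      by (intro Bochner_Integration.integrable_sum integrable_abs sbdd_integrable gTk_component_sbdd[OF n f])
    show "\<bar>norm (gTk f k x)\<bar> \<le> (\<Sum>i\<in>UNIV. \<bar>gTk f k x $ i\<bar>)" for x
      using norm_le_l1_cart[of "gTk f k x"] by simp
  qed (use gm in measurable)
  fix X :: "real^'n \<Rightarrow> real^'n" and X'
  assume "C1_map X X' \<and> (\<forall>x. x \<bullet> X x = 0)"
  then have X: "C1_map X X'" and tan: "\<And>x. x \<bullet> X x = 0" by auto
  have Xc: "continuous_on UNIV X" by (rule C1_map_continuous[OF X])
  have [measurable]: "X \<in> borel_measurable borel" by (rule borel_measurable_continuous_onI[OF Xc])
  have tc: "continuous_on UNIV (tdiv X')" unfolding tdiv_def[abs_def]
    by (intro continuous_intros C1_map_continuous_deriv[OF X])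
  have ti: "integrable sphere_meas (tdiv X')" by (rule integrable_sphere_continuous[OF tc])
  have "sbdd (\<lambda>x. norm (X x))" by (rule sbdd_continuous) (intro continuous_on_norm Xc)
  then obtain C where "\<And>x. norm x = 1 \<Longrightarrow> \<bar>norm (X x)\<bar> \<le> C" by (rule sbddE) blast
  then have C: "\<And>x. norm x = 1 \<Longrightarrow> norm (X x) \<le> C" by simp
  define k0 where "k0 y x = kern' ?d k (y \<bullet> x) * (y \<bullet> X x)" for y x
  have [measurable]: "case_prod k0 \<in> borel_measurable (borel \<Otimes>\<^sub>M borel)"
    unfolding k0_def by measurable
  have k0b: "\<bar>k0 y x\<bar> \<le> kcoef ?d k * (k * 2 ^ (k - 1)) * C" if "norm y = 1" "norm x = 1" for y x
    unfolding k0_def abs_mult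
    using kern'_unit_bound[OF n that, of k] Cauchy_Schwarz_ineq2[of y "X x"] C[OF that(2)] that
    by (intro mult_mono) auto
  have "(\<integral>x. gTk f k x \<bullet> X x \<partial>sphere_meas) = (\<integral>x. 1 * (\<integral>y. f y * k0 y x \<partial>sphere_meas) \<partial>sphere_meas)"
    by (simp add: gTk_inner[OF f] tan k0_def)
  also have "\<dots> = (\<integral>y. f y * (\<integral>x. 1 * k0 y x \<partial>sphere_meas) \<partial>sphere_meas)"
    by (rule sphere_swap(1)[OF f _ _ k0b]) auto
  also have "\<dots> = (\<integral>y. f y * - (\<integral>x. tdiv X' x * kern ?d k (y \<bullet> x) \<partial>sphere_meas) \<partial>sphere_meas)"
  proof (rule arg_cong[where f="integral\<^sup>L sphere_meas"], rule ext)
    fix y :: "real^'n"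
    have "C1_map (\<lambda>x. kern ?d k (y \<bullet> x)) (\<lambda>x v. kern' ?d k (y \<bullet> x) * (y \<bullet> v))"
      by (rule ridge_C1) (auto intro: kern_derivs)
    from wgrad_C1[OF this] X tan
    have "(\<integral>x. ((\<chi> j. kern' ?d k (y \<bullet> x) * (y \<bullet> axis j 1)) - (kern' ?d k (y \<bullet> x) * (y \<bullet> x)) *\<^sub>R x) \<bullet> X x \<partial>sphere_meas)
      = - (\<integral>x. kern ?d k (y \<bullet> x) * tdiv X' x \<partial>sphere_meas)"
      by (auto simp: wgrad_def)
    moreover have "((\<chi> j. kern' ?d k (y \<bullet> x) * (y \<bullet> axis j 1)) - (kern' ?d k (y \<bullet> x) * (y \<bullet> x)) *\<^sub>R x) \<bullet> X x = 1 * k0 y x" for x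
    proof -
      have "(\<chi> j. kern' ?d k (y \<bullet> x) * (y \<bullet> axis j 1)) = kern' ?d k (y \<bullet> x) *\<^sub>R y"
        by (simp add: vec_eq_iff inner_axis)
      then show ?thesis by (simp add: inner_diff_left tan k0_def)
    qed
    ultimately show "f y * (\<integral>x. 1 * k0 y x \<partial>sphere_meas) = f y * - (\<integral>x. tdiv X' x * kern ?d k (y \<bullet> x) \<partial>sphere_meas)"
      by (simp add: mult.commute)
  qed
  also have "\<dots> = - (\<integral>y. f y * (\<integral>x. tdiv X' x * kern ?d k (y \<bullet> x) \<partial>sphere_meas) \<partial>sphere_meas)"
    by simp
  also have "(\<integral>y. f y * (\<integral>x. tdiv X' x * kern ?d k (y \<bullet> x) \<partial>sphere_meas) \<partial>sphere_meas)
      = (\<integral>x. tdiv X' x * (\<integral>y. f y * kern ?d k (y \<bullet> x) \<partial>sphere_meas) \<partial>sphere_meas)"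
  proof (rule sphere_swap(1)[OF f ti, symmetric])
    show "\<bar>kern ?d k (x \<bullet> y)\<bar> \<le> kcoef ?d k * 2 ^ k" if "norm x = 1" "norm y = 1" for x y :: "real^'n"
      using kern_unit_bounds[OF n that, of k] by simp
  qed measurable
  also have "\<dots> = (\<integral>x. Tk f k x * tdiv X' x \<partial>sphere_meas)" by (simp add: Tk_def mult.commute)
  finally show "(\<integral>x. gTk f k x \<bullet> X x \<partial>sphere_meas) = - (\<integral>x. Tk f k x * tdiv X' x \<partial>sphere_meas)" .
qed

lemma gTk_bounded:
  fixes f :: "real^'n \<Rightarrow> real"
  assumes n: "CARD('n) \<ge> 2" and f: "integrable sphere_meas f"
  obtains C where "\<And>x. norm x = 1 \<Longrightarrow> norm (gTk f k x) \<le> C"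
proof -
  have "sbdd (\<lambda>x. (\<Sum>i\<in>UNIV. (gTk f k x $ i)\<^sup>2))"
    unfolding power2_eq_square by (intro sbdd_sum sbdd_mult gTk_component_sbdd[OF n f])
  then obtain C where C: "\<And>x. norm x = 1 \<Longrightarrow> \<bar>\<Sum>i\<in>UNIV. (gTk f k x $ i)\<^sup>2\<bar> \<le> C" by (rule sbddE) blast
  show ?thesis
  proof (rule that[of "sqrt C"])
    fix x :: "real^'n" assume "norm x = 1"
    from C[OF this] show "norm (gTk f k x) \<le> sqrt C"
      unfolding norm_vec_def L2_set_def by simp
  qed
qed

text \<open>Green's formula combined with the Laplace relation of the kernels. The two indices are
  independent: as the left-hand side is symmetric, the operator taking each average to its negative
  Laplacian is symmetric on the span of the averages.\<close>

lemma gTk_energy: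
  fixes f :: "real^'n \<Rightarrow> real"
  assumes n: "CARD('n) \<ge> 2" and f: "integrable sphere_meas f"
  shows "(\<integral>x. gTk f (Suc a) x \<bullet> gTk f b x \<partial>sphere_meas)
     = (\<integral>x. Tk f b x * (lam (dm TYPE('n)) (Suc a) * (Tk f (Suc a) x - Tk f a x)) \<partial>sphere_meas)"
proof -
  let ?d = "dm TYPE('n)"
  have d: "?d > 0" using n by simp
  define r where "r = gTk f b"
  have [measurable]: "f \<in> borel_measurable borel" "r \<in> borel_measurable borel"
    using f gTk_measurable[OF n f] by (auto simp: r_def)
  obtain C where C: "\<And>x. norm x = 1 \<Longrightarrow> norm (r x) \<le> C" unfolding r_def by (rule gTk_bounded[OF n f]) blast
  have rx: "r x \<bullet> x = 0" if "norm x = 1" for x unfolding r_def by (rule gTk_tangential[OF f that])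
  define k0 where "k0 y x = kern' ?d (Suc a) (y \<bullet> x) * (y \<bullet> r x - (y \<bullet> x) * (x \<bullet> r x))" for y x
  have [measurable]: "case_prod k0 \<in> borel_measurable (borel \<Otimes>\<^sub>M borel)" unfolding k0_def by measurable
  have k0b: "\<bar>k0 y x\<bar> \<le> kcoef ?d (Suc a) * (Suc a * 2 ^ (Suc a - 1)) * C" if "norm y = 1" "norm x = 1" for y x
    unfolding k0_def abs_mult
    using kern'_unit_bound[OF n that, of "Suc a"] Cauchy_Schwarz_ineq2[of y "r x"] C[OF that(2)] that rx[OF that(2)]
    by (intro mult_mono) (auto simp: inner_commute[of x])
  note F = Tk_integrable_sphere[OF n f, of b]
  have inner: "(\<integral>x. 1 * k0 y x \<partial>sphere_meas) = lam ?d (Suc a) * (Tk (Tk f b) (Suc a) y - Tk (Tk f b) a y)" if y: "norm y = 1" for y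
  proof -
    have yy: "y \<bullet> y = 1" using y by (simp add: norm_eq_1)
    have "(\<integral>x. 1 * k0 y x \<partial>sphere_meas) = (\<integral>x. (r x \<bullet> y - (r x \<bullet> x) * (x \<bullet> y)) * kern' ?d (Suc a) (x \<bullet> y) \<partial>sphere_meas)"
      by (rule Bochner_Integration.integral_cong) (auto simp: k0_def inner_commute algebra_simps)
    also have "\<dots> = - (\<integral>x. Tk f b x * ((y \<bullet> y - (x \<bullet> y)\<^sup>2) * kern'' ?d (Suc a) (x \<bullet> y) - ?d * (x \<bullet> y) * kern' ?d (Suc a) (x \<bullet> y)) \<partial>sphere_meas)"
      unfolding r_def by (rule wgrad_ridge[OF wgrad_Tk[OF n f]]) (auto intro: kern_derivs)
    also have "\<dots> = (\<integral>x. lam ?d (Suc a) * (Tk f b x * kern ?d (Suc a) (x \<bullet> y) - Tk f b x * kern ?d a (x \<bullet> y)) \<partial>sphere_meas)"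
      unfolding yy kern_laplace[OF d] Bochner_Integration.integral_minus[symmetric]
      by (rule Bochner_Integration.integral_cong) (auto simp: algebra_simps)
    also have "\<dots> = lam ?d (Suc a) * (Tk (Tk f b) (Suc a) y - Tk (Tk f b) a y)"
      unfolding Tk_def[of "Tk f b"] using Tk_integrable[OF F kern_derivs(3)] by simp
    finally show ?thesis .
  qed
  have "(\<integral>x. gTk f (Suc a) x \<bullet> r x \<partial>sphere_meas) = (\<integral>x. 1 * (\<integral>y. f y * k0 y x \<partial>sphere_meas) \<partial>sphere_meas)"
    unfolding gTk_inner[OF f] k0_def mult_1 ..
  also have "\<dots> = (\<integral>y. f y * (\<integral>x. 1 * k0 y x \<partial>sphere_meas) \<partial>sphere_meas)"
    by (rule sphere_swap(1)[OF f _ _ k0b]) auto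
  also have "\<dots> = (\<integral>y. lam ?d (Suc a) * (f y * Tk (Tk f b) (Suc a) y - f y * Tk (Tk f b) a y) \<partial>sphere_meas)"
  proof (rule sphere_integral_cong)
    show "f y * (\<integral>x. 1 * k0 y x \<partial>sphere_meas) = lam ?d (Suc a) * (f y * Tk (Tk f b) (Suc a) y - f y * Tk (Tk f b) a y)" if "norm y = 1" for y
      unfolding inner[OF that] by (simp add: algebra_simps)
    show "(\<lambda>y. f y * (\<integral>x. 1 * k0 y x \<partial>sphere_meas)) \<in> borel_measurable borel" by measurable
  qed measurable
  also have "\<dots> = lam ?d (Suc a) * ((\<integral>y. f y * Tk (Tk f b) (Suc a) y \<partial>sphere_meas) - (\<integral>y. f y * Tk (Tk f b) a y \<partial>sphere_meas))"
    using kern_swap(2)[OF n F f] by simp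
  also have "\<dots> = lam ?d (Suc a) * ((\<integral>y. Tk f b y * Tk f (Suc a) y \<partial>sphere_meas) - (\<integral>y. Tk f b y * Tk f a y \<partial>sphere_meas))"
    unfolding kern_swap(1)[OF n F f] ..
  also have "\<dots> = (\<integral>x. Tk f b x * (lam ?d (Suc a) * (Tk f (Suc a) x - Tk f a x)) \<partial>sphere_meas)"
  proof -
    have "Tk f b x * (lam ?d (Suc a) * (Tk f (Suc a) x - Tk f a x)) = lam ?d (Suc a) * (Tk f b x * Tk f (Suc a) x - Tk f b x * Tk f a x)" for x
      by (simp add: algebra_simps)
    note e = this
    show ?thesis unfolding e using kern_swap(2)[OF n f F] by simp
  qed
  finally show ?thesis by (simp add: r_def)
qed

text \<open>Jensen's inequality is applied to each rotational derivative, which commutes with the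
  averaging; averaging preserves means, and Lagrange's identity translates the sum of squares back
  on both sides.\<close>

lemma gTk_contraction:
  fixes f :: "real^'n \<Rightarrow> real"
  assumes n: "CARD('n) \<ge> 2" and w: "wgrad f h" and tan: "\<And>x. norm x = 1 \<Longrightarrow> h x \<bullet> x = 0"
    and int: "integrable sphere_meas (\<lambda>x. (norm (h x))\<^sup>2)"
  shows "(\<integral>x. gTk f k x \<bullet> gTk f k x \<partial>sphere_meas) \<le> (\<integral>x. (norm (h x))\<^sup>2 \<partial>sphere_meas)"
proof -
  have f: "integrable sphere_meas f" and [measurable]: "h \<in> borel_measurable borel"
    and h1: "integrable sphere_meas (\<lambda>x. norm (h x))" using w by (auto simp: wgrad_def)
  let ?H = "\<lambda>i j y. rot i j y (h y)"
  have Hb: "(?H i j y)\<^sup>2 \<le> 2 * (norm (h y))\<^sup>2" if "norm y = 1" for i j y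
  proof -
    have "(?H i j y)\<^sup>2 \<le> (\<Sum>j\<in>UNIV. (?H i j y)\<^sup>2)" by (rule member_le_sum) auto
    also have "\<dots> \<le> (\<Sum>i\<in>UNIV. \<Sum>j\<in>UNIV. (?H i j y)\<^sup>2)"
      by (rule member_le_sum[of i UNIV "\<lambda>i. \<Sum>j\<in>UNIV. (?H i j y)\<^sup>2"]) (auto intro: sum_nonneg)
    finally show ?thesis using that tan[OF that] unfolding sum_rot_sq
      by (simp add: norm_eq_1 inner_commute power2_norm_eq_inner)
  qed
  have [measurable]: "?H i j \<in> borel_measurable borel" for i j unfolding rot_def by measurable
  have H2: "integrable sphere_meas (\<lambda>y. (?H i j y)\<^sup>2)" for i j
    by (rule sphere_integrable_bound[of "\<lambda>y. 2 * (norm (h y))\<^sup>2"]) (use int Hb in auto)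
  have H1: "integrable sphere_meas (?H i j)" for i j
  proof (rule sphere_integrable_bound[of "\<lambda>y. 1 + (?H i j y)\<^sup>2"])
    show "\<bar>?H i j x\<bar> \<le> 1 + (?H i j x)\<^sup>2" for x
      using sum_squares_bound[of 1 "\<bar>?H i j x\<bar>"] by simp
  qed (use H2 in auto)
  have pt: "gTk f k x \<bullet> gTk f k x \<le> (\<Sum>i\<in>UNIV. \<Sum>j\<in>UNIV. Tk (\<lambda>y. (?H i j y)\<^sup>2) k x) / 2" if x: "norm x = 1" for x
  proof -
    have "2 * (gTk f k x \<bullet> gTk f k x) = (\<Sum>i\<in>UNIV. \<Sum>j\<in>UNIV. (rot i j x (gTk f k x))\<^sup>2)"
      unfolding sum_rot_sq using x gTk_tangential[OF f x, of k] by (simp add: norm_eq_1 inner_commute)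
    also have "\<dots> = (\<Sum>i\<in>UNIV. \<Sum>j\<in>UNIV. \<bar>Tk (?H i j) k x\<bar>\<^sup>2)" by (simp add: rot_gTk[OF w])
    also have "\<dots> \<le> (\<Sum>i\<in>UNIV. \<Sum>j\<in>UNIV. Tk (\<lambda>y. (?H i j y)\<^sup>2) k x)"
    proof (intro sum_mono)
      fix i j
      have "\<bar>Tk (?H i j) k x\<bar>\<^sup>2 \<le> (Tk (\<lambda>y. \<bar>?H i j y\<bar>) k x)\<^sup>2"
        by (rule power_mono[OF Tk_abs_le[OF n H1 x]]) simp
      also have "\<dots> \<le> Tk (\<lambda>y. \<bar>?H i j y\<bar>\<^sup>2) k x"
        by (rule Tk_jensen[OF n _ _ _ _ x]) (use H1 H2 in auto)
      finally show "\<bar>Tk (?H i j) k x\<bar>\<^sup>2 \<le> Tk (\<lambda>y. (?H i j y)\<^sup>2) k x" by simp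
    qed
    finally show ?thesis by simp
  qed
  note TH = Tk_integrable_sphere[OF n H2]
  have "(\<integral>x. gTk f k x \<bullet> gTk f k x \<partial>sphere_meas) \<le> (\<integral>x. (\<Sum>i\<in>UNIV. \<Sum>j\<in>UNIV. Tk (\<lambda>y. (?H i j y)\<^sup>2) k x) / 2 \<partial>sphere_meas)"
  proof (rule sphere_integral_mono[OF _ _ pt])
    show "integrable sphere_meas (\<lambda>x. gTk f k x \<bullet> gTk f k x)"
      unfolding inner_vec_def inner_real_def
      by (intro Bochner_Integration.integrable_sum sbdd_integrable sbdd_mult gTk_component_sbdd[OF n f])
  qed (use TH in \<open>auto intro!: Bochner_Integration.integrable_sum\<close>)
  also have "\<dots> = (\<Sum>i\<in>UNIV. \<Sum>j\<in>UNIV. \<integral>x. (?H i j x)\<^sup>2 \<partial>sphere_meas) / 2"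
    using TH by (simp add: Bochner_Integration.integral_sum Bochner_Integration.integrable_sum integral_Tk[OF n H2])
  also have "\<dots> = (\<integral>x. (\<Sum>i\<in>UNIV. \<Sum>j\<in>UNIV. (?H i j x)\<^sup>2) / 2 \<partial>sphere_meas)"
    using H2 by (simp add: Bochner_Integration.integral_sum Bochner_Integration.integrable_sum)
  also have "\<dots> = (\<integral>x. (norm (h x))\<^sup>2 \<partial>sphere_meas)"
  proof (rule sphere_integral_cong)
    show "(\<Sum>i\<in>UNIV. \<Sum>j\<in>UNIV. (?H i j x)\<^sup>2) / 2 = (norm (h x))\<^sup>2" if "norm x = 1" for x
      unfolding sum_rot_sq using that tan[OF that] by (simp add: norm_eq_1 inner_commute power2_norm_eq_inner)
  qed measurable
  finally show ?thesis .
qed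

section \<open>Eigenfunctions by finite linear algebra\<close>

text \<open>\<open>AG F l h g\<close> says that \<open>g = A h\<close>, where \<open>A\<close> is the linear operator determined on the span
  of the functions \<open>F\<^sub>k\<close> by \<open>A F\<^sub>k = l\<^sub>k (F\<^sub>k - F\<^sub>k\<^sub>-\<^sub>1)\<close>.\<close>

inductive AG :: "(nat \<Rightarrow> 'a \<Rightarrow> real) \<Rightarrow> (nat \<Rightarrow> real) \<Rightarrow> ('a \<Rightarrow> real) \<Rightarrow> ('a \<Rightarrow> real) \<Rightarrow> bool"
  for F l where
  base: "AG F l (F (Suc k)) (\<lambda>x. l (Suc k) * (F (Suc k) x - F k x))"
| scale: "AG F l h g \<Longrightarrow> AG F l (\<lambda>x. c * h x) (\<lambda>x. c * g x)"
| add: "AG F l h g \<Longrightarrow> AG F l h' g' \<Longrightarrow> AG F l (\<lambda>x. h x + h' x) (\<lambda>x. g x + g' x)"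

lemma AG_sum: "(\<And>i. i \<in> I \<Longrightarrow> AG F l (h i) (g i)) \<Longrightarrow> AG F l (\<lambda>x. \<Sum>i\<in>I. h i x) (\<lambda>x. \<Sum>i\<in>I. g i x)"
proof (induction I rule: infinite_finite_induct)
  case (insert i I)
  then show ?case using AG.add[of F l "h i" "g i" "\<lambda>x. \<Sum>i\<in>I. h i x" "\<lambda>x. \<Sum>i\<in>I. g i x"] by simp
qed (use AG.scale[OF AG.base, of F l 0 0] in simp_all)

text \<open>The operator is triangular on the sequence of the \<open>F\<close>, with distinct
  diagonal entries, hence diagonalisable. As \<open>F 1\<close> vanishes, no eigenvalue before
  \<open>l 2\<close> occurs; the last clause expands the image of \<open>F k\<close> under the
  operator.\<close>

lemma eigen_decomposition:
  assumes F1: "\<And>x. F 1 x = 0" and l: "\<And>i j. 1 \<le> i \<Longrightarrow> i < j \<Longrightarrow> l i < l j" "\<And>i. 1 \<le> i \<Longrightarrow> l i > (0::real)"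
    and k: "k \<ge> 1"
  shows "\<exists>h. (\<forall>x. F k x = (\<Sum>j\<in>{2..k}. h j x)) \<and> (\<forall>j\<in>{2..k}. AG F l (h j) (\<lambda>x. l j * h j x))
     \<and> (k \<ge> 2 \<longrightarrow> (\<forall>x. l k * (F k x - F (k - 1) x) = (\<Sum>j\<in>{2..k}. l j * h j x)))"
  using k
proof (induction k rule: dec_induct)
  case base
  then show ?case using F1 by simp
next
  case (step k)
  then obtain h where h: "\<And>x. F k x = (\<Sum>j\<in>{2..k}. h j x)" "\<And>j. j \<in> {2..k} \<Longrightarrow> AG F l (h j) (\<lambda>x. l j * h j x)"
    by blast
  let ?L = "l (Suc k)"
  have L: "?L > 0" using l by simp
  \<comment> \<open>The divisor is chosen so that the sum \<open>S\<close> of the \<open>h'\<close>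
    satisfies the inhomogeneous equation: its image \<open>S'\<close> is
    \<open>?L * (S - F k)\<close>. Then \<open>F (Suc k) - S\<close> is an eigenvector for
    \<open>?L\<close>, the one new component.\<close>
  define h' where "h' j x = (1 / (1 - l j / ?L)) * h j x" for j x
  have q: "1 - l j / ?L > 0" if "j \<in> {2..k}" for j using l(1)[of j "Suc k"] L that by simp
  have AG': "AG F l (h' j) (\<lambda>x. l j * h' j x)" if "j \<in> {2..k}" for j
    using AG.scale[OF h(2)[OF that], of "1 / (1 - l j / ?L)"] unfolding h'_def[abs_def] by (simp only: mult.left_commute)
  have hh: "h j x = (1 - l j / ?L) * h' j x" if "j \<in> {2..k}" for j x
  proof -
    have "a * (1 / a * b) = b" if "a > 0" for a b :: real using that by simp
    from this[OF q[OF that]] show ?thesis by (simp only: h'_def)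
  qed
  define S where "S x = (\<Sum>j\<in>{2..k}. h' j x)" for x
  define S' where "S' x = (\<Sum>j\<in>{2..k}. l j * h' j x)" for x
  define e where "e x = F (Suc k) x + - 1 * S x" for x
  have Fk: "F k x = S x - S' x / ?L" for x
    unfolding h(1) S_def S'_def sum_divide_distrib sum_subtractf[symmetric]
    by (rule sum.cong) (auto simp: hh algebra_simps)
  have "AG F l S S'" unfolding S_def[abs_def] S'_def[abs_def] by (rule AG_sum[OF AG'])
  then have "AG F l e (\<lambda>x. ?L * (F (Suc k) x - F k x) + - 1 * S' x)"
    unfolding e_def[abs_def] by (intro AG.add AG.base AG.scale)
  moreover have "?L * (F (Suc k) x - F k x) + - 1 * S' x = ?L * e x" for x
    unfolding Fk e_def using L by (simp add: algebra_simps)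
  ultimately have e: "AG F l e (\<lambda>x. ?L * e x)" by simp
  define g where "g j = (if j = Suc k then e else h' j)" for j
  have sg: "(\<Sum>j\<in>{2..Suc k}. c j * g j x) = c (Suc k) * e x + (\<Sum>j\<in>{2..k}. c j * h' j x)" for c x
  proof -
    have "{2..Suc k} = insert (Suc k) {2..k}" using step by auto
    then show ?thesis by (simp add: g_def)
  qed
  show ?case
  proof (intro exI[of _ g] conjI allI ballI impI)
    show "F (Suc k) x = (\<Sum>j\<in>{2..Suc k}. g j x)" for x
      using sg[of "\<lambda>_. 1" x] by (simp add: e_def S_def)
    show "AG F l (g j) (\<lambda>x. l j * g j x)" if "j \<in> {2..Suc k}" for j
      using that e AG'[of j] by (cases "j = Suc k") (auto simp: g_def)
    show "?L * (F (Suc k) x - F (Suc k - 1) x) = (\<Sum>j\<in>{2..Suc k}. l j * g j x)" for x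
    proof -
      have "?L * F k x = ?L * S x - S' x" unfolding Fk using L by (simp add: right_diff_distrib)
      then show ?thesis
        unfolding sg S'_def[symmetric] e_def by (simp add: right_diff_distrib)
    qed
  qed
qed

text \<open>The hypothesis \<open>sym\<close> makes the operator symmetric in L^2, so components
  with different eigenvalues are orthogonal. Both integrals become sums of squares, weighted by
  \<open>l 2\<close> on the left and by the respective eigenvalues on the right.\<close>

lemma eigen_energy:
  fixes F :: "nat \<Rightarrow> real^'n \<Rightarrow> real"
  assumes F1: "\<And>x. F 1 x = 0" and l: "\<And>i j. 1 \<le> i \<Longrightarrow> i < j \<Longrightarrow> l i < l j" "\<And>i. 1 \<le> i \<Longrightarrow> l i > (0::real)"
    and b: "\<And>k. sbdd (F k)"
    and sym: "\<And>a b. (\<integral>x. F (Suc b) x * (l (Suc a) * (F (Suc a) x - F a x)) \<partial>sphere_meas)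
        = (\<integral>x. F (Suc a) x * (l (Suc b) * (F (Suc b) x - F b x)) \<partial>sphere_meas)"
    and k: "k \<ge> 2"
  shows "l 2 * (\<integral>x. (F k x)\<^sup>2 \<partial>sphere_meas) \<le> (\<integral>x. F k x * (l k * (F k x - F (k - 1) x)) \<partial>sphere_meas)"
proof -
  have bd: "sbdd h \<and> sbdd g" if "AG F l h g" for h g
    using that by induction (auto intro!: sbdd_cmult sbdd_diff sbdd_add b)
  have s1: "(\<integral>x. g x * F (Suc b) x \<partial>sphere_meas) = (\<integral>x. h x * (l (Suc b) * (F (Suc b) x - F b x)) \<partial>sphere_meas)"
    if "AG F l h g" for h g b
    using that
  proof induction
    case (base a)
    then show ?case using sym[of b a] by (simp add: mult.commute)
  next
    case (scale h g c)
    then show ?case by (simp add: mult.assoc)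
  next
    case (add h g h' g')
    have i: "integrable sphere_meas (\<lambda>x. p x * F (Suc b) x)" "integrable sphere_meas (\<lambda>x. p x * (l (Suc b) * (F (Suc b) x - F b x)))"
      if "sbdd p" for p
      by (intro sbdd_integrable sbdd_mult sbdd_cmult sbdd_diff that assms(4))+
    show ?case unfolding distrib_right
      using add i bd[OF add(1)] bd[OF add(2)] by simp
  qed
  have s2: "(\<integral>x. g x * h' x \<partial>sphere_meas) = (\<integral>x. h x * g' x \<partial>sphere_meas)" if "AG F l h' g'" "AG F l h g" for h g h' g'
    using that(1)
  proof induction
    case (base a)
    show ?case by (rule s1[OF that(2)])
  next
    case (scale h' g' c)
    then show ?case by (simp add: mult.left_commute)
  next
    case (add h1 g1 h2 g2)
    show ?case unfolding distrib_left
      using add bd[OF add(1)] bd[OF add(2)] bd[OF that(2)] by (simp add: sbdd_integrable sbdd_mult)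
  qed
  from eigen_decomposition[of F l k] F1 l k obtain h where
    h: "\<And>x. F k x = (\<Sum>j\<in>{2..k}. h j x)" "\<And>j. j \<in> {2..k} \<Longrightarrow> AG F l (h j) (\<lambda>x. l j * h j x)"
       "\<And>x. l k * (F k x - F (k - 1) x) = (\<Sum>j\<in>{2..k}. l j * h j x)" by auto
  have hb: "sbdd (h j)" if "j \<in> {2..k}" for j using bd[OF h(2)[OF that]] by simp
  have orth: "(\<integral>x. h i x * h j x \<partial>sphere_meas) = 0" if "i \<in> {2..k}" "j \<in> {2..k}" "i \<noteq> j" for i j
  proof -
    have "l i * (\<integral>x. h i x * h j x \<partial>sphere_meas) = l j * (\<integral>x. h i x * h j x \<partial>sphere_meas)"
      using s2[OF h(2)[OF that(2)] h(2)[OF that(1)]] by (simp add: mult.assoc mult.left_commute)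
    moreover have "l i \<noteq> l j" using l(1)[of i j] l(1)[of j i] that by (cases "i < j") auto
    ultimately show ?thesis by simp
  qed
  have exp: "(\<integral>x. F k x * (\<Sum>j\<in>{2..k}. c j * h j x) \<partial>sphere_meas) = (\<Sum>j\<in>{2..k}. c j * (\<integral>x. (h j x)\<^sup>2 \<partial>sphere_meas))" for c
  proof -
    have "(\<integral>x. F k x * (\<Sum>j\<in>{2..k}. c j * h j x) \<partial>sphere_meas) = (\<integral>x. (\<Sum>j\<in>{2..k}. \<Sum>i\<in>{2..k}. c j * (h i x * h j x)) \<partial>sphere_meas)"
      unfolding h(1) by (rule Bochner_Integration.integral_cong) (auto simp: sum_distrib_left sum_distrib_right mult_ac)
    also have "\<dots> = (\<Sum>j\<in>{2..k}. \<Sum>i\<in>{2..k}. c j * (\<integral>x. h i x * h j x \<partial>sphere_meas))"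
    proof -
      have ij: "integrable sphere_meas (\<lambda>x. c j * (h i x * h j x))" if "i \<in> {2..k}" "j \<in> {2..k}" for i j
        by (intro sbdd_integrable sbdd_cmult sbdd_mult hb that)
      show ?thesis
        by (subst Bochner_Integration.integral_sum, intro Bochner_Integration.integrable_sum ij, simp, simp,
            rule sum.cong[OF refl], subst Bochner_Integration.integral_sum, rule ij, simp, simp, simp)
    qed
    also have "\<dots> = (\<Sum>j\<in>{2..k}. c j * (\<integral>x. (h j x)\<^sup>2 \<partial>sphere_meas))"
    proof (rule sum.cong[OF refl])
      fix j assume j: "j \<in> {2..k}"
      have "(\<Sum>i\<in>{2..k}. c j * (\<integral>x. h i x * h j x \<partial>sphere_meas)) = (\<Sum>i\<in>{2..k}. if i = j then c j * (\<integral>x. (h j x)\<^sup>2 \<partial>sphere_meas) else 0)"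
      proof (rule sum.cong[OF refl])
        fix i assume "i \<in> {2..k}"
        then show "c j * (\<integral>x. h i x * h j x \<partial>sphere_meas) = (if i = j then c j * (\<integral>x. (h j x)\<^sup>2 \<partial>sphere_meas) else 0)"
          using orth[OF _ j, of i] by (cases "i = j") (simp_all add: power2_eq_square)
      qed
      then show "(\<Sum>i\<in>{2..k}. c j * (\<integral>x. h i x * h j x \<partial>sphere_meas)) = c j * (\<integral>x. (h j x)\<^sup>2 \<partial>sphere_meas)"
        using j by simp
    qed
    finally show ?thesis .
  qed
  have "l 2 * (\<integral>x. (F k x)\<^sup>2 \<partial>sphere_meas) = (\<Sum>j\<in>{2..k}. l 2 * (\<integral>x. (h j x)\<^sup>2 \<partial>sphere_meas))"
    using exp[of "\<lambda>_. 1"] by (simp add: h(1)[symmetric] power2_eq_square[of "F k _"] sum_distrib_left)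
  also have "\<dots> \<le> (\<Sum>j\<in>{2..k}. l j * (\<integral>x. (h j x)\<^sup>2 \<partial>sphere_meas))"
  proof (intro sum_mono mult_right_mono)
    show "l 2 \<le> l j" if "j \<in> {2..k}" for j using l(1)[of 2 j] that by (cases "j = 2") auto
  qed simp
  also have "\<dots> = (\<integral>x. F k x * (l k * (F k x - F (k - 1) x)) \<partial>sphere_meas)"
    unfolding h(3) exp ..
  finally show ?thesis .
qed

text \<open>The kernel of index 1 is 1 + x \<bullet> z, so orthogonality to the constant and linear
  functions says that the average of index 1 vanishes. The expansion of every later average then
  starts at the second eigenvalue, which is 2 n. Averaging does not increase the energy, so the
  inequality passes to the limit.\<close>

proposition poincare_gap:
  fixes f :: "real^'n \<Rightarrow> real"
  assumes n: "CARD('n) \<ge> 2" and w: "wgrad f h" and tan: "\<And>x. norm x = 1 \<Longrightarrow> h x \<bullet> x = 0"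
    and int: "integrable sphere_meas (\<lambda>x. (norm (h x))\<^sup>2)" and bd: "sbdd f"
    and o0: "(\<integral>x. f x \<partial>sphere_meas) = 0" and o1: "\<And>z. (\<integral>x. f x * (x \<bullet> z) \<partial>sphere_meas) = 0"
  shows "2 * real CARD('n) * (\<integral>x. (f x)\<^sup>2 \<partial>sphere_meas) \<le> (\<integral>x. (norm (h x))\<^sup>2 \<partial>sphere_meas)"
proof -
  let ?d = "dm TYPE('n)" and ?F = "Tk f"
  have d: "?d > 0" using n by simp
  have f: "integrable sphere_meas f" and [measurable]: "f \<in> borel_measurable borel" using w by (auto simp: wgrad_def)
  have F1: "?F 1 z = 0" for z
  proof -
    have "?F 1 z = (\<integral>y. f y + f y * (y \<bullet> z) \<partial>sphere_meas)"
      using d by (simp add: Tk_def kern_def distrib_left)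
    also have "\<dots> = 0"
    proof -
      have "integrable sphere_meas (\<lambda>y. f y * (y \<bullet> z))"
        by (rule integrable_sphere_mult_continuous[OF f]) (intro continuous_intros)
      then show ?thesis using o0 o1[of z] f by simp
    qed
    finally show ?thesis .
  qed
  have lmono: "lam ?d i < lam ?d j" if "1 \<le> i" "i < j" for i j
    unfolding lam_def using that d by (intro mult_strict_mono) auto
  have lpos: "lam ?d i > 0" if "1 \<le> i" for i unfolding lam_def using that d by (intro mult_pos_pos) auto
  have gap: "2 * real CARD('n) * (\<integral>x. (?F k x)\<^sup>2 \<partial>sphere_meas) \<le> (\<integral>x. (norm (h x))\<^sup>2 \<partial>sphere_meas)" if k: "k \<ge> 2" for k
  proof -
    have "lam ?d 2 * (\<integral>x. (?F k x)\<^sup>2 \<partial>sphere_meas) \<le> (\<integral>x. ?F k x * (lam ?d k * (?F k x - ?F (k - 1) x)) \<partial>sphere_meas)"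
    proof (rule eigen_energy[where F="?F" and l="lam ?d" and k=k, OF F1 lmono lpos _ _ k])
      show "sbdd (?F k)" for k by (rule sbdd_Tk[OF n f])
      show "(\<integral>x. ?F (Suc b) x * (lam ?d (Suc a) * (?F (Suc a) x - ?F a x)) \<partial>sphere_meas)
        = (\<integral>x. ?F (Suc a) x * (lam ?d (Suc b) * (?F (Suc b) x - ?F b x)) \<partial>sphere_meas)" for a b
        unfolding gTk_energy[OF n f, symmetric] by (simp add: inner_commute)
    qed
    also have "\<dots> = (\<integral>x. gTk f k x \<bullet> gTk f k x \<partial>sphere_meas)"
      using gTk_energy[OF n f, of "k - 1" k] k by simp
    also have "\<dots> \<le> (\<integral>x. (norm (h x))\<^sup>2 \<partial>sphere_meas)" by (rule gTk_contraction[OF n w tan int])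
    also have "lam ?d 2 = 2 * real CARD('n)" by (simp add: lam_def)
    finally show ?thesis .
  qed
  obtain C where C: "\<And>x. norm x = 1 \<Longrightarrow> \<bar>f x\<bar> \<le> C" using bd by (rule sbddE) blast
  have FC: "\<bar>?F k x\<bar> \<le> C" if "norm x = 1" for k x
  proof -
    have "\<bar>?F k x\<bar> \<le> Tk (\<lambda>x. \<bar>f x\<bar>) k x" by (rule Tk_abs_le[OF n f that])
    also have "\<dots> \<le> Tk (\<lambda>_. C) k x" by (rule Tk_mono[OF n _ _ C that]) (use f in auto)
    finally show ?thesis by (simp add: Tk_const[OF n that])
  qed
  note Fi = Tk_integrable_sphere[OF n f]
  have f2: "integrable sphere_meas (\<lambda>x. (f x)\<^sup>2)" "integrable sphere_meas (\<lambda>x. (?F k x)\<^sup>2)" for k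
    unfolding power2_eq_square by (intro sbdd_integrable sbdd_mult bd sbdd_Tk[OF n f])+
  \<comment> \<open>The averages converge only in L^1; the common bound \<open>C\<close> of
    \<open>f\<close> and all its averages upgrades this to convergence of the L^2 norms.\<close>
  have "(\<lambda>k. \<integral>x. (?F k x)\<^sup>2 \<partial>sphere_meas) \<longlonglongrightarrow> (\<integral>x. (f x)\<^sup>2 \<partial>sphere_meas)"
  proof (rule LIM_zero_cancel, rule Lim_null_comparison)
    show "(\<lambda>k. 2 * C * (\<integral>x. \<bar>?F k x - f x\<bar> \<partial>sphere_meas)) \<longlonglongrightarrow> 0"
      using tendsto_mult_right_zero[OF Tk_L1_convergence[OF n f]] .
    have "\<bar>(\<integral>x. (?F k x)\<^sup>2 \<partial>sphere_meas) - (\<integral>x. (f x)\<^sup>2 \<partial>sphere_meas)\<bar> \<le> 2 * C * (\<integral>x. \<bar>?F k x - f x\<bar> \<partial>sphere_meas)" for k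
    proof -
      have "\<bar>(\<integral>x. (?F k x)\<^sup>2 \<partial>sphere_meas) - (\<integral>x. (f x)\<^sup>2 \<partial>sphere_meas)\<bar> = \<bar>\<integral>x. (?F k x)\<^sup>2 - (f x)\<^sup>2 \<partial>sphere_meas\<bar>"
        using f2 by simp
      also have "\<dots> \<le> (\<integral>x. \<bar>(?F k x)\<^sup>2 - (f x)\<^sup>2\<bar> \<partial>sphere_meas)" by (rule integral_abs_bound)
      also have "\<dots> \<le> (\<integral>x. 2 * C * \<bar>?F k x - f x\<bar> \<partial>sphere_meas)"
      proof (rule sphere_integral_mono)
        fix x :: "real^'n" assume x: "norm x = 1"
        have "(?F k x)\<^sup>2 - (f x)\<^sup>2 = (?F k x + f x) * (?F k x - f x)" by (simp add: power2_eq_square algebra_simps)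
        moreover have "\<bar>?F k x + f x\<bar> \<le> 2 * C" using C[OF x] FC[OF x, of k] by linarith
        ultimately show "\<bar>(?F k x)\<^sup>2 - (f x)\<^sup>2\<bar> \<le> 2 * C * \<bar>?F k x - f x\<bar>"
          by (simp only: abs_mult) (intro mult_right_mono, auto)
      qed (use f2 Fi f in auto)
      finally show ?thesis by simp
    qed
    then show "\<forall>\<^sub>F k in sequentially. norm ((\<integral>x. (?F k x)\<^sup>2 \<partial>sphere_meas) - (\<integral>x. (f x)\<^sup>2 \<partial>sphere_meas)) \<le> 2 * C * (\<integral>x. \<bar>?F k x - f x\<bar> \<partial>sphere_meas)"
      by simp
  qed
  then have "(\<lambda>k. 2 * real CARD('n) * (\<integral>x. (?F k x)\<^sup>2 \<partial>sphere_meas)) \<longlonglongrightarrow> 2 * real CARD('n) * (\<integral>x. (f x)\<^sup>2 \<partial>sphere_meas)"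
    by (intro tendsto_intros)
  then show ?thesis by (rule LIMSEQ_le_const2) (use gap in blast)
qed

section \<open>Null Lagrangians\<close>

text \<open>The determinant as a function of its family of rows, so that replacing a row is a
  function update.\<close>

definition rdet :: "('n::finite \<Rightarrow> real^'n) \<Rightarrow> real" where
  "rdet r = det (\<chi> m. r m)"

lemma rdet_add: "rdet (r(i := u + v)) = rdet (r(i := u)) + rdet (r(i := v))"
  using det_row_add[of i "\<lambda>_. u" "\<lambda>_. v" r] by (simp add: rdet_def fun_upd_def)

lemma rdet_scale: "rdet (r(i := c *\<^sub>R u)) = c * rdet (r(i := u))"
  using det_row_mul[of i c "\<lambda>_. u" r] unfolding rdet_def fun_upd_def scalar_mult_eq_scaleR .

lemma rdet_eq_rows: "i \<noteq> j \<Longrightarrow> r i = r j \<Longrightarrow> rdet r = 0"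
  unfolding rdet_def by (rule det_identical_rows[of i j]) (simp_all add: row_def)

lemma rdet_linear: "linear (\<lambda>v. rdet (r(i := v)))"
  by (rule linearI) (simp_all add: rdet_add rdet_scale)

text \<open>The cofactors along row \<open>i\<close>: the vector that represents the determinant as
  a linear function of this row.\<close>

definition rcof :: "('n::finite \<Rightarrow> real^'n) \<Rightarrow> 'n \<Rightarrow> real^'n" where
  "rcof r i = (\<chi> j. rdet (r(i := axis j 1)))"

lemma rdet_rcof: "rdet (r(i := v)) = v \<bullet> rcof r i"
proof -
  interpret L: linear "\<lambda>v. rdet (r(i := v))" by (rule rdet_linear)
  have "v = (\<Sum>j\<in>UNIV. (v $ j) *\<^sub>R axis j 1)"
    using basis_expansion[of v] by (simp add: scalar_mult_eq_scaleR)
  then have "rdet (r(i := v)) = rdet (r(i := \<Sum>j\<in>UNIV. (v $ j) *\<^sub>R axis j 1))" by simp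
  also have "\<dots> = v \<bullet> rcof r i"
    unfolding L.sum L.scale by (simp add: rcof_def inner_vec_def)
  finally show ?thesis .
qed

lemma rdet_scale_rows: "rdet (\<lambda>m. c m *\<^sub>R r m) = (\<Prod>m\<in>UNIV. c m) * rdet r"
  unfolding rdet_def using det_rows_mul[of c r] by (simp add: scalar_mult_eq_scaleR)

lemma rdet_add_multiples:
  fixes v :: "'n::finite \<Rightarrow> real^'n"
  shows "rdet ((\<lambda>m. v m + c m *\<^sub>R x)(i := x)) = rdet (v(i := x))"
proof -
  define R where "R S = (\<lambda>m. if m \<in> S then v m + c m *\<^sub>R x else v m)(i := x)" for S
  have "rdet (R S) = rdet (v(i := x))" if "finite S" "i \<notin> S" for S
    using that
  proof (induction S rule: finite_induct)
    case empty
    then show ?case by (simp add: R_def)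
  next
    case (insert l S)
    then have li: "l \<noteq> i" by auto
    have "R (insert l S) = (R S)(l := R S l + c l *\<^sub>R x)"
      using insert(2) li by (auto simp: R_def fun_eq_iff)
    then have "rdet (R (insert l S)) = rdet ((R S)(l := R S l)) + c l * rdet ((R S)(l := x))"
      by (simp only: rdet_add rdet_scale)
    moreover have "rdet ((R S)(l := x)) = 0"
      by (rule rdet_eq_rows[OF li]) (use li in \<open>simp add: R_def\<close>)
    ultimately show ?case using insert by simp
  qed
  from this[of "- {i}"] have "rdet (R (- {i})) = rdet (v(i := x))" by simp
  moreover have "R (- {i}) = (\<lambda>m. v m + c m *\<^sub>R x)(i := x)" by (auto simp: R_def fun_eq_iff)
  ultimately show ?thesis by simp
qed

text \<open>Products of ridge functions: the determinant is the derivative of such a product along the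
  rotation field \<open>B\<close>, which is orthogonal to all the directions \<open>y m\<close> but one.\<close>

lemma null_lagrangian_ridge:
  fixes y :: "'n::finite \<Rightarrow> real^'n"
  assumes n: "CARD('n) \<ge> 2"
  shows "(\<integral>x. rdet ((\<lambda>m. kern' d k (y m \<bullet> x) *\<^sub>R y m)(i := x)) \<partial>sphere_meas) = 0"
proof -
  obtain l where l: "l \<noteq> i"
  proof (rule ccontr)
    assume no: "\<not> thesis"
    have "l = i" for l using that[of l] no by blast
    then have "UNIV = {i}" by blast
    then have "CARD('n) = card {i}" by simp
    then show False using n by simp
  qed
  define I where "I = UNIV - {i}"
  \<comment> \<open>The product \<open>v \<bullet> B x\<close> is the determinant with
    \<open>x\<close> in row \<open>i\<close> and \<open>v\<close> in row \<open>l\<close>. It is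
    linear in \<open>x\<close> and vanishes for \<open>v = x\<close>, which makes \<open>B\<close> a
    rotation field.\<close>
  define B where "B x = rcof (y(i := x)) l" for x
  have Bv: "v \<bullet> B x = rdet ((y(i := x))(l := v))" for v x by (simp add: B_def rdet_rcof)
  have B1: "linear B"
  proof (rule linearI)
    show "B (a + b) = B a + B b" for a b
      unfolding vec_eq_iff using l
      by (simp add: B_def rcof_def fun_upd_twist[of i l] rdet_add)
    show "B (c *\<^sub>R a) = c *\<^sub>R B a" for c a
      unfolding vec_eq_iff using l
      by (simp add: B_def rcof_def fun_upd_twist[of i l] rdet_scale)
  qed
  have B2: "x \<bullet> B x = 0" for x
    unfolding Bv by (rule rdet_eq_rows[OF l]) (use l in simp)
  have B3: "y m \<bullet> B x = 0" if "m \<noteq> i" "m \<noteq> l" for m x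
    unfolding Bv by (rule rdet_eq_rows[of l m]) (use that in auto)
  have B4: "y l \<bullet> B x = rdet (y(i := x))" for x
  proof -
    have "(y(i := x))(l := y l) = y(i := x)" using l by auto
    then show ?thesis unfolding Bv by simp
  qed
  \<comment> \<open>Along \<open>B\<close> only the factor of index \<open>l\<close> varies. It is
    therefore the antiderivative \<open>kern\<close>, whose derivative supplies the missing
    \<open>kern'\<close>; the other factors carry \<open>kern'\<close> from the start.\<close>
  define \<eta> where "\<eta> m = (if m = l then kern d k else kern' d k)" for m :: 'n
  define \<eta>' where "\<eta>' m = (if m = l then kern' d k else kern'' d k)" for m :: 'n
  have \<eta>: "(\<eta> m has_real_derivative \<eta>' m s) (at s)" "continuous_on UNIV (\<eta> m)" "continuous_on UNIV (\<eta>' m)" for m s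
    by (auto simp: \<eta>_def \<eta>'_def intro: kern_derivs)
  define q where "q x = (\<Prod>m\<in>I. \<eta> m (y m \<bullet> x))" for x
  define q' where "q' x v = (\<Sum>m\<in>I. \<eta>' m (y m \<bullet> x) * (y m \<bullet> v) * (\<Prod>j\<in>I - {m}. \<eta> j (y j \<bullet> x)))" for x v
  have q: "C1_map q q'"
    unfolding C1_map_def
  proof (intro conjI allI)
    show "(q has_derivative q' x) (at x)" for x
      unfolding q_def[abs_def] q'_def[abs_def]
      by (rule has_derivative_prod) (use ridge_C1[OF \<eta>(1,3)] in \<open>auto simp: C1_map_def\<close>)
    have "continuous_on UNIV (\<lambda>x. \<eta> m (y m \<bullet> x))" "continuous_on UNIV (\<lambda>x. \<eta>' m (y m \<bullet> x))" for m
      by (rule continuous_on_compose2[OF \<eta>(2)], auto intro!: continuous_intros)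
         (rule continuous_on_compose2[OF \<eta>(3)], auto intro!: continuous_intros)
    then show "continuous_on UNIV (\<lambda>x. q' x v)" for v
      unfolding q'_def by (intro continuous_intros)
  qed
  have "(\<integral>x. (0 \<bullet> B x) * q x \<partial>sphere_meas) = - (\<integral>x. 1 * q' x (B x) \<partial>sphere_meas)"
    by (rule wgrad_rotation[OF wgrad_const q B1 B2])
  then have 0: "(\<integral>x. q' x (B x) \<partial>sphere_meas) = 0" by simp
  have "q' x (B x) = rdet ((\<lambda>m. kern' d k (y m \<bullet> x) *\<^sub>R y m)(i := x))" for x
  proof -
    have lI: "l \<in> I" "finite I" using l by (auto simp: I_def)
    have "q' x (B x) = (\<Sum>m\<in>I. if m = l then kern' d k (y l \<bullet> x) * rdet (y(i := x)) * (\<Prod>j\<in>I - {l}. kern' d k (y j \<bullet> x)) else 0)"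
      unfolding q'_def
    proof (rule sum.cong[OF refl])
      fix m assume m: "m \<in> I"
      have "(\<Prod>j\<in>I - {l}. \<eta> j (y j \<bullet> x)) = (\<Prod>j\<in>I - {l}. kern' d k (y j \<bullet> x))"
        by (rule prod.cong) (auto simp: \<eta>_def)
      then show "\<eta>' m (y m \<bullet> x) * (y m \<bullet> B x) * (\<Prod>j\<in>I - {m}. \<eta> j (y j \<bullet> x))
         = (if m = l then kern' d k (y l \<bullet> x) * rdet (y(i := x)) * (\<Prod>j\<in>I - {l}. kern' d k (y j \<bullet> x)) else 0)"
        using B3[of m x] B4[of x] m by (auto simp: \<eta>'_def I_def)
    qed
    also have "\<dots> = rdet (y(i := x)) * (\<Prod>j\<in>I. kern' d k (y j \<bullet> x))"
      using lI by (simp add: prod.remove[OF lI(2,1)])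
    also have "\<dots> = rdet ((\<lambda>m. kern' d k (y m \<bullet> x) *\<^sub>R y m)(i := x))"
    proof -
      define c where "c m = (if m = i then 1 else kern' d k (y m \<bullet> x))" for m
      have "(\<lambda>m. kern' d k (y m \<bullet> x) *\<^sub>R y m)(i := x) = (\<lambda>m. c m *\<^sub>R (y(i := x)) m)"
        by (auto simp: c_def fun_eq_iff)
      then have "rdet ((\<lambda>m. kern' d k (y m \<bullet> x) *\<^sub>R y m)(i := x)) = (\<Prod>m\<in>UNIV. c m) * rdet (y(i := x))"
        by (simp only: rdet_scale_rows)
      moreover have "(\<Prod>m\<in>UNIV. c m) = c i * (\<Prod>m\<in>I. c m)"
        unfolding I_def by (rule prod.remove) auto
      moreover have "(\<Prod>m\<in>I. c m) = (\<Prod>j\<in>I. kern' d k (y j \<bullet> x))"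
        by (rule prod.cong) (auto simp: c_def I_def)
      ultimately show ?thesis by (simp add: c_def)
    qed
    finally show ?thesis .
  qed
  then show ?thesis using 0 by simp
qed

text \<open>Differs from \<open>gTk f k z\<close> by a multiple of \<open>z\<close>, which a determinant with \<open>z\<close> as one of its rows does not see.\<close>

definition raw_grad :: "(real^'n \<Rightarrow> real) \<Rightarrow> nat \<Rightarrow> real^'n \<Rightarrow> real^'n" where
  "raw_grad f k z = (\<chi> j. \<integral>y. f y * (kern' (dm TYPE('n)) k (y \<bullet> z) * y $ j) \<partial>sphere_meas)"

lemma raw_grad_component_sbdd:
  fixes f :: "real^'n \<Rightarrow> real"
  assumes n: "CARD('n) \<ge> 2" and f: "integrable sphere_meas f"
  shows "sbdd (\<lambda>z. raw_grad f k z $ j)"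
  unfolding raw_grad_def vec_lambda_beta
proof (rule sbdd_inner_integral[OF f])
  show "\<bar>kern' (dm TYPE('n)) k (x \<bullet> y) * x $ j\<bar> \<le> kcoef (dm TYPE('n)) k * (k * 2 ^ (k - 1)) * 1" if "norm x = 1" "norm y = 1" for x y :: "real^'n"
    unfolding abs_mult using kern'_unit_bound[OF n that, of k] component_le_norm_cart[of x j] that
    by (intro mult_mono) auto
qed measurable

lemma gTk_raw_grad:
  fixes f :: "real^'n \<Rightarrow> real"
  assumes f: "integrable sphere_meas f"
  shows "gTk f k x = raw_grad f k x + (- (\<integral>y. f y * (kern' (dm TYPE('n)) k (y \<bullet> x) * (y \<bullet> x)) \<partial>sphere_meas)) *\<^sub>R x"
proof -
  let ?d = "dm TYPE('n)"
  have kc: "continuous_on UNIV (\<lambda>y. kern' ?d k (y \<bullet> x))"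
    by (rule continuous_on_compose2[OF kern_derivs(4)[of UNIV]]) (auto intro!: continuous_intros)
  have i1: "integrable sphere_meas (\<lambda>y. f y * (kern' ?d k (y \<bullet> x) * y $ j))" for j
    by (rule integrable_sphere_mult_continuous[OF f]) (intro continuous_intros kc)
  have i2: "integrable sphere_meas (\<lambda>y. f y * (kern' ?d k (y \<bullet> x) * (y \<bullet> x)) * x $ j)" for j
    by (rule integrable_mult_left, rule integrable_sphere_mult_continuous[OF f]) (intro continuous_intros kc)
  have "f y * (kern' ?d k (y \<bullet> x) * (y $ j - (y \<bullet> x) * x $ j)) = f y * (kern' ?d k (y \<bullet> x) * y $ j) - f y * (kern' ?d k (y \<bullet> x) * (y \<bullet> x)) * x $ j" for y j
    by (simp add: algebra_simps)
  note e = this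
  show ?thesis
    unfolding vec_eq_iff gTk_def raw_grad_def vec_lambda_beta e
    using i1 i2 by simp
qed

lemma sbdd_prod: "(\<And>i. i \<in> I \<Longrightarrow> sbdd (F i)) \<Longrightarrow> sbdd (\<lambda>x. \<Prod>i\<in>I. F i x)"
  by (induction I rule: infinite_finite_induct) (auto intro: sbdd_const sbdd_mult)

lemma sbdd_rdet:
  assumes "\<And>m j. sbdd (\<lambda>x. r x m $ j)"
  shows "sbdd (\<lambda>x. rdet (r x))"
  unfolding rdet_def det_def vec_lambda_beta by (intro sbdd_sum sbdd_cmult sbdd_prod assms)

text \<open>A row \<open>raw_grad\<close> is a superposition of ridge gradients over the direction,
  and the determinant is linear in each row. By Fubini's theorem the rows in \<open>J\<close> are
  turned one at a time into ridge rows; the direction becomes the integration variable, so the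
  induction runs over all \<open>y\<close>.\<close>

lemma null_lagrangian_raw:
  fixes f :: "'n::finite \<Rightarrow> real^'n \<Rightarrow> real"
  assumes n: "CARD('n) \<ge> 2" and f: "\<And>m. integrable sphere_meas (f m)"
  shows "(\<integral>x. rdet ((\<lambda>m. if m \<in> J then raw_grad (f m) k x else kern' (dm TYPE('n)) k (y m \<bullet> x) *\<^sub>R y m)(i := x)) \<partial>sphere_meas) = 0"
proof -
  let ?d = "dm TYPE('n)"
  have "finite J" by simp
  then show ?thesis
  proof (induction J arbitrary: y rule: finite_induct)
    case empty
    show ?case using null_lagrangian_ridge[OF n, of ?d k y i] by (simp only: empty_iff if_False)
  next
    case (insert l J)
    show ?case
    proof (cases "l = i")
      case True
      have "(\<lambda>m. if m \<in> insert l J then raw_grad (f m) k x else kern' ?d k (y m \<bullet> x) *\<^sub>R y m)(i := x)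
        = (\<lambda>m. if m \<in> J then raw_grad (f m) k x else kern' ?d k (y m \<bullet> x) *\<^sub>R y m)(i := x)" for x
        using True by (auto simp: fun_eq_iff)
      then show ?thesis using insert.IH[of y] by simp
    next
      case False
      define R where "R x = (\<lambda>m. if m \<in> J then raw_grad (f m) k x else kern' ?d k (y m \<bullet> x) *\<^sub>R y m)(i := x)" for x
      define c where "c x = rcof (R x) l" for x
      have Rb: "sbdd (\<lambda>x. R x m $ j)" for m j
      proof -
        have "continuous_on UNIV (\<lambda>x. kern' ?d k (y m \<bullet> x))"
          by (rule continuous_on_compose2[OF kern_derivs(4)[of UNIV]]) (auto intro!: continuous_intros)
        then have 1: "sbdd (\<lambda>x. kern' ?d k (y m \<bullet> x) * y m $ j)" by (intro sbdd_continuous continuous_intros)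
        have 2: "sbdd (\<lambda>x::real^'n. x $ j)" by (intro sbdd_continuous continuous_intros)
        show ?thesis unfolding R_def
          using 1 2 raw_grad_component_sbdd[OF n f[of m], of k j] by (cases "m = i"; cases "m \<in> J") auto
      qed
      have cb: "sbdd (\<lambda>x. c x $ j)" for j
        unfolding c_def rcof_def vec_lambda_beta
      proof (rule sbdd_rdet)
        show "sbdd (\<lambda>x. ((R x)(l := axis j 1)) m $ j')" for m j'
          using Rb[of m j'] sbdd_const by (cases "m = l") auto
      qed
      have cm: "c \<in> borel_measurable borel"
      proof -
        have "(\<lambda>z. c z \<bullet> axis i 1) \<in> borel_measurable borel" for i
          using cb[of i] unfolding sbdd_def inner_axis by simp
        then show ?thesis
          by (intro borel_measurable_euclidean_space[THEN iffD2]) (auto simp: Basis_vec_def)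
      qed
      have "sbdd (\<lambda>x. \<Sum>j\<in>UNIV. \<bar>c x $ j\<bar>)"
      proof (rule sbdd_sum)
        fix j
        obtain C where "(\<lambda>x. c x $ j) \<in> borel_measurable borel" "\<And>x. norm x = 1 \<Longrightarrow> \<bar>c x $ j\<bar> \<le> C" using cb[of j] by (rule sbddE) blast
        then show "sbdd (\<lambda>x. \<bar>c x $ j\<bar>)" by (intro sbddI[of _ C]) auto
      qed
      then obtain C where C': "\<And>x. norm x = 1 \<Longrightarrow> \<bar>\<Sum>j\<in>UNIV. \<bar>c x $ j\<bar>\<bar> \<le> C" by (rule sbddE) blast
      have C: "norm (c x) \<le> C" if "norm x = 1" for x using C'[OF that] norm_le_l1_cart[of "c x"] by linarith
      define k0 where "k0 y x = kern' ?d k (y \<bullet> x) * (y \<bullet> c x)" for y x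
      have k0m: "case_prod k0 \<in> borel_measurable (borel \<Otimes>\<^sub>M borel)" unfolding k0_def using cm by measurable
      have k0b: "\<bar>k0 y x\<bar> \<le> kcoef ?d k * (k * 2 ^ (k - 1)) * C" if "norm y = 1" "norm x = 1" for y x
        unfolding k0_def abs_mult
        using kern'_unit_bound[OF n that, of k] Cauchy_Schwarz_ineq2[of y "c x"] C[OF that(2)] that
        by (intro mult_mono) auto
      have "rdet ((\<lambda>m. if m \<in> insert l J then raw_grad (f m) k x else kern' ?d k (y m \<bullet> x) *\<^sub>R y m)(i := x))
          = 1 * (\<integral>z. f l z * k0 z x \<partial>sphere_meas)" for x
      proof -
        have "(\<lambda>m. if m \<in> insert l J then raw_grad (f m) k x else kern' ?d k (y m \<bullet> x) *\<^sub>R y m)(i := x) = (R x)(l := raw_grad (f l) k x)"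
          using False by (auto simp: R_def fun_eq_iff)
        then have "rdet ((\<lambda>m. if m \<in> insert l J then raw_grad (f m) k x else kern' ?d k (y m \<bullet> x) *\<^sub>R y m)(i := x)) = raw_grad (f l) k x \<bullet> c x"
          by (simp only: rdet_rcof c_def)
        also have "\<dots> = (\<Sum>j\<in>UNIV. \<integral>z. f l z * (kern' ?d k (z \<bullet> x) * z $ j) * c x $ j \<partial>sphere_meas)"
          by (simp add: inner_vec_def raw_grad_def)
        also have "\<dots> = (\<integral>z. (\<Sum>j\<in>UNIV. f l z * (kern' ?d k (z \<bullet> x) * z $ j) * c x $ j) \<partial>sphere_meas)"
        proof (rule Bochner_Integration.integral_sum[symmetric])
          fix j
          have "continuous_on UNIV (\<lambda>z. kern' ?d k (z \<bullet> x))"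
            by (rule continuous_on_compose2[OF kern_derivs(4)[of UNIV]]) (auto intro!: continuous_intros)
          then show "integrable sphere_meas (\<lambda>z. f l z * (kern' ?d k (z \<bullet> x) * z $ j) * c x $ j)"
            by (intro integrable_mult_left integrable_sphere_mult_continuous[OF f] continuous_intros)
        qed
        also have "\<dots> = 1 * (\<integral>z. f l z * k0 z x \<partial>sphere_meas)"
          unfolding mult_1
        proof (rule Bochner_Integration.integral_cong[OF refl])
          fix z :: "real^'n"
          have "(\<Sum>j\<in>UNIV. f l z * (kern' ?d k (z \<bullet> x) * z $ j) * c x $ j) = f l z * kern' ?d k (z \<bullet> x) * (\<Sum>j\<in>UNIV. z $ j * c x $ j)"
            by (simp add: sum_distrib_left mult_ac)
          also have "(\<Sum>j\<in>UNIV. z $ j * c x $ j) = z \<bullet> c x" by (simp add: inner_vec_def)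
          finally show "(\<Sum>j\<in>UNIV. f l z * (kern' ?d k (z \<bullet> x) * z $ j) * c x $ j) = f l z * k0 z x"
            by (simp add: k0_def mult.assoc)
        qed
        finally show ?thesis .
      qed
      then have "(\<integral>x. rdet ((\<lambda>m. if m \<in> insert l J then raw_grad (f m) k x else kern' ?d k (y m \<bullet> x) *\<^sub>R y m)(i := x)) \<partial>sphere_meas)
        = (\<integral>x. 1 * (\<integral>z. f l z * k0 z x \<partial>sphere_meas) \<partial>sphere_meas)" by (simp only:)
      also have "\<dots> = (\<integral>z. f l z * (\<integral>x. 1 * k0 z x \<partial>sphere_meas) \<partial>sphere_meas)"
        by (rule sphere_swap(1)[OF f _ k0m k0b]) auto
      also have "\<dots> = 0"
      proof -
      have "(\<integral>x. 1 * k0 z x \<partial>sphere_meas) = 0" for z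
      proof -
        have "1 * k0 z x = rdet ((\<lambda>m. if m \<in> J then raw_grad (f m) k x else kern' ?d k ((y(l := z)) m \<bullet> x) *\<^sub>R (y(l := z)) m)(i := x))" for x
        proof -
          have "1 * k0 z x = rdet ((R x)(l := kern' ?d k (z \<bullet> x) *\<^sub>R z))"
            unfolding rdet_scale rdet_rcof by (simp add: k0_def c_def)
          also have "(R x)(l := kern' ?d k (z \<bullet> x) *\<^sub>R z) = (\<lambda>m. if m \<in> J then raw_grad (f m) k x else kern' ?d k ((y(l := z)) m \<bullet> x) *\<^sub>R (y(l := z)) m)(i := x)"
            using False insert(2) by (auto simp: R_def fun_eq_iff)
          finally show ?thesis .
        qed
        then show ?thesis using insert.IH[of "y(l := z)"] by (simp only:)
      qed
      note z0 = this
      show ?thesis unfolding z0 by simp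
      qed
      finally show ?thesis .
    qed
  qed
qed

lemma null_lagrangian_gTk:
  fixes f :: "'n::finite \<Rightarrow> real^'n \<Rightarrow> real"
  assumes n: "CARD('n) \<ge> 2" and f: "\<And>m. integrable sphere_meas (f m)"
  shows "(\<integral>x. rdet ((\<lambda>m. gTk (f m) k x)(i := x)) \<partial>sphere_meas) = 0"
proof -
  have "rdet ((\<lambda>m. gTk (f m) k x)(i := x)) = rdet ((\<lambda>m. raw_grad (f m) k x)(i := x))" for x
    unfolding gTk_raw_grad[OF f] by (rule rdet_add_multiples)
  then show ?thesis using null_lagrangian_raw[where J=UNIV and k=k and i=i, OF n f] by (simp only: UNIV_I if_True)
qed

section \<open>From averages to weak gradients in the null Lagrangian\<close>

lemma rdet_bound:
  fixes r :: "'n::finite \<Rightarrow> real^'n"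
  shows "\<bar>rdet r\<bar> \<le> fact CARD('n) * (\<Prod>m\<in>UNIV. norm (r m))"
proof -
  let ?P = "{p. p permutes (UNIV :: 'n set)}"
  have "\<bar>rdet r\<bar> \<le> (\<Sum>p\<in>?P. \<bar>of_int (sign p) * (\<Prod>m\<in>UNIV. r m $ p m)\<bar>)"
    unfolding rdet_def det_def vec_lambda_beta by (rule sum_abs)
  also have "\<dots> \<le> (\<Sum>p\<in>?P. \<Prod>m\<in>UNIV. norm (r m))"
  proof (rule sum_mono)
    fix p
    have "\<bar>of_int (sign p) * (\<Prod>m\<in>UNIV. r m $ p m)\<bar> = (\<Prod>m\<in>UNIV. \<bar>r m $ p m\<bar>)"
      by (simp add: abs_mult abs_prod sign_def)
    also have "\<dots> \<le> (\<Prod>m\<in>UNIV. norm (r m))"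
      by (rule prod_mono) (auto simp: component_le_norm_cart)
    finally show "\<bar>of_int (sign p) * (\<Prod>m\<in>UNIV. r m $ p m)\<bar> \<le> (\<Prod>m\<in>UNIV. norm (r m))" .
  qed
  also have "\<dots> = fact CARD('n) * (\<Prod>m\<in>UNIV. norm (r m))"
    by (simp add: card_permutations)
  finally show ?thesis .
qed

lemma rdet_unit_row_bound:
  fixes r :: "'n::finite \<Rightarrow> real^'n"
  assumes x: "norm x = 1" and b: "\<And>m. norm (r m) \<le> b"
  shows "\<bar>rdet (r(i := x))\<bar> \<le> fact CARD('n) * b ^ (CARD('n) - 1)"
proof -
  have "(\<Prod>m\<in>UNIV. norm ((r(i := x)) m)) = norm ((r(i := x)) i) * (\<Prod>m\<in>UNIV - {i}. norm ((r(i := x)) m))"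
    by (rule prod.remove) auto
  also have "\<dots> = (\<Prod>m\<in>UNIV - {i}. norm (r m))" using x by simp
  also have "\<dots> \<le> (\<Prod>m\<in>UNIV - {i}. b)" by (rule prod_mono) (use b in auto)
  also have "\<dots> = b ^ (CARD('n) - 1)" by simp
  finally show ?thesis
    using rdet_bound[of "r(i := x)"] by (meson fact_ge_zero mult_left_mono order_trans)
qed

text \<open>Recovers a tangent vector from its rotation entries, so bounds and limits proved for the
  averages of these entries carry over to \<open>gTk\<close>.\<close>

lemma tangential_rot:
  fixes x v :: "real^'n"
  assumes "norm x = 1" "v \<bullet> x = 0"
  shows "v $ j = (\<Sum>i\<in>UNIV. x $ i * rot i j x v)"
proof -
  have "(\<Sum>i\<in>UNIV. x $ i * rot i j x v) = (\<Sum>i\<in>UNIV. x $ i * x $ i) * v $ j - x $ j * (\<Sum>i\<in>UNIV. v $ i * x $ i)"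
    unfolding rot_def by (simp add: sum_distrib_left sum_distrib_right sum_subtractf algebra_simps)
  also have "\<dots> = v $ j" using assms by (simp add: norm_eq_1 inner_vec_def)
  finally show ?thesis by simp
qed

lemma rot_abs_le:
  fixes x v :: "real^'n"
  assumes "norm x = 1"
  shows "\<bar>rot i j x v\<bar> \<le> 2 * norm v"
proof -
  have *: "\<bar>x $ i * v $ j\<bar> \<le> 1 * norm v" for i j
    unfolding abs_mult using component_le_norm_cart[of x i] component_le_norm_cart[of v j] assms
    by (intro mult_mono) auto
  show ?thesis unfolding rot_def using *[of i j] *[of j i] by linarith
qed

text \<open>The rotation entries of \<open>gTk\<close> are averages of those of \<open>h\<close>,
  and averaging is monotone. The constant is crude, since it only enters the dominating
  function.\<close>

lemma gTk_norm_le: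
  fixes f :: "real^'n \<Rightarrow> real"
  assumes n: "CARD('n) \<ge> 2" and w: "wgrad f h" and g: "integrable sphere_meas g" "\<And>y. norm (h y) \<le> g y" and x: "norm x = 1"
  shows "norm (gTk f k x) \<le> 2 * (real CARD('n))\<^sup>2 * Tk g k x"
proof -
  have f: "integrable sphere_meas f" and hm [measurable]: "h \<in> borel_measurable borel" using w by (auto simp: wgrad_def)
  have gm: "g \<in> borel_measurable borel" using g by auto
  have ri: "integrable sphere_meas (\<lambda>y. rot i j y (h y))" for i j
  proof (rule sphere_integrable_bound[of "\<lambda>y. 2 * g y"])
    show "\<bar>rot i j y (h y)\<bar> \<le> 2 * g y" if "norm y = 1" for y using rot_abs_le[OF that, of i j "h y"] g(2)[of y] by linarith
    show "(\<lambda>y. rot i j y (h y)) \<in> borel_measurable borel" unfolding rot_def by measurable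
  qed (use g in auto)
  have T: "\<bar>Tk (\<lambda>y. rot i j y (h y)) k x\<bar> \<le> 2 * Tk g k x" for i j
  proof -
    have "\<bar>Tk (\<lambda>y. rot i j y (h y)) k x\<bar> \<le> Tk (\<lambda>y. \<bar>rot i j y (h y)\<bar>) k x" by (rule Tk_abs_le[OF n ri x])
    also have "\<dots> \<le> Tk (\<lambda>y. 2 * g y) k x"
    proof (rule Tk_mono[OF n _ _ _ x])
      show "\<bar>rot i j y (h y)\<bar> \<le> 2 * g y" if "norm y = 1" for y using rot_abs_le[OF that, of i j "h y"] g(2)[of y] by linarith
    qed (use ri g in auto)
    finally show ?thesis using Tk_linear(3)[OF g(1) g(1)] by simp
  qed
  have c: "\<bar>gTk f k x $ j\<bar> \<le> real CARD('n) * (2 * Tk g k x)" for j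
  proof -
    have "\<bar>gTk f k x $ j\<bar> = \<bar>\<Sum>i\<in>UNIV. x $ i * Tk (\<lambda>y. rot i j y (h y)) k x\<bar>"
      by (subst tangential_rot[OF x gTk_tangential[OF f x]]) (simp add: rot_gTk[OF w])
    also have "\<dots> \<le> (\<Sum>i\<in>UNIV. \<bar>x $ i * Tk (\<lambda>y. rot i j y (h y)) k x\<bar>)" by (rule sum_abs)
    also have "\<dots> \<le> (\<Sum>i\<in>(UNIV::'n set). 1 * (2 * Tk g k x))"
    proof (rule sum_mono)
      show "\<bar>x $ i * Tk (\<lambda>y. rot i j y (h y)) k x\<bar> \<le> 1 * (2 * Tk g k x)" for i
        unfolding abs_mult using component_le_norm_cart[of x i] x T[of i j] by (intro mult_mono) auto
    qed
    finally show ?thesis by simp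
  qed
  have "norm (gTk f k x) \<le> (\<Sum>j\<in>UNIV. \<bar>gTk f k x $ j\<bar>)" by (rule norm_le_l1_cart)
  also have "\<dots> \<le> (\<Sum>j\<in>(UNIV::'n set). real CARD('n) * (2 * Tk g k x))" by (rule sum_mono) (rule c)
  finally show ?thesis by (simp add: power2_eq_square mult_ac)
qed

lemma tendsto_rdet:
  assumes "\<And>m j. (\<lambda>k::nat. r k m $ j) \<longlonglongrightarrow> s m $ j"
  shows "(\<lambda>k. rdet (r k)) \<longlonglongrightarrow> rdet s"
  unfolding rdet_def det_def vec_lambda_beta by (intro tendsto_intros assms)

text \<open>Dominated convergence with dominating functions that vary and converge in L^1: here they
  are averages of a power of the gradient norm, for which no single integrable majorant is at
  hand.\<close>

lemma L1_limit_dominated: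
  fixes D :: "real^'n \<Rightarrow> real"
  assumes Dk: "\<And>k. integrable sphere_meas (Dk k)" and D: "D \<in> borel_measurable borel"
    and ae: "AE x in sphere_meas. (\<lambda>k::nat. Dk k x) \<longlonglongrightarrow> D x"
    and b: "\<And>k x. norm x = 1 \<Longrightarrow> \<bar>Dk k x\<bar> \<le> p k x" "\<And>x. norm x = 1 \<Longrightarrow> \<bar>D x\<bar> \<le> P x"
    and p: "\<And>k. integrable sphere_meas (p k)" "integrable sphere_meas P" "(\<lambda>k. \<integral>x. \<bar>p k x - P x\<bar> \<partial>sphere_meas) \<longlonglongrightarrow> 0"
    and z: "\<And>k. (\<integral>x. Dk k x \<partial>sphere_meas) = 0"
  shows "integrable sphere_meas D" "(\<integral>x. D x \<partial>sphere_meas) = 0"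
proof -
  have [measurable]: "P \<in> borel_measurable borel" "p k \<in> borel_measurable borel" "Dk k \<in> borel_measurable borel" for k
    using p Dk[of k] by (auto dest: borel_measurable_integrable)
  note D [measurable]
  show Di: "integrable sphere_meas D" by (rule sphere_integrable_bound[OF p(2) D b(2)])
  \<comment> \<open>The difference is at most p + P, hence at most 2 |P| + |p - P|. Cutting it at 2
    |P| costs no more than |p - P|, and the cut difference is dominated by a fixed function.\<close>
  let ?m = "\<lambda>k x. min \<bar>Dk k x - D x\<bar> (2 * \<bar>P x\<bar>)"
  have "(\<lambda>k. \<integral>x. ?m k x \<partial>sphere_meas) \<longlonglongrightarrow> integral\<^sup>L sphere_meas (\<lambda>x::real^'n. 0)"
  proof (rule integral_dominated_convergence[where w="\<lambda>x. 2 * \<bar>P x\<bar>"])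
    show "AE x in sphere_meas. (\<lambda>k. ?m k x) \<longlonglongrightarrow> 0"
      using ae
    proof eventually_elim
      case (elim x)
      have "(\<lambda>k. min \<bar>Dk k x - D x\<bar> (2 * \<bar>P x\<bar>)) \<longlonglongrightarrow> min \<bar>D x - D x\<bar> (2 * \<bar>P x\<bar>)"
        by (intro tendsto_intros elim)
      then show ?case by simp
    qed
  qed (use p in auto)
  then have "(\<lambda>k. (\<integral>x. ?m k x \<partial>sphere_meas) + (\<integral>x. \<bar>p k x - P x\<bar> \<partial>sphere_meas)) \<longlonglongrightarrow> 0 + 0"
    using p(3) by (intro tendsto_add) auto
  moreover have "\<bar>\<integral>x. D x \<partial>sphere_meas\<bar> \<le> (\<integral>x. ?m k x \<partial>sphere_meas) + (\<integral>x. \<bar>p k x - P x\<bar> \<partial>sphere_meas)" for k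
  proof -
    have mi: "integrable sphere_meas (?m k)"
      by (rule sphere_integrable_bound[of "\<lambda>x. 2 * \<bar>P x\<bar>"]) (use p in auto)
    have "\<bar>\<integral>x. D x \<partial>sphere_meas\<bar> = \<bar>\<integral>x. Dk k x - D x \<partial>sphere_meas\<bar>" using Dk Di z by simp
    also have "\<dots> \<le> (\<integral>x. \<bar>Dk k x - D x\<bar> \<partial>sphere_meas)" by (rule integral_abs_bound)
    also have "\<dots> \<le> (\<integral>x. ?m k x + \<bar>p k x - P x\<bar> \<partial>sphere_meas)"
    proof (rule sphere_integral_mono)
      fix x :: "real^'n" assume x: "norm x = 1"
      show "\<bar>Dk k x - D x\<bar> \<le> ?m k x + \<bar>p k x - P x\<bar>" using b(1)[OF x, of k] b(2)[OF x] by linarith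
    qed (use Dk Di mi p in auto)
    also have "\<dots> = (\<integral>x. ?m k x \<partial>sphere_meas) + (\<integral>x. \<bar>p k x - P x\<bar> \<partial>sphere_meas)"
      using mi p by simp
    finally show ?thesis .
  qed
  ultimately have "\<bar>\<integral>x. D x \<partial>sphere_meas\<bar> \<le> 0 + 0" by (intro LIMSEQ_le_const) auto
  then show "(\<integral>x. D x \<partial>sphere_meas) = 0" by simp
qed

text \<open>The determinants of the averages have mean zero. They are dominated by averages of
  \<open>g ^ (CARD('n) - 1)\<close>, which converge in L^1 since this power is integrable, and along
  a subsequence they converge almost everywhere.\<close>

proposition null_lagrangian:
  fixes f :: "'n::finite \<Rightarrow> real^'n \<Rightarrow> real" and h :: "'n \<Rightarrow> real^'n \<Rightarrow> real^'n"
  assumes n: "CARD('n) \<ge> 2" and w: "\<And>m. wgrad (f m) (h m)" and tan: "\<And>m x. norm x = 1 \<Longrightarrow> h m x \<bullet> x = 0"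
    and g: "integrable sphere_meas g" "\<And>m y. norm (h m y) \<le> g y" "integrable sphere_meas (\<lambda>x. g x ^ (CARD('n) - 1))"
  shows "integrable sphere_meas (\<lambda>x. rdet ((\<lambda>m. h m x)(i := x)))" (is ?A)
    and "(\<integral>x. rdet ((\<lambda>m. h m x)(i := x)) \<partial>sphere_meas) = 0" (is ?B)
proof -
  let ?N = "real CARD('n)" and ?c = "CARD('n) - 1"
  have f: "integrable sphere_meas (f m)" and hm [measurable]: "h m \<in> borel_measurable borel" for m using w[of m] by (auto simp: wgrad_def)
  have g0: "g y \<ge> 0" for y using g(2)[of undefined y] norm_ge_zero order_trans by blast
  have [measurable]: "g \<in> borel_measurable borel" using g by auto
  let ?H = "\<lambda>(m, i, j) y. rot i j y (h m y)"
  have Hi: "integrable sphere_meas (?H t)" for t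
  proof -
    obtain m i j where t: "t = (m, i, j)" by (cases t)
    have "integrable sphere_meas (\<lambda>y. rot i j y (h m y))"
    proof (rule sphere_integrable_bound[of "\<lambda>y. 2 * g y"])
      show "\<bar>rot i j y (h m y)\<bar> \<le> 2 * g y" if "norm y = 1" for y using rot_abs_le[OF that, of i j "h m y"] g(2)[of m y] by linarith
      show "(\<lambda>y. rot i j y (h m y)) \<in> borel_measurable borel" unfolding rot_def by measurable
    qed (use g in auto)
    then show ?thesis by (simp add: t)
  qed
  note TH = Tk_integrable_sphere[OF n Hi]
  \<comment> \<open>All rotation entries of all components are collected in one sum, so that a
    single subsequence serves every entry.\<close>
  define S where "S k x = (\<Sum>t\<in>UNIV. \<bar>Tk (?H t) k x - ?H t x\<bar>)" for k x
  have Si: "integrable sphere_meas (S k)" for k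
    unfolding S_def using TH Hi by (intro Bochner_Integration.integrable_sum integrable_abs Bochner_Integration.integrable_diff)
  have "(\<lambda>k. \<Sum>t\<in>UNIV. \<integral>x. \<bar>Tk (?H t) k x - ?H t x\<bar> \<partial>sphere_meas) \<longlonglongrightarrow> (\<Sum>t\<in>(UNIV::('n \<times> 'n \<times> 'n) set). 0)"
    by (intro tendsto_sum Tk_L1_convergence[OF n Hi])
  moreover have "(\<integral>x. norm (S k x) \<partial>sphere_meas) = (\<Sum>t\<in>UNIV. \<integral>x. \<bar>Tk (?H t) k x - ?H t x\<bar> \<partial>sphere_meas)" for k
  proof -
    have "norm (S k x) = S k x" for x by (simp add: S_def sum_nonneg)
    then have "(\<integral>x. norm (S k x) \<partial>sphere_meas) = (\<integral>x. (\<Sum>t\<in>UNIV. \<bar>Tk (?H t) k x - ?H t x\<bar>) \<partial>sphere_meas)"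
      by (simp add: S_def)
    also have "\<dots> = (\<Sum>t\<in>UNIV. \<integral>x. \<bar>Tk (?H t) k x - ?H t x\<bar> \<partial>sphere_meas)"
      by (rule Bochner_Integration.integral_sum) (intro integrable_abs Bochner_Integration.integrable_diff TH Hi)
    finally show ?thesis .
  qed
  ultimately have "(\<lambda>k. \<integral>x. norm (S k x) \<partial>sphere_meas) \<longlonglongrightarrow> 0" by simp
  from tendsto_L1_AE_subseq[OF Si this] obtain r where r: "strict_mono r" "AE x in sphere_meas. (\<lambda>k. S (r k) x) \<longlonglongrightarrow> 0" by blast
  define Dk where "Dk k x = rdet ((\<lambda>m. gTk (f m) (r k) x)(i := x))" for k x
  define D where "D x = rdet ((\<lambda>m. h m x)(i := x))" for x
  define K where "K = fact CARD('n) * (2 * ?N\<^sup>2) ^ ?c"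
  have N1: "?N \<ge> 1" using n by simp
  have Dki: "integrable sphere_meas (Dk k)" for k
    unfolding Dk_def
  proof (rule sbdd_integrable, rule sbdd_rdet)
    show "sbdd (\<lambda>x. ((\<lambda>m. gTk (f m) (r k) x)(i := x)) m $ j)" for m j
    proof (cases "m = i")
      case True
      have "sbdd (\<lambda>x::real^'n. x $ j)" by (intro sbdd_continuous continuous_intros)
      then show ?thesis using True by simp
    next
      case False
      then show ?thesis using gTk_component_sbdd[OF n f[of m], of "r k" j] by simp
    qed
  qed
  have Dm: "D \<in> borel_measurable borel"
  proof -
    have "(\<lambda>x. ((\<lambda>m. h m x)(i := x)) m $ j) \<in> borel_measurable borel" for m j
      by (cases "m = i") auto
    then show ?thesis unfolding D_def[abs_def] rdet_def det_def vec_lambda_beta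
      by (intro borel_measurable_sum borel_measurable_times borel_measurable_const borel_measurable_prod)
  qed
  have ae: "AE x in sphere_meas. (\<lambda>k. Dk k x) \<longlonglongrightarrow> D x"
    using r(2) AE_sphere_meas_norm
  proof eventually_elim
    case (elim x)
    have T: "(\<lambda>k. Tk (?H t) (r k) x) \<longlonglongrightarrow> ?H t x" for t
    proof (rule LIM_zero_cancel, rule Lim_null_comparison[OF _ elim(1)])
      have "\<bar>Tk (?H t) (r k) x - ?H t x\<bar> \<le> S (r k) x" for k
        unfolding S_def by (rule member_le_sum[of t UNIV "\<lambda>t. \<bar>Tk (?H t) (r k) x - ?H t x\<bar>"]) auto
      then show "\<forall>\<^sub>F k in sequentially. norm (Tk (?H t) (r k) x - ?H t x) \<le> S (r k) x" by simp
    qed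
    have G: "(\<lambda>k. gTk (f m) (r k) x $ j) \<longlonglongrightarrow> h m x $ j" for m j
    proof -
      have "(\<lambda>k. \<Sum>i\<in>UNIV. x $ i * Tk (?H (m, i, j)) (r k) x) \<longlonglongrightarrow> (\<Sum>i\<in>UNIV. x $ i * ?H (m, i, j) x)"
        by (intro tendsto_intros T)
      moreover have "(\<Sum>i\<in>UNIV. x $ i * Tk (?H (m, i, j)) (r k) x) = gTk (f m) (r k) x $ j" for k
        using tangential_rot[OF elim(2) gTk_tangential[OF f[of m] elim(2), of "r k"], of j] by (simp add: rot_gTk[OF w])
      moreover have "(\<Sum>i\<in>UNIV. x $ i * ?H (m, i, j) x) = h m x $ j"
        using tangential_rot[OF elim(2) tan[OF elim(2), of m], of j] by simp
      ultimately show ?thesis by simp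
    qed
    show ?case unfolding Dk_def D_def
    proof (rule tendsto_rdet)
      show "(\<lambda>k. ((\<lambda>m. gTk (f m) (r k) x)(i := x)) m $ j) \<longlonglongrightarrow> ((\<lambda>m. h m x)(i := x)) m $ j" for m j
        using G by (cases "m = i") auto
    qed
  qed
  have b1: "\<bar>Dk k x\<bar> \<le> K * Tk (\<lambda>x. g x ^ ?c) (r k) x" if x: "norm x = 1" for k x
  proof -
    have "\<bar>Dk k x\<bar> \<le> fact CARD('n) * (2 * ?N\<^sup>2 * Tk g (r k) x) ^ ?c"
      unfolding Dk_def by (rule rdet_unit_row_bound[OF x gTk_norm_le[OF n w g(1,2) x]])
    also have "\<dots> = K * (Tk g (r k) x) ^ ?c" by (simp add: K_def power_mult_distrib)
    also have "\<dots> \<le> K * Tk (\<lambda>x. g x ^ ?c) (r k) x"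
      by (intro mult_left_mono Tk_jensen[OF n g(1) g(3) g0 _ x]) (use n in \<open>auto simp: K_def\<close>)
    finally show ?thesis .
  qed
  have b2: "\<bar>D x\<bar> \<le> K * g x ^ ?c" if x: "norm x = 1" for x
  proof -
    have "\<bar>D x\<bar> \<le> fact CARD('n) * g x ^ ?c" unfolding D_def by (rule rdet_unit_row_bound[OF x g(2)])
    also have "\<dots> \<le> K * g x ^ ?c"
    proof (rule mult_right_mono)
      have "1 \<le> 2 * ?N\<^sup>2" using N1 one_le_power[of ?N 2] by linarith
      then have "1 \<le> (2 * ?N\<^sup>2) ^ ?c" by (rule one_le_power)
      then show "fact CARD('n) \<le> K" unfolding K_def using mult_left_mono[of 1 _ "fact CARD('n) :: real"] by simp
    qed (simp add: g0)
    finally show ?thesis .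
  qed
  have z: "(\<integral>x. Dk k x \<partial>sphere_meas) = 0" for k unfolding Dk_def by (rule null_lagrangian_gTk[OF n f])
  have p: "(\<lambda>k. \<integral>x. \<bar>K * Tk (\<lambda>x. g x ^ ?c) (r k) x - K * g x ^ ?c\<bar> \<partial>sphere_meas) \<longlonglongrightarrow> 0"
  proof -
    have "(\<lambda>k. \<integral>x. \<bar>Tk (\<lambda>x. g x ^ ?c) (r k) x - g x ^ ?c\<bar> \<partial>sphere_meas) \<longlonglongrightarrow> 0"
      using LIMSEQ_subseq_LIMSEQ[OF Tk_L1_convergence[OF n g(3)] r(1)] by (simp add: o_def)
    then have "(\<lambda>k. \<bar>K\<bar> * (\<integral>x. \<bar>Tk (\<lambda>x. g x ^ ?c) (r k) x - g x ^ ?c\<bar> \<partial>sphere_meas)) \<longlonglongrightarrow> 0"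
      by (rule tendsto_mult_right_zero)
    then show ?thesis by (simp add: abs_mult flip: right_diff_distrib)
  qed
  have I: "integrable sphere_meas (\<lambda>x. K * Tk (\<lambda>x. g x ^ ?c) (r k) x)" "integrable sphere_meas (\<lambda>x. K * g x ^ ?c)" for k
    by (intro integrable_mult_right Tk_integrable_sphere[OF n g(3)] g(3))+
  have "integrable sphere_meas D"
    by (rule L1_limit_dominated(1)[OF Dki Dm ae _ _ I p z]) (erule b1, erule b2)
  then show ?A unfolding D_def[abs_def] .
  have "(\<integral>x. D x \<partial>sphere_meas) = 0"
    by (rule L1_limit_dominated(2)[OF Dki Dm ae _ _ I p z]) (erule b1, erule b2)
  then show ?B unfolding D_def .
qed

text \<open>In an orthonormal basis that has \<open>x\<close> as its \<open>k\<close>-th vector, the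
  matrix with rows \<open>v m + e $ m *\<^sub>R x\<close> has \<open>e\<close> as its
  \<open>k\<close>-th column, and the other columns do not depend on \<open>e\<close>. So the
  determinant is linear in \<open>e\<close>, and 0 for \<open>e = 0\<close>. Its value at a basis
  vector follows from additivity in one row.\<close>

lemma det_rank_one:
  fixes v :: "'n::finite \<Rightarrow> real^'n"
  assumes v: "\<And>m. v m \<bullet> x = 0" and x: "norm x = 1"
  shows "det (\<chi> m. v m + e $ m *\<^sub>R x) = (\<Sum>i\<in>UNIV. e $ i * rdet (v(i := x)))"
    and "rdet v = 0"
proof -
  fix k :: 'n
  obtain R where R: "orthogonal_matrix R" "R *v axis k 1 = x"
    using orthogonal_matrix_exists_basis[OF x] by metis
  have oR: "(R *v axis j 1) \<bullet> x = 0" if "j \<noteq> k" for j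
  proof -
    have "(R *v axis j 1) \<bullet> (R *v axis k 1) = axis j 1 \<bullet> (axis k 1 :: real^'n)"
    proof -
      have "orthogonal_transformation ((*v) R)" using R(1) by (simp add: orthogonal_transformation_matrix)
      then show ?thesis by (simp add: orthogonal_transformation_def)
    qed
    then show ?thesis using that R(2) by (simp add: inner_axis_axis)
  qed
  define c where "c j = (\<chi> m. v m \<bullet> (R *v axis j 1))" for j
  have dR: "det R \<noteq> 0" using det_orthogonal_matrix[OF R(1)] by auto
  define L where "L e = rdet (c(k := e)) / det R" for e
  interpret L: linear L
    by (rule linearI) (simp_all add: L_def rdet_add rdet_scale add_divide_distrib)
  have detL: "det (\<chi> m. v m + e $ m *\<^sub>R x) = L e" for e
  proof -
    let ?M = "\<chi> m. v m + e $ m *\<^sub>R x"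
    have "(?M ** R) $ m $ j = (v m + e $ m *\<^sub>R x) \<bullet> (R *v axis j 1)" for m j
      by (simp only: matrix_vector_mult_basis) (simp add: matrix_matrix_mult_def column_def inner_vec_def)
    note e1 = this
    have "(?M ** R) $ m $ j = (c(k := e)) j $ m" for m j
    proof (cases "j = k")
      case True
      then show ?thesis using R(2) v[of m] x by (simp add: e1 inner_add_left norm_eq_1)
    next
      case False
      have "x \<bullet> (R *v axis j 1) = 0" using oR[OF False] by (subst inner_commute)
      then show ?thesis using False by (simp add: e1 inner_add_left c_def)
    qed
    then have "transpose (?M ** R) = (\<chi> j. (c(k := e)) j)"
      by (simp add: vec_eq_iff transpose_def)
    then have "rdet (c(k := e)) = det (?M ** R)" unfolding rdet_def using det_transpose[of "?M ** R"] by (simp only:)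
    then show ?thesis using dR by (simp add: det_mul L_def)
  qed
  show v0: "rdet v = 0" using detL[of 0] L.zero by (simp add: rdet_def)
  have Lax: "L (axis i 1) = rdet (v(i := x))" for i
  proof -
    have "(\<chi> m. v m + axis i 1 $ m *\<^sub>R x) = (\<chi> m. (v(i := v i + x)) m)"
      by (auto simp: vec_eq_iff axis_def)
    then have "L (axis i 1) = rdet (v(i := v i + x))" using detL[of "axis i 1"] by (simp only: rdet_def)
    then show ?thesis unfolding rdet_add using v0 by simp
  qed
  have "e = (\<Sum>i\<in>UNIV. (e $ i) *\<^sub>R axis i 1)"
    using basis_expansion[of e] by (simp add: scalar_mult_eq_scaleR)
  then have "L e = L (\<Sum>i\<in>UNIV. (e $ i) *\<^sub>R axis i 1)" by simp
  then show "det (\<chi> m. v m + e $ m *\<^sub>R x) = (\<Sum>i\<in>UNIV. e $ i * rdet (v(i := x)))"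
    unfolding detL L.sum L.scale Lax by simp
qed

section \<open>Determinants, singular values and orthogonal matrices\<close>

definition outer :: "real^'n \<Rightarrow> real^'n \<Rightarrow> real^'n^'n" where
  "outer u w = (\<chi> i j. u $ i * w $ j)"

lemma outer_mv: "outer u w *v x = (w \<bullet> x) *\<^sub>R u"
  by (simp add: vec_eq_iff outer_def matrix_vector_mult_def inner_vec_def sum_distrib_left sum_distrib_right mult_ac)

lemma outer_inner: "outer u w \<bullet> B = u \<bullet> (B *v w)"
  by (simp add: outer_def inner_vec_def matrix_vector_mult_def sum_distrib_left mult_ac)

lemma inner_matrix_mult: "((Q::real^'n^'n) ** R) \<bullet> A = R \<bullet> (transpose Q ** A)"
proof -
  have "(Q ** R) \<bullet> A = (\<Sum>i\<in>UNIV. \<Sum>j\<in>UNIV. \<Sum>k\<in>UNIV. Q $ i $ k * R $ k $ j * A $ i $ j)"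
    by (simp add: inner_vec_def matrix_matrix_mult_def sum_distrib_right)
  also have "\<dots> = (\<Sum>i\<in>UNIV. \<Sum>k\<in>UNIV. \<Sum>j\<in>UNIV. Q $ i $ k * R $ k $ j * A $ i $ j)"
    by (rule sum.cong[OF refl], rule sum.swap)
  also have "\<dots> = (\<Sum>k\<in>UNIV. \<Sum>i\<in>UNIV. \<Sum>j\<in>UNIV. Q $ i $ k * R $ k $ j * A $ i $ j)" by (rule sum.swap)
  also have "\<dots> = (\<Sum>k\<in>UNIV. \<Sum>j\<in>UNIV. \<Sum>i\<in>UNIV. Q $ i $ k * R $ k $ j * A $ i $ j)"
    by (rule sum.cong[OF refl], rule sum.swap)
  also have "\<dots> = R \<bullet> (transpose Q ** A)"
    by (simp add: inner_vec_def matrix_matrix_mult_def transpose_def sum_distrib_left mult_ac)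
  finally show ?thesis .
qed

lemma norm_orthogonal_mult: "orthogonal_matrix Q \<Longrightarrow> norm (Q ** X) = norm (X::real^'n^'n)"
  unfolding norm_eq_sqrt_inner inner_matrix_mult
  by (simp add: matrix_mul_assoc orthogonal_matrix_def)

lemma norm_matrix_sq_columns: "(norm (A::real^'n^'n))\<^sup>2 = (\<Sum>j\<in>UNIV. (norm (A *v axis j 1))\<^sup>2)"
proof -
  have "(norm A)\<^sup>2 = (\<Sum>i\<in>UNIV. \<Sum>j\<in>UNIV. (A $ i $ j)\<^sup>2)"
    unfolding power2_norm_eq_inner by (simp add: inner_vec_def power2_eq_square)
  also have "\<dots> = (\<Sum>j\<in>UNIV. \<Sum>i\<in>UNIV. (A $ i $ j)\<^sup>2)" by (rule sum.swap)
  also have "\<dots> = (\<Sum>j\<in>UNIV. (norm (A *v axis j 1))\<^sup>2)"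
    unfolding power2_norm_eq_inner matrix_vector_mult_basis by (simp add: inner_vec_def power2_eq_square column_def)
  finally show ?thesis .
qed

lemma norm_matrix_sq_rows: "(norm (A::real^'n^'n))\<^sup>2 = (\<Sum>i\<in>UNIV. (norm (A $ i))\<^sup>2)"
  by (simp add: power2_norm_eq_inner inner_vec_def)

lemma norm_mv_le: "norm ((A::real^'n^'n) *v v) \<le> norm A * norm v"
proof (rule power2_le_imp_le)
  have "(norm (A *v v))\<^sup>2 = (\<Sum>i\<in>UNIV. (A $ i \<bullet> v)\<^sup>2)"
    unfolding power2_norm_eq_inner inner_vec_def[of "A *v v"] by (simp add: matrix_vector_mul_component power2_eq_square)
  also have "\<dots> \<le> (\<Sum>i\<in>UNIV. (norm (A $ i))\<^sup>2 * (norm v)\<^sup>2)"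
  proof (rule sum_mono)
    fix i
    have "\<bar>A $ i \<bullet> v\<bar>\<^sup>2 \<le> (norm (A $ i) * norm v)\<^sup>2" by (rule power_mono[OF Cauchy_Schwarz_ineq2]) simp
    then show "(A $ i \<bullet> v)\<^sup>2 \<le> (norm (A $ i))\<^sup>2 * (norm v)\<^sup>2" by (simp add: power_mult_distrib)
  qed
  also have "\<dots> = (norm A * norm v)\<^sup>2" by (simp add: norm_matrix_sq_rows power_mult_distrib sum_distrib_right)
  finally show "(norm (A *v v))\<^sup>2 \<le> (norm A * norm v)\<^sup>2" .
qed simp

text \<open>Tensor power trick: a crude bound, with a constant depending on the dimension, is applied to
  the powers of the matrix.\<close>

lemma det_le_operator_norm:
  fixes B :: "real^'n^'n"
  assumes B: "\<And>v. norm (B *v v) \<le> s * norm v" and s: "s \<ge> 0"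
  shows "\<bar>det B\<bar> \<le> s ^ CARD('n)"
proof -
  have crude: "\<bar>det M\<bar> \<le> fact CARD('n) * t ^ CARD('n)" if M: "\<And>v. norm (M *v v) \<le> t * norm v" for M :: "real^'n^'n" and t
  proof -
    have row: "norm (M $ m) \<le> t" for m
    proof (cases "M $ m = 0")
      case True
      have "0 \<le> norm (M *v axis m 1)" by simp
      also have "\<dots> \<le> t" using M[of "axis m 1"] by simp
      finally show ?thesis using True by simp
    next
      case False
      have "norm (M $ m) * norm (M $ m) = (M *v (M $ m)) $ m"
        by (simp add: matrix_vector_mul_component power2_norm_eq_inner[symmetric] power2_eq_square)
      also have "\<dots> \<le> norm (M *v (M $ m))" using component_le_norm_cart[of "M *v (M $ m)" m] by simp
      also have "\<dots> \<le> t * norm (M $ m)" by (rule M)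
      finally show ?thesis using False by simp
    qed
    have "\<bar>det M\<bar> \<le> fact CARD('n) * (\<Prod>m\<in>UNIV. norm (M $ m))"
      using rdet_bound[of "\<lambda>m. M $ m"] by (simp add: rdet_def)
    also have "\<dots> \<le> fact CARD('n) * (\<Prod>m\<in>(UNIV::'n set). t)"
      by (intro mult_left_mono prod_mono) (use row in auto)
    finally show ?thesis by simp
  qed
  have pow: "\<exists>M::real^'n^'n. det M = det B ^ k \<and> (\<forall>v. norm (M *v v) \<le> s ^ k * norm v)" for k
  proof (induction k)
    case 0
    show ?case by (rule exI[of _ "mat 1"]) simp
  next
    case (Suc k)
    then obtain M :: "real^'n^'n" where M: "det M = det B ^ k" "\<And>v. norm (M *v v) \<le> s ^ k * norm v" by blast
    have "norm ((B ** M) *v v) \<le> s ^ Suc k * norm v" for v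
    proof -
      have "norm ((B ** M) *v v) \<le> s * norm (M *v v)" using B[of "M *v v"] by (simp add: matrix_vector_mul_assoc)
      also have "\<dots> \<le> s * (s ^ k * norm v)" by (rule mult_left_mono[OF M(2) s])
      finally show ?thesis by (simp add: mult.assoc)
    qed
    then show ?case using M(1) by (intro exI[of _ "B ** M"]) (simp add: det_mul)
  qed
  have key: "\<bar>det B\<bar> ^ k \<le> fact CARD('n) * (s ^ CARD('n)) ^ k" for k
  proof -
    obtain M :: "real^'n^'n" where M: "det M = det B ^ k" "\<And>v. norm (M *v v) \<le> s ^ k * norm v" using pow[of k] by blast
    then show ?thesis using crude[OF M(2)] by (simp add: power_abs power_mult[symmetric] mult.commute)
  qed
  show ?thesis
  proof (rule ccontr)
    assume "\<not> ?thesis"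
    then have lt: "s ^ CARD('n) < \<bar>det B\<bar>" by simp
    show False
    proof (cases "s = 0")
      case True
      then show False using key[of 1] lt by (simp add: power_0_left)
    next
      case False
      then have sp: "s ^ CARD('n) > 0" using s by simp
      then have "\<bar>det B\<bar> / s ^ CARD('n) > 1" using lt by simp
      then obtain k where k: "fact CARD('n) < (\<bar>det B\<bar> / s ^ CARD('n)) ^ k" using real_arch_pow by blast
      then have "fact CARD('n) * (s ^ CARD('n)) ^ k < \<bar>det B\<bar> ^ k"
        using sp by (simp add: power_divide pos_less_divide_eq)
      then show False using key[of k] by simp
    qed
  qed
qed

lemma PT_mv: "PT x *v v = v - (x \<bullet> v) *\<^sub>R x"
proof -
  have "PT x = mat 1 - outer x x" by (simp add: PT_def outer_def)
  then show ?thesis by (simp add: matrix_vector_mult_diff_rdistrib outer_mv)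
qed

lemma PT_norm:
  assumes "norm x = 1"
  shows "(norm (PT x *v v))\<^sup>2 = (norm v)\<^sup>2 - (x \<bullet> v)\<^sup>2" "PT x *v x = 0" "x \<bullet> (PT x *v v) = 0"
    "PT x *v (PT x *v v) = PT x *v v"
  using assms unfolding PT_mv power2_norm_eq_inner
  by (simp_all add: norm_eq_1 inner_diff_left inner_diff_right inner_commute power2_eq_square)

lemma PT_norm_le: "norm x = 1 \<Longrightarrow> norm (PT x *v v) \<le> norm v"
  by (rule power2_le_imp_le) (simp_all add: PT_norm(1))

lemma PT_row: "((X::real^'n^'n) ** PT x) $ i = PT x *v (X $ i)"
  by (simp add: vec_eq_iff matrix_matrix_mult_def matrix_vector_mult_def PT_def mult_ac mat_def eq_commute)

lemma norm_mult_PT_le: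
  fixes X :: "real^'n^'n"
  assumes x: "norm x = 1"
  shows "norm (X ** PT x) \<le> norm X"
proof (rule power2_le_imp_le)
  show "(norm (X ** PT x))\<^sup>2 \<le> (norm X)\<^sup>2"
    unfolding norm_matrix_sq_rows PT_row using PT_norm_le[OF x] by (auto intro!: sum_mono power_mono)
qed simp

text \<open>The vector \<open>N\<close> representing \<open>e \<mapsto> det (H + e x\<^sup>t)\<close> is orthogonal to the range of \<open>H\<close>,
  so that \<open>H + s \<nu> x\<^sup>t\<close> with \<open>\<nu> = N / |N|\<close> still has operator norm at most \<open>s\<close>.\<close>

lemma det_rank_one_bound:
  fixes H :: "real^'n^'n"
  assumes n: "CARD('n) \<ge> 2" and x: "norm x = 1" and Hx: "H *v x = 0" and s: "s \<ge> 0" "\<And>v. norm (H *v v) \<le> s * norm v"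
  shows "\<bar>det (H + outer e x)\<bar> \<le> norm e * s ^ (CARD('n) - 1)"
proof -
  have rows: "H $ m \<bullet> x = 0" for m using Hx by (simp add: vec_eq_iff matrix_vector_mul_component)
  define N where "N = (\<chi> i. rdet ((\<lambda>m. H $ m)(i := x)))"
  have det: "det (H + outer e x) = e \<bullet> N" for e
  proof -
    have "H + outer e x = (\<chi> m. H $ m + e $ m *\<^sub>R x)" by (simp add: vec_eq_iff outer_def)
    moreover have "e \<bullet> N = (\<Sum>i\<in>UNIV. e $ i * rdet ((\<lambda>m. H $ m)(i := x)))"
      unfolding N_def inner_vec_def by (simp only: vec_lambda_beta inner_real_def)
    ultimately show ?thesis using det_rank_one(1)[where v="\<lambda>m. H $ m" and x=x and e=e, OF rows x] by (simp only:)
  qed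
  have det0: "det H = 0" using det_rank_one(2)[where v="\<lambda>m. H $ m" and x=x, OF rows x] by (simp add: rdet_def)
  \<comment> \<open>Adding \<open>outer (H *v v) x\<close> to \<open>H\<close> amounts to
    multiplying \<open>H\<close> by another matrix; since \<open>H\<close> is singular, the
    determinant stays 0.\<close>
  have orth: "(H *v v) \<bullet> N = 0" for v
  proof -
    have "H + outer (H *v v) x = H ** (mat 1 + outer v x)"
      unfolding matrix_eq matrix_vector_mul_assoc[symmetric] matrix_vector_mult_add_rdistrib outer_mv
        matrix_vector_right_distrib matrix_vector_mult_scaleR matrix_vector_mul_lid by simp
    then show ?thesis unfolding det[symmetric] by (simp only: det_mul det0 mult_zero_left)
  qed
  have N: "norm N \<le> s ^ (CARD('n) - 1)"
  proof (cases "s = 0 \<or> N = 0")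
    case True
    moreover have "N = 0" if "s = 0"
    proof -
      have "H *v v = 0" for v using s(2)[of v] that by simp
      then have "H = 0" by (simp add: matrix_eq)
      then have "\<bar>rdet ((\<lambda>m. H $ m)(i := x))\<bar> \<le> fact CARD('n) * 0 ^ (CARD('n) - 1)" for i
        by (intro rdet_unit_row_bound[OF x]) simp
      then show ?thesis using n unfolding N_def vec_eq_iff vec_lambda_beta zero_index by (simp only: power_0_left) auto
    qed
    ultimately show ?thesis using s by auto
  next
    case False
    then have sp: "s > 0" and Np: "norm N > 0" using s by auto
    define \<nu> where "\<nu> = (1 / norm N) *\<^sub>R N"
    have \<nu>: "\<nu> \<bullet> \<nu> = 1" "(H *v v) \<bullet> \<nu> = 0" for v
    proof -
      have "\<nu> \<bullet> \<nu> = (norm \<nu>)\<^sup>2" by (rule power2_norm_eq_inner[symmetric])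
      also have "norm \<nu> = 1" using Np by (simp add: \<nu>_def)
      finally show "\<nu> \<bullet> \<nu> = 1" by simp
      show "(H *v v) \<bullet> \<nu> = 0" by (simp only: \<nu>_def inner_scaleR_right orth mult_zero_right)
    qed
    \<comment> \<open>Pythagoras: the range of \<open>H\<close> is orthogonal to \<nu>, and
      \<open>H\<close> sees only the part of \<open>v\<close> orthogonal to \<open>x\<close>, while
      the new term sees only the part along \<open>x\<close>. The determinant of this matrix is s
      |N|, so the bound s^n becomes the desired bound for |N| after division by s.\<close>
    have B: "norm ((H + outer (s *\<^sub>R \<nu>) x) *v v) \<le> s * norm v" for v
    proof (rule power2_le_imp_le)
      have "H *v v = H *v (PT x *v v)" unfolding PT_mv
        by (simp add: matrix_vector_mult_diff_distrib matrix_vector_mult_scaleR Hx)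
      then have "norm (H *v v) \<le> s * norm (PT x *v v)" using s(2)[of "PT x *v v"] by simp
      then have "(norm (H *v v))\<^sup>2 \<le> (s * norm (PT x *v v))\<^sup>2" by (rule power_mono) simp
      also have "\<dots> = s\<^sup>2 * ((norm v)\<^sup>2 - (x \<bullet> v)\<^sup>2)" by (simp add: power_mult_distrib PT_norm(1)[OF x])
      finally have 1: "(norm (H *v v))\<^sup>2 \<le> s\<^sup>2 * ((norm v)\<^sup>2 - (x \<bullet> v)\<^sup>2)" .
      have "(H + outer (s *\<^sub>R \<nu>) x) *v v = H *v v + (s * (x \<bullet> v)) *\<^sub>R \<nu>"
        by (simp add: matrix_vector_mult_add_rdistrib outer_mv mult.commute)
      then have "(norm ((H + outer (s *\<^sub>R \<nu>) x) *v v))\<^sup>2 = (norm (H *v v))\<^sup>2 + (s * (x \<bullet> v))\<^sup>2"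
      proof -
        have "\<nu> \<bullet> (H *v v) = 0" using \<nu>(2)[of v] by (subst inner_commute)
        then have "(H *v v + a *\<^sub>R \<nu>) \<bullet> (H *v v + a *\<^sub>R \<nu>) = (H *v v) \<bullet> (H *v v) + a\<^sup>2" for a
          unfolding inner_add_left inner_add_right inner_scaleR_left inner_scaleR_right \<nu> by (simp add: power2_eq_square)
        then show ?thesis
          using \<open>(H + outer (s *\<^sub>R \<nu>) x) *v v = H *v v + (s * (x \<bullet> v)) *\<^sub>R \<nu>\<close>
          unfolding power2_norm_eq_inner by (simp only:)
      qed
      then show "(norm ((H + outer (s *\<^sub>R \<nu>) x) *v v))\<^sup>2 \<le> (s * norm v)\<^sup>2"
        using 1 by (simp add: power_mult_distrib algebra_simps)
    qed (use s in simp)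
    have "\<bar>det (H + outer (s *\<^sub>R \<nu>) x)\<bar> \<le> s ^ CARD('n)" by (rule det_le_operator_norm[OF B s(1)])
    moreover have "det (H + outer (s *\<^sub>R \<nu>) x) = s * norm N"
    proof -
      have "(s *\<^sub>R \<nu>) \<bullet> N = s / norm N * (norm N)\<^sup>2" unfolding power2_norm_eq_inner by (simp add: \<nu>_def)
      also have "\<dots> = s * norm N" using Np by (simp add: power2_eq_square)
      finally show ?thesis unfolding det .
    qed
    moreover have "s ^ CARD('n) = s * s ^ (CARD('n) - 1)" using n by (simp add: power_eq_if)
    ultimately show ?thesis using sp Np by (simp add: abs_mult)
  qed
  have "\<bar>det (H + outer e x)\<bar> \<le> norm e * norm N" unfolding det by (rule Cauchy_Schwarz_ineq2)
  also have "\<dots> \<le> norm e * s ^ (CARD('n) - 1)" by (rule mult_left_mono[OF N]) simp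
  finally show ?thesis .
qed

section \<open>The largest singular value\<close>

definition PT' :: "real^'n \<Rightarrow> real^'n^'n" where
  "PT' x = PT (x /\<^sub>R norm x)"

text \<open>Valid at every \<open>x\<close>, not only on the sphere: \<open>PT'\<close> normalises
  first, and at 0 it is the identity, in accordance with the empty orthogonality constraint there.
  Measurability of \<open>sigma_max\<close> then follows from continuity of the operator
  norm.\<close>

lemma sigma_max_onorm:
  fixes G :: "real^'n \<Rightarrow> real^'n^'n"
  assumes n: "CARD('n) \<ge> 2"
  shows "sigma_max G x = onorm ((*v) (G x ** PT' x))"
proof -
  let ?A = "G x ** PT' x"
  define u where "u = x /\<^sub>R norm x"
  have u: "u = 0 \<or> norm u = 1" and xu: "x = norm x *\<^sub>R u"
    by (cases "x = 0"; simp add: u_def)+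
  have Pv: "PT' x *v v = v - (u \<bullet> v) *\<^sub>R u" for v by (simp add: PT'_def u_def PT_mv)
  have Ple: "norm (PT' x *v v) \<le> norm v" for v
    using u PT_norm_le[of u v] unfolding Pv PT_mv by auto
  have Px: "(PT' x *v v) \<bullet> x = 0" for v
  proof -
    have "(PT' x *v v) \<bullet> x = norm x * ((PT' x *v v) \<bullet> u)" using arg_cong[OF xu, of "\<lambda>z. (PT' x *v v) \<bullet> z"] by simp
    also have "(PT' x *v v) \<bullet> u = 0"
      unfolding Pv inner_diff_left inner_scaleR_left using u by (auto simp: norm_eq_1 inner_commute[of v u])
    finally show ?thesis by simp
  qed
  define S where "S = {norm (G x *v v) | v. norm v = 1 \<and> v \<bullet> x = 0}"
  have sS: "sigma_max G x = Sup S" by (simp add: sigma_max_def S_def)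
  have bl: "bounded_linear ((*v) ?A)" by simp
  have up: "t \<le> onorm ((*v) ?A)" if "t \<in> S" for t
  proof -
    obtain v where v: "t = norm (G x *v v)" "norm v = 1" "v \<bullet> x = 0" using \<open>t \<in> S\<close> by (auto simp: S_def)
    have "PT' x *v v = v" unfolding Pv using v(3) by (simp add: u_def inner_commute)
    then have "t = norm (?A *v v)" using v(1) by (simp add: matrix_vector_mul_assoc[symmetric])
    then show ?thesis using onorm[OF bl, of v] v(2) by simp
  qed
  have bdd: "bdd_above S" using up by (rule bdd_aboveI)
  have ne: "S \<noteq> {}"
  proof -
    have "2 \<le> DIM(real^'n)" using n by simp
    then obtain v :: "real^'n" where v: "v \<noteq> 0" "orthogonal x v"
      by (rule orthogonal_to_vector_exists[of x])
    have "norm ((1 / norm v) *\<^sub>R v) = 1" "((1 / norm v) *\<^sub>R v) \<bullet> x = 0"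
      using v by (simp_all add: orthogonal_def inner_commute)
    then have "norm (G x *v ((1 / norm v) *\<^sub>R v)) \<in> S"
      unfolding S_def by blast
    then show ?thesis by blast
  qed
  have S0: "Sup S \<ge> 0"
  proof -
    obtain t where "t \<in> S" using ne by blast
    moreover then have "t \<ge> 0" by (auto simp: S_def)
    ultimately show ?thesis using cSup_upper[OF _ bdd, of t] by linarith
  qed
  have "onorm ((*v) ?A) \<le> Sup S"
  proof (rule onorm_bound[OF S0])
    fix w :: "real^'n"
    define p where "p = PT' x *v w"
    have Aw: "?A *v w = G x *v p" by (simp add: p_def matrix_vector_mul_assoc[symmetric])
    show "norm (?A *v w) \<le> Sup S * norm w"
    proof (cases "p = 0")
      case True
      then show ?thesis using S0 by (simp add: Aw)
    next
      case False
      have "norm (G x *v ((1 / norm p) *\<^sub>R p)) \<in> S"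
      proof -
        have "norm ((1 / norm p) *\<^sub>R p) = 1" "((1 / norm p) *\<^sub>R p) \<bullet> x = 0"
          using False Px[of w] by (simp_all add: p_def)
        then show ?thesis unfolding S_def by blast
      qed
      then have "norm (G x *v ((1 / norm p) *\<^sub>R p)) \<le> Sup S" by (rule cSup_upper[OF _ bdd])
      then have "norm (G x *v p) \<le> Sup S * norm p"
        using False by (simp add: matrix_vector_mult_scaleR field_simps)
      also have "\<dots> \<le> Sup S * norm w" using Ple[of w] S0 by (intro mult_left_mono) (auto simp: p_def)
      finally show ?thesis by (simp add: Aw)
    qed
  qed
  moreover have "Sup S \<le> onorm ((*v) ?A)" by (rule cSup_least[OF ne up])
  ultimately show ?thesis by (simp add: sS)
qed

lemma borel_measurable_matrixI:
  fixes M :: "'a \<Rightarrow> real^'n^'m"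
  assumes "\<And>i j. (\<lambda>x. M x $ i $ j) \<in> borel_measurable N"
  shows "M \<in> borel_measurable N"
  by (intro borel_measurable_euclidean_space[THEN iffD2])
     (use assms in \<open>auto simp: Basis_vec_def inner_axis\<close>)

lemma continuous_onorm: "continuous_on UNIV (\<lambda>A::real^'n^'n. onorm ((*v) A))"
proof (rule lipschitz_on_continuous_on)
  have le: "onorm ((*v) A) \<le> onorm ((*v) B) + norm (A - B)" for A B :: "real^'n^'n"
  proof (rule onorm_bound)
    show "norm (A *v v) \<le> (onorm ((*v) B) + norm (A - B)) * norm v" for v
    proof -
      have "A *v v = B *v v + (A - B) *v v" by (simp add: matrix_vector_mult_diff_rdistrib)
      then have "norm (A *v v) \<le> norm (B *v v) + norm ((A - B) *v v)" by (metis norm_triangle_ineq)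
      also have "\<dots> \<le> onorm ((*v) B) * norm v + norm (A - B) * norm v"
        by (intro add_mono onorm norm_mv_le) simp
      finally show ?thesis by (simp add: distrib_right)
    qed
    show "0 \<le> onorm ((*v) B) + norm (A - B)" using onorm_pos_le[of "(*v) B"] by simp
  qed
  show "1-lipschitz_on UNIV (\<lambda>A::real^'n^'n. onorm ((*v) A))"
  proof (rule lipschitz_onI)
    fix A B :: "real^'n^'n"
    show "dist (onorm ((*v) A)) (onorm ((*v) B)) \<le> 1 * dist A B"
      using le[of A B] le[of B A] by (simp add: dist_real_def dist_norm norm_minus_commute abs_le_iff)
  qed simp
qed

lemma sigma_max_measurable:
  fixes G :: "real^'n \<Rightarrow> real^'n^'n"
  assumes n: "CARD('n) \<ge> 2" and [measurable]: "G \<in> borel_measurable borel"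
  shows "sigma_max G \<in> borel_measurable borel"
proof -
  have [measurable]: "(\<lambda>x::real^'n. (x /\<^sub>R norm x) $ i) \<in> borel_measurable borel" for i
    by measurable
  have "(\<lambda>x. G x ** PT' x) \<in> borel_measurable borel"
  proof (rule borel_measurable_matrixI)
    fix i j
    have "(\<lambda>x. \<Sum>k\<in>UNIV. G x $ i $ k * ((if k = j then 1 else 0) - (x /\<^sub>R norm x) $ k * (x /\<^sub>R norm x) $ j)) \<in> borel_measurable borel"
      by measurable
    then show "(\<lambda>x. (G x ** PT' x) $ i $ j) \<in> borel_measurable borel"
      by (simp add: matrix_matrix_mult_def PT'_def PT_def mat_def)
  qed
  then have "(\<lambda>x. onorm ((*v) (G x ** PT' x))) \<in> borel_measurable borel"
    by (rule measurable_compose) (rule borel_measurable_continuous_onI[OF continuous_onorm])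
  then show ?thesis by (simp add: sigma_max_onorm[OF n, abs_def])
qed

text \<open>In the last claim the j-th column is the image of the projected basis vector, whose
  squared length is 1 - x_j^2, and these add up to n - 1. The constant has to be sharp: it is
  matched against the first eigenvalue of the sphere.\<close>

lemma sigma_max_facts:
  fixes G :: "real^'n \<Rightarrow> real^'n^'n"
  assumes n: "CARD('n) \<ge> 2" and x: "norm x = 1"
  shows "norm ((G x ** PT x) *v v) \<le> sigma_max G x * norm v" "sigma_max G x \<ge> 0" "sigma_max G x \<le> norm (G x ** PT x)"
    "(norm (G x ** PT x))\<^sup>2 \<le> (real CARD('n) - 1) * (sigma_max G x)\<^sup>2"
proof -
  let ?H = "G x ** PT x"
  have s: "sigma_max G x = onorm ((*v) ?H)" using x by (simp add: sigma_max_onorm[OF n] PT'_def)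
  show 1: "norm (?H *v v) \<le> sigma_max G x * norm v" for v unfolding s by (rule onorm) simp
  show "sigma_max G x \<ge> 0" unfolding s by (rule onorm_pos_le) simp
  show "sigma_max G x \<le> norm ?H" unfolding s by (rule onorm_bound[OF norm_ge_zero norm_mv_le])
  have HP: "?H *v v = ?H *v (PT x *v v)" for v
    by (simp add: matrix_vector_mul_assoc[symmetric] PT_norm(4)[OF x])
  have "(norm ?H)\<^sup>2 \<le> (\<Sum>j\<in>UNIV. (sigma_max G x)\<^sup>2 * (1 - (x $ j)\<^sup>2))"
    unfolding norm_matrix_sq_columns
  proof (rule sum_mono)
    fix j
    have "(norm (?H *v axis j 1))\<^sup>2 \<le> (sigma_max G x * norm (PT x *v axis j 1))\<^sup>2"
      using 1[of "PT x *v axis j 1"] by (subst HP) (rule power_mono, auto)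
    then show "(norm (?H *v axis j 1))\<^sup>2 \<le> (sigma_max G x)\<^sup>2 * (1 - (x $ j)\<^sup>2)"
      by (simp add: power_mult_distrib PT_norm(1)[OF x] inner_axis)
  qed
  also have "\<dots> = (sigma_max G x)\<^sup>2 * (real CARD('n) - (\<Sum>j\<in>UNIV. (x $ j)\<^sup>2))"
    by (simp add: sum_distrib_left[symmetric] sum_subtractf)
  also have "(\<Sum>j\<in>UNIV. (x $ j)\<^sup>2) = 1" using x by (simp add: norm_eq_1 inner_vec_def power2_eq_square)
  finally show "(norm ?H)\<^sup>2 \<le> (real CARD('n) - 1) * (sigma_max G x)\<^sup>2" by (simp add: mult.commute)
qed

section \<open>Reflections and the polar decomposition\<close>

lemma scaleR_outer_mv: "(c *\<^sub>R outer u w) *v x = (c * (w \<bullet> x)) *\<^sub>R u"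
  by (simp add: vec_eq_iff outer_def matrix_vector_mult_def inner_vec_def sum_distrib_left sum_distrib_right mult_ac)

text \<open>For \<open>u = 0\<close> the quotient is 0 and the matrix is the identity, so
  orthogonality holds without a side condition.\<close>

definition refl_mat :: "real^'n \<Rightarrow> real^'n^'n" where
  "refl_mat u = mat 1 - (2 / (u \<bullet> u)) *\<^sub>R outer u u"

lemma refl_mat_mv: "refl_mat u *v x = x - (2 * (u \<bullet> x) / (u \<bullet> u)) *\<^sub>R u"
  unfolding refl_mat_def matrix_vector_mult_diff_rdistrib scaleR_outer_mv by simp

lemma orthogonal_refl_mat: "orthogonal_matrix (refl_mat u)"
proof (cases "u = 0")
  case True
  then show ?thesis by (simp add: refl_mat_def orthogonal_matrix_id)
next
  case False
  have "transpose (refl_mat u) = refl_mat u"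
    by (simp add: vec_eq_iff transpose_def refl_mat_def outer_def mat_def mult.commute)
  moreover have "refl_mat u ** refl_mat u = mat 1"
    unfolding matrix_eq
  proof
    fix x
    define a where "a = 2 * (u \<bullet> x) / (u \<bullet> u)"
    have "a * (u \<bullet> u) = 2 * (u \<bullet> x)" using False by (simp add: a_def)
    then have "u \<bullet> (x - a *\<^sub>R u) = - (u \<bullet> x)" by (simp only: inner_diff_right inner_scaleR_right)
    then have "(refl_mat u ** refl_mat u) *v x = x - a *\<^sub>R u - (2 * (- (u \<bullet> x)) / (u \<bullet> u)) *\<^sub>R u"
      by (simp only: matrix_vector_mul_assoc[symmetric] refl_mat_mv a_def)
    then show "(refl_mat u ** refl_mat u) *v x = mat 1 *v x" by (simp add: a_def)
  qed
  ultimately show ?thesis by (simp add: orthogonal_matrix)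
qed

lemma refl_mat_inner: "refl_mat u \<bullet> B = mat 1 \<bullet> B - 2 / (u \<bullet> u) * (u \<bullet> (B *v u))"
  unfolding refl_mat_def inner_diff_left inner_scaleR_left outer_inner ..

text \<open>Two reflections compose to a rotation in the plane of \<open>w\<close> and
  \<open>v\<close>. The formula is used with \<open>w\<close> close to \<open>v\<close>, where this
  rotation is close to the identity.\<close>

lemma refl_mat2_inner:
  "(refl_mat w ** refl_mat v) \<bullet> B = mat 1 \<bullet> B - 2 / (w \<bullet> w) * (w \<bullet> (B *v w)) - 2 / (v \<bullet> v) * (v \<bullet> (B *v v))
     + 4 * (w \<bullet> v) / ((w \<bullet> w) * (v \<bullet> v)) * (w \<bullet> (B *v v))"
proof -
  have "refl_mat w ** refl_mat v = mat 1 - (2 / (w \<bullet> w)) *\<^sub>R outer w w - (2 / (v \<bullet> v)) *\<^sub>R outer v v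
     + (4 * (w \<bullet> v) / ((w \<bullet> w) * (v \<bullet> v))) *\<^sub>R outer w v"
    unfolding matrix_eq
  proof
    fix x
    define a where "a = 2 * (v \<bullet> x) / (v \<bullet> v)"
    have c: "2 * (w \<bullet> x - a * (w \<bullet> v)) / (w \<bullet> w) = 2 / (w \<bullet> w) * (w \<bullet> x) - 4 * (w \<bullet> v) / ((w \<bullet> w) * (v \<bullet> v)) * (v \<bullet> x)"
      by (simp add: a_def diff_divide_distrib right_diff_distrib mult_ac)
    have "(refl_mat w ** refl_mat v) *v x = x - a *\<^sub>R v - (2 * (w \<bullet> x - a * (w \<bullet> v)) / (w \<bullet> w)) *\<^sub>R w"
      unfolding matrix_vector_mul_assoc[symmetric] refl_mat_mv a_def inner_diff_right inner_scaleR_right ..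
    also have "\<dots> = x - (2 / (w \<bullet> w) * (w \<bullet> x)) *\<^sub>R w - a *\<^sub>R v + (4 * (w \<bullet> v) / ((w \<bullet> w) * (v \<bullet> v)) * (v \<bullet> x)) *\<^sub>R w"
      unfolding c scaleR_diff_left by (simp only: diff_diff_eq2 algebra_simps)
    also have "a = 2 / (v \<bullet> v) * (v \<bullet> x)" by (simp add: a_def)
    finally show "(refl_mat w ** refl_mat v) *v x = (mat 1 - (2 / (w \<bullet> w)) *\<^sub>R outer w w - (2 / (v \<bullet> v)) *\<^sub>R outer v v
      + (4 * (w \<bullet> v) / ((w \<bullet> w) * (v \<bullet> v))) *\<^sub>R outer w v) *v x"
      unfolding matrix_vector_mult_diff_rdistrib matrix_vector_mult_add_rdistrib scaleR_outer_mv matrix_vector_mul_lid .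
  qed
  then show ?thesis by (simp only: inner_diff_left inner_add_left inner_scaleR_left outer_inner)
qed

text \<open>The maximiser of \<open>Q \<mapsto> tr (Q\<^sup>t A)\<close> on the orthogonal group; comparing it with its products with one and
  two reflections shows that \<open>Q\<^sup>t A\<close> is positive semidefinite and symmetric.\<close>

lemma polar_factor:
  fixes A :: "real^'n^'n"
  obtains Q where "orthogonal_matrix Q" "\<And>v. v \<bullet> ((transpose Q ** A) *v v) \<ge> 0" "transpose (transpose Q ** A) = transpose Q ** A"
proof -
  let ?O = "{Q::real^'n^'n. transpose Q ** Q = mat 1}"
  have cont: "continuous_on UNIV (\<lambda>Q::real^'n^'n. transpose Q ** Q)"
    unfolding matrix_matrix_mult_def transpose_def
    by (intro continuous_on_vec_lambda continuous_intros)
  have "closed ?O" by (rule closed_Collect_eq[OF cont continuous_on_const])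
  moreover have "bounded ?O"
  proof (rule boundedI)
    fix Q :: "real^'n^'n" assume "Q \<in> ?O"
    then have "norm (Q ** mat 1) = norm (mat 1 :: real^'n^'n)" by (intro norm_orthogonal_mult) (simp add: orthogonal_matrix)
    then show "norm Q \<le> norm (mat 1 :: real^'n^'n)" by simp
  qed
  ultimately have "compact ?O" by (simp add: compact_eq_bounded_closed)
  moreover have "?O \<noteq> {}" using orthogonal_matrix_id by (auto simp: orthogonal_matrix intro!: exI[of _ "mat 1"])
  moreover have "continuous_on ?O (\<lambda>Q. Q \<bullet> A)" by (intro continuous_intros)
  ultimately obtain Q where Q: "Q \<in> ?O" "\<And>R. R \<in> ?O \<Longrightarrow> R \<bullet> A \<le> Q \<bullet> A"
    using continuous_attains_sup[of ?O "\<lambda>Q. Q \<bullet> A"] by blast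
  have oQ: "orthogonal_matrix Q" using Q(1) by (simp add: orthogonal_matrix)
  define B where "B = transpose Q ** A"
  have max: "R \<bullet> B \<le> mat 1 \<bullet> B" if "orthogonal_matrix R" for R
  proof -
    have "orthogonal_matrix (Q ** R)" by (rule orthogonal_matrix_mul[OF oQ that])
    then have "(Q ** R) \<bullet> A \<le> (Q ** mat 1) \<bullet> A" using Q(2)[of "Q ** R"] by (simp add: orthogonal_matrix)
    then show ?thesis unfolding inner_matrix_mult B_def .
  qed
  have psd: "v \<bullet> (B *v v) \<ge> 0" for v
  proof (cases "v = 0")
    case False
    have "0 \<le> 2 / (v \<bullet> v) * (v \<bullet> (B *v v))" using max[OF orthogonal_refl_mat[of v]] unfolding refl_mat_inner by simp
    moreover have "v \<bullet> v > 0" using False by simp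
    ultimately show ?thesis by (simp add: zero_le_divide_iff not_le[symmetric])
  qed simp
  have le: "z \<bullet> (B *v v) \<le> v \<bullet> (B *v z)" if vz: "v \<bullet> v = 1" "z \<bullet> z = 1" "v \<bullet> z = 0" for v z
  proof (rule ccontr)
    assume neg: "\<not> z \<bullet> (B *v v) \<le> v \<bullet> (B *v z)"
    define a where "a = z \<bullet> (B *v v) - v \<bullet> (B *v z)"
    define c where "c = z \<bullet> (B *v z) + v \<bullet> (B *v v)"
    have a: "a > 0" using neg by (simp add: a_def)
    have c: "c \<ge> 0" using psd by (simp add: c_def)
    have ineq: "a \<le> t * c" if t: "t > 0" for t
    proof -
      \<comment> \<open>For small t the composition is a rotation by a small angle. In the
        comparison with the identity the terms of order zero cancel, those of order one leave the
        antisymmetric part \<open>a\<close>, and those of order two leave \<open>c\<close>.\<close>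
      define w where "w = v + t *\<^sub>R z"
      have zv: "z \<bullet> v = 0" using vz by (simp add: inner_commute)
      have ww: "w \<bullet> w = 1 + t\<^sup>2" "w \<bullet> v = 1"
        using vz zv by (auto simp: w_def inner_add_left inner_add_right power2_eq_square)
      have p: "1 + t\<^sup>2 > 0" by (simp add: add_pos_nonneg)
      have "(refl_mat w ** refl_mat v) \<bullet> B \<le> mat 1 \<bullet> B"
        by (rule max[OF orthogonal_matrix_mul[OF orthogonal_refl_mat orthogonal_refl_mat]])
      then have main: "4 / (1 + t\<^sup>2) * (w \<bullet> (B *v v)) \<le> 2 / (1 + t\<^sup>2) * (w \<bullet> (B *v w)) + 2 * (v \<bullet> (B *v v))"
        unfolding refl_mat2_inner ww vz by simp
      have "4 * (w \<bullet> (B *v v)) \<le> 2 * (w \<bullet> (B *v w)) + 2 * (v \<bullet> (B *v v)) * (1 + t\<^sup>2)"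
      proof -
        have "4 * X \<le> 2 * Y + 2 * Z * q" if "4 / q * X \<le> 2 / q * Y + 2 * Z" "q > 0" for q X Y Z :: real
          using mult_left_mono[OF that(1), of q] that(2) by (simp add: distrib_left mult_ac)
        then show ?thesis using main p by blast
      qed
      moreover have "w \<bullet> (B *v v) = v \<bullet> (B *v v) + t * (z \<bullet> (B *v v))" by (simp add: w_def inner_add_left)
      moreover have "w \<bullet> (B *v w) = v \<bullet> (B *v v) + t * (v \<bullet> (B *v z)) + t * (z \<bullet> (B *v v)) + t\<^sup>2 * (z \<bullet> (B *v z))"
        by (simp add: w_def inner_add_left matrix_vector_right_distrib matrix_vector_mult_scaleR inner_add_right power2_eq_square algebra_simps)
      ultimately have "t * a \<le> t * (t * c)"
        by (simp add: a_def c_def power2_eq_square algebra_simps)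
      then show ?thesis using t by simp
    qed
    \<comment> \<open>Any t with t c < a contradicts \<open>ineq\<close>; the summand 1 in the
      denominator covers the case c = 0.\<close>
    have "a \<le> a / (2 * (c + 1)) * c" by (rule ineq) (use a c in simp)
    also have "\<dots> < a"
    proof -
      have "a * c < a * (2 * (c + 1))" using a c by (intro mult_strict_left_mono) auto
      then show ?thesis using c by (simp add: divide_simps mult.commute)
    qed
    finally show False by simp
  qed
  have "B $ i $ j = B $ j $ i" for i j
  proof (cases "i = j")
    case False
    have e: "axis i 1 \<bullet> (B *v axis j 1) = B $ i $ j" for i j
      by (simp add: matrix_vector_mult_basis inner_axis' column_def)
    show ?thesis using le[of "axis i 1" "axis j 1"] le[of "axis j 1" "axis i 1"] False
      by (simp add: e inner_axis_axis)
  qed simp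
  then have "transpose B = B" by (simp add: vec_eq_iff transpose_def)
  then show ?thesis using that[OF oQ] psd by (simp add: B_def)
qed

text \<open>In the polar decomposition A = Q B one has A^t A - 1 = B^2 - 1 = (B - 1) (B + 1), and B
  + 1 does not shorten any vector because B is positive semidefinite.\<close>

lemma near_orthogonal:
  fixes A :: "real^'n^'n"
  obtains Q where "orthogonal_matrix Q" "norm (A - Q) \<le> norm (transpose A ** A - mat 1)"
proof -
  obtain Q where Q: "orthogonal_matrix Q" "\<And>v. v \<bullet> ((transpose Q ** A) *v v) \<ge> 0" "transpose (transpose Q ** A) = transpose Q ** A"
    by (rule polar_factor[of A]) blast
  define B where "B = transpose Q ** A"
  have QQ: "Q ** transpose Q = mat 1" "transpose Q ** Q = mat 1" using Q(1) by (auto simp: orthogonal_matrix_def)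
  have A: "A = Q ** B" by (simp add: B_def matrix_mul_assoc QQ)
  have sym: "transpose B = B" using Q(3) by (simp add: B_def)
  have "transpose A ** A = B ** B"
  proof -
    have "transpose (Q ** B) ** (Q ** B) = transpose B ** (transpose Q ** Q) ** B"
      by (simp only: matrix_transpose_mul matrix_mul_assoc)
    then show ?thesis unfolding A[symmetric] QQ(2) sym by simp
  qed
  then have f: "transpose A ** A - mat 1 = (B - mat 1) ** (B + mat 1)"
    by (simp add: matrix_eq matrix_vector_mul_assoc[symmetric] matrix_vector_mult_add_rdistrib
        matrix_vector_mult_diff_rdistrib matrix_vector_right_distrib)
  have "Q ** B - Q = Q ** (B - mat 1)"
    by (simp add: matrix_eq matrix_vector_mul_assoc[symmetric] matrix_vector_mult_diff_rdistrib matrix_vector_mult_diff_distrib)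
  then have "norm (A - Q) = norm (Q ** (B - mat 1))" unfolding A[symmetric] by simp
  also have "\<dots> = norm (B - mat 1)" by (rule norm_orthogonal_mult[OF Q(1)])
  also have "\<dots> \<le> norm ((B - mat 1) ** (B + mat 1))"
  proof (rule power2_le_imp_le)
    have row: "((B - mat 1) ** (B + mat 1)) $ i = (B + mat 1) *v ((B - mat 1) $ i)" for i
    proof -
      have tr: "transpose (B + mat 1) = B + mat 1"
        using sym by (simp add: vec_eq_iff transpose_def mat_def eq_commute)
      have "(B + mat 1) $ k $ j = (B + mat 1) $ j $ k" for j k
        using arg_cong[OF tr, of "\<lambda>M. M $ j $ k"] by (simp add: transpose_def)
      then show ?thesis by (simp add: vec_eq_iff matrix_matrix_mult_def matrix_vector_mult_def mult.commute)
    qed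
    have big: "(norm v)\<^sup>2 \<le> (norm ((B + mat 1) *v v))\<^sup>2" for v
    proof -
      have "(B + mat 1) *v v = B *v v + v" by (simp add: matrix_vector_mult_add_rdistrib)
      then have "(norm ((B + mat 1) *v v))\<^sup>2 = (norm (B *v v))\<^sup>2 + 2 * (v \<bullet> (B *v v)) + (norm v)\<^sup>2"
        unfolding power2_norm_eq_inner by (simp add: inner_add_left inner_add_right inner_commute)
      then show ?thesis using Q(2)[of v] by (simp add: B_def)
    qed
    show "(norm (B - mat 1))\<^sup>2 \<le> (norm ((B - mat 1) ** (B + mat 1)))\<^sup>2"
      unfolding norm_matrix_sq_rows row by (rule sum_mono) (rule big)
  qed simp
  finally show ?thesis using that[OF Q(1)] by (simp add: f)
qed

section \<open>The deficit in the Poincare inequality\<close>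

lemma sphere_Cauchy_Schwarz:
  fixes f g :: "real^'n \<Rightarrow> real"
  assumes f: "integrable sphere_meas (\<lambda>x. (f x)\<^sup>2)" and g: "integrable sphere_meas (\<lambda>x. (g x)\<^sup>2)"
    and m: "f \<in> borel_measurable borel" "g \<in> borel_measurable borel"
  shows "integrable sphere_meas (\<lambda>x. f x * g x)"
    and "(\<integral>x. f x * g x \<partial>sphere_meas) \<le> sqrt (\<integral>x. (f x)\<^sup>2 \<partial>sphere_meas) * sqrt (\<integral>x. (g x)\<^sup>2 \<partial>sphere_meas)"
proof -
  have young: "\<bar>f x * g x\<bar> \<le> ((f x)\<^sup>2 + (g x)\<^sup>2) / 2" for x
    using sum_squares_bound[of "\<bar>f x\<bar>" "\<bar>g x\<bar>"] by (simp add: abs_mult)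
  show i: "integrable sphere_meas (\<lambda>x. f x * g x)"
    by (rule sphere_integrable_bound[of "\<lambda>x. ((f x)\<^sup>2 + (g x)\<^sup>2) / 2"]) (use f g m young in auto)
  define a where "a = (\<integral>x. (f x)\<^sup>2 \<partial>sphere_meas)"
  define b where "b = (\<integral>x. (g x)\<^sup>2 \<partial>sphere_meas)"
  define c where "c = (\<integral>x. f x * g x \<partial>sphere_meas)"
  have ab: "a \<ge> 0" "b \<ge> 0" by (auto simp: a_def b_def)
  have q: "2 * t * c \<le> a + t\<^sup>2 * b" for t
  proof -
    have e: "(f x - t * g x)\<^sup>2 = (f x)\<^sup>2 + t\<^sup>2 * (g x)\<^sup>2 - 2 * t * (f x * g x)" for x
      by (simp add: power2_diff power_mult_distrib)
    have "0 \<le> (\<integral>x. (f x - t * g x)\<^sup>2 \<partial>sphere_meas)" by simp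
    also have "\<dots> = a + t\<^sup>2 * b - 2 * t * c"
      unfolding e a_def b_def c_def using f g i by simp
    finally show ?thesis by simp
  qed
  have "c\<^sup>2 \<le> a * b"
  proof (cases "b = 0")
    case True
    have "c = 0"
    proof (rule ccontr)
      assume "c \<noteq> 0"
      then have "2 * ((a + 1) / (2 * c)) * c = a + 1" by simp
      then show False using q[of "(a + 1) / (2 * c)"] True by simp
    qed
    then show ?thesis using ab by simp
  next
    case False
    then have "b > 0" using ab by simp
    have "2 * (c / b) * c \<le> a + (c / b)\<^sup>2 * b" by (rule q)
    then have "c\<^sup>2 / b \<le> a" using \<open>b > 0\<close> by (simp add: power2_eq_square)
    then show ?thesis using \<open>b > 0\<close> by (simp add: pos_divide_le_eq)
  qed
  then have "\<bar>c\<bar> \<le> sqrt (a * b)" by (metis real_sqrt_abs real_sqrt_le_iff)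
  then have "c \<le> sqrt a * sqrt b" by (simp add: real_sqrt_mult)
  then show "(\<integral>x. f x * g x \<partial>sphere_meas) \<le> sqrt (\<integral>x. (f x)\<^sup>2 \<partial>sphere_meas) * sqrt (\<integral>x. (g x)\<^sup>2 \<partial>sphere_meas)"
    by (simp add: a_def b_def c_def)
qed

lemma integral_le_sqrt_integral_sq:
  fixes f :: "real^'n \<Rightarrow> real"
  assumes "integrable sphere_meas (\<lambda>x. (f x)\<^sup>2)" "f \<in> borel_measurable borel"
  shows "integrable sphere_meas f" "(\<integral>x. f x \<partial>sphere_meas) \<le> sqrt (\<integral>x. (f x)\<^sup>2 \<partial>sphere_meas)"
  using sphere_Cauchy_Schwarz[of f "\<lambda>_. 1"] assms by (simp_all add: sphere.prob_space[unfolded space_sphere_meas])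

lemma wgrad_integrable:
  fixes f :: "real^'n \<Rightarrow> real"
  assumes w: "wgrad f h" and X: "C1_map X X'"
  shows "integrable sphere_meas (\<lambda>x. h x \<bullet> X x)" "integrable sphere_meas (\<lambda>x. f x * tdiv X' x)"
proof -
  have [measurable]: "h \<in> borel_measurable borel" and hi: "integrable sphere_meas (\<lambda>x. norm (h x))"
    and f: "integrable sphere_meas f" using w by (auto simp: wgrad_def)
  have Xc: "continuous_on UNIV X" by (rule C1_map_continuous[OF X])
  have [measurable]: "X \<in> borel_measurable borel" by (rule borel_measurable_continuous_onI[OF Xc])
  have "integrable sphere_meas (\<lambda>x. norm (h x) * norm (X x))"
    by (rule integrable_sphere_mult_continuous[OF hi]) (intro continuous_on_norm Xc)
  then show "integrable sphere_meas (\<lambda>x. h x \<bullet> X x)"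
    by (rule sphere_integrable_bound) (simp_all add: Cauchy_Schwarz_ineq2)
  have "continuous_on UNIV (tdiv X')" unfolding tdiv_def[abs_def]
    by (intro continuous_intros C1_map_continuous_deriv[OF X])
  then show "integrable sphere_meas (\<lambda>x. f x * tdiv X' x)" by (rule integrable_sphere_mult_continuous[OF f])
qed

lemma wgrad_add:
  fixes f :: "real^'n \<Rightarrow> real"
  assumes w: "wgrad f h" "wgrad f' h'"
  shows "wgrad (\<lambda>x. f x + a * f' x) (\<lambda>x. h x + a *\<^sub>R h' x)"
  unfolding wgrad_def
proof (intro conjI allI impI)
  have [measurable]: "f \<in> borel_measurable borel" "f' \<in> borel_measurable borel" "h \<in> borel_measurable borel" "h' \<in> borel_measurable borel"
    and i: "integrable sphere_meas f" "integrable sphere_meas f'" "integrable sphere_meas (\<lambda>x. norm (h x))" "integrable sphere_meas (\<lambda>x. norm (h' x))"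
    using w by (auto simp: wgrad_def)
  show "(\<lambda>x. f x + a * f' x) \<in> borel_measurable borel" "(\<lambda>x. h x + a *\<^sub>R h' x) \<in> borel_measurable borel" by measurable
  show "integrable sphere_meas (\<lambda>x. f x + a * f' x)" using i by simp
  show "integrable sphere_meas (\<lambda>x. norm (h x + a *\<^sub>R h' x))"
  proof (rule sphere_integrable_bound[of "\<lambda>x. norm (h x) + \<bar>a\<bar> * norm (h' x)"])
    show "\<bar>norm (h x + a *\<^sub>R h' x)\<bar> \<le> norm (h x) + \<bar>a\<bar> * norm (h' x)" for x
      using norm_triangle_ineq[of "h x" "a *\<^sub>R h' x"] by simp
  qed (use i in auto)
  fix X :: "real^'n \<Rightarrow> real^'n" and X' assume "C1_map X X' \<and> (\<forall>x. x \<bullet> X x = 0)"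
  then have X: "C1_map X X'" "\<forall>x. x \<bullet> X x = 0" by auto
  note J = wgrad_integrable[OF w(1) X(1)] wgrad_integrable[OF w(2) X(1)]
  have "(\<integral>x. h x \<bullet> X x \<partial>sphere_meas) = - (\<integral>x. f x * tdiv X' x \<partial>sphere_meas)"
    "(\<integral>x. h' x \<bullet> X x \<partial>sphere_meas) = - (\<integral>x. f' x * tdiv X' x \<partial>sphere_meas)"
    using w X unfolding wgrad_def by blast+
  then show "(\<integral>x. (h x + a *\<^sub>R h' x) \<bullet> X x \<partial>sphere_meas) = - (\<integral>x. (f x + a * f' x) * tdiv X' x \<partial>sphere_meas)"
    using J by (simp add: inner_add_left distrib_right mult.assoc)
qed

lemma wgrad_cong_AE:
  fixes f :: "real^'n \<Rightarrow> real"
  assumes w: "wgrad f h" and m: "f' \<in> borel_measurable borel" and ae: "AE x in sphere_meas. f x = f' x"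
  shows "wgrad f' h"
proof -
  have [measurable]: "f \<in> borel_measurable borel" and f: "integrable sphere_meas f" using w by (auto simp: wgrad_def)
  note m [measurable]
  have "integrable sphere_meas f'" using f by (rule Bochner_Integration.integrable_cong_AE_imp) (use ae in auto)
  moreover have "(\<integral>x. f' x * tdiv X' x \<partial>sphere_meas) = (\<integral>x. f x * tdiv X' x \<partial>sphere_meas)" if X: "C1_map X X'" for X :: "real^'n \<Rightarrow> real^'n" and X'
  proof (rule integral_cong_AE)
    have "continuous_on UNIV (tdiv X')" unfolding tdiv_def[abs_def]
      by (intro continuous_intros C1_map_continuous_deriv[OF X])
    then have [measurable]: "tdiv X' \<in> borel_measurable borel" by (rule borel_measurable_continuous_onI)
    show "(\<lambda>x. f' x * tdiv X' x) \<in> borel_measurable sphere_meas" "(\<lambda>x. f x * tdiv X' x) \<in> borel_measurable sphere_meas" by measurable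
  qed (use ae in \<open>auto elim: eventually_mono\<close>)
  ultimately show ?thesis using w m unfolding wgrad_def by metis
qed

lemma wgrad_tangential:
  fixes f :: "real^'n \<Rightarrow> real"
  assumes w: "wgrad f h"
  shows "wgrad f (\<lambda>x. PT x *v h x)"
proof -
  have [measurable]: "h \<in> borel_measurable borel" and hi: "integrable sphere_meas (\<lambda>x. norm (h x))" using w by (auto simp: wgrad_def)
  have m: "(\<lambda>x. PT x *v h x) \<in> borel_measurable borel" unfolding PT_mv by measurable
  have "integrable sphere_meas (\<lambda>x. norm (PT x *v h x))"
    by (rule sphere_integrable_bound[OF hi]) (use m PT_norm_le in auto)
  moreover have "(PT x *v h x) \<bullet> X x = h x \<bullet> X x" if "\<forall>x. x \<bullet> X x = 0" for X :: "real^'n \<Rightarrow> real^'n" and x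
    using that by (simp add: PT_mv inner_diff_left)
  ultimately show ?thesis using w m unfolding wgrad_def by simp
qed

text \<open>The vector \<open>a\<close> gives the L^2 projection of \<open>f\<close> on the linear
  functions; the factor n inverts the second moment |z|^2 / n. Both identities are Pythagoras'
  theorem. For the gradients the cross term is found by integration by parts, a linear function
  being an eigenfunction for n - 1. The remainder is orthogonal to constants and linear functions,
  so \<open>poincare_gap\<close> applies to it.\<close>

lemma scalar_deficit:
  fixes f :: "real^'n \<Rightarrow> real"
  assumes n: "CARD('n) \<ge> 2" and w: "wgrad f h" and tan: "\<And>x. norm x = 1 \<Longrightarrow> h x \<bullet> x = 0"
    and int: "integrable sphere_meas (\<lambda>x. (norm (h x))\<^sup>2)" and bd: "sbdd f" and o0: "(\<integral>x. f x \<partial>sphere_meas) = 0"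
    and a: "a = (\<chi> j. real CARD('n) * (\<integral>x. f x * x $ j \<partial>sphere_meas))"
  shows "(\<integral>x. (norm (h x))\<^sup>2 \<partial>sphere_meas) = (\<integral>x. (norm (h x - PT x *v a))\<^sup>2 \<partial>sphere_meas) + (real CARD('n) - 1) * ((a \<bullet> a) / real CARD('n))"
    and "(\<integral>x. (f x)\<^sup>2 \<partial>sphere_meas) = (\<integral>x. (f x - a \<bullet> x)\<^sup>2 \<partial>sphere_meas) + (a \<bullet> a) / real CARD('n)"
    and "2 * real CARD('n) * (\<integral>x. (f x - a \<bullet> x)\<^sup>2 \<partial>sphere_meas) \<le> (\<integral>x. (norm (h x - PT x *v a))\<^sup>2 \<partial>sphere_meas)"
    and "integrable sphere_meas (\<lambda>x. (norm (h x - PT x *v a))\<^sup>2)"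
proof -
  let ?N = "real CARD('n)"
  have N: "?N > 0" using n by simp
  have [measurable]: "f \<in> borel_measurable borel" "h \<in> borel_measurable borel" and f: "integrable sphere_meas f" using w by (auto simp: wgrad_def)
  have fl: "integrable sphere_meas (\<lambda>x. f x * (x \<bullet> z))" for z
    by (rule integrable_sphere_mult_continuous[OF f]) (intro continuous_intros)
  have fz: "(\<integral>x. f x * (x \<bullet> z) \<partial>sphere_meas) = (a \<bullet> z) / ?N" for z
  proof -
    have "(\<integral>x. f x * (x \<bullet> z) \<partial>sphere_meas) = (\<integral>x. (\<Sum>j\<in>UNIV. f x * x $ j * z $ j) \<partial>sphere_meas)"
      by (simp add: inner_vec_def sum_distrib_left mult.assoc)
    also have "\<dots> = (\<Sum>j\<in>UNIV. \<integral>x. f x * x $ j * z $ j \<partial>sphere_meas)"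
      by (rule Bochner_Integration.integral_sum, rule integrable_mult_left, rule integrable_sphere_mult_continuous[OF f])
         (intro continuous_intros)
    also have "\<dots> = (a \<bullet> z) / ?N" using N by (simp add: a inner_vec_def sum_divide_distrib)
    finally show ?thesis .
  qed
  have PTm: "(\<lambda>x. PT x *v a) \<in> borel_measurable borel" unfolding PT_mv by measurable
  note PTm [measurable]
  have linC: "C1_map (\<lambda>x. a \<bullet> x) (\<lambda>x v. 1 * (a \<bullet> v))" by (rule ridge_C1) auto
  have lin: "wgrad (\<lambda>x. a \<bullet> x) (\<lambda>x. PT x *v a)"
  proof -
    have "(\<chi> j. 1 * (a \<bullet> axis j 1)) - (1 * (a \<bullet> x)) *\<^sub>R x = PT x *v a" for x
      by (simp add: PT_mv vec_eq_iff inner_axis inner_commute)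
    then show ?thesis using wgrad_C1[OF linC] by simp
  qed
  have D: "wgrad (\<lambda>x. f x - a \<bullet> x) (\<lambda>x. h x - PT x *v a)"
    using wgrad_add[OF w lin, of "- 1"] by simp
  have PTn: "(norm (PT x *v a))\<^sup>2 \<le> (norm a)\<^sup>2" if "norm x = 1" for x
    using PT_norm_le[OF that, of a] by (intro power_mono) auto
  show Di: "integrable sphere_meas (\<lambda>x. (norm (h x - PT x *v a))\<^sup>2)"
  proof (rule sphere_integrable_bound[of "\<lambda>x. 2 * (norm (h x))\<^sup>2 + 2 * (norm a)\<^sup>2"])
    show "\<bar>(norm (h x - PT x *v a))\<^sup>2\<bar> \<le> 2 * (norm (h x))\<^sup>2 + 2 * (norm a)\<^sup>2" if "norm x = 1" for x
    proof -
      have "(norm (h x - PT x *v a))\<^sup>2 \<le> (norm (h x) + norm (PT x *v a))\<^sup>2" by (intro power_mono norm_triangle_ineq4) auto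
      also have "\<dots> \<le> 2 * (norm (h x))\<^sup>2 + 2 * (norm (PT x *v a))\<^sup>2"
        using sum_squares_bound[of "norm (h x)" "norm (PT x *v a)"] by (simp add: power2_sum)
      finally show ?thesis unfolding abs_power2 using PTn[OF that] by linarith
    qed
  qed (use int in auto)
  have ax: "sbdd (\<lambda>x. a \<bullet> x)" by (intro sbdd_continuous continuous_intros)
  show "2 * ?N * (\<integral>x. (f x - a \<bullet> x)\<^sup>2 \<partial>sphere_meas) \<le> (\<integral>x. (norm (h x - PT x *v a))\<^sup>2 \<partial>sphere_meas)"
  proof (rule poincare_gap[OF n D _ Di sbdd_diff[OF bd ax]])
    show "(h x - PT x *v a) \<bullet> x = 0" if "norm x = 1" for x
      unfolding inner_diff_left using tan[OF that] PT_norm(3)[OF that, of a] by (simp add: inner_commute[of "PT x *v a"])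
    have "(\<integral>x. a \<bullet> x \<partial>sphere_meas) = 0"
    proof -
      have "(\<integral>x. (0 \<bullet> a - (0 \<bullet> x) * (x \<bullet> a)) * 1 \<partial>sphere_meas) = - (\<integral>x. 1 * ((a \<bullet> a - (x \<bullet> a)\<^sup>2) * 0 - (?N - 1) * (x \<bullet> a) * 1) \<partial>sphere_meas)"
        by (rule wgrad_ridge[OF wgrad_const]) auto
      then show ?thesis using n by (simp add: inner_commute)
    qed
    then show "(\<integral>x. f x - a \<bullet> x \<partial>sphere_meas) = 0" using f sbdd_integrable[OF ax] o0 by simp
    show "(\<integral>x. (f x - a \<bullet> x) * (x \<bullet> z) \<partial>sphere_meas) = 0" for z
    proof -
      have "integrable sphere_meas (\<lambda>x. (x \<bullet> a) * (x \<bullet> z))"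
        by (rule integrable_sphere_continuous) (intro continuous_intros)
      then show ?thesis using fl[of z] fz[of z] sphere_moment2[of a z]
        by (simp add: left_diff_distrib inner_commute[of a])
    qed
  qed
  have aa: "integrable sphere_meas (\<lambda>x. (x \<bullet> a)\<^sup>2)" by (rule integrable_sphere_continuous) (intro continuous_intros)
  have f2: "integrable sphere_meas (\<lambda>x. (f x)\<^sup>2)"
    unfolding power2_eq_square by (intro sbdd_integrable sbdd_mult bd)
  have e: "(f x - a \<bullet> x)\<^sup>2 = (f x)\<^sup>2 + (x \<bullet> a)\<^sup>2 - 2 * (f x * (x \<bullet> a))" for x
    by (simp add: power2_diff inner_commute)
  have "(\<integral>x. (f x - a \<bullet> x)\<^sup>2 \<partial>sphere_meas) = (\<integral>x. (f x)\<^sup>2 \<partial>sphere_meas) + (a \<bullet> a) / ?N - 2 * ((a \<bullet> a) / ?N)"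
    unfolding e using f2 aa fl[of a] by (simp add: fz sphere_moment2_diag)
  then show "(\<integral>x. (f x)\<^sup>2 \<partial>sphere_meas) = (\<integral>x. (f x - a \<bullet> x)\<^sup>2 \<partial>sphere_meas) + (a \<bullet> a) / ?N" by simp
  have hP: "(\<integral>x. (h x \<bullet> a - (h x \<bullet> x) * (x \<bullet> a)) * 1 \<partial>sphere_meas) = - (\<integral>x. f x * ((a \<bullet> a - (x \<bullet> a)\<^sup>2) * 0 - (?N - 1) * (x \<bullet> a) * 1) \<partial>sphere_meas)"
    by (rule wgrad_ridge[OF w]) auto
  have hPa: "h x \<bullet> (PT x *v a) = (h x \<bullet> a - (h x \<bullet> x) * (x \<bullet> a)) * 1" for x
    by (simp add: PT_mv inner_diff_right mult.commute)
  have e2: "f x * ((a \<bullet> a - (x \<bullet> a)\<^sup>2) * 0 - (?N - 1) * (x \<bullet> a) * 1) = (1 - ?N) * (f x * (x \<bullet> a))" for x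
    by (simp add: left_diff_distrib right_diff_distrib)
  have hP2: "(\<integral>x. h x \<bullet> (PT x *v a) \<partial>sphere_meas) = (?N - 1) * ((a \<bullet> a) / ?N)"
    unfolding hPa hP e2 integral_mult_right_zero fz by (simp add: left_diff_distrib diff_divide_distrib)
  have hPi: "integrable sphere_meas (\<lambda>x. h x \<bullet> (PT x *v a))"
  proof (rule sphere_integrable_bound[of "\<lambda>x. norm (h x) * norm a"])
    show "integrable sphere_meas (\<lambda>x. norm (h x) * norm a)" using w by (auto simp: wgrad_def)
    show "\<bar>h x \<bullet> (PT x *v a)\<bar> \<le> norm (h x) * norm a" if "norm x = 1" for x
      using Cauchy_Schwarz_ineq2[of "h x" "PT x *v a"] mult_left_mono[OF PT_norm_le[OF that, of a], of "norm (h x)"] by simp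
  qed measurable
  have "(\<integral>x. (norm (h x - PT x *v a))\<^sup>2 \<partial>sphere_meas) = (\<integral>x. (norm (h x))\<^sup>2 - 2 * (h x \<bullet> (PT x *v a)) + (a \<bullet> a - (x \<bullet> a)\<^sup>2) \<partial>sphere_meas)"
  proof (rule sphere_integral_cong)
    show "(norm (h x - PT x *v a))\<^sup>2 = (norm (h x))\<^sup>2 - 2 * (h x \<bullet> (PT x *v a)) + (a \<bullet> a - (x \<bullet> a)\<^sup>2)" if "norm x = 1" for x
    proof -
      have "(norm (h x - PT x *v a))\<^sup>2 = (norm (h x))\<^sup>2 - 2 * (h x \<bullet> (PT x *v a)) + (norm (PT x *v a))\<^sup>2"
        unfolding power2_norm_eq_inner by (simp add: inner_diff_left inner_diff_right inner_commute)
      then show ?thesis unfolding PT_norm(1)[OF that] by (simp add: power2_norm_eq_inner)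
    qed
  qed measurable
  also have "\<dots> = (\<integral>x. (norm (h x))\<^sup>2 \<partial>sphere_meas) - 2 * ((?N - 1) * ((a \<bullet> a) / ?N)) + (a \<bullet> a - (a \<bullet> a) / ?N)"
    using int hPi aa by (simp add: hP2 sphere_moment2_diag sphere.prob_space[unfolded space_sphere_meas])
  also have "a \<bullet> a - (a \<bullet> a) / ?N = (?N - 1) * ((a \<bullet> a) / ?N)" using N by (simp add: field_simps)
  finally show "(\<integral>x. (norm (h x))\<^sup>2 \<partial>sphere_meas) = (\<integral>x. (norm (h x - PT x *v a))\<^sup>2 \<partial>sphere_meas) + (?N - 1) * ((a \<bullet> a) / ?N)" by simp
qed

section \<open>Rigidity of almost optimal matrices\<close>

lemma mv_norm_sq: "(norm ((A::real^'n^'n) *v v))\<^sup>2 = (\<Sum>i\<in>UNIV. (A $ i \<bullet> v)\<^sup>2)"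
  unfolding power2_norm_eq_inner inner_vec_def[of "A *v v"] by (simp add: matrix_vector_mul_component power2_eq_square)

text \<open>Each row is expanded with P_T v = v - (x \<bullet> v) x and integrated with the second
  and fourth moments. For an orthogonal matrix the value is 1 - 1/n, the mean of |P_T v|^2.\<close>

lemma integral_norm_PT_sq:
  fixes A :: "real^'n^'n"
  assumes v: "norm v = 1"
  shows "(\<integral>x. (norm (A *v (PT x *v v)))\<^sup>2 \<partial>sphere_meas)
     = (norm (A *v v))\<^sup>2 * (1 - 2 / real CARD('n) + 2 / (real CARD('n) * (real CARD('n) + 2)))
       + (norm A)\<^sup>2 / (real CARD('n) * (real CARD('n) + 2))"
proof -
  let ?N = "real CARD('n)" and ?c = "real CARD('n) * (real CARD('n) + 2)"
  have vv: "v \<bullet> v = 1" using v by (simp add: norm_eq_1)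
  have row: "(\<integral>x. (b \<bullet> (PT x *v v))\<^sup>2 \<partial>sphere_meas) = (b \<bullet> v)\<^sup>2 * (1 - 2 / ?N + 2 / ?c) + (b \<bullet> b) / ?c" for b
  proof -
    have e: "(b \<bullet> (PT x *v v))\<^sup>2 = (b \<bullet> v)\<^sup>2 - 2 * (b \<bullet> v) * ((x \<bullet> v) * (x \<bullet> b)) + (x \<bullet> v)\<^sup>2 * (x \<bullet> b)\<^sup>2" for x
      by (simp add: PT_mv inner_diff_right power2_diff power_mult_distrib inner_commute[of b x] mult_ac)
    have i: "integrable sphere_meas (\<lambda>x. (x \<bullet> v) * (x \<bullet> b))" "integrable sphere_meas (\<lambda>x. (x \<bullet> v)\<^sup>2 * (x \<bullet> b)\<^sup>2)"
      by (rule integrable_sphere_continuous; intro continuous_intros)+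
    have "(\<integral>x. (b \<bullet> (PT x *v v))\<^sup>2 \<partial>sphere_meas) = (b \<bullet> v)\<^sup>2 - 2 * (b \<bullet> v) * ((v \<bullet> b) / ?N) + ((v \<bullet> v) * (b \<bullet> b) + 2 * (v \<bullet> b)\<^sup>2) / ?c"
      unfolding e using i by (simp add: sphere_moment2 sphere_moment4 sphere.prob_space[unfolded space_sphere_meas])
    also have "\<dots> = (b \<bullet> v)\<^sup>2 * (1 - 2 / ?N + 2 / ?c) + (b \<bullet> b) / ?c"
      unfolding vv inner_commute[of v b] by (simp add: algebra_simps add_divide_distrib power2_eq_square)
    finally show ?thesis .
  qed
  have i: "integrable sphere_meas (\<lambda>x. (A $ i \<bullet> (PT x *v v))\<^sup>2)" for i
    by (rule integrable_sphere_continuous) (unfold PT_mv, intro continuous_intros)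
  have "(\<integral>x. (norm (A *v (PT x *v v)))\<^sup>2 \<partial>sphere_meas) = (\<Sum>i\<in>UNIV. \<integral>x. (A $ i \<bullet> (PT x *v v))\<^sup>2 \<partial>sphere_meas)"
    unfolding mv_norm_sq by (rule Bochner_Integration.integral_sum) (rule i)
  also have "\<dots> = (\<Sum>i\<in>UNIV. (A $ i \<bullet> v)\<^sup>2 * (1 - 2 / ?N + 2 / ?c) + (A $ i \<bullet> A $ i) / ?c)" unfolding row ..
  also have "\<dots> = (norm (A *v v))\<^sup>2 * (1 - 2 / ?N + 2 / ?c) + (norm A)\<^sup>2 / ?c"
    unfolding mv_norm_sq norm_matrix_sq_rows
    by (simp only: sum.distrib sum_distrib_right sum_divide_distrib power2_norm_eq_inner)
  finally show ?thesis .
qed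

text \<open>The form belonging to (1 + p) 1 - A^t A is positive semidefinite by the upper bound, and
  its trace is at most n p + q by the lower one. All its entries are then small, so A^t A is close
  to the identity and \<open>near_orthogonal\<close> applies.\<close>

lemma matrix_rigidity:
  fixes A :: "real^'n^'n"
  assumes up: "\<And>v. norm v = 1 \<Longrightarrow> (norm (A *v v))\<^sup>2 \<le> 1 + p" and low: "(norm A)\<^sup>2 \<ge> real CARD('n) - q"
    and pq: "p \<ge> 0" "q \<ge> 0"
  obtains Q where "orthogonal_matrix Q" "norm (A - Q) \<le> (real CARD('n))\<^sup>2 * (real CARD('n) * p + q + p)"
proof -
  let ?N = "real CARD('n)"
  define S where "S = transpose A ** A"
  have S: "v \<bullet> (S *v w) = (A *v v) \<bullet> (A *v w)" for v w
  proof -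
    have "(A *v v) \<bullet> (A *v w) = v \<bullet> (transpose A *v (A *v w))"
      by (metis dot_lmul_matrix inner_commute vector_transpose_matrix)
    then show ?thesis by (simp add: S_def matrix_vector_mul_assoc)
  qed
  define T where "T v w = (1 + p) * (v \<bullet> w) - (A *v v) \<bullet> (A *v w)" for v w
  have Tsym: "T v w = T w v" for v w by (simp add: T_def inner_commute)
  have Tpos: "T v v \<ge> 0" for v
  proof (cases "v = 0")
    case False
    have "(norm (A *v ((1 / norm v) *\<^sub>R v)))\<^sup>2 \<le> 1 + p" by (rule up) (use False in simp)
    then have "(norm (A *v v))\<^sup>2 \<le> (1 + p) * (norm v)\<^sup>2"
      using False by (simp add: matrix_vector_mult_scaleR power_divide divide_le_eq)
    then show ?thesis by (simp add: T_def power2_norm_eq_inner)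
  qed (simp add: T_def)
  have Tadd: "T (v + w) (v + w) = T v v + 2 * T v w + T w w" "T (v - w) (v - w) = T v v - 2 * T v w + T w w" for v w
    by (simp_all add: T_def matrix_vector_right_distrib matrix_vector_mult_diff_distrib inner_add_left inner_add_right
        inner_diff_left inner_diff_right inner_commute algebra_simps)
  let ?e = "\<lambda>i. axis i 1 :: real^'n"
  have tr: "(\<Sum>i\<in>UNIV. T (?e i) (?e i)) \<le> ?N * p + q"
  proof -
    have "(\<Sum>i\<in>UNIV. T (?e i) (?e i)) = ?N * (1 + p) - (norm A)\<^sup>2"
      unfolding norm_matrix_sq_columns by (simp add: T_def sum_subtractf power2_norm_eq_inner inner_axis_axis)
    then show ?thesis using low by (simp add: algebra_simps)
  qed
  have diag: "T (?e i) (?e i) \<le> ?N * p + q" for i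
    using member_le_sum[of i UNIV "\<lambda>i. T (?e i) (?e i)"] Tpos tr by auto
  \<comment> \<open>Positivity on the sum and on the difference of two basis vectors bounds an
    off-diagonal entry by the mean of two diagonal ones.\<close>
  have ent: "\<bar>T (?e i) (?e j)\<bar> \<le> ?N * p + q" for i j
    using Tpos[of "?e i + ?e j"] Tpos[of "?e i - ?e j"] diag[of i] diag[of j] unfolding Tadd by (simp add: abs_le_iff)
  have SI: "\<bar>(S - mat 1) $ i $ j\<bar> \<le> ?N * p + q + p" for i j
  proof -
    have "S $ i $ j = ?e i \<bullet> (S *v ?e j)" by (simp add: matrix_vector_mult_basis inner_axis' column_def)
    also have "\<dots> = (1 + p) * (?e i \<bullet> ?e j) - T (?e i) (?e j)" by (simp add: S T_def)
    finally have "(S - mat 1) $ i $ j = p * (?e i \<bullet> ?e j) - T (?e i) (?e j)"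
      by (simp add: mat_def inner_axis_axis)
    moreover have "\<bar>p * (?e i \<bullet> ?e j)\<bar> \<le> p" using pq by (simp add: inner_axis_axis)
    ultimately show ?thesis using ent[of i j] by linarith
  qed
  have "norm (S - mat 1) \<le> (\<Sum>i\<in>UNIV. norm ((S - mat 1) $ i))" unfolding norm_vec_def by (rule L2_set_le_sum) simp
  also have "\<dots> \<le> (\<Sum>i\<in>(UNIV::'n set). \<Sum>j\<in>(UNIV::'n set). ?N * p + q + p)"
    by (intro sum_mono order_trans[OF norm_le_l1_cart] SI)
  also have "\<dots> = ?N\<^sup>2 * (?N * p + q + p)" by (simp add: power2_eq_square)
  finally have "norm (transpose A ** A - mat 1) \<le> ?N\<^sup>2 * (?N * p + q + p)" by (simp add: S_def)
  moreover obtain Q where "orthogonal_matrix Q" "norm (A - Q) \<le> norm (transpose A ** A - mat 1)"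
    by (rule near_orthogonal[of A]) blast
  ultimately show ?thesis using that by (meson order_trans)
qed

section \<open>From pointwise bounds to the final estimate\<close>

lemma power_le_one_plus:
  fixes t :: real
  assumes "t \<ge> 0" "k \<le> l"
  shows "t ^ k \<le> 1 + t ^ l"
proof (cases "t \<le> 1")
  case True
  then have "t ^ k \<le> 1" using assms by (intro power_le_one)
  then show ?thesis using assms zero_le_power[of t l] by linarith
next
  case False
  then have "t ^ k \<le> t ^ l" using assms by (intro power_increasing) auto
  then show ?thesis by simp
qed

text \<open>With \<epsilon> the positive part of \<sigma> - 1, convexity at 1 + \<epsilon> gives (1
  + \<epsilon>)^(n - 1) \<le> 1 + (n - 1) \<epsilon> (1 + \<epsilon>)^(n - 2), and \<epsilon> \<le>
  \<sigma> is at most the gradient norm. The error is thus \<epsilon> times a power n - 2 of the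
  gradient, a product of two L^2 functions.\<close>

lemma det_pointwise_bound:
  fixes G :: "real^'n \<Rightarrow> real^'n^'n"
  assumes n: "CARD('n) \<ge> 2" and x: "norm x = 1"
  shows "\<bar>det (G x ** PT x + outer e x)\<bar>
    \<le> norm e + norm e * (real CARD('n) - 1) * (max (sigma_max G x - 1) 0 * (1 + grad_norm G x) ^ (CARD('n) - 2))"
proof -
  let ?H = "G x ** PT x" and ?s = "sigma_max G x" and ?k = "CARD('n) - 1"
  define \<epsilon> where "\<epsilon> = max (?s - 1) 0"
  have \<epsilon>: "\<epsilon> \<ge> 0" "?s \<le> 1 + \<epsilon>" "\<epsilon> \<le> ?s" using sigma_max_facts(2)[where G=G, OF n x] by (auto simp: \<epsilon>_def)
  have Hx: "?H *v x = 0" using PT_norm(2)[OF x] by (simp add: matrix_vector_mul_assoc[symmetric])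
  have "\<bar>det (?H + outer e x)\<bar> \<le> norm e * ?s ^ ?k"
    by (rule det_rank_one_bound[OF n x Hx sigma_max_facts(2)[where G=G, OF n x] sigma_max_facts(1)[where G=G, OF n x]])
  also have "\<dots> \<le> norm e * (1 + (real CARD('n) - 1) * (\<epsilon> * (1 + grad_norm G x) ^ (CARD('n) - 2)))"
  proof (rule mult_left_mono)
    have "?s ^ ?k \<le> (1 + \<epsilon>) ^ ?k" using \<epsilon> sigma_max_facts(2)[where G=G, OF n x] by (intro power_mono) auto
    also have "\<dots> \<le> 1 + ?k * (1 + \<epsilon>) ^ (?k - 1) * \<epsilon>"
    proof -
      have "1 \<le> ?k" using n by simp
      then show ?thesis using power_tangent[of "1 + \<epsilon>" 1 ?k] \<epsilon>(1) by simp
    qed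
    also have "\<dots> \<le> 1 + ?k * (1 + grad_norm G x) ^ (?k - 1) * \<epsilon>"
    proof -
      have "1 + \<epsilon> \<le> 1 + grad_norm G x" using \<epsilon>(3) sigma_max_facts(3)[where G=G, OF n x] by (simp add: grad_norm_def)
      then have "(1 + \<epsilon>) ^ (?k - 1) \<le> (1 + grad_norm G x) ^ (?k - 1)" using \<epsilon> by (intro power_mono) auto
      then show ?thesis using \<epsilon> by (intro add_left_mono mult_right_mono mult_left_mono) auto
    qed
    finally show "?s ^ ?k \<le> 1 + (real CARD('n) - 1) * (\<epsilon> * (1 + grad_norm G x) ^ (CARD('n) - 2))"
      using n by (simp add: of_nat_diff mult_ac numeral_2_eq_2)
  qed simp
  finally show ?thesis by (simp add: \<epsilon>_def distrib_left mult.assoc)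
qed

lemma grad_norm_row_le: "norm ((G x ** PT x) $ i) \<le> grad_norm G x"
  unfolding grad_norm_def by (rule Finite_Cartesian_Product.norm_nth_le)

lemma mult_PT_measurable:
  fixes G :: "real^'n \<Rightarrow> real^'n^'n"
  assumes [measurable]: "G \<in> borel_measurable borel"
  shows "(\<lambda>x. G x ** PT x) \<in> borel_measurable borel"
proof (rule borel_measurable_matrixI)
  fix i j
  have "(\<lambda>x. \<Sum>k\<in>UNIV. G x $ i $ k * ((if k = j then 1 else 0) - x $ k * x $ j)) \<in> borel_measurable borel"
    by measurable
  then show "(\<lambda>x. (G x ** PT x) $ i $ j) \<in> borel_measurable borel"
    by (simp add: matrix_matrix_mult_def PT_def mat_def)
qed

lemma grad_norm_integral_bound:
  fixes G :: "real^'n \<Rightarrow> real^'n^'n"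
  assumes n: "CARD('n) \<ge> 4" and M: "M > 0"
    and int: "integrable sphere_meas (\<lambda>x. grad_norm G x powr (2 * (real CARD('n) - 2)))"
    and Lp: "Lp_sphere (2 * (real CARD('n) - 2)) (grad_norm G) \<le> M"
  shows "integrable sphere_meas (\<lambda>x. grad_norm G x ^ (2 * (CARD('n) - 2)))"
    and "(\<integral>x. grad_norm G x ^ (2 * (CARD('n) - 2)) \<partial>sphere_meas) \<le> M ^ (2 * (CARD('n) - 2))"
proof -
  let ?l = "2 * (CARD('n) - 2)"
  have p: "2 * (real CARD('n) - 2) = real ?l" using n by (simp add: of_nat_diff)
  have l: "?l \<noteq> 0" "real ?l > 0" using n by auto
  have g: "grad_norm G x \<ge> 0" for x by (simp add: grad_norm_def)
  have pw: "grad_norm G x powr real ?l = grad_norm G x ^ ?l" for x by (rule powr_realpow'[OF g l(1)])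
  show "integrable sphere_meas (\<lambda>x. grad_norm G x ^ ?l)" using int unfolding p pw .
  define I where "I = (\<integral>x. grad_norm G x ^ ?l \<partial>sphere_meas)"
  have I: "I \<ge> 0" unfolding I_def by (simp add: g)
  have "I powr (1 / real ?l) \<le> M" using Lp unfolding Lp_sphere_def Av_def p abs_of_nonneg[OF g] pw I_def .
  then have "(I powr (1 / real ?l)) powr real ?l \<le> M powr real ?l" using l by (intro powr_mono2) auto
  moreover have "(I powr (1 / real ?l)) powr real ?l = I" using I l by (simp add: powr_powr)
  moreover have "M powr real ?l = M ^ ?l" by (rule powr_realpow[OF M])
  ultimately show "(\<integral>x. grad_norm G x ^ ?l \<partial>sphere_meas) \<le> M ^ ?l" by (simp add: I_def)
qed

text \<open>\<open>w\<close> is \<open>u\<close> minus its mean (modified on a null set), and \<open>A\<close> is the matrix of its projection on the linear functions.\<close>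

lemma analytic_estimates:
  fixes u :: "real^'n \<Rightarrow> real^'n" and G :: "real^'n \<Rightarrow> real^'n^'n"
  assumes n: "CARD('n) \<ge> 4" and M: "M > 0" and tw: "tang_weak_grad u G"
    and int: "integrable sphere_meas (\<lambda>x. grad_norm G x ^ (2 * (CARD('n) - 2)))"
    and bd: "(\<integral>x. grad_norm G x ^ (2 * (CARD('n) - 2)) \<partial>sphere_meas) \<le> M ^ (2 * (CARD('n) - 2))"
  obtains w :: "real^'n \<Rightarrow> real^'n" and A :: "real^'n^'n" and S :: real
  where "w \<in> borel_measurable borel" "\<And>x. norm (w x) \<le> real CARD('n) * \<bar>morrey_const TYPE('n) * M\<bar>"
    "\<bar>signed_volume u G\<bar> \<le> (\<integral>x. \<bar>det (G x ** PT x + outer (w x) x)\<bar> \<partial>sphere_meas)"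
    "integrable sphere_meas (\<lambda>x. \<bar>det (G x ** PT x + outer (w x) x)\<bar>)"
    "integrable sphere_meas (\<lambda>x. (norm (G x ** PT x - A ** PT x))\<^sup>2)"
    "(\<integral>x. (grad_norm G x)\<^sup>2 \<partial>sphere_meas) = (\<integral>x. (norm (G x ** PT x - A ** PT x))\<^sup>2 \<partial>sphere_meas)
       + (real CARD('n) - 1) * ((norm A)\<^sup>2 / real CARD('n))"
    "(\<integral>x. (norm (w x))\<^sup>2 \<partial>sphere_meas) = S + (norm A)\<^sup>2 / real CARD('n)" "S \<ge> 0"
    "2 * real CARD('n) * S \<le> (\<integral>x. (norm (G x ** PT x - A ** PT x))\<^sup>2 \<partial>sphere_meas)"
proof -
  let ?N = "real CARD('n)" and ?l = "2 * (CARD('n) - 2)"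
  have n2: "CARD('n) \<ge> 2" using n by simp
  have [measurable]: "u \<in> borel_measurable borel" "G \<in> borel_measurable borel" using tw by (auto simp: tang_weak_grad_def)
  define h where "h i x = (G x ** PT x) $ i" for i x
  note mult_PT_measurable[OF \<open>G \<in> borel_measurable borel\<close>, measurable]
  have [measurable]: "h i \<in> borel_measurable borel" for i unfolding h_def[abs_def] by measurable
  have gm [measurable]: "grad_norm G \<in> borel_measurable borel" unfolding grad_norm_def[abs_def] by measurable
  have g0: "grad_norm G x \<ge> 0" for x by (simp add: grad_norm_def)
  have hg: "norm (h i x) \<le> grad_norm G x" for i x unfolding h_def by (rule grad_norm_row_le)
  have gk: "integrable sphere_meas (\<lambda>x. grad_norm G x ^ k)" if "k \<le> ?l" for k
    by (rule sphere_integrable_bound[of "\<lambda>x. 1 + grad_norm G x ^ ?l"])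
       (use int power_le_one_plus[OF g0 that] g0 in auto)
  have wu: "wgrad (\<lambda>x. u x $ i) (h i)" for i
  proof -
    have "wgrad (\<lambda>x. u x $ i) (\<lambda>x. PT x *v (G x $ i))" by (rule wgrad_tangential[OF tang_weak_grad_imp_wgrad[OF tw]])
    then show ?thesis unfolding h_def[abs_def] PT_row .
  qed
  have tan: "h i x \<bullet> x = 0" if "norm x = 1" for i x
    unfolding h_def PT_row using PT_norm(3)[OF that] by (simp add: inner_commute)
  have hl: "integrable sphere_meas (\<lambda>x. norm (h i x) ^ ?l)" for i
    by (rule sphere_integrable_bound[OF int]) (auto intro!: power_mono hg)
  have hlM: "(\<integral>x. norm (h i x) ^ ?l \<partial>sphere_meas) \<le> M ^ ?l" for i
  proof -
    have "(\<integral>x. norm (h i x) ^ ?l \<partial>sphere_meas) \<le> (\<integral>x. grad_norm G x ^ ?l \<partial>sphere_meas)"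
      by (rule sphere_integral_mono[OF hl int]) (intro power_mono hg norm_ge_zero)
    then show ?thesis using bd by linarith
  qed
  have h2: "integrable sphere_meas (\<lambda>x. (norm (h i x))\<^sup>2)" for i
    by (rule sphere_integrable_bound[OF gk[of 2]]) (use n in \<open>auto intro!: power_mono hg\<close>)
  define CM where "CM = \<bar>morrey_const TYPE('n) * M\<bar>"
  define ub where "ub i = (\<integral>x. u x $ i \<partial>sphere_meas)" for i
  \<comment> \<open>Morrey's bound holds only almost everywhere. Setting the function to 0 where it
    fails gives a representative that is bounded everywhere, and the weak gradient is
    unaffected.\<close>
  define f where "f i x = (if \<bar>u x $ i - ub i\<bar> \<le> CM then u x $ i - ub i else 0)" for i x
  have fm [measurable]: "f i \<in> borel_measurable borel" for i unfolding f_def[abs_def] by measurable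
  have fb: "\<bar>f i x\<bar> \<le> CM" for i x by (auto simp: f_def CM_def)
  have fae: "AE x in sphere_meas. u x $ i - ub i = f i x" for i
  proof -
    have "AE x in sphere_meas. \<bar>u x $ i - (\<integral>x. u x $ i \<partial>sphere_meas)\<bar> \<le> morrey_const TYPE('n) * M"
      by (rule morrey_bound[OF n wu tan hl hlM M])
    then show ?thesis by eventually_elim (auto simp: f_def CM_def ub_def)
  qed
  have wf: "wgrad (f i) (h i)" for i
    by (rule wgrad_cong_AE[OF _ fm fae]) (use wgrad_add[OF wu[of i] wgrad_const, of "- ub i"] in simp)
  have sf: "sbdd (f i)" for i by (rule sbddI[of _ CM]) (auto simp: fb)
  have ui: "integrable sphere_meas (\<lambda>x. u x $ i)" for i using wu[of i] by (simp add: wgrad_def)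
  have f0: "(\<integral>x. f i x \<partial>sphere_meas) = 0" for i
  proof -
    have "(\<integral>x. f i x \<partial>sphere_meas) = (\<integral>x. u x $ i - ub i \<partial>sphere_meas)"
      by (rule integral_cong_AE) (use fae[of i] in \<open>auto elim: eventually_mono\<close>)
    then show ?thesis using ui[of i] by (simp add: ub_def sphere.prob_space[unfolded space_sphere_meas])
  qed
  define A where "A = (\<chi> i j. ?N * (\<integral>x. f i x * x $ j \<partial>sphere_meas))"
  have Ai: "A $ i = (\<chi> j. ?N * (\<integral>x. f i x * x $ j \<partial>sphere_meas))" for i by (simp add: A_def)
  have SD: "(\<integral>x. (norm (h i x))\<^sup>2 \<partial>sphere_meas) = (\<integral>x. (norm (h i x - PT x *v A $ i))\<^sup>2 \<partial>sphere_meas) + (?N - 1) * ((A $ i \<bullet> A $ i) / ?N)"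
    "(\<integral>x. (f i x)\<^sup>2 \<partial>sphere_meas) = (\<integral>x. (f i x - A $ i \<bullet> x)\<^sup>2 \<partial>sphere_meas) + (A $ i \<bullet> A $ i) / ?N"
    "2 * ?N * (\<integral>x. (f i x - A $ i \<bullet> x)\<^sup>2 \<partial>sphere_meas) \<le> (\<integral>x. (norm (h i x - PT x *v A $ i))\<^sup>2 \<partial>sphere_meas)"
    "integrable sphere_meas (\<lambda>x. (norm (h i x - PT x *v A $ i))\<^sup>2)" for i
    by (rule scalar_deficit[OF n2 wf tan h2 sf f0 Ai]; assumption)+
  define w where "w x = (\<chi> i. f i x)" for x
  define S where "S = (\<Sum>i\<in>UNIV. \<integral>x. (f i x - A $ i \<bullet> x)\<^sup>2 \<partial>sphere_meas)"
  have rowD: "(norm (G x ** PT x - A ** PT x))\<^sup>2 = (\<Sum>i\<in>UNIV. (norm (h i x - PT x *v (A $ i)))\<^sup>2)" for x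
    unfolding norm_matrix_sq_rows by (simp add: h_def PT_row)
  have Dint: "integrable sphere_meas (\<lambda>x. (norm (G x ** PT x - A ** PT x))\<^sup>2)"
    unfolding rowD by (intro Bochner_Integration.integrable_sum SD(4))
  have D: "(\<integral>x. (norm (G x ** PT x - A ** PT x))\<^sup>2 \<partial>sphere_meas) = (\<Sum>i\<in>UNIV. \<integral>x. (norm (h i x - PT x *v (A $ i)))\<^sup>2 \<partial>sphere_meas)"
    unfolding rowD by (rule Bochner_Integration.integral_sum) (rule SD(4))
  have nA: "(norm A)\<^sup>2 = (\<Sum>i\<in>UNIV. A $ i \<bullet> A $ i)" unfolding norm_matrix_sq_rows power2_norm_eq_inner ..
  have g2: "(\<integral>x. (grad_norm G x)\<^sup>2 \<partial>sphere_meas) = (\<Sum>i\<in>UNIV. \<integral>x. (norm (h i x))\<^sup>2 \<partial>sphere_meas)"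
    unfolding grad_norm_def norm_matrix_sq_rows h_def[symmetric]
    by (rule Bochner_Integration.integral_sum) (rule h2)
  have W: "(\<integral>x. (norm (w x))\<^sup>2 \<partial>sphere_meas) = (\<Sum>i\<in>UNIV. \<integral>x. (f i x)\<^sup>2 \<partial>sphere_meas)"
  proof -
    have "(norm (w x))\<^sup>2 = (\<Sum>i\<in>UNIV. (f i x)\<^sup>2)" for x
      unfolding power2_norm_eq_inner by (simp add: w_def inner_vec_def power2_eq_square)
    moreover have "integrable sphere_meas (\<lambda>x. (f i x)\<^sup>2)" for i
      unfolding power2_eq_square by (intro sbdd_integrable sbdd_mult sf)
    ultimately show ?thesis by (simp add: Bochner_Integration.integral_sum)
  qed
  define Nc where "Nc i x = rdet ((\<lambda>m. h m x)(i := x))" for i x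
  have Nci: "integrable sphere_meas (Nc i)" "(\<integral>x. Nc i x \<partial>sphere_meas) = 0" for i
  proof -
    have gg: "integrable sphere_meas (grad_norm G)" using gk[of 1] n by simp
    have gd: "integrable sphere_meas (\<lambda>x. grad_norm G x ^ (CARD('n) - 1))" by (rule gk) (use n in simp)
    show "integrable sphere_meas (Nc i)" unfolding Nc_def[abs_def]
      by (rule null_lagrangian(1)[OF n2 wf tan gg hg gd]; assumption)
    show "(\<integral>x. Nc i x \<partial>sphere_meas) = 0" unfolding Nc_def
      by (rule null_lagrangian(2)[OF n2 wf tan gg hg gd]; assumption)
  qed
  have [measurable]: "Nc i \<in> borel_measurable borel" for i using Nci(1)[of i] by auto
  have det: "det (G x ** PT x + outer e x) = (\<Sum>i\<in>UNIV. e $ i * Nc i x)" if x: "norm x = 1" for e x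
  proof -
    have "G x ** PT x + outer e x = (\<chi> m. h m x + e $ m *\<^sub>R x)" by (simp add: vec_eq_iff outer_def h_def)
    then show ?thesis unfolding Nc_def using det_rank_one(1)[where v="\<lambda>m. h m x" and x=x and e=e, OF tan[OF x] x] by (simp only:)
  qed
  have fN: "integrable sphere_meas (\<lambda>x. f i x * Nc i x)" for i
  proof (rule sphere_integrable_bound[of "\<lambda>x. CM * \<bar>Nc i x\<bar>"])
    show "\<bar>f i x * Nc i x\<bar> \<le> CM * \<bar>Nc i x\<bar>" for x unfolding abs_mult by (rule mult_right_mono[OF fb]) simp
  qed (use Nci(1)[of i] in auto)
  have wm: "w \<in> borel_measurable borel"
  proof -
    have "(\<lambda>x. w x \<bullet> axis i 1) \<in> borel_measurable borel" for i by (simp add: w_def inner_axis)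
    then show ?thesis
      by (intro borel_measurable_euclidean_space[THEN iffD2]) (auto simp: Basis_vec_def)
  qed
  have sumi: "integrable sphere_meas (\<lambda>x. \<Sum>i\<in>UNIV. f i x * Nc i x)" by (intro Bochner_Integration.integrable_sum fN)
  have detae: "AE x in sphere_meas. det (G x ** PT x + outer (w x) x) = (\<Sum>i\<in>UNIV. f i x * Nc i x)"
    using AE_sphere_meas_norm by eventually_elim (simp add: det w_def)
  have entm: "(\<lambda>x. (G x ** PT x + outer (v x) x) $ i $ j) \<in> borel_measurable borel" if [measurable]: "v \<in> borel_measurable borel" for v i j
    unfolding outer_def vector_add_component vec_lambda_beta by measurable
  have detm: "(\<lambda>x. det (G x ** PT x + outer (v x) x)) \<in> borel_measurable borel" if "v \<in> borel_measurable borel" for v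
    unfolding det_def by (intro borel_measurable_sum borel_measurable_times borel_measurable_const borel_measurable_prod entm[OF that])
  have deti: "integrable sphere_meas (\<lambda>x. det (G x ** PT x + outer (w x) x))"
    by (rule Bochner_Integration.integrable_cong_AE_imp[OF sumi]) (use detm[OF wm] detae in \<open>auto elim: eventually_mono\<close>)
  have sv: "\<bar>signed_volume u G\<bar> = \<bar>\<integral>x. det (G x ** PT x + outer (u x) x) \<partial>sphere_meas\<bar>"
    unfolding signed_volume_def Av_def outer_def by (simp add: abs_mult power_abs)
  have "AE x in sphere_meas. \<forall>i\<in>UNIV. u x $ i - ub i = f i x"
    by (rule AE_finite_allI) (auto intro: fae)
  \<comment> \<open>The determinant is linear in the column that carries \<open>u\<close>, so the
    mean of \<open>u\<close> contributes its product with \<open>Nc\<close>, which integrates to 0.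
    Hence \<open>u\<close> may be replaced by \<open>w\<close> in the volume.\<close>
  then have "AE x in sphere_meas. det (G x ** PT x + outer (u x) x) = (\<Sum>i\<in>UNIV. f i x * Nc i x) + (\<Sum>i\<in>UNIV. ub i * Nc i x)"
    using AE_sphere_meas_norm
  proof eventually_elim
    case (elim x)
    have "u x $ i = f i x + ub i" for i using elim(1) by (metis UNIV_I add.commute add_diff_cancel_left' diff_add_cancel)
    then show ?case unfolding det[OF elim(2)] by (simp add: distrib_right sum.distrib)
  qed
  then have "(\<integral>x. det (G x ** PT x + outer (u x) x) \<partial>sphere_meas) = (\<integral>x. (\<Sum>i\<in>UNIV. f i x * Nc i x) + (\<Sum>i\<in>UNIV. ub i * Nc i x) \<partial>sphere_meas)"
    by (intro integral_cong_AE) (use detm[of u] in auto)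
  also have "\<dots> = (\<integral>x. (\<Sum>i\<in>UNIV. f i x * Nc i x) \<partial>sphere_meas) + (\<Sum>i\<in>UNIV. ub i * (\<integral>x. Nc i x \<partial>sphere_meas))"
    using sumi Nci(1) by (simp add: Bochner_Integration.integral_sum)
  also have "\<dots> = (\<integral>x. (\<Sum>i\<in>UNIV. f i x * Nc i x) \<partial>sphere_meas)" by (simp add: Nci(2))
  also have "\<dots> = (\<integral>x. det (G x ** PT x + outer (w x) x) \<partial>sphere_meas)"
    by (rule integral_cong_AE) (use detm[OF wm] sumi detae in \<open>auto elim: eventually_mono\<close>)
  finally have sv2: "\<bar>signed_volume u G\<bar> \<le> (\<integral>x. \<bar>det (G x ** PT x + outer (w x) x)\<bar> \<partial>sphere_meas)"
    unfolding sv using integral_abs_bound[of sphere_meas "\<lambda>x. det (G x ** PT x + outer (w x) x)"] by simp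
  have wn: "norm (w x) \<le> ?N * \<bar>morrey_const TYPE('n) * M\<bar>" for x
  proof -
    have "norm (w x) \<le> (\<Sum>i\<in>UNIV. \<bar>w x $ i\<bar>)" by (rule norm_le_l1_cart)
    also have "\<dots> \<le> (\<Sum>i\<in>(UNIV::'n set). CM)" by (rule sum_mono) (simp add: w_def fb)
    finally show ?thesis by (simp add: CM_def)
  qed
  show ?thesis
  proof (rule that[of w A S])
    show "(\<integral>x. (grad_norm G x)\<^sup>2 \<partial>sphere_meas) = (\<integral>x. (norm (G x ** PT x - A ** PT x))\<^sup>2 \<partial>sphere_meas) + (?N - 1) * ((norm A)\<^sup>2 / ?N)"
      unfolding g2 D nA SD(1) by (simp add: sum.distrib sum_distrib_left sum_divide_distrib)
    show "(\<integral>x. (norm (w x))\<^sup>2 \<partial>sphere_meas) = S + (norm A)\<^sup>2 / ?N"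
      unfolding W nA SD(2) S_def by (simp add: sum.distrib sum_divide_distrib)
    show "S \<ge> 0" unfolding S_def by (intro sum_nonneg) simp
    show "2 * ?N * S \<le> (\<integral>x. (norm (G x ** PT x - A ** PT x))\<^sup>2 \<partial>sphere_meas)"
      unfolding S_def D sum_distrib_left by (rule sum_mono) (rule SD(3))
  qed (use wm wn sv2 deti Dint in auto)
qed

lemma square_sum_le: "(a + b)\<^sup>2 \<le> 2 * (a\<^sup>2 + b\<^sup>2)" for a b :: real
  using sum_squares_bound[of a b] by (simp add: power2_sum)

text \<open>The pointwise bound is integrated. The leading term is the mean of |w|, hence at most
  its L^2 norm; in the error term |w| is replaced by its bound \<open>B\<close>, and Cauchy-Schwarz
  pairs \<epsilon> with (1 + |H|)^(n - 2), whose square is controlled by \<open>M\<close>.\<close>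

lemma det_integral_bound:
  fixes G :: "real^'n \<Rightarrow> real^'n^'n" and w :: "real^'n \<Rightarrow> real^'n"
  assumes n: "CARD('n) \<ge> 4" and G [measurable]: "G \<in> borel_measurable borel"
    and int: "integrable sphere_meas (\<lambda>x. grad_norm G x ^ (2 * (CARD('n) - 2)))"
    and bd: "(\<integral>x. grad_norm G x ^ (2 * (CARD('n) - 2)) \<partial>sphere_meas) \<le> M ^ (2 * (CARD('n) - 2))"
    and w [measurable]: "w \<in> borel_measurable borel" and wB: "\<And>x. norm (w x) \<le> B"
    and D: "integrable sphere_meas (\<lambda>x. \<bar>det (G x ** PT x + outer (w x) x)\<bar>)"
  shows "(\<integral>x. \<bar>det (G x ** PT x + outer (w x) x)\<bar> \<partial>sphere_meas)
    \<le> sqrt (\<integral>x. (norm (w x))\<^sup>2 \<partial>sphere_meas)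
      + (real CARD('n) - 1) * B * sqrt (2 ^ (2 * (CARD('n) - 2)) * (1 + M ^ (2 * (CARD('n) - 2))))
        * sqrt (\<integral>x. (max (sigma_max G x - 1) 0)\<^sup>2 \<partial>sphere_meas)"
proof -
  let ?N = "real CARD('n)" and ?m = "CARD('n) - 2" and ?g = "grad_norm G"
  let ?\<epsilon> = "\<lambda>x. max (sigma_max G x - 1) 0"
  have n2: "CARD('n) \<ge> 2" using n by simp
  note mult_PT_measurable[OF G, measurable] sigma_max_measurable[OF n2 G, measurable]
  have gm [measurable]: "?g \<in> borel_measurable borel" unfolding grad_norm_def[abs_def] by measurable
  have g0: "?g x \<ge> 0" for x by (simp add: grad_norm_def)
  have B0: "B \<ge> 0" using wB[of 0] norm_ge_zero order_trans by blast
  have \<epsilon>g: "(?\<epsilon> x)\<^sup>2 \<le> (?g x)\<^sup>2" if "norm x = 1" for x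
    by (rule power_mono) (use sigma_max_facts(2,3)[where G=G, OF n2 that] in \<open>auto simp: grad_norm_def\<close>)
  have g2: "integrable sphere_meas (\<lambda>x. (?g x)\<^sup>2)"
    by (rule sphere_integrable_bound[of "\<lambda>x. 1 + ?g x ^ (2 * ?m)"])
       (use int power_le_one_plus[OF g0, of 2 "2 * ?m"] n in auto)
  have \<epsilon>2: "integrable sphere_meas (\<lambda>x. (?\<epsilon> x)\<^sup>2)"
    by (rule sphere_integrable_bound[OF g2]) (use \<epsilon>g in auto)
  have pw: "((1 + ?g x) ^ ?m)\<^sup>2 \<le> 2 ^ (2 * ?m) * (1 + ?g x ^ (2 * ?m))" for x
  proof -
    have "(1 + ?g x) ^ (2 * ?m) \<le> (2 * max 1 (?g x)) ^ (2 * ?m)" using g0[of x] by (intro power_mono) auto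
    also have "\<dots> = 2 ^ (2 * ?m) * max 1 (?g x) ^ (2 * ?m)" by (rule power_mult_distrib)
    also have "max 1 (?g x) ^ (2 * ?m) \<le> 1 + ?g x ^ (2 * ?m)"
      using g0[of x] by (cases "?g x \<le> 1") (auto simp: max_def)
    finally show ?thesis by (simp add: power_mult[symmetric] mult.commute)
  qed
  have \<phi>2: "integrable sphere_meas (\<lambda>x. ((1 + ?g x) ^ ?m)\<^sup>2)"
    by (rule sphere_integrable_bound[of "\<lambda>x. 2 ^ (2 * ?m) * (1 + ?g x ^ (2 * ?m))"]) (use int pw in auto)
  have "(\<integral>x. ((1 + ?g x) ^ ?m)\<^sup>2 \<partial>sphere_meas) \<le> (\<integral>x. 2 ^ (2 * ?m) * (1 + ?g x ^ (2 * ?m)) \<partial>sphere_meas)"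
    by (rule sphere_integral_mono[OF \<phi>2]) (use int pw in auto)
  also have "\<dots> = 2 ^ (2 * ?m) * (1 + (\<integral>x. ?g x ^ (2 * ?m) \<partial>sphere_meas))"
    using int by (simp add: sphere.prob_space[unfolded space_sphere_meas])
  also have "\<dots> \<le> 2 ^ (2 * ?m) * (1 + M ^ (2 * ?m))" using bd by simp
  finally have \<phi>M: "(\<integral>x. ((1 + ?g x) ^ ?m)\<^sup>2 \<partial>sphere_meas) \<le> 2 ^ (2 * ?m) * (1 + M ^ (2 * ?m))" .
  have \<epsilon>m: "?\<epsilon> \<in> borel_measurable borel" by measurable
  have \<phi>m: "(\<lambda>x. (1 + ?g x) ^ ?m) \<in> borel_measurable borel" by measurable
  note CS = sphere_Cauchy_Schwarz[OF \<epsilon>2 \<phi>2 \<epsilon>m \<phi>m]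
  have w2: "integrable sphere_meas (\<lambda>x. (norm (w x))\<^sup>2)"
    by (rule sphere_integrable_bound[of "\<lambda>x. B\<^sup>2"]) (use wB in \<open>auto intro: power_mono\<close>)
  note wi = integral_le_sqrt_integral_sq[of "\<lambda>x. norm (w x)", OF w2]
  have wi1: "integrable sphere_meas (\<lambda>x. norm (w x))" by (rule wi) measurable
  have wi2: "(\<integral>x. norm (w x) \<partial>sphere_meas) \<le> sqrt (\<integral>x. (norm (w x))\<^sup>2 \<partial>sphere_meas)" by (rule wi) measurable
  have "(\<integral>x. \<bar>det (G x ** PT x + outer (w x) x)\<bar> \<partial>sphere_meas)
      \<le> (\<integral>x. norm (w x) + (?N - 1) * B * (?\<epsilon> x * (1 + ?g x) ^ ?m) \<partial>sphere_meas)"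
  proof (rule sphere_integral_mono[OF D])
    show "integrable sphere_meas (\<lambda>x. norm (w x) + (?N - 1) * B * (?\<epsilon> x * (1 + ?g x) ^ ?m))"
      by (intro Bochner_Integration.integrable_add wi1 integrable_mult_right CS(1))
    fix x :: "real^'n" assume x: "norm x = 1"
    have "norm (w x) * ((?N - 1) * (?\<epsilon> x * (1 + ?g x) ^ ?m)) \<le> B * ((?N - 1) * (?\<epsilon> x * (1 + ?g x) ^ ?m))"
      using g0[of x] n by (intro mult_right_mono wB mult_nonneg_nonneg) auto
    then show "\<bar>det (G x ** PT x + outer (w x) x)\<bar> \<le> norm (w x) + (?N - 1) * B * (?\<epsilon> x * (1 + ?g x) ^ ?m)"
      using det_pointwise_bound[OF n2 x, of G "w x"] by (simp only: mult_ac)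
  qed
  also have "\<dots> = (\<integral>x. norm (w x) \<partial>sphere_meas) + (?N - 1) * B * (\<integral>x. ?\<epsilon> x * (1 + ?g x) ^ ?m \<partial>sphere_meas)"
    using wi1 CS(1) by simp
  also have "\<dots> \<le> sqrt (\<integral>x. (norm (w x))\<^sup>2 \<partial>sphere_meas) + (?N - 1) * B *
      (sqrt (2 ^ (2 * ?m) * (1 + M ^ (2 * ?m))) * sqrt (\<integral>x. (?\<epsilon> x)\<^sup>2 \<partial>sphere_meas))"
  proof (intro add_mono wi2 mult_left_mono)
    have "(\<integral>x. ?\<epsilon> x * (1 + ?g x) ^ ?m \<partial>sphere_meas) \<le> sqrt (\<integral>x. (?\<epsilon> x)\<^sup>2 \<partial>sphere_meas) * sqrt (\<integral>x. ((1 + ?g x) ^ ?m)\<^sup>2 \<partial>sphere_meas)"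
      by (rule CS(2))
    also have "\<dots> \<le> sqrt (\<integral>x. (?\<epsilon> x)\<^sup>2 \<partial>sphere_meas) * sqrt (2 ^ (2 * ?m) * (1 + M ^ (2 * ?m)))"
      by (intro mult_left_mono real_sqrt_le_mono \<phi>M) simp
    finally show "(\<integral>x. ?\<epsilon> x * (1 + ?g x) ^ ?m \<partial>sphere_meas) \<le> sqrt (2 ^ (2 * ?m) * (1 + M ^ (2 * ?m))) * sqrt (\<integral>x. (?\<epsilon> x)\<^sup>2 \<partial>sphere_meas)"
      by (simp only: mult.commute)
    show "0 \<le> (?N - 1) * B" using B0 n by simp
  qed
  finally show ?thesis by (simp only: mult.assoc)
qed

text \<open>Pointwise |H|^2 \<le> (n - 1) \<sigma>^2 and \<sigma> \<le> 1 + \<epsilon>. The mean of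
  (1 + \<epsilon>)^2 is expanded and the mean of \<epsilon> bounded by its L^2 norm, which completes
  the square.\<close>

lemma energy_bound:
  fixes G :: "real^'n \<Rightarrow> real^'n^'n"
  assumes n: "CARD('n) \<ge> 2" and G [measurable]: "G \<in> borel_measurable borel"
    and g2: "integrable sphere_meas (\<lambda>x. (grad_norm G x)\<^sup>2)"
  shows "integrable sphere_meas (\<lambda>x. (max (sigma_max G x - 1) 0)\<^sup>2)"
    and "(\<integral>x. (grad_norm G x)\<^sup>2 \<partial>sphere_meas)
      \<le> (real CARD('n) - 1) * (1 + sqrt (\<integral>x. (max (sigma_max G x - 1) 0)\<^sup>2 \<partial>sphere_meas))\<^sup>2"
proof -
  let ?\<epsilon> = "\<lambda>x. max (sigma_max G x - 1) 0"
  let ?I = "\<integral>x. (?\<epsilon> x)\<^sup>2 \<partial>sphere_meas"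
  note mult_PT_measurable[OF G, measurable] sigma_max_measurable[OF n G, measurable]
  have \<epsilon>g: "(?\<epsilon> x)\<^sup>2 \<le> (grad_norm G x)\<^sup>2" if "norm x = 1" for x
    by (rule power_mono) (use sigma_max_facts(2,3)[where G=G, OF n that] in \<open>auto simp: grad_norm_def\<close>)
  show \<epsilon>2: "integrable sphere_meas (\<lambda>x. (?\<epsilon> x)\<^sup>2)"
    by (rule sphere_integrable_bound[OF g2]) (use \<epsilon>g in auto)
  have \<epsilon>m: "?\<epsilon> \<in> borel_measurable borel" by measurable
  note \<epsilon>1 = integral_le_sqrt_integral_sq[OF \<epsilon>2 \<epsilon>m]
  have e: "(1 + ?\<epsilon> x)\<^sup>2 = 1 + 2 * ?\<epsilon> x + (?\<epsilon> x)\<^sup>2" for x by (simp add: power2_sum)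
  have i: "integrable sphere_meas (\<lambda>x. (real CARD('n) - 1) * (1 + ?\<epsilon> x)\<^sup>2)"
    unfolding e by (intro integrable_mult_right Bochner_Integration.integrable_add \<epsilon>2 \<epsilon>1(1)) simp
  have "(\<integral>x. (grad_norm G x)\<^sup>2 \<partial>sphere_meas) \<le> (\<integral>x. (real CARD('n) - 1) * (1 + ?\<epsilon> x)\<^sup>2 \<partial>sphere_meas)"
  proof (rule sphere_integral_mono[OF g2 i])
    fix x :: "real^'n" assume x: "norm x = 1"
    have "(sigma_max G x)\<^sup>2 \<le> (1 + ?\<epsilon> x)\<^sup>2"
      using sigma_max_facts(2)[where G=G, OF n x] by (intro power_mono) auto
    then have "(real CARD('n) - 1) * (sigma_max G x)\<^sup>2 \<le> (real CARD('n) - 1) * (1 + ?\<epsilon> x)\<^sup>2"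
      using n by (intro mult_left_mono) auto
    then show "(grad_norm G x)\<^sup>2 \<le> (real CARD('n) - 1) * (1 + ?\<epsilon> x)\<^sup>2"
      using sigma_max_facts(4)[where G=G, OF n x] unfolding grad_norm_def by linarith
  qed
  also have "\<dots> = (real CARD('n) - 1) * (1 + 2 * (\<integral>x. ?\<epsilon> x \<partial>sphere_meas) + ?I)"
    unfolding e using \<epsilon>2 \<epsilon>1(1) by (simp add: sphere.prob_space[unfolded space_sphere_meas])
  also have "\<dots> \<le> (real CARD('n) - 1) * (1 + 2 * sqrt ?I + ?I)"
    using n \<epsilon>1(2) by (intro mult_left_mono) auto
  also have "1 + 2 * sqrt ?I + ?I = (1 + sqrt ?I)\<^sup>2" by (simp add: power2_sum)
  finally show "(\<integral>x. (grad_norm G x)\<^sup>2 \<partial>sphere_meas) \<le> (real CARD('n) - 1) * (1 + sqrt ?I)\<^sup>2" .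
qed

text \<open>An operator norm is to be bounded from information in L^2. At each point |A P_T v| \<le>
  |P_T v| + \<epsilon> + r, where r is the distance between the two gradients; squaring and
  averaging over the sphere bounds a quantity that \<open>integral_norm_PT_sq\<close> computes
  exactly in terms of |A v| and |A|. Here r enters linearly, hence the root of
  \<open>E\<close>.\<close>

lemma linear_part_bound:
  fixes G :: "real^'n \<Rightarrow> real^'n^'n" and A :: "real^'n^'n"
  assumes n: "CARD('n) \<ge> 2" and G [measurable]: "G \<in> borel_measurable borel"
    and \<epsilon>2: "integrable sphere_meas (\<lambda>x. (max (sigma_max G x - 1) 0)\<^sup>2)"
    and r2: "integrable sphere_meas (\<lambda>x. (norm (G x ** PT x - A ** PT x))\<^sup>2)"
    and v: "norm v = 1"
  defines "e \<equiv> sqrt (\<integral>x. (max (sigma_max G x - 1) 0)\<^sup>2 \<partial>sphere_meas)"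
    and "E \<equiv> \<integral>x. (norm (G x ** PT x - A ** PT x))\<^sup>2 \<partial>sphere_meas"
  shows "(norm (A *v v))\<^sup>2 * (1 - 1 / real CARD('n) - 1 / (real CARD('n) + 2))
     + (norm A)\<^sup>2 / (real CARD('n) * (real CARD('n) + 2))
     \<le> 1 - 1 / real CARD('n) + 2 * (e + sqrt E) + 2 * (e\<^sup>2 + E)"
proof -
  let ?N = "real CARD('n)"
  let ?\<epsilon> = "\<lambda>x. max (sigma_max G x - 1) 0" and ?r = "\<lambda>x. norm (G x ** PT x - A ** PT x)"
  have N: "?N > 0" by simp
  have cA: "(\<lambda>x. A) \<in> borel_measurable borel" by simp
  note mult_PT_measurable[OF G, measurable] mult_PT_measurable[OF cA, measurable] sigma_max_measurable[OF n G, measurable]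
  have \<epsilon>m: "?\<epsilon> \<in> borel_measurable borel" and rm: "?r \<in> borel_measurable borel" by measurable
  note \<epsilon>1 = integral_le_sqrt_integral_sq[OF \<epsilon>2 \<epsilon>m] and r1 = integral_le_sqrt_integral_sq[OF r2 rm]
  have id: "(norm (mat 1 :: real^'n^'n))\<^sup>2 = ?N"
    unfolding norm_matrix_sq_columns by (simp add: matrix_vector_mul_lid)
  have k: "1 - 2 / ?N + 2 / (?N * (?N + 2)) = 1 - 1 / ?N - 1 / (?N + 2)"
  proof -
    have "2 / (?N * (?N + 2)) = 1 / ?N - 1 / (?N + 2)" using N by (simp add: diff_frac_eq)
    moreover have "2 / ?N = 2 * (1 / ?N)" by simp
    ultimately show ?thesis by linarith
  qed
  have Pv: "(\<integral>x. (norm (PT x *v v))\<^sup>2 \<partial>sphere_meas) = 1 - 1 / ?N"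
  proof -
    have "?N / (?N * (?N + 2)) = 1 / (?N + 2)" using N by simp
    then show ?thesis using integral_norm_PT_sq[OF v, of "mat 1"] v unfolding id k by (simp add: matrix_vector_mul_lid)
  qed
  have Pi: "integrable sphere_meas (\<lambda>x. (norm (PT x *v v))\<^sup>2)" and Ai: "integrable sphere_meas (\<lambda>x. (norm (A *v (PT x *v v)))\<^sup>2)"
    unfolding mv_norm_sq[of A] by (rule integrable_sphere_continuous; unfold PT_mv; intro continuous_intros)+
  have "(\<integral>x. (norm (A *v (PT x *v v)))\<^sup>2 \<partial>sphere_meas)
      \<le> (\<integral>x. (norm (PT x *v v))\<^sup>2 + 2 * (?\<epsilon> x + ?r x) + 2 * ((?\<epsilon> x)\<^sup>2 + (?r x)\<^sup>2) \<partial>sphere_meas)"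
  proof (rule sphere_integral_mono[OF Ai])
    show "integrable sphere_meas (\<lambda>x. (norm (PT x *v v))\<^sup>2 + 2 * (?\<epsilon> x + ?r x) + 2 * ((?\<epsilon> x)\<^sup>2 + (?r x)\<^sup>2))"
      by (intro Bochner_Integration.integrable_add integrable_mult_right Pi \<epsilon>1(1) r1(1) \<epsilon>2 r2)
    fix x :: "real^'n" assume x: "norm x = 1"
    define a where "a = norm (PT x *v v)"
    define b where "b = ?\<epsilon> x + ?r x"
    have a: "0 \<le> a" "a \<le> 1" using PT_norm_le[OF x, of v] v by (auto simp: a_def)
    have b: "b \<ge> 0" by (simp add: b_def)
    let ?p = "PT x *v v"
    have eq: "A *v ?p = (G x ** PT x) *v ?p - (G x ** PT x - A ** PT x) *v ?p"
      by (simp add: matrix_vector_mult_diff_rdistrib matrix_vector_mul_assoc[symmetric] PT_norm(4)[OF x])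
    have "norm (A *v ?p) \<le> norm ((G x ** PT x) *v ?p) + norm ((G x ** PT x - A ** PT x) *v ?p)"
      unfolding eq by (rule norm_triangle_ineq4)
    also have "\<dots> \<le> sigma_max G x * a + ?r x * a"
      unfolding a_def by (intro add_mono sigma_max_facts(1)[OF n x] norm_mv_le)
    also have "\<dots> \<le> (1 + ?\<epsilon> x) * a + ?r x * a" by (intro add_right_mono mult_right_mono a(1)) simp
    also have "\<dots> = a + b * a" by (simp add: b_def algebra_simps)
    also have "\<dots> \<le> a + b" using mult_left_le[OF a(2) b] by simp
    finally have "(norm (A *v ?p))\<^sup>2 \<le> (a + b)\<^sup>2" by (rule power_mono) simp
    also have "\<dots> = a\<^sup>2 + 2 * (a * b) + b\<^sup>2" by (simp add: power2_sum)
    also have "\<dots> \<le> a\<^sup>2 + 2 * b + 2 * ((?\<epsilon> x)\<^sup>2 + (?r x)\<^sup>2)"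
    proof -
      have "a * b \<le> b" using a(2) b using mult_right_mono[OF a(2) b] by simp
      moreover have "b\<^sup>2 \<le> 2 * ((?\<epsilon> x)\<^sup>2 + (?r x)\<^sup>2)"
        unfolding b_def by (rule square_sum_le)
      ultimately show ?thesis by linarith
    qed
    finally show "(norm (A *v ?p))\<^sup>2 \<le> (norm ?p)\<^sup>2 + 2 * (?\<epsilon> x + ?r x) + 2 * ((?\<epsilon> x)\<^sup>2 + (?r x)\<^sup>2)"
      by (simp only: a_def b_def)
  qed
  also have "\<dots> = (1 - 1 / ?N) + 2 * ((\<integral>x. ?\<epsilon> x \<partial>sphere_meas) + (\<integral>x. ?r x \<partial>sphere_meas)) + 2 * (e\<^sup>2 + E)"
    using Pi \<epsilon>1(1) r1(1) \<epsilon>2 r2 by (simp add: Pv e_def E_def)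
  also have "\<dots> \<le> (1 - 1 / ?N) + 2 * (e + sqrt E) + 2 * (e\<^sup>2 + E)"
    using \<epsilon>1(2) r1(2) by (simp add: e_def E_def)
  finally show ?thesis unfolding integral_norm_PT_sq[OF v] k by simp
qed

text \<open>Integrability of the power of the gradient is stated separately because the Bochner
  integral of a non-integrable function is 0, so that a bound on \<open>Lp_sphere\<close> would say
  nothing about it.\<close>

theorem theorem1p3:
  fixes M :: real
  assumes n4: "CARD('n::finite) \<ge> 4" and Mpos: "M > 0"
  shows "\<exists>c>0. \<forall>(u :: real^'n \<Rightarrow> real^'n) G.
           tang_weak_grad u G \<and>
           integrable sphere_meas (\<lambda>x. grad_norm G x powr (2 * (real CARD('n) - 2))) \<and>
           Lp_sphere (2 * (real CARD('n) - 2)) (grad_norm G) \<le> M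
           \<longrightarrow> (\<exists>Q. orthogonal_matrix Q \<and>
                 Av (\<lambda>x. (norm (G x ** PT x - Q ** PT x))\<^sup>2)
                 \<le> c * (Lp_sphere 2 (\<lambda>x. max (sigma_max G x - 1) 0)
                        + max (1 - \<bar>signed_volume u G\<bar>) 0))"
proof -
  let ?N = "real CARD('n)" and ?m = "CARD('n) - 2"
  have N: "?N \<ge> 4" and n2: "CARD('n) \<ge> 2" using n4 by auto
  \<comment> \<open>With \<delta> the bracket on the right-hand side: \<open>B\<close> bounds |w|,
    the L^2 norm of w is at least 1 - C3 \<delta>, E \<le> C5 \<delta>, |A|^2 \<ge> n - C6 \<delta>,
    |A v|^2 \<le> 1 + P sqrt \<delta> for unit v, and A is within C7 sqrt \<delta> of an orthogonal
    matrix. \<open>C8\<close> bounds the left-hand side for Q = 1 outright.\<close>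
  define B where "B = ?N * \<bar>morrey_const TYPE('n) * M\<bar>"
  define C3 where "C3 = 1 + (?N - 1) * B * sqrt (2 ^ (2 * ?m) * (1 + M ^ (2 * ?m)))"
  define C5 where "C5 = 2 * (?N - 1) * (3 + 2 * C3)"
  define C6 where "C6 = ?N * (2 * C3 + C5)"
  define P where "P = 2 * (C6 + 6 + 4 * C5)"
  define C7 where "C7 = ?N\<^sup>2 * (?N * P + C6 + P)"
  define C8 where "C8 = 2 * (1 + M ^ (2 * ?m)) + 2 * ?N"
  define c where "c = 2 * C5 + 2 * C7\<^sup>2 + C8"
  have C3: "C3 \<ge> 1" unfolding C3_def B_def using N Mpos by simp
  have C5: "C5 \<ge> 0" unfolding C5_def using N C3 by simp
  have C6: "C6 \<ge> 0" unfolding C6_def using N C3 C5 by simp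
  have P: "P \<ge> 0" unfolding P_def using C5 C6 by simp
  have C7: "C7 \<ge> 0" unfolding C7_def using N P C6 by simp
  have C8: "C8 > 0" unfolding C8_def using N Mpos by (simp add: add_pos_pos)
  have c: "c > 0" "C8 \<le> c" "2 * C5 + 2 * C7\<^sup>2 \<le> c" unfolding c_def using C5 C8 by (auto intro: add_nonneg_pos)
  have main: "\<exists>Q. orthogonal_matrix Q \<and>
                 Av (\<lambda>x. (norm (G x ** PT x - Q ** PT x))\<^sup>2)
                 \<le> c * (Lp_sphere 2 (\<lambda>x. max (sigma_max G x - 1) 0)
                        + max (1 - \<bar>signed_volume u G\<bar>) 0)"
    if tw: "tang_weak_grad u G"
      and int: "integrable sphere_meas (\<lambda>x. grad_norm G x powr (2 * (?N - 2)))"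
      and Lp: "Lp_sphere (2 * (?N - 2)) (grad_norm G) \<le> M"
    for u :: "real^'n \<Rightarrow> real^'n" and G
  proof -
    let ?g = "grad_norm G" and ?\<epsilon> = "\<lambda>x. max (sigma_max G x - 1) 0"
    have G [measurable]: "G \<in> borel_measurable borel" using tw by (simp add: tang_weak_grad_def)
    note mult_PT_measurable[OF G, measurable]
    have gm [measurable]: "?g \<in> borel_measurable borel" unfolding grad_norm_def[abs_def] by measurable
    have g0: "?g x \<ge> 0" for x by (simp add: grad_norm_def)
    note gb = grad_norm_integral_bound[OF n4 Mpos int Lp]
    have gl: "(?g x)\<^sup>2 \<le> 1 + ?g x ^ (2 * ?m)" for x by (rule power_le_one_plus[OF g0]) (use n4 in simp)
    have g2: "integrable sphere_meas (\<lambda>x. (?g x)\<^sup>2)"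
      by (rule sphere_integrable_bound[of "\<lambda>x. 1 + ?g x ^ (2 * ?m)"]) (use gb(1) gl in auto)
    have g2M: "(\<integral>x. (?g x)\<^sup>2 \<partial>sphere_meas) \<le> 1 + M ^ (2 * ?m)"
    proof -
      have "(\<integral>x. (?g x)\<^sup>2 \<partial>sphere_meas) \<le> (\<integral>x. 1 + ?g x ^ (2 * ?m) \<partial>sphere_meas)"
        by (rule sphere_integral_mono[OF g2]) (use gb(1) gl in auto)
      then show ?thesis using gb by (simp add: sphere.prob_space[unfolded space_sphere_meas])
    qed
    define e where "e = sqrt (\<integral>x. (?\<epsilon> x)\<^sup>2 \<partial>sphere_meas)"
    define V where "V = \<bar>signed_volume u G\<bar>"
    define \<delta> where "\<delta> = e + max (1 - V) 0"
    have e0: "e \<ge> 0" unfolding e_def by simp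
    have \<delta>0: "\<delta> \<ge> 0" "e \<le> \<delta>" "1 - V \<le> \<delta>" using e0 by (auto simp: \<delta>_def)
    have Le: "Lp_sphere 2 ?\<epsilon> = e"
    proof -
      have "\<bar>?\<epsilon> x\<bar> powr 2 = (?\<epsilon> x)\<^sup>2" for x by simp
      then show ?thesis unfolding Lp_sphere_def Av_def e_def by (simp add: powr_half_sqrt)
    qed
    have Ni: "(norm (Q ** PT x))\<^sup>2 \<le> (norm Q)\<^sup>2" if "norm x = 1" for Q :: "real^'n^'n" and x
      by (rule power_mono[OF norm_mult_PT_le[OF that]]) simp
    have cmp: "(\<integral>x. (norm (G x ** PT x - Q ** PT x))\<^sup>2 \<partial>sphere_meas) \<le> 2 * (\<integral>x. (norm (G x ** PT x - A ** PT x))\<^sup>2 \<partial>sphere_meas) + 2 * (norm (A - Q))\<^sup>2"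
      if r: "integrable sphere_meas (\<lambda>x. (norm (G x ** PT x - A ** PT x))\<^sup>2)" for A Q
    proof -
      have q: "(norm (G x ** PT x - Q ** PT x))\<^sup>2 \<le> 2 * (norm (G x ** PT x - A ** PT x))\<^sup>2 + 2 * (norm (A - Q))\<^sup>2" if "norm x = 1" for x
      proof -
        let ?a = "norm (G x ** PT x - A ** PT x)" and ?b = "norm ((A - Q) ** PT x)"
        have s: "G x ** PT x - Q ** PT x = (G x ** PT x - A ** PT x) + (A - Q) ** PT x"
          by (simp add: vec_eq_iff matrix_matrix_mult_def left_diff_distrib sum_subtractf)
        have "(norm (G x ** PT x - Q ** PT x))\<^sup>2 \<le> (?a + ?b)\<^sup>2"
          unfolding s by (intro power_mono norm_triangle_ineq) simp
        also have "\<dots> \<le> 2 * ?a\<^sup>2 + 2 * ?b\<^sup>2" using square_sum_le[of ?a ?b] by simp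
        finally show ?thesis using Ni[OF that, of "A - Q"] by linarith
      qed
      have cQ: "(\<lambda>x. Q) \<in> borel_measurable borel" by simp
      note mult_PT_measurable[OF cQ, measurable]
      have i: "integrable sphere_meas (\<lambda>x. 2 * (norm (G x ** PT x - A ** PT x))\<^sup>2 + 2 * (norm (A - Q))\<^sup>2)"
        by (intro Bochner_Integration.integrable_add integrable_mult_right r) simp
      have "(\<integral>x. (norm (G x ** PT x - Q ** PT x))\<^sup>2 \<partial>sphere_meas) \<le> (\<integral>x. 2 * (norm (G x ** PT x - A ** PT x))\<^sup>2 + 2 * (norm (A - Q))\<^sup>2 \<partial>sphere_meas)"
        by (rule sphere_integral_mono[OF sphere_integrable_bound[OF i] i q]) (use q in \<open>auto simp del: abs_power2 simp add: abs_power2\<close>)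
      also have "\<dots> = 2 * (\<integral>x. (norm (G x ** PT x - A ** PT x))\<^sup>2 \<partial>sphere_meas) + 2 * (norm (A - Q))\<^sup>2"
        using r by (simp add: sphere.prob_space[unfolded space_sphere_meas])
      finally show ?thesis .
    qed
    have "\<exists>Q. orthogonal_matrix Q \<and> (\<integral>x. (norm (G x ** PT x - Q ** PT x))\<^sup>2 \<partial>sphere_meas) \<le> c * \<delta>"
    proof (cases "\<delta> < 1")
      case False
      have "(norm (mat 1 :: real^'n^'n))\<^sup>2 = ?N"
        unfolding norm_matrix_sq_columns by (simp add: matrix_vector_mul_lid)
      moreover have "(0 :: real^'n^'n) ** X = 0" for X :: "real^'n^'n" by (simp add: vec_eq_iff matrix_matrix_mult_def)
      ultimately have "(\<integral>x. (norm (G x ** PT x - mat 1 ** PT x))\<^sup>2 \<partial>sphere_meas) \<le> C8"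
        using cmp[of 0 "mat 1"] g2 g2M unfolding C8_def grad_norm_def by simp
      also have "\<dots> \<le> c * \<delta>"
      proof -
        have "c * 1 \<le> c * \<delta>" using c(1) False by (intro mult_left_mono) auto
        then show ?thesis using c(2) by linarith
      qed
      finally show ?thesis using orthogonal_matrix_id by blast
    next
      case True
      obtain w :: "real^'n \<Rightarrow> real^'n" and A :: "real^'n^'n" and S where wm: "w \<in> borel_measurable borel" and wB: "\<And>x. norm (w x) \<le> ?N * \<bar>morrey_const TYPE('n) * M\<bar>"
        and Vd: "\<bar>signed_volume u G\<bar> \<le> (\<integral>x. \<bar>det (G x ** PT x + outer (w x) x)\<bar> \<partial>sphere_meas)"
        and Di: "integrable sphere_meas (\<lambda>x. \<bar>det (G x ** PT x + outer (w x) x)\<bar>)"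
        and ri: "integrable sphere_meas (\<lambda>x. (norm (G x ** PT x - A ** PT x))\<^sup>2)"
        and gE: "(\<integral>x. (?g x)\<^sup>2 \<partial>sphere_meas) = (\<integral>x. (norm (G x ** PT x - A ** PT x))\<^sup>2 \<partial>sphere_meas) + (?N - 1) * ((norm A)\<^sup>2 / ?N)"
        and W: "(\<integral>x. (norm (w x))\<^sup>2 \<partial>sphere_meas) = S + (norm A)\<^sup>2 / ?N" and S: "S \<ge> 0"
        and gap: "2 * ?N * S \<le> (\<integral>x. (norm (G x ** PT x - A ** PT x))\<^sup>2 \<partial>sphere_meas)"
        by (rule analytic_estimates[OF n4 Mpos tw gb]) (rule that)
      note wB = wB[folded B_def] and Vd = Vd[folded V_def]
      define E where "E = (\<integral>x. (norm (G x ** PT x - A ** PT x))\<^sup>2 \<partial>sphere_meas)"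
      define a where "a = (norm A)\<^sup>2 / ?N"
      have a0: "a \<ge> 0" by (simp add: a_def)
      have E0: "E \<ge> 0" by (simp add: E_def)
      note en = energy_bound[OF n2 G g2, folded e_def]
      have e2: "e\<^sup>2 \<le> e" using \<delta>0(2) True e0 power_le_one_iff[of e] by (simp add: power2_eq_square mult_left_le)
      have Vw: "1 - C3 * \<delta> \<le> sqrt (S + a)"
      proof -
        have "V \<le> sqrt (S + a) + (C3 - 1) * e"
          using Vd det_integral_bound[OF n4 G gb wm wB Di] by (simp add: W a_def C3_def e_def)
        moreover have "(C3 - 1) * e \<le> (C3 - 1) * \<delta>" using C3 \<delta>0 by (intro mult_left_mono) auto
        moreover have "(C3 - 1) * \<delta> = C3 * \<delta> - \<delta>" by (simp add: left_diff_distrib)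
        ultimately show ?thesis using \<delta>0(3) by linarith
      qed
      \<comment> \<open>The inequality t^2 \<ge> 2 t - 1 replaces squaring the lower bound 1 - C3
        \<delta>, which may be negative.\<close>
      have Wl: "S + a \<ge> 1 - 2 * (C3 * \<delta>)"
      proof -
        define t where "t = sqrt (S + a)"
        have t: "t\<^sup>2 = S + a" "t \<ge> 1 - C3 * \<delta>" using S a0 Vw by (auto simp: t_def)
        have "t\<^sup>2 \<ge> 2 * t - 1" using zero_le_power2[of "t - 1"] by (simp add: power2_diff)
        then show ?thesis using t by linarith
      qed
      have gu: "E + (?N - 1) * a \<le> (?N - 1) * (1 + 3 * \<delta>)"
      proof -
        have "(1 + e)\<^sup>2 \<le> 1 + 3 * \<delta>" using e2 \<delta>0(2) by (simp add: power2_sum)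
        then have "(?N - 1) * (1 + e)\<^sup>2 \<le> (?N - 1) * (1 + 3 * \<delta>)" using N by (intro mult_left_mono) auto
        then show ?thesis using en(2) gE by (simp add: E_def a_def)
      qed
      \<comment> \<open>Here the gap is decisive. With the first eigenvalue alone one would only
        have (n - 1) S \<le> E, and subtracting the two main inequalities would leave nothing of
        \<open>E\<close>; the second eigenvalue leaves half of it.\<close>
      have Sd: "(?N - 1) * S \<le> E / 2"
      proof -
        have "(?N - 1) * S \<le> ?N * S" using S by (intro mult_right_mono) auto
        then show ?thesis using gap by (simp add: E_def)
      qed
      have "(?N - 1) * (1 - 2 * (C3 * \<delta>)) \<le> (?N - 1) * (S + a)" using Wl N by (intro mult_left_mono) auto
      then have "E / 2 \<le> (?N - 1) * (1 + 3 * \<delta>) - (?N - 1) * (1 - 2 * (C3 * \<delta>))"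
        using gu Sd by (simp add: distrib_left)
      also have "\<dots> = C5 * \<delta> / 2" by (simp add: C5_def algebra_simps)
      finally have E5: "E \<le> C5 * \<delta>" by simp
      have low: "(norm A)\<^sup>2 \<ge> ?N - C6 * \<delta>"
      proof -
        have "S \<le> E" using Sd mult_right_mono[of 1 "?N - 1" S] S N E0 by simp
        then have "a \<ge> 1 - (2 * C3 + C5) * \<delta>" using Wl E5 by (simp add: algebra_simps)
        then have "?N * (1 - (2 * C3 + C5) * \<delta>) \<le> ?N * a" by (intro mult_left_mono) auto
        then show ?thesis using N by (simp add: a_def C6_def algebra_simps)
      qed
      \<comment> \<open>The bound for \<open>A\<close> contains the root of \<open>E\<close>, so it
        is of order sqrt \<delta>. As \<delta> < 1 in this case, the terms of order \<delta> are
        absorbed into it.\<close>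
      define s where "s = sqrt \<delta>"
      have s: "s \<ge> 0" "s\<^sup>2 = \<delta>" "\<delta> \<le> s"
      proof -
        show "s \<ge> 0" "s\<^sup>2 = \<delta>" using \<delta>0 by (auto simp: s_def)
        have "s \<le> 1" using True by (simp add: s_def)
        then show "\<delta> \<le> s" using \<open>s \<ge> 0\<close> \<open>s\<^sup>2 = \<delta>\<close> by (metis mult_left_le power2_eq_square)
      qed
      have up: "(norm (A *v v))\<^sup>2 \<le> 1 + P * s" if v: "norm v = 1" for v
      proof -
        \<comment> \<open>The coefficient of |A v|^2 in \<open>linear_part_bound\<close>. Since
          \<kappa> + 1/(n + 2) = 1 - 1/n, inserting |A|^2 \<ge> n - C6 \<delta> leaves \<kappa> (|A
          v|^2 - 1) bounded by the errors. The factor 2 in \<open>P\<close> is the inverse of the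
          lower bound 1/2 for \<kappa>.\<close>
        define \<kappa> where "\<kappa> = 1 - 1 / ?N - 1 / (?N + 2)"
        define b where "b = (norm (A *v v))\<^sup>2"
        have \<kappa>: "\<kappa> \<ge> 1 / 2"
        proof -
          have "1 / ?N \<le> 1 / 4" "1 / (?N + 2) \<le> 1 / 4" using N by (auto intro!: divide_left_mono)
          then show ?thesis unfolding \<kappa>_def by linarith
        qed
        have sE: "sqrt E \<le> (1 + C5) * s"
        proof -
          have "C5 \<le> (1 + C5)\<^sup>2" using C5 by (simp add: power2_eq_square algebra_simps)
          then have "E \<le> ((1 + C5) * s)\<^sup>2" using E5 \<delta>0(1) mult_right_mono[of C5 "(1 + C5)\<^sup>2" \<delta>] by (simp add: power_mult_distrib s(2))
          then show ?thesis using C5 s(1) by (intro real_le_lsqrt) auto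
        qed
        have 1: "b * \<kappa> + (norm A)\<^sup>2 / (?N * (?N + 2)) \<le> 1 - 1 / ?N + 2 * (e + sqrt E) + 2 * (e\<^sup>2 + E)"
          using linear_part_bound[OF n2 G en(1) ri v] unfolding b_def \<kappa>_def e_def E_def .
        have 2: "1 / (?N + 2) - C6 * \<delta> \<le> (norm A)\<^sup>2 / (?N * (?N + 2))"
        proof -
          have k: "?N * (?N + 2) \<ge> 1" using N mult_mono[of 1 ?N 1 "?N + 2"] by simp
          have "(?N - C6 * \<delta>) / (?N * (?N + 2)) \<le> (norm A)\<^sup>2 / (?N * (?N + 2))" using low by (intro divide_right_mono) auto
          moreover have "C6 * \<delta> / (?N * (?N + 2)) \<le> C6 * \<delta> / 1" using C6 \<delta>0 k by (intro divide_left_mono) auto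
          moreover have "?N / (?N * (?N + 2)) = 1 / (?N + 2)" using N by simp
          ultimately show ?thesis by (simp add: diff_divide_distrib)
        qed
        have m: "C6 * \<delta> \<le> C6 * s" "C5 * \<delta> \<le> C5 * s" using C6 C5 s(3) by (auto intro: mult_left_mono)
        have "b * \<kappa> \<le> \<kappa> + (C6 * \<delta> + 2 * (e + sqrt E) + 2 * (e\<^sup>2 + E))"
          using 1 2 \<kappa>_def by linarith
        also have "\<dots> \<le> \<kappa> + (C6 * s + 2 * (s + (1 + C5) * s) + 2 * (s + C5 * s))"
        proof (intro add_mono mult_left_mono order_refl m(1))
          show "sqrt E \<le> (1 + C5) * s" "e \<le> s" "e\<^sup>2 \<le> s" "E \<le> C5 * s"
            using sE e2 \<delta>0(2) s(3) E5 m(2) by linarith+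
        qed (use C6 s(3) in auto)
        also have "\<dots> = \<kappa> + P / 2 * s" by (simp add: P_def algebra_simps)
        finally have le: "(b - 1) * \<kappa> \<le> P / 2 * s" by (simp add: left_diff_distrib)
        have "b - 1 \<le> P * s"
        proof (cases "b \<le> 1")
          case True
          then show ?thesis using mult_nonneg_nonneg[OF P s(1)] by linarith
        next
          case False
          then have "(b - 1) * (1 / 2) \<le> (b - 1) * \<kappa>" using \<kappa> by (intro mult_left_mono) auto
          then show ?thesis using le by simp
        qed
        then show ?thesis by (simp add: b_def)
      qed
      have "?N - C6 * s \<le> (norm A)\<^sup>2" using low mult_left_mono[OF s(3) C6] by linarith
      then obtain Q where Q: "orthogonal_matrix Q" "norm (A - Q) \<le> ?N\<^sup>2 * (?N * (P * s) + C6 * s + P * s)"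
        using matrix_rigidity[of A "P * s" "C6 * s"] up P C6 s(1) by (metis mult_nonneg_nonneg)
      have "?N\<^sup>2 * (?N * (P * s) + C6 * s + P * s) = C7 * s" by (simp add: C7_def algebra_simps)
      then have "(norm (A - Q))\<^sup>2 \<le> (C7 * s)\<^sup>2" using Q(2) by (intro power_mono) auto
      also have "\<dots> = C7\<^sup>2 * \<delta>" by (simp add: power_mult_distrib s(2))
      finally have "(\<integral>x. (norm (G x ** PT x - Q ** PT x))\<^sup>2 \<partial>sphere_meas) \<le> 2 * (C5 * \<delta>) + 2 * (C7\<^sup>2 * \<delta>)"
        using cmp[OF ri, of Q] E5 unfolding E_def by linarith
      also have "\<dots> = (2 * C5 + 2 * C7\<^sup>2) * \<delta>" by (simp add: algebra_simps)
      also have "\<dots> \<le> c * \<delta>" by (rule mult_right_mono[OF c(3) \<delta>0(1)])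
      finally show ?thesis using Q(1) by blast
    qed
    then show ?thesis unfolding Av_def Le \<delta>_def V_def .
  qed
  show ?thesis by (rule exI[of _ c]) (use c(1) main in blast)
qed

end
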